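(* Let $c>0$, let $f,g:[0,1]\to\mathbb R_{\ge0}$ be piecewise $\mathcal C^1$ with $f(s)>0$, $g(s)\ge 0$, let $n,k\to\infty$ with $\lim\frac kn=c$, and let $\lambda$ be a random Young diagram in the $n\times k$ rectangle distributed according to $$\mu_{n,k}(\lambda)=\frac{s_\lambda(x_1,\dots,x_n)s_{\lambda'}(y_1,\dots,y_k)}{\prod_{i=1}^n\prod_{j=1}^k(1+x_iy_j)},\qquad x_i=f(i/n),\ y_j=g(j/k).$$ Let $F_n$ be the upper boundary of $\lambda$ rotated and scaled by $\frac1n$, regarded as a function $F_n(u)$ of $u\in[-1,c]$. Then the functions $F_n$ converge in probability with respect to $\mu_{n,k}$, in the supremum norm $\|\cdot\|_\infty$, to the limit shape $$\Omega(u)=1+\int_{-1}^u\bigl(1-2\rho(t)\bigr)\,dt;$$ that is, for any $\varepsilon>0$, $$\lim_{n\to\infty}\mathbb P\Bigl[\sup_u|F_n(u)-\Omega(u)|>\varepsilon\Bigr]=0 .$$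
   Context: $s_\lambda$ is the Schur polynomial and $\lambda'$ the conjugate partition. Rotated boundary: put $a_i=\lambda_i-i+\frac12$ for $1\le i\le n$. $F_n$ is the continuous piecewise linear function on $[-1,\infty)$ with $F_n(-1)=1$, slope $-1$ on each interval $\bigl(\frac{a_i-1/2}{n},\frac{a_i+1/2}{n}\bigr)$, $1\le i\le n$, and slope $+1$ elsewhere. This is the boundary of $\lambda$ drawn in Russian convention, rotated by $45^\circ$ and scaled by $\frac1n$, so that the empty diagram gives $|u|$. Support intervals: let $z^{(1)},\dots,z^{(m)}\in\mathbb R\sqcup\{\infty\}$ be the real roots of $$\int_0^1\frac{f(s)}{(1-f(s)z)^2}ds-c\int_0^1\frac{g(s)}{(z+g(s))^2}ds=0,$$ and let $t^{(i)}=\int_0^1\frac{f(s)z^{(i)}}{1-f(s)z^{(i)}}ds+c\int_0^1\frac{g(s)}{z^{(i)}+g(s)}ds$, indexed so that $-1=:t^{(0)}\le t^{(1)}\le\dots\le t^{(m)}\le t^{(m+1)}:=c$. For each $a$, the equation $$\int_0^1\frac{f(s)z}{1-f(s)z}ds+c\int_0^1\frac{g(s)}{z+g(s)}ds-t=0$$ has either exactly two complex conjugate non-real roots $z_1(t),\overline{z_1(t)}$ for all $t\in(t^{(a)},t^{(a+1)})$, or only real roots for all such $t$. In the first case $(t^{(a)},t^{(a+1)})$ is called a support interval. Limit density: on a support interval, $\rho(t)=\frac1\pi\arg z_1(t)$ with $\operatorname{Im}z_1(t)>0$ and $\arg\in(0,\pi)$. On a maximal interval of $[-1,c]$ without complex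 roots that shares an endpoint $t^{(i)}$ with a support interval, $\rho$ is the constant $1$ if $z^{(i)}<0$ and $0$ if $z^{(i)}>0$.
   Formalization: Added assumption: g is nonzero almost everywhere, or the limit density ρ has integral 1 over [-1,c]; otherwise the claim fails, e.g. f=1, c=2, g=4 on [0,1/2] and g=0 on (1/2,1], and the integral condition is necessary for the conclusion. *)

theory Defs
  imports "HOL-Analysis.Analysis"
begin

text \<open>A Young diagram is its set of cells (row, column), both counted from 1; the conjugate
  diagram is the converse relation.\<close>

definition young_diagrams :: "nat \<Rightarrow> nat \<Rightarrow> (nat \<times> nat) set set" where
  "young_diagrams n k =
     {D. D \<subseteq> {1..n} \<times> {1..k} \<and>
         (\<forall>i j i' j'. (i, j) \<in> D \<longrightarrow> 1 \<le> i' \<longrightarrow> i' \<le> i \<longrightarrow> 1 \<le> j' \<longrightarrow> j' \<le> j \<longrightarrow> (i', j') \<in> D)}"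

definition row_length :: "(nat \<times> nat) set \<Rightarrow> nat \<Rightarrow> nat" where
  "row_length D i = card {j. (i, j) \<in> D}"

definition ssyt :: "(nat \<times> nat) set \<Rightarrow> nat \<Rightarrow> (nat \<times> nat \<Rightarrow> nat) set" where
  "ssyt D N =
     {T \<in> D \<rightarrow>\<^sub>E {1..N}.
        (\<forall>i j j'. (i, j) \<in> D \<longrightarrow> (i, j') \<in> D \<longrightarrow> j < j' \<longrightarrow> T (i, j) \<le> T (i, j')) \<and>
        (\<forall>i i' j. (i, j) \<in> D \<longrightarrow> (i', j) \<in> D \<longrightarrow> i < i' \<longrightarrow> T (i, j) < T (i', j))}"

text \<open>\<open>schur D N x\<close> is the Schur polynomial of shape \<open>D\<close> in the variables \<open>x 1, \<dots>, x N\<close>.\<close>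

definition schur :: "(nat \<times> nat) set \<Rightarrow> nat \<Rightarrow> (nat \<Rightarrow> real) \<Rightarrow> real" where
  "schur D N x = (\<Sum>T\<in>ssyt D N. \<Prod>b\<in>D. x (T b))"

definition mu_weight ::
  "(real \<Rightarrow> real) \<Rightarrow> (real \<Rightarrow> real) \<Rightarrow> nat \<Rightarrow> nat \<Rightarrow> (nat \<times> nat) set \<Rightarrow> real" where
  "mu_weight f g n k D =
     (let x = (\<lambda>i. f (real i / real n)); y = (\<lambda>j. g (real j / real k))
      in schur D n x * schur (D\<inverse>) k y / (\<Prod>i=1..n. \<Prod>j=1..k. 1 + x i * y j))"

definition mu ::
  "(real \<Rightarrow> real) \<Rightarrow> (real \<Rightarrow> real) \<Rightarrow> nat \<Rightarrow> nat \<Rightarrow> (nat \<times> nat) set measure" where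
  "mu f g n k = point_measure (young_diagrams n k) (\<lambda>D. ennreal (mu_weight f g n k D))"

definition particle :: "(nat \<times> nat) set \<Rightarrow> nat \<Rightarrow> real" where
  "particle D i = real (row_length D i) - real i + 1/2"

definition rotated_boundary :: "nat \<Rightarrow> (nat \<times> nat) set \<Rightarrow> real \<Rightarrow> real" where
  "rotated_boundary n D u =
     1 + integral {-1..u} (\<lambda>v.
       if \<exists>i\<in>{1..n}. (particle D i - 1/2) / real n < v \<and> v < (particle D i + 1/2) / real n
       then -1 else 1)"

text \<open>Piecewise \<open>C\<^sup>1\<close> on \<open>[0,1]\<close>: on each open piece the function is the restriction of a
  \<open>C\<^sup>1\<close> function on the closed piece. Jumps at the finitely many break points are
  allowed, unlike in \<open>piecewise_C1_differentiable_on\<close>; without jumps there is never more than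
  one support interval.\<close>

definition piecewise_C1 :: "(real \<Rightarrow> real) \<Rightarrow> bool" where
  "piecewise_C1 f \<longleftrightarrow>
     (\<exists>P. finite P \<and> {0, 1} \<subseteq> P \<and> P \<subseteq> {0..1} \<and>
        (\<forall>a\<in>P. \<forall>b\<in>P. a < b \<and> {a<..<b} \<inter> P = {} \<longrightarrow>
           (\<exists>h. h C1_differentiable_on {a..b} \<and> (\<forall>s\<in>{a<..<b}. h s = f s))))"

text \<open>The left-hand side of the equation \<open>G(z) = t\<close>, for real or complex \<open>z\<close>.\<close>

definition G_fun ::
  "(real \<Rightarrow> real) \<Rightarrow> (real \<Rightarrow> real) \<Rightarrow> real \<Rightarrow> 'a :: real_normed_field \<Rightarrow> 'a" where
  "G_fun f g c z =
     integral {0..1} (\<lambda>s. of_real (f s) * z / (1 - of_real (f s) * z))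
     + of_real c * integral {0..1} (\<lambda>s. of_real (g s) / (z + of_real (g s)))"

text \<open>Points of \<open>\<real> \<squnion> {\<infinity>}\<close> are of type \<open>real option\<close>, with \<open>None\<close> for \<open>\<infinity>\<close>. At a real \<open>z\<close> the
  integrals have to make sense: the denominators vanish only on a null set and both
  (nonnegative) integrands are integrable. At \<open>\<infinity>\<close> the left-hand side of the equation always
  vanishes to second order, so \<open>\<infinity>\<close> counts as a root when \<open>z\<^sup>2\<close> times it vanishes there.\<close>

fun is_critical ::
  "(real \<Rightarrow> real) \<Rightarrow> (real \<Rightarrow> real) \<Rightarrow> real \<Rightarrow> real option \<Rightarrow> bool" where
  "is_critical f g c (Some z) \<longleftrightarrow>
     negligible {s\<in>{0..1}. 1 - f s * z = 0} \<and>
     negligible {s\<in>{0..1}. z + g s = 0} \<and>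
     (\<lambda>s. f s / (1 - f s * z)\<^sup>2) integrable_on {0..1} \<and>
     (\<lambda>s. g s / (z + g s)\<^sup>2) integrable_on {0..1} \<and>
     integral {0..1} (\<lambda>s. f s / (1 - f s * z)\<^sup>2)
       - c * integral {0..1} (\<lambda>s. g s / (z + g s)\<^sup>2) = 0"
| "is_critical f g c None \<longleftrightarrow>
     (\<lambda>s. 1 / f s) integrable_on {0..1} \<and>
     integral {0..1} (\<lambda>s. 1 / f s) - c * integral {0..1} g = 0"

text \<open>The value at \<open>\<infinity>\<close> is the limit of \<open>G_fun\<close>, as \<open>f > 0\<close>.\<close>

fun critical_value ::
  "(real \<Rightarrow> real) \<Rightarrow> (real \<Rightarrow> real) \<Rightarrow> real \<Rightarrow> real option \<Rightarrow> real" where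
  "critical_value f g c (Some z) = G_fun f g c z"
| "critical_value f g c None = -1"

definition division_points :: "(real \<Rightarrow> real) \<Rightarrow> (real \<Rightarrow> real) \<Rightarrow> real \<Rightarrow> real set" where
  "division_points f g c = {-1, c} \<union> critical_value f g c ` {z. is_critical f g c z}"

definition nonreal_roots ::
  "(real \<Rightarrow> real) \<Rightarrow> (real \<Rightarrow> real) \<Rightarrow> real \<Rightarrow> real \<Rightarrow> complex set" where
  "nonreal_roots f g c t = {z. Im z \<noteq> 0 \<and> G_fun f g c z - of_real t = 0}"

definition support_interval ::
  "(real \<Rightarrow> real) \<Rightarrow> (real \<Rightarrow> real) \<Rightarrow> real \<Rightarrow> real \<Rightarrow> real \<Rightarrow> bool" where
  "support_interval f g c a b \<longleftrightarrow>
     a \<in> division_points f g c \<and> b \<in> division_points f g c \<and> a < b \<and>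
     {a<..<b} \<inter> division_points f g c = {} \<and>
     (\<forall>t\<in>{a<..<b}. \<exists>z. Im z > 0 \<and> nonreal_roots f g c t = {z, cnj z})"

definition upper_root ::
  "(real \<Rightarrow> real) \<Rightarrow> (real \<Rightarrow> real) \<Rightarrow> real \<Rightarrow> real \<Rightarrow> complex" where
  "upper_root f g c t = (THE z. z \<in> nonreal_roots f g c t \<and> Im z > 0)"

text \<open>The maximal interval of \<open>[-1,c]\<close> around \<open>t\<close> without nonreal roots (empty if there is none).\<close>

definition real_interval ::
  "(real \<Rightarrow> real) \<Rightarrow> (real \<Rightarrow> real) \<Rightarrow> real \<Rightarrow> real \<Rightarrow> real set" where
  "real_interval f g c t =
     connected_component_set {u\<in>{-1..c}. nonreal_roots f g c u = {}} t"

text \<open>The last case is \<open>z > 0\<close>, and is also used where nothing is prescribed.\<close>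

definition limit_density ::
  "(real \<Rightarrow> real) \<Rightarrow> (real \<Rightarrow> real) \<Rightarrow> real \<Rightarrow> real \<Rightarrow> real" where
  "limit_density f g c t =
     (if \<exists>a b. support_interval f g c a b \<and> a < t \<and> t < b
      then Arg (upper_root f g c t) / pi
      else if \<exists>z a b. z < 0 \<and> is_critical f g c (Some z) \<and> support_interval f g c a b \<and>
                critical_value f g c (Some z) \<in> {a, b} \<inter> frontier (real_interval f g c t)
      then 1
      else 0)"

definition limit_shape ::
  "(real \<Rightarrow> real) \<Rightarrow> (real \<Rightarrow> real) \<Rightarrow> real \<Rightarrow> real \<Rightarrow> real" where
  "limit_shape f g c u = 1 + integral {-1..u} (\<lambda>t. 1 - 2 * limit_density f g c t)"

end

(*
By the bialternant formula and the dual Cauchy identity, the operator sending x_i to q x_i has the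
Schur polynomials as eigenfunctions up to the Vandermonde factor. Hence the expectation of
Y = 1 + (q - 1) (sum of q^(l_i)), l_i = lambda_i + n - i, is a contour integral of an explicit
product, and Var Y is a double contour integral with a prefactor (q - 1)^2. For q = exp(s/n),
Y is exactly 1 + s * (integral of exp(s (1 + t)) against the particle density), so these exponential
moments concentrate around (1 / 2 pi i) * (contour integral of exp(s (1 + G(1/v))) dv / v).

In the coordinate z = exp(x + i theta), Im G(z) changes sign exactly once on each vertical segment
0 < theta < pi, at theta = Th x. On this curve G is real and strictly decreasing in x. Deforming
the contour to the curve and integrating by parts turns the limit into the exponential moments of
the density Th / pi, read as a function of t = G. The critical points of G on the curve are
locally finite and separate the support intervals from the intervals where Th is 0 or pi, which
identifies Th / pi with the limit density. Exponential moments determine the density by the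
Weierstrass theorem, uniformly enough to bound the boundary in the supremum norm.
*)

theory Submission
 imports Defs "HOL-Complex_Analysis.Complex_Analysis" "Jordan_Normal_Form.Determinant"
begin

section \<open>Schur polynomials and the dual Cauchy identity\<close>

text \<open>Four obstacles shape the details. The sampled variables \<open>f (i / n)\<close> may
  coincide, and then the Vandermonde factor cannot be cancelled; the contour formulas are proved for
  distinct positive variables and carried over along x_i + d i as d tends to 0 from above.
  \<open>f\<close> and \<open>g\<close> may jump, so the closures of their ranges can have gaps and
  G can be regular on several real intervals; beyond continuity, smoothness is used only as
  non-integrability of poles over the range, which keeps the curve off the singularities of G even
  where it runs along the real line. The map z -> -1/z exchanges \<open>f\<close> with
  \<open>g\<close> and \<open>c\<close> with \<open>1 / c\<close> and turns G into -G/c; so height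
  pi, negative critical points and the right end of the curve mirror height 0, positive critical
  points and the left end. Finally, if \<open>g\<close> vanishes on a set of positive measure, the
  values of G on the curve end at \<open>c * pos_mass g < c\<close>, where the prescribed limit
  density could differ from the true one; comparing total masses excludes this.\<close>

definition strips :: "(nat \<times> nat) set => (nat \<times> nat) set set" where
 "strips D = {E. E \<subseteq> D \<and>
   (\<forall>i j j'. (i, j') \<in> E \<longrightarrow> (i, j) \<in> D \<longrightarrow> j < j' \<longrightarrow> (i, j) \<in> E) \<and>
   (\<forall>i i' j. (i, j) \<in> D \<longrightarrow> (i', j) \<in> D \<longrightarrow> i < i' \<longrightarrow> (i, j) \<in> E)}"

lemma finite_strips: "finite D ==> finite (strips D)" by (rule finite_subset[of _ "Pow D"]) (auto simp: strips_def)

lemma finite_ssyt: "finite D ==> finite (ssyt D N)" by (rule finite_subset[of _ "D \<rightarrow>\<^sub>E {1..N}"]) (auto simp: ssyt_def intro: finite_PiE)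

lemma ssyt_range: assumes "T \<in> ssyt D N" "b \<in> D" shows "1 \<le> T b \<and> T b \<le> N"
 using PiE_mem[of T D "\<lambda>_. {1..N}" b] assms by (simp add: ssyt_def)

text \<open>The cells with entry \<open>Suc N\<close> are split off. Column strictness puts every
  cell with a cell of \<open>D\<close> below it into \<open>E\<close>, and weakly increasing rows
  make \<open>E\<close> closed to the left, so \<open>D - E\<close> is a horizontal strip.
  \<open>strips\<close> speaks of arbitrary cell sets because converses of diagrams occur as
  well.\<close>

lemma bij_betw_ssyt_Suc: assumes D: "finite D" shows "bij_betw (\<lambda>(E, T). (\<lambda>b. if b \<in> E then T b else if b \<in> D then Suc N else undefined))
      (SIGMA E:strips D. ssyt E N) (ssyt D (Suc N))"
  (is "bij_betw ?F _ _")
proof (rule bij_betw_byWitness[where f' = "\<lambda>T. ({b\<in>D. T b \<le> N}, restrict T {b\<in>D. T b \<le> N})"], goal_cases)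
 case 1
 show ?case
 proof (clarify, intro conjI)
  fix E T assume E: "E \<in> strips D" and T: "T \<in> ssyt E N"
  have le: "T b \<le> N" if "b \<in> E" for b using ssyt_range[OF T that] by simp
  have ED: "E \<subseteq> D" using E by (simp add: strips_def)
  have eq: "{b\<in>D. ?F (E, T) b \<le> N} = E" using le ED by (auto split: if_splits)
  show "{b \<in> D. (if b \<in> E then T b else if b \<in> D then Suc N else undefined) \<le> N} = E" using eq by simp
  show "restrict (\<lambda>b. if b \<in> E then T b else if b \<in> D then Suc N else undefined)
    {b \<in> D. (if b \<in> E then T b else if b \<in> D then Suc N else undefined) \<le> N} = T"
   using eq T by (auto simp: fun_eq_iff ssyt_def PiE_def extensional_def restrict_def)
 qed
next
 case 2
 show ?case
 proof
  fix T assume T: "T \<in> ssyt D (Suc N)"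
  show "?F ({b\<in>D. T b \<le> N}, restrict T {b\<in>D. T b \<le> N}) = T"
  proof
   fix b
   show "?F ({b\<in>D. T b \<le> N}, restrict T {b\<in>D. T b \<le> N}) b = T b"
   proof (cases "b \<in> D")
    case True
    then have "T b \<le> Suc N" using ssyt_range[OF T] by simp
    then show ?thesis using True by auto
   next
    case False
    have "T \<in> D \<rightarrow>\<^sub>E {1..Suc N}" using T by (simp add: ssyt_def)
    from PiE_arb[OF this False] False show ?thesis by simp
   qed
  qed
 qed
next
 case 3
 show ?case
 proof (clarify)
  fix E T assume E: "E \<in> strips D" and T: "T \<in> ssyt E N"
  have ED: "E \<subseteq> D" using E by (simp add: strips_def)
  note rng = ssyt_range[OF T]
  have row: "T (i, j) \<le> T (i, j')" if "(i, j) \<in> E" "(i, j') \<in> E" "j < j'" for i j j' using T that by (auto simp: ssyt_def)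
  have col: "T (i, j) < T (i', j)" if "(i, j) \<in> E" "(i', j) \<in> E" "i < i'" for i i' j using T that by (auto simp: ssyt_def)
  have E1: "(i, j) \<in> E" if "(i, j') \<in> E" "(i, j) \<in> D" "j < j'" for i j j' using E that unfolding strips_def by blast
  have E2: "(i, j) \<in> E" if "(i, j) \<in> D" "(i', j) \<in> D" "i < i'" for i i' j using E that unfolding strips_def by blast
  let ?T = "\<lambda>b. if b \<in> E then T b else if b \<in> D then Suc N else undefined"
  have "?T \<in> D \<rightarrow>\<^sub>E {1..Suc N}" using rng ED by (fastforce simp: PiE_def Pi_def extensional_def)
  moreover have "?T (i, j) \<le> ?T (i, j')" if "(i, j) \<in> D" "(i, j') \<in> D" "j < j'" for i j j'
   using that row[of i j j'] E1[of i j' j] rng[of "(i,j)"] by auto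
  moreover have "?T (i, j) < ?T (i', j)" if "(i, j) \<in> D" "(i', j) \<in> D" "i < i'" for i i' j
   using that col[of i j i'] E2[of i j i'] rng[of "(i,j)"] by auto
  ultimately show "?T \<in> ssyt D (Suc N)" unfolding ssyt_def by blast
 qed
next
 case 4
 show ?case
 proof (clarify)
  fix T assume T: "T \<in> ssyt D (Suc N)"
  note rng = ssyt_range[OF T]
  have row: "T (i, j) \<le> T (i, j')" if "(i, j) \<in> D" "(i, j') \<in> D" "j < j'" for i j j' using T that by (auto simp: ssyt_def)
  have col: "T (i, j) < T (i', j)" if "(i, j) \<in> D" "(i', j) \<in> D" "i < i'" for i i' j using T that by (auto simp: ssyt_def)
  have "T (i, j) \<le> N" if "(i, j') \<in> D" "T (i, j') \<le> N" "(i, j) \<in> D" "j < j'" for i j j' using row[of i j j'] that by simp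
  moreover have "T (i, j) \<le> N" if "(i, j) \<in> D" "(i', j) \<in> D" "i < i'" for i i' j using col[of i j i'] rng[of "(i', j)"] that by simp
  ultimately have "{b \<in> D. T b \<le> N} \<in> strips D" unfolding strips_def by blast
  moreover have "restrict T {b \<in> D. T b \<le> N} \<in> ssyt {b \<in> D. T b \<le> N} N" unfolding ssyt_def using row col rng by (auto simp: PiE_def Pi_def)
  ultimately show "{b \<in> D. T b \<le> N} \<in> strips D \<and>
    restrict T {b \<in> D. T b \<le> N} \<in> ssyt {b \<in> D. T b \<le> N} N" by blast
 qed
qed

lemma schur_Suc: assumes D: "finite D" shows "schur D (Suc N) x = (\<Sum>E\<in>strips D. schur E N x * x (Suc N) ^ card (D - E))" proof -
 let ?F = "\<lambda>(E, T). (\<lambda>b. if b \<in> E then T b else if b \<in> D then Suc N else undefined)"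
 have fin: "finite E" if "E \<in> strips D" for E using that D by (auto simp: strips_def intro: finite_subset)
 have "schur D (Suc N) x = (\<Sum>ET\<in>(SIGMA E:strips D. ssyt E N). \<Prod>b\<in>D. x (?F ET b))"
  unfolding schur_def by (rule sum.reindex_bij_betw[OF bij_betw_ssyt_Suc[OF D], symmetric])
 also have "\<dots> = (\<Sum>E\<in>strips D. \<Sum>T\<in>ssyt E N. \<Prod>b\<in>D. x (?F (E, T) b))"
  using fin finite_ssyt finite_strips[OF D] by (subst sum.Sigma) (auto intro!: sum.cong prod.cong)
 also have "\<dots> = (\<Sum>E\<in>strips D. \<Sum>T\<in>ssyt E N. (\<Prod>b\<in>E. x (T b)) * x (Suc N) ^ card (D - E))"
 proof (intro sum.cong refl)
  fix E T assume E: "E \<in> strips D"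
  then have "E \<subseteq> D" by (simp add: strips_def)
  then have "(\<Prod>b\<in>D. x (?F (E, T) b)) = (\<Prod>b\<in>D - E. x (?F (E, T) b)) * (\<Prod>b\<in>E. x (?F (E, T) b))" using D by (rule prod.subset_diff)
  also have "(\<Prod>b\<in>D - E. x (?F (E, T) b)) = (\<Prod>b\<in>D - E. x (Suc N))" by (intro prod.cong) auto
  also have "(\<Prod>b\<in>E. x (?F (E, T) b)) = (\<Prod>b\<in>E. x (T b))" by (intro prod.cong) auto
  finally show "(\<Prod>b\<in>D. x (?F (E, T) b)) = (\<Prod>b\<in>E. x (T b)) * x (Suc N) ^ card (D - E)" by simp
 qed
 finally show ?thesis by (simp add: schur_def sum_distrib_right)
qed

lemma schur_0: "schur D 0 x = (if D = {} then 1 else 0)"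
proof (cases "D = {}")
 case False
 then have "ssyt D 0 = {}" by (auto simp: ssyt_def PiE_def Pi_def)
 then show ?thesis using False by (simp add: schur_def)
next
 case True
 have "ssyt {} 0 = {\<lambda>b. undefined}" by (auto simp: ssyt_def)
 then show ?thesis using True by (simp add: schur_def)
qed

text \<open>Entries strictly increase down a column, so the one in row \<open>i\<close> is at least
  \<open>i\<close>. This discards the smaller shapes in the branching rule that are too tall for the
  remaining variables.\<close>

lemma schur_eq_0_long_column: assumes "\<And>i. 1 \<le> i ==> i \<le> Suc N ==> (i, j) \<in> D" shows "schur D N x = 0" proof -
 have "ssyt D N = {}"
 proof (rule ccontr)
  assume "ssyt D N \<noteq> {}"
  then obtain T where T: "T \<in> ssyt D N" by blast
  have "i \<le> T (i, j)" if "1 \<le> i" "i \<le> Suc N" for i using that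
  proof (induction i rule: dec_induct)
   case base
   then show ?case using T assms[of 1] by (auto simp: ssyt_def PiE_def Pi_def)
  next
   case (step m)
   then have "T (m, j) < T (Suc m, j)" using T assms[of m] assms[of "Suc m"] by (auto simp: ssyt_def)
   then show ?case using step by simp
  qed
  from this[of "Suc N"] have "Suc N \<le> T (Suc N, j)" by simp
  moreover have "T (Suc N, j) \<le> N" using T assms[of "Suc N"] by (auto simp: ssyt_def PiE_def Pi_def)
  ultimately show False by simp
 qed
 then show ?thesis by (simp add: schur_def)
qed

section \<open>Diagrams given by their row lengths, and their strips\<close>

definition dgm :: "nat => (nat => nat) => (nat \<times> nat) set" where
 "dgm n lam = Sigma {1..n} (\<lambda>i. {1..lam i})"

definition decr :: "nat => (nat => nat) => bool" where
 "decr n lam \<longleftrightarrow> (\<forall>i j. 1 \<le> i \<longrightarrow> i \<le> j \<longrightarrow> j \<le> n \<longrightarrow> lam j \<le> lam i)"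

lemma decrD: "decr n lam ==> 1 \<le> i ==> i \<le> j ==> j \<le> n ==> lam j \<le> lam i" unfolding decr_def by blast

lemma decrI_Suc: assumes "\<And>i. 1 \<le> i ==> i < n ==> lam (Suc i) \<le> lam i" shows "decr n lam" unfolding decr_def
proof (intro allI impI)
 fix i j assume "1 \<le> i" "i \<le> j" "j \<le> n"
 from \<open>i \<le> j\<close> \<open>j \<le> n\<close> show "lam j \<le> lam i"
 proof (induction j rule: dec_induct)
  case (step k)
  then show ?case using assms[of k] \<open>1 \<le> i\<close> by fastforce
 qed simp
qed

lemma finite_dgm [simp]: "finite (dgm n lam)" by (simp add: dgm_def)

lemma mem_dgm: "(i, j) \<in> dgm n lam \<longleftrightarrow> 1 \<le> i \<and> i \<le> n \<and> 1 \<le> j \<and> j \<le> lam i" by (auto simp: dgm_def)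

lemma row_length_dgm: "1 \<le> i ==> i \<le> n ==> row_length (dgm n lam) i = lam i" proof -
 assume "1 \<le> i" "i \<le> n"
 then have "{j. (i, j) \<in> dgm n lam} = {1..lam i}" by (auto simp: mem_dgm)
 then show ?thesis by (simp add: row_length_def)
qed

text \<open>\<open>dgm n\<close> only sees values on \<open>{1..n}\<close>, which is why row-length
  functions are taken extensional.\<close>

lemma inj_on_dgm: "inj_on (dgm n) ({1..n} \<rightarrow>\<^sub>E B)"
proof (rule inj_onI)
 fix l m assume l: "l \<in> {1..n} \<rightarrow>\<^sub>E B" and m: "m \<in> {1..n} \<rightarrow>\<^sub>E B" and eq: "dgm n l = dgm n m"
 show "l = m"
 proof (rule PiE_ext[OF l m])
  fix i assume "i \<in> {1..n}"
  then show "l i = m i" using row_length_dgm[of i n l] row_length_dgm[of i n m] eq by simp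
 qed
qed

lemma inj_on_dgm_PiE: "inj_on (dgm n) (Pi\<^sub>E {1..n} B)" by (rule inj_on_subset[OF inj_on_dgm[of n UNIV]]) (auto simp: PiE_def)

lemma down_closed_eq_atLeastAtMost: fixes S :: "nat set" assumes "finite S" "\<And>j. j \<in> S ==> 1 \<le> j" "\<And>j j'. j' \<in> S ==> 1 \<le> j ==> j < j' ==> j \<in> S"
 shows "S = {1..card S}"
proof (cases "S = {}")
 case False
 have "S = {1..Max S}"
 proof
  show "S \<subseteq> {1..Max S}" using assms(1,2) by auto
  show "{1..Max S} \<subseteq> S"
  proof
   fix j assume "j \<in> {1..Max S}"
   then show "j \<in> S" using assms(3)[of "Max S" j] Max_in[OF assms(1) False] by (cases "j = Max S") auto
  qed
 qed
 then show ?thesis by (metis card_atLeastAtMost diff_Suc_1 One_nat_def)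
qed simp

lemma row_closed_eq_dgm: assumes fin: "finite E" and sub: "\<And>i j. (i, j) \<in> E ==> 1 \<le> i \<and> i \<le> n \<and> 1 \<le> j"
  and closed: "\<And>i j j'. (i, j') \<in> E ==> 1 \<le> j ==> j < j' ==> (i, j) \<in> E" shows "E = dgm n (restrict (row_length E) {1..n})" proof -
 have row: "{j. (i, j) \<in> E} = {1..row_length E i}" for i unfolding row_length_def
 proof (rule down_closed_eq_atLeastAtMost)
  show "finite {j. (i, j) \<in> E}" by (rule finite_subset[of _ "snd ` E"]) (use fin in force)+
  show "1 \<le> j" if "j \<in> {j. (i, j) \<in> E}" for j using sub that by blast
  show "j \<in> {j. (i, j) \<in> E}" if "j' \<in> {j. (i, j) \<in> E}" "1 \<le> j" "j < j'" for j j' using closed[of i j' j] that by blast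
 qed
 show ?thesis
 proof (rule Set.set_eqI)
  fix b show "b \<in> E \<longleftrightarrow> b \<in> dgm n (restrict (row_length E) {1..n})"
  proof (cases b)
   case (Pair i j)
   have "(i, j) \<in> E \<longleftrightarrow> j \<in> {1..row_length E i}" using row[of i] by blast
   then show ?thesis using sub[of i j] unfolding Pair mem_dgm by auto
  qed
 qed
qed

lemma row_length_le: assumes "E \<subseteq> dgm n lam" "1 \<le> i" "i \<le> n" shows "row_length E i \<le> lam i" proof -
 have "card {j. (i, j) \<in> E} \<le> card {1..lam i}" by (rule card_mono) (use assms in \<open>auto simp: dgm_def\<close>)
 then show ?thesis by (simp add: row_length_def)
qed

text \<open>The cells of row i above a cell of row i + 1 are those in the columns up to
  \<open>lam (Suc i)\<close>, and they have to survive: this is interlacing. Nothing lies below the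
  last row, hence its lower bound 0.\<close>

lemma strips_dgm: assumes lam: "decr n lam" shows "strips (dgm n lam) =
  dgm n ` (\<Pi>\<^sub>E i\<in>{1..n}. {(if i < n then lam (Suc i) else 0)..lam i})"
proof (intro equalityI subsetI)
 fix E assume E: "E \<in> strips (dgm n lam)"
 have sub: "E \<subseteq> dgm n lam" using E by (simp add: strips_def)
 have E1: "(i, j) \<in> E" if "(i, j') \<in> E" "1 \<le> j" "j < j'" for i j j' using E that sub unfolding strips_def by (fastforce simp: mem_dgm)
 have E2: "(i, j) \<in> E" if "(i, j) \<in> dgm n lam" "(i', j) \<in> dgm n lam" "i < i'" for i i' j using E that unfolding strips_def by blast
 define nu where "nu = restrict (row_length E) {1..n}"
 have Emu: "E = dgm n nu" unfolding nu_def
 proof (rule row_closed_eq_dgm)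
  show "finite E" using sub finite_dgm finite_subset by blast
  show "1 \<le> i \<and> i \<le> n \<and> 1 \<le> j" if "(i, j) \<in> E" for i j using sub that by (auto simp: dgm_def)
  show "(i, j) \<in> E" if "(i, j') \<in> E" "1 \<le> j" "j < j'" for i j j' using E1 that by blast
 qed
 have "nu \<in> (\<Pi>\<^sub>E i\<in>{1..n}. {(if i < n then lam (Suc i) else 0)..lam i})"
 proof (rule PiE_I)
  fix i assume i: "i \<in> {1..n}"
  have "lam (Suc i) \<le> nu i" if "i < n"
  proof (cases "lam (Suc i) = 0")
   case False
   have "(i, lam (Suc i)) \<in> E" by (rule E2[of _ _ "Suc i"]) (use False that i decrD[OF lam, of i "Suc i"] in \<open>auto simp: mem_dgm\<close>)
   then show ?thesis unfolding Emu mem_dgm by simp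
  qed simp
  moreover have "nu i \<le> lam i" using row_length_le[OF sub, of i] i by (simp add: nu_def)
  ultimately show "nu i \<in> {(if i < n then lam (Suc i) else 0)..lam i}" by auto
 qed (auto simp: nu_def)
 then show "E \<in> dgm n ` (\<Pi>\<^sub>E i\<in>{1..n}. {(if i < n then lam (Suc i) else 0)..lam i})" using Emu by blast
next
 fix E assume "E \<in> dgm n ` (\<Pi>\<^sub>E i\<in>{1..n}. {(if i < n then lam (Suc i) else 0)..lam i})"
 then obtain nu where nu: "nu \<in> (\<Pi>\<^sub>E i\<in>{1..n}. {(if i < n then lam (Suc i) else 0)..lam i})" and E: "E = dgm n nu" by blast
 have bnd: "nu i \<le> lam i \<and> (i < n \<longrightarrow> lam (Suc i) \<le> nu i)" if "1 \<le> i" "i \<le> n" for i using PiE_mem[OF nu, of i] that by auto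
 have "dgm n nu \<subseteq> dgm n lam" using bnd by (fastforce simp: dgm_def)
 moreover have "(i, j) \<in> dgm n nu"
  if "(i, j) \<in> dgm n lam" "(i', j) \<in> dgm n lam" "i < i'" for i i' j
  using that bnd[of i] decrD[OF lam, of "Suc i" i'] by (auto simp: mem_dgm)
 ultimately show "E \<in> strips (dgm n lam)" unfolding E strips_def by (auto simp: mem_dgm)
qed

text \<open>Transposition turns horizontal strips into vertical ones, which take at most one cell
  from each row. Unlike interlacing, this bound does not force \<open>nu\<close> to decrease, so
  that is demanded separately.\<close>

lemma strips_dgm_converse: assumes lam: "decr n lam" shows "strips ((dgm n lam)\<inverse>) =
  (\<lambda>nu. (dgm n nu)\<inverse>) ` {nu \<in> (\<Pi>\<^sub>E i\<in>{1..n}. {lam i - 1..lam i}). decr n nu}"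
proof (intro equalityI subsetI)
 fix E assume E: "E \<in> strips ((dgm n lam)\<inverse>)"
 define C where "C = E\<inverse>"
 have EC: "E = C\<inverse>" by (simp add: C_def)
 have sub: "C \<subseteq> dgm n lam" using E unfolding strips_def EC by auto
 have C1: "(i, j) \<in> C" if "(i', j) \<in> C" "(i, j) \<in> dgm n lam" "i < i'" for i i' j using E that unfolding strips_def EC by blast
 have C2: "(i, j) \<in> C" if "(i, j) \<in> dgm n lam" "(i, j') \<in> dgm n lam" "j < j'" for i j j' using E that unfolding strips_def EC by blast
 define nu where "nu = restrict (row_length C) {1..n}"
 have Cnu: "C = dgm n nu" unfolding nu_def
 proof (rule row_closed_eq_dgm)
  show "finite C" using sub finite_dgm finite_subset by blast
  show "1 \<le> i \<and> i \<le> n \<and> 1 \<le> j" if "(i, j) \<in> C" for i j using sub that by (auto simp: dgm_def)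
  show "(i, j) \<in> C" if "(i, j') \<in> C" "1 \<le> j" "j < j'" for i j j'
  proof (rule C2[of _ _ j'])
   show "(i, j') \<in> dgm n lam" using sub that by blast
   then show "(i, j) \<in> dgm n lam" using that by (simp add: mem_dgm)
  qed (use that in simp)
 qed
 have le: "nu i \<le> lam i" if "1 \<le> i" "i \<le> n" for i using row_length_le[OF sub, of i] that by (simp add: nu_def)
 have "nu \<in> (\<Pi>\<^sub>E i\<in>{1..n}. {lam i - 1..lam i})"
 proof (rule PiE_I)
  fix i assume i: "i \<in> {1..n}"
  have "lam i - 1 \<le> nu i"
  proof (cases "lam i \<le> 1")
   case False
   have "(i, lam i - 1) \<in> C" by (rule C2[of _ _ "lam i"]) (use False i in \<open>auto simp: mem_dgm\<close>)
   then show ?thesis unfolding Cnu mem_dgm by simp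
  qed simp
  then show "nu i \<in> {lam i - 1..lam i}" using le[of i] i by auto
 qed (auto simp: nu_def)
 moreover have "decr n nu"
 proof (rule decrI_Suc)
  fix i assume i: "1 \<le> i" "i < n"
  show "nu (Suc i) \<le> nu i"
  proof (cases "nu (Suc i) = 0")
   case False
   have "(Suc i, nu (Suc i)) \<in> C" using False i unfolding Cnu mem_dgm by simp
   moreover have "(i, nu (Suc i)) \<in> dgm n lam" using False i le[of "Suc i"] decrD[OF lam, of i "Suc i"] by (simp add: mem_dgm)
   ultimately have "(i, nu (Suc i)) \<in> C" by (rule C1) simp
   then show ?thesis unfolding Cnu mem_dgm by simp
  qed simp
 qed
 ultimately show "E \<in> (\<lambda>nu. (dgm n nu)\<inverse>) ` {nu \<in> (\<Pi>\<^sub>E i\<in>{1..n}. {lam i - 1..lam i}). decr n nu}" unfolding EC Cnu by blast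
next
 fix E assume "E \<in> (\<lambda>nu. (dgm n nu)\<inverse>) ` {nu \<in> (\<Pi>\<^sub>E i\<in>{1..n}. {lam i - 1..lam i}). decr n nu}"
 then obtain nu where nu: "nu \<in> (\<Pi>\<^sub>E i\<in>{1..n}. {lam i - 1..lam i})" "decr n nu" and E: "E = (dgm n nu)\<inverse>" by blast
 have bnd: "nu i \<le> lam i \<and> lam i - 1 \<le> nu i" if "1 \<le> i" "i \<le> n" for i using PiE_mem[OF nu(1), of i] that by auto
 have "dgm n nu \<subseteq> dgm n lam" using bnd by (fastforce simp: dgm_def)
 moreover have "(i, j) \<in> dgm n nu"
  if "(i, j) \<in> dgm n lam" "(i, j') \<in> dgm n lam" "j < j'" for i j j' using that bnd[of i] by (auto simp: mem_dgm)
 moreover have "(i, j) \<in> dgm n nu"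
  if "(i', j) \<in> dgm n nu" "(i, j) \<in> dgm n lam" "i < i'" for i i' j using that decrD[OF nu(2), of i i'] by (auto simp: mem_dgm)
 ultimately show "E \<in> strips ((dgm n lam)\<inverse>)" unfolding E strips_def by blast
qed

lemma card_dgm_diff: assumes "\<And>i. 1 \<le> i ==> i \<le> n ==> nu i \<le> lam i" shows "card (dgm n lam - dgm n nu) = (\<Sum>i=1..n. lam i - nu i)" proof -
 have "dgm n lam - dgm n nu = Sigma {1..n} (\<lambda>i. {nu i<..lam i})" by (auto simp: dgm_def)
 then show ?thesis by simp
qed

section \<open>Alternants and the bialternant formula\<close>

definition Dt :: "nat => (nat => nat => real) => real" where
 "Dt n F = Determinant.det (Matrix.mat n n (\<lambda>(i, j). F (Suc i) (Suc j)))"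

lemma Dt_leibniz:
 "Dt n F = (\<Sum>p | p permutes {0..<n}. signof p * (\<Prod>j=1..n. F (Suc (p (j - 1))) j))" proof -
 let ?A = "Matrix.mat n n (\<lambda>(i, j). F (Suc i) (Suc j))"
 have "Dt n F = (\<Sum>p | p permutes {0..<n}. signof p * (\<Prod>j<n. ?A $$ (p j, j)))" unfolding Dt_def by (rule Determinant.det_col) simp
 also have "\<dots> = (\<Sum>p | p permutes {0..<n}. signof p * (\<Prod>j<n. F (Suc (p j)) (Suc j)))"
 proof (intro sum.cong refl arg_cong2[where f = "(*)"] prod.cong)
  fix p j assume "p \<in> {p. p permutes {0..<n}}" "j \<in> {..<n}"
  then have "p j < n" "j < n" using permutes_in_image[of p "{0..<n}" j] by auto
  then show "?A $$ (p j, j) = F (Suc (p j)) (Suc j)" by simp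
 qed
 finally show ?thesis by (simp add: prod.atLeast1_atMost_eq)
qed

lemma Dt_cong: assumes "\<And>i j. 1 \<le> i ==> i \<le> n ==> 1 \<le> j ==> j \<le> n ==> F i j = G i j" shows "Dt n F = Dt n G" proof -
 have "Matrix.mat n n (\<lambda>(i, j). F (Suc i) (Suc j)) = Matrix.mat n n (\<lambda>(i, j). G (Suc i) (Suc j))" using assms by (intro Matrix.eq_matI) auto
 then show ?thesis by (simp add: Dt_def)
qed

lemma prod_permutes_shift: assumes "p permutes {0..<n}" shows "(\<Prod>j=1..n. a (Suc (p (j - 1)))) = (\<Prod>j=1..n. a j :: real)" proof -
 have "(\<Prod>j=1..n. a (Suc (p (j - 1)))) = (\<Prod>j\<in>{0..<n}. ((\<lambda>i. a (Suc i)) \<circ> p) j)" by (simp add: prod.atLeast1_atMost_eq atLeast0LessThan)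
 also have "\<dots> = (\<Prod>j\<in>{0..<n}. a (Suc j))" using prod.permute[OF assms, of "\<lambda>i. a (Suc i)"] by simp
 finally show ?thesis by (simp add: prod.atLeast1_atMost_eq atLeast0LessThan)
qed

lemma Dt_scale:
 "Dt n (\<lambda>i j. a i * b j * F i j) = (\<Prod>i=1..n. a i) * (\<Prod>j=1..n. b j) * Dt n F" proof -
 have "(\<Prod>j=1..n. a (Suc (p (j - 1))) * b j * F (Suc (p (j - 1))) j) =
   (\<Prod>i=1..n. a i) * (\<Prod>j=1..n. b j) * (\<Prod>j=1..n. F (Suc (p (j - 1))) j)"
  if "p permutes {0..<n}" for p using prod_permutes_shift[OF that, of a] by (simp add: prod.distrib)
 then show ?thesis by (simp add: Dt_leibniz sum_distrib_left mult_ac)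
qed

text \<open>Multilinearity in the columns. The choice \<open>nu\<close> of one summand per column
  will be the row-length function of another diagram.\<close>

lemma Dt_sum: assumes "\<And>j. finite (B j)" shows "Dt n (\<lambda>i j. \<Sum>m\<in>B j. F j m i) = (\<Sum>nu\<in>Pi\<^sub>E {1..n} B. Dt n (\<lambda>i j. F j (nu j) i))" proof -
 have "(\<Prod>j=1..n. \<Sum>m\<in>B j. F j m (Suc (p (j - 1)))) =
   (\<Sum>nu\<in>Pi\<^sub>E {1..n} B. \<Prod>j=1..n. F j (nu j) (Suc (p (j - 1))))" for p by (rule prod_sum_PiE) (use assms in auto)
 then have "Dt n (\<lambda>i j. \<Sum>m\<in>B j. F j m i) = (\<Sum>p | p permutes {0..<n}.
   \<Sum>nu\<in>Pi\<^sub>E {1..n} B. signof p * (\<Prod>j=1..n. F j (nu j) (Suc (p (j - 1)))))" by (simp add: Dt_leibniz sum_distrib_left)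
 also have "\<dots> = (\<Sum>nu\<in>Pi\<^sub>E {1..n} B. Dt n (\<lambda>i j. F j (nu j) i))" unfolding Dt_leibniz by (rule sum.swap)
 finally show ?thesis .
qed

definition alt :: "nat => (nat => nat) => (nat => real) => real" where
 "alt n l x = Dt n (\<lambda>i j. x i ^ l j)"

lemma alt_eq_0: assumes "l i = l j" "1 \<le> i" "i < j" "j \<le> n" shows "alt n l x = 0" unfolding alt_def Dt_def
 by (rule Determinant.det_identical_columns[of _ n "i - 1" "j - 1"]) (use assms in \<open>auto intro!: eq_vecI simp: Matrix.col_def\<close>)

text \<open>Subtracting from column j the multiple \<open>x (Suc n) ^ (l j - l (Suc j))\<close> of
  column j + 1 clears the last row up to its last entry, and expansion along that row leaves the
  minor on the right. The unitriangular matrix \<open>L\<close> performs all these column operations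
  at once.\<close>

lemma alt_Suc: assumes l: "\<And>j. 1 \<le> j ==> j \<le> n ==> l (Suc j) \<le> l j" shows "alt (Suc n) l x = x (Suc n) ^ l (Suc n) *
  Dt n (\<lambda>i j. x i ^ l j - x i ^ l (Suc j) * x (Suc n) ^ (l j - l (Suc j)))" proof -
 define t where "t = x (Suc n)"
 define A where "A = Matrix.mat (Suc n) (Suc n) (\<lambda>(i, j). x (Suc i) ^ l (Suc j))"
 define L where "L = Matrix.mat (Suc n) (Suc n) (\<lambda>(i, j). if i = j then 1
  else if i = Suc j then - (t ^ (l (Suc j) - l (Suc i))) else 0 :: real)"
 have A: "A \<in> carrier_mat (Suc n) (Suc n)" and L: "L \<in> carrier_mat (Suc n) (Suc n)" by (auto simp: A_def L_def)
 have "Determinant.det L = prod_list (diag_mat L)" by (rule Determinant.det_lower_triangular[OF _ L]) (auto simp: L_def)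
 also have "diag_mat L = map (\<lambda>i. 1) [0..<Suc n]" unfolding diag_mat_def by (rule map_cong) (auto simp: L_def)
 also have "prod_list \<dots> = 1" by (simp add: map_replicate_const)
 finally have detL: "Determinant.det L = 1" .
 have ent: "(A * L) $$ (i, j) = (if j < n then x (Suc i) ^ l (Suc j) -
    x (Suc i) ^ l (Suc (Suc j)) * t ^ (l (Suc j) - l (Suc (Suc j))) else x (Suc i) ^ l (Suc j))"
  if i: "i < Suc n" and j: "j < Suc n" for i j proof -
  have "(A * L) $$ (i, j) = (\<Sum>k\<in>{0..<Suc n}. A $$ (i, k) * L $$ (k, j))" using i j by (simp add: A_def L_def Matrix.scalar_prod_def)
  also have "\<dots> = (\<Sum>k\<in>{0..<Suc n}. (if k = j then x (Suc i) ^ l (Suc j) else 0)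
    + (if k = Suc j then - (x (Suc i) ^ l (Suc (Suc j)) * t ^ (l (Suc j) - l (Suc (Suc j)))) else 0))"
   using i j by (intro sum.cong) (auto simp: A_def L_def)
  also have "\<dots> = x (Suc i) ^ l (Suc j) +
    (if Suc j < Suc n then - (x (Suc i) ^ l (Suc (Suc j)) * t ^ (l (Suc j) - l (Suc (Suc j)))) else 0)" using j by (simp add: sum.distrib)
  finally show ?thesis using j by auto
 qed
 have AL: "A * L \<in> carrier_mat (Suc n) (Suc n)" using A L by simp
 have "alt (Suc n) l x = Determinant.det A" by (simp add: alt_def Dt_def A_def)
 also have "\<dots> = Determinant.det (A * L)" using Determinant.det_mult[OF A L] detL by simp
 also have "\<dots> = (\<Sum>j<Suc n. (A * L) $$ (n, j) * cofactor (A * L) n j)" by (rule Determinant.laplace_expansion_row[OF AL]) simp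
 also have "\<dots> = (\<Sum>j<Suc n. if j = n then t ^ l (Suc n) * cofactor (A * L) n n else 0)"
 proof (intro sum.cong refl)
  fix j assume "j \<in> {..<Suc n}"
  then have "(A * L) $$ (n, j) = (if j = n then t ^ l (Suc n) else 0)"
   using ent[of n j] l[of "Suc j"] by (auto simp: t_def power_add[symmetric])
  then show "(A * L) $$ (n, j) * cofactor (A * L) n j =
    (if j = n then t ^ l (Suc n) * cofactor (A * L) n n else 0)" by simp
 qed
 also have "\<dots> = t ^ l (Suc n) * cofactor (A * L) n n" by simp
 also have "cofactor (A * L) n n = Dt n (\<lambda>i j. x i ^ l j - x i ^ l (Suc j) * t ^ (l j - l (Suc j)))" proof -
  have "mat_delete (A * L) n n = Matrix.mat n n
    (\<lambda>(i, j). x (Suc i) ^ l (Suc j) - x (Suc i) ^ l (Suc (Suc j)) * t ^ (l (Suc j) - l (Suc (Suc j))))"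
  proof (rule Matrix.eq_matI, goal_cases)
   case (1 i j)
   then show ?case using ent[of i j] mat_delete_carrier[OF AL, of n n] AL by (auto simp: mat_delete_def A_def L_def)
  qed (auto simp: mat_delete_def A_def L_def)
  then show ?thesis by (simp add: cofactor_def Dt_def flip: mult_2)
 qed
 finally show ?thesis by (simp add: t_def)
qed

text \<open>The factors are oriented so that this equals the alternant with exponents
  \<open>n - j\<close> without a sign; see \<open>vdm_eq_alt\<close>.\<close>

definition vdm :: "nat => (nat => real) => real" where
 "vdm n x = (\<Prod>i=1..n. \<Prod>j\<in>{1..<i}. x j - x i)"

lemma vdm_Suc: "vdm (Suc n) x = vdm n x * (\<Prod>j=1..n. x j - x (Suc n))" by (simp add: vdm_def atLeastLessThanSuc_atLeastAtMost)

text \<open>With \<open>d = n - j\<close> the right side is the entry of column j in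
  \<open>alt_Suc\<close>, and \<open>m\<close> runs over the interlacing values for row j.\<close>

lemma geometric_telescope: fixes x t :: real assumes "b \<le> a"
 shows "(x - t) * (\<Sum>m=b..a. t ^ (a - m) * x ^ (m + d)) = x ^ (Suc a + d) - x ^ (b + d) * t ^ (Suc a - b)" using assms
proof (induction a rule: dec_induct)
 case base
 then show ?case by (simp add: algebra_simps)
next
 case (step a)
 have "(\<Sum>m=b..Suc a. t ^ (Suc a - m) * x ^ (m + d)) =
   t * (\<Sum>m=b..a. t ^ (a - m) * x ^ (m + d)) + x ^ (Suc a + d)" using step by (simp add: sum_distrib_left Suc_diff_le mult_ac)
 then have "(x - t) * (\<Sum>m=b..Suc a. t ^ (Suc a - m) * x ^ (m + d)) =
   t * ((x - t) * (\<Sum>m=b..a. t ^ (a - m) * x ^ (m + d))) + (x - t) * x ^ (Suc a + d)" by (simp add: algebra_simps)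
 also have "\<dots> = t * (x ^ (Suc a + d) - x ^ (b + d) * t ^ (Suc a - b)) + (x - t) * x ^ (Suc a + d)" using step.IH by simp
 also have "\<dots> = x ^ (Suc (Suc a) + d) - x ^ (b + d) * t ^ (Suc (Suc a) - b)" using step by (simp add: algebra_simps Suc_diff_le)
 finally show ?case .
qed

text \<open>Induction on the number of variables. The new Vandermonde factors x_i - x_{n+1} turn the
  geometric sums over interlacing values into the columns of \<open>alt_Suc\<close>, and
  multilinearity matches the determinant with the branching sum term by term.\<close>

theorem schur_vdm_eq_alt: assumes "decr n lam" shows "schur (dgm n lam) n x * vdm n x = alt n (\<lambda>j. lam j + n - j) x" using assms
proof (induction n arbitrary: lam)
 case 0
 then show ?case by (simp add: schur_0 vdm_def dgm_def alt_def Dt_def)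
next
 case (Suc n)
 define t where "t = x (Suc n)"
 define l where "l = (\<lambda>j. lam j + Suc n - j)"
 define B where "B = (\<lambda>j. {lam (Suc j)..lam j})"
 have mono: "lam (Suc j) \<le> lam j" if "1 \<le> j" "j \<le> n" for j using decrD[OF Suc.prems, of j "Suc j"] that by simp
 have sub: "dgm n ` Pi\<^sub>E {1..n} B \<subseteq> strips (dgm (Suc n) lam)"
 proof
  fix E assume "E \<in> dgm n ` Pi\<^sub>E {1..n} B"
  then obtain nu where nu: "nu \<in> Pi\<^sub>E {1..n} B" and E: "E = dgm n nu" by blast
  have "E = dgm (Suc n) (nu(Suc n := 0))" unfolding E by (auto simp: dgm_def le_Suc_eq)
  moreover have "nu(Suc n := 0) \<in> (\<Pi>\<^sub>E i\<in>{1..Suc n}. {(if i < Suc n then lam (Suc i) else 0)..lam i})"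
   using nu by (fastforce simp: PiE_def Pi_def extensional_def B_def)
  ultimately show "E \<in> strips (dgm (Suc n) lam)" unfolding strips_dgm[OF Suc.prems] by blast
 qed
 \<comment> \<open>A remaining shape with a nonempty last row has \<open>Suc n\<close> cells in its
   first column and contributes nothing in \<open>n\<close> variables; so only interlacing sequences
   with \<open>n\<close> rows survive.\<close>
 have zero: "schur E n x = 0" if "E \<in> strips (dgm (Suc n) lam) - dgm n ` Pi\<^sub>E {1..n} B" for E proof -
  have "E \<in> dgm (Suc n) ` (\<Pi>\<^sub>E i\<in>{1..Suc n}. {(if i < Suc n then lam (Suc i) else 0)..lam i})"
   using that unfolding strips_dgm[OF Suc.prems] by (rule DiffD1)
  then obtain nu where E: "E = dgm (Suc n) nu" and nu: "nu \<in> (\<Pi>\<^sub>E i\<in>{1..Suc n}. {(if i < Suc n then lam (Suc i) else 0)..lam i})"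
   by (rule imageE)
  have "nu (Suc n) \<noteq> 0"
  proof
   assume "nu (Suc n) = 0"
   then have "E = dgm n (restrict nu {1..n})" unfolding E by (auto simp: dgm_def le_Suc_eq)
   moreover have "restrict nu {1..n} \<in> Pi\<^sub>E {1..n} B" using nu by (fastforce simp: PiE_def Pi_def B_def)
   ultimately show False using that by blast
  qed
  moreover have "nu (Suc n) \<le> nu i" if "1 \<le> i" "i \<le> Suc n" for i
  proof (cases "i = Suc n")
   case False
   have "nu (Suc n) \<le> lam (Suc n)" using PiE_mem[OF nu, of "Suc n"] by simp
   also have "\<dots> \<le> lam (Suc i)" using decrD[OF Suc.prems, of "Suc i" "Suc n"] that False by simp
   also have "\<dots> \<le> nu i" using PiE_mem[OF nu, of i] that False by simp
   finally show ?thesis .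
  qed simp
  ultimately have "(i, 1) \<in> E" if "1 \<le> i" "i \<le> Suc n" for i
   using that unfolding E mem_dgm by (metis One_nat_def Suc_leI le_trans neq0_conv le_refl)
  then show ?thesis by (rule schur_eq_0_long_column)
 qed
 have trm: "schur (dgm n nu) n x * t ^ card (dgm (Suc n) lam - dgm n nu) * vdm (Suc n) x =
   t ^ lam (Suc n) * Dt n (\<lambda>i j. (x i - t) * (t ^ (lam j - nu j) * x i ^ (nu j + n - j)))"
  if nu: "nu \<in> Pi\<^sub>E {1..n} B" for nu proof -
  have bnd: "lam (Suc j) \<le> nu j \<and> nu j \<le> lam j" if "1 \<le> j" "j \<le> n" for j using PiE_mem[OF nu, of j] that by (simp add: B_def)
  have "decr n nu"
  proof (rule decrI_Suc)
   fix i assume "1 \<le> i" "i < n"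
   then show "nu (Suc i) \<le> nu i" using bnd[of i] bnd[of "Suc i"] by simp
  qed
  then have IH: "schur (dgm n nu) n x * vdm n x = alt n (\<lambda>j. nu j + n - j) x" by (rule Suc.IH)
  have "dgm n nu = dgm (Suc n) (nu(Suc n := 0))" by (auto simp: dgm_def le_Suc_eq)
  then have "card (dgm (Suc n) lam - dgm n nu) = (\<Sum>i=1..Suc n. lam i - (nu(Suc n := 0)) i)"
   using card_dgm_diff[of "Suc n" "nu(Suc n := 0)" lam] bnd by simp
  also have "\<dots> = (\<Sum>i=1..n. lam i - nu i) + lam (Suc n)" by (auto intro!: sum.cong)
  finally have card: "card (dgm (Suc n) lam - dgm n nu) = (\<Sum>i=1..n. lam i - nu i) + lam (Suc n)" .
  have "Dt n (\<lambda>i j. (x i - t) * (t ^ (lam j - nu j) * x i ^ (nu j + n - j))) =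
    (\<Prod>i=1..n. x i - t) * (\<Prod>j=1..n. t ^ (lam j - nu j)) * alt n (\<lambda>j. nu j + n - j) x"
   unfolding alt_def by (subst Dt_scale[symmetric]) (simp add: mult.assoc)
  then show ?thesis unfolding card vdm_Suc power_add power_sum IH[symmetric] t_def by (simp add: mult_ac)
 qed
 have "schur (dgm (Suc n) lam) (Suc n) x =
   (\<Sum>E\<in>strips (dgm (Suc n) lam). schur E n x * t ^ card (dgm (Suc n) lam - E))" by (simp add: schur_Suc t_def)
 also have "\<dots> = (\<Sum>E\<in>dgm n ` Pi\<^sub>E {1..n} B. schur E n x * t ^ card (dgm (Suc n) lam - E))"
  by (rule sum.mono_neutral_right) (use sub zero in \<open>auto intro: finite_strips\<close>)
 also have "\<dots> = (\<Sum>nu\<in>Pi\<^sub>E {1..n} B. schur (dgm n nu) n x * t ^ card (dgm (Suc n) lam - dgm n nu))"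
  by (subst sum.reindex[OF inj_on_dgm_PiE]) simp
 finally have "schur (dgm (Suc n) lam) (Suc n) x * vdm (Suc n) x = (\<Sum>nu\<in>Pi\<^sub>E {1..n} B.
   t ^ lam (Suc n) * Dt n (\<lambda>i j. (x i - t) * (t ^ (lam j - nu j) * x i ^ (nu j + n - j))))"
  using trm by (simp add: sum_distrib_right cong: sum.cong)
 also have "\<dots> = t ^ lam (Suc n) * (\<Sum>nu\<in>Pi\<^sub>E {1..n} B.
   Dt n (\<lambda>i j. (x i - t) * (t ^ (lam j - nu j) * x i ^ (nu j + n - j))))" by (simp add: sum_distrib_left)
 also have "(\<Sum>nu\<in>Pi\<^sub>E {1..n} B.
   Dt n (\<lambda>i j. (x i - t) * (t ^ (lam j - nu j) * x i ^ (nu j + n - j)))) =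
   Dt n (\<lambda>i j. \<Sum>m\<in>B j. (x i - t) * (t ^ (lam j - m) * x i ^ (m + n - j)))"
  by (rule Dt_sum[symmetric, where F = "\<lambda>j m i. (x i - t) * (t ^ (lam j - m) * x i ^ (m + n - j))"]) (simp add: B_def)
 also have "\<dots> = Dt n (\<lambda>i j. x i ^ l j - x i ^ l (Suc j) * t ^ (l j - l (Suc j)))"
 proof (rule Dt_cong)
  fix i j assume j: "1 \<le> j" "j \<le> n"
  have "(\<Sum>m\<in>B j. (x i - t) * (t ^ (lam j - m) * x i ^ (m + n - j))) =
    (x i - t) * (\<Sum>m=lam (Suc j)..lam j. t ^ (lam j - m) * x i ^ (m + (n - j)))" using j by (simp add: B_def sum_distrib_left)
  also have "\<dots> = x i ^ (Suc (lam j) + (n - j)) - x i ^ (lam (Suc j) + (n - j)) * t ^ (Suc (lam j) - lam (Suc j))"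
   by (rule geometric_telescope) (use mono j in auto)
  finally show "(\<Sum>m\<in>B j. (x i - t) * (t ^ (lam j - m) * x i ^ (m + n - j))) =
    x i ^ l j - x i ^ l (Suc j) * t ^ (l j - l (Suc j))" using j mono[of j] by (simp add: l_def Suc_diff_le)
 qed
 also have "t ^ lam (Suc n) * \<dots> = alt (Suc n) l x" proof -
  have "l (Suc j) \<le> l j" if "1 \<le> j" "j \<le> n" for j using mono[OF that] that by (simp add: l_def)
  then have "alt (Suc n) l x = x (Suc n) ^ l (Suc n) *
    Dt n (\<lambda>i j. x i ^ l j - x i ^ l (Suc j) * x (Suc n) ^ (l j - l (Suc j)))" by (rule alt_Suc)
  moreover have "l (Suc n) = lam (Suc n)" by (simp add: l_def)
  ultimately show ?thesis by (simp only: t_def)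
 qed
 finally show ?case by (simp add: l_def)
qed

section \<open>Partitions in the rectangle, the dual Cauchy identity and the shift operator\<close>

definition parts :: "nat => nat => (nat => nat) set" where
 "parts n k = {lam \<in> {1..n} \<rightarrow>\<^sub>E {0..k}. decr n lam}"

lemma finite_parts [simp]: "finite (parts n k)" by (rule finite_subset[of _ "{1..n} \<rightarrow>\<^sub>E {0..k}"]) (auto simp: parts_def intro: finite_PiE)

lemma bij_betw_dgm_parts: "bij_betw (dgm n) (parts n k) (young_diagrams n k)"
proof (rule bij_betw_imageI)
 show "inj_on (dgm n) (parts n k)" by (rule inj_on_subset[OF inj_on_dgm]) (auto simp: parts_def)
 show "dgm n ` parts n k = young_diagrams n k"
 proof (intro equalityI subsetI)
  fix D assume "D \<in> dgm n ` parts n k"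
  then obtain lam where lam: "lam \<in> parts n k" and D: "D = dgm n lam" by blast
  have d: "decr n lam" and b: "\<And>i. i \<in> {1..n} ==> lam i \<le> k" using lam by (auto simp: parts_def)
  have "(i', j') \<in> D" if "(i, j) \<in> D" "1 \<le> i'" "i' \<le> i" "1 \<le> j'" "j' \<le> j" for i j i' j'
   using that decrD[OF d, of i' i] unfolding D mem_dgm by auto
  moreover have "D \<subseteq> {1..n} \<times> {1..k}" using b unfolding D dgm_def by fastforce
  ultimately show "D \<in> young_diagrams n k" unfolding young_diagrams_def by blast
 next
  fix D assume D: "D \<in> young_diagrams n k"
  have sub: "D \<subseteq> {1..n} \<times> {1..k}" using D by (simp add: young_diagrams_def)
  have cl: "(i', j') \<in> D" if "(i, j) \<in> D" "1 \<le> i'" "i' \<le> i" "1 \<le> j'" "j' \<le> j" for i j i' j'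
   using D that unfolding young_diagrams_def by blast
  define lam where "lam = restrict (row_length D) {1..n}"
  have Dl: "D = dgm n lam" unfolding lam_def
  proof (rule row_closed_eq_dgm)
   show "finite D" by (rule finite_subset[OF sub]) simp
   show "1 \<le> i \<and> i \<le> n \<and> 1 \<le> j" if "(i, j) \<in> D" for i j using sub that by auto
   show "(i, j) \<in> D" if "(i, j') \<in> D" "1 \<le> j" "j < j'" for i j j' by (rule cl[OF that(1)]) (use sub that in auto)
  qed
  have "lam i \<le> k" if "i \<in> {1..n}" for i using row_length_le[of D n "\<lambda>_. k" i] sub that by (auto simp: lam_def dgm_def)
  moreover have "decr n lam"
  proof (rule decrI_Suc)
   fix i assume i: "1 \<le> i" "i < n"
   show "lam (Suc i) \<le> lam i"
   proof (cases "lam (Suc i) = 0")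
    case False
    then have "(Suc i, lam (Suc i)) \<in> D" using i unfolding Dl mem_dgm by simp
    then have "(i, lam (Suc i)) \<in> D" using cl[of "Suc i" "lam (Suc i)" i "lam (Suc i)"] False i by simp
    then show ?thesis unfolding Dl mem_dgm by simp
   qed simp
  qed
  ultimately have "lam \<in> parts n k" by (auto simp: parts_def lam_def)
  then show "D \<in> dgm n ` parts n k" using Dl by blast
 qed
qed

text \<open>Multiplying row i of the alternant by 1 + x_i y raises each column exponent by 0 or 1.
  Choices that are not decreasing are still in the sum; their alternants vanish, which is used in
  \<open>dual_cauchy_alt\<close>.\<close>

lemma alt_pieri:
 "(\<Prod>i=1..n. 1 + x i * y) * alt n (\<lambda>j. nu j + n - j) x =
  (\<Sum>lam\<in>(\<Pi>\<^sub>E j\<in>{1..n}. {nu j, Suc (nu j)}). y ^ (\<Sum>j=1..n. lam j - nu j) * alt n (\<lambda>j. lam j + n - j) x)" proof -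
 have "(\<Prod>i=1..n. 1 + x i * y) * alt n (\<lambda>j. nu j + n - j) x =
   Dt n (\<lambda>i j. (1 + x i * y) * 1 * x i ^ (nu j + n - j))" unfolding alt_def by (subst Dt_scale) simp
 also have "\<dots> = Dt n (\<lambda>i j. \<Sum>m\<in>{nu j, Suc (nu j)}. 1 * y ^ (m - nu j) * x i ^ (m + n - j))"
  by (rule Dt_cong) (simp add: algebra_simps Suc_diff_le)
 also have "\<dots> = (\<Sum>lam\<in>(\<Pi>\<^sub>E j\<in>{1..n}. {nu j, Suc (nu j)}).
   Dt n (\<lambda>i j. 1 * y ^ (lam j - nu j) * x i ^ (lam j + n - j)))"
  by (rule Dt_sum[where F = "\<lambda>j m i. 1 * y ^ (m - nu j) * x i ^ (m + n - j)"]) simp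
 finally show ?thesis by (simp only: Dt_scale alt_def power_sum) simp
qed

text \<open>A shape with more than \<open>k\<close> columns has a converse with a column longer than
  \<open>k\<close>, whose Schur polynomial in \<open>k\<close> variables vanishes. This cuts the
  vertical-strip sum down to \<open>parts n k\<close>.\<close>

lemma schur_converse_Suc: assumes lam: "decr n lam" shows "schur ((dgm n lam)\<inverse>) (Suc k) y =
  (\<Sum>nu\<in>{nu \<in> parts n k. \<forall>i\<in>{1..n}. nu i \<le> lam i \<and> lam i \<le> Suc (nu i)}.
    schur ((dgm n nu)\<inverse>) k y * y (Suc k) ^ (\<Sum>i=1..n. lam i - nu i))" proof -
 let ?A = "{nu \<in> (\<Pi>\<^sub>E i\<in>{1..n}. {lam i - 1..lam i}). decr n nu}"
 have finA: "finite ?A" by (rule finite_subset[of _ "\<Pi>\<^sub>E i\<in>{1..n}. {lam i - 1..lam i}"]) (auto intro: finite_PiE)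
 have inj: "inj_on (\<lambda>nu. (dgm n nu)\<inverse>) ?A"
 proof (rule inj_onI)
  fix a b assume "a \<in> ?A" "b \<in> ?A" "(dgm n a)\<inverse> = (dgm n b)\<inverse>"
  then show "a = b" using inj_onD[OF inj_on_dgm_PiE[of n "\<lambda>i. {lam i - 1..lam i}"], of a b]
   by (metis (no_types, lifting) converse_converse mem_Collect_eq)
 qed
 have card: "card ((dgm n lam)\<inverse> - (dgm n nu)\<inverse>) = (\<Sum>i=1..n. lam i - nu i)" if "nu \<in> ?A" for nu proof -
  have "(dgm n lam)\<inverse> - (dgm n nu)\<inverse> = (dgm n lam - dgm n nu)\<inverse>" by auto
  then show ?thesis using card_dgm_diff[of n nu lam] that by (fastforce simp: PiE_def Pi_def)
 qed
 have "schur ((dgm n lam)\<inverse>) (Suc k) y = (\<Sum>E\<in>strips ((dgm n lam)\<inverse>).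
   schur E k y * y (Suc k) ^ card ((dgm n lam)\<inverse> - E))" by (rule schur_Suc) simp
 also have "\<dots> = (\<Sum>nu\<in>?A. schur ((dgm n nu)\<inverse>) k y * y (Suc k) ^ (\<Sum>i=1..n. lam i - nu i))"
  unfolding strips_dgm_converse[OF lam] sum.reindex[OF inj] comp_def by (intro sum.cong refl) (simp only: card)
 also have "\<dots> = (\<Sum>nu\<in>{nu \<in> parts n k. \<forall>i\<in>{1..n}. nu i \<le> lam i \<and> lam i \<le> Suc (nu i)}.
    schur ((dgm n nu)\<inverse>) k y * y (Suc k) ^ (\<Sum>i=1..n. lam i - nu i))"
 proof (rule sum.mono_neutral_right[OF finA])
  show "{nu \<in> parts n k. \<forall>i\<in>{1..n}. nu i \<le> lam i \<and> lam i \<le> Suc (nu i)} \<subseteq> ?A"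
  proof
   fix nu assume nu: "nu \<in> {nu \<in> parts n k. \<forall>i\<in>{1..n}. nu i \<le> lam i \<and> lam i \<le> Suc (nu i)}"
   then have "nu i \<in> {lam i - 1..lam i}" if "i \<in> {1..n}" for i using that by force
   with nu show "nu \<in> ?A" by (simp add: parts_def PiE_iff)
  qed
  show "\<forall>nu\<in>?A - {nu \<in> parts n k. \<forall>i\<in>{1..n}. nu i \<le> lam i \<and> lam i \<le> Suc (nu i)}.
    schur ((dgm n nu)\<inverse>) k y * y (Suc k) ^ (\<Sum>i=1..n. lam i - nu i) = 0"
  proof
   fix nu assume nu: "nu \<in> ?A - {nu \<in> parts n k. \<forall>i\<in>{1..n}. nu i \<le> lam i \<and> lam i \<le> Suc (nu i)}"
   have bnd: "\<forall>i\<in>{1..n}. nu i \<le> lam i \<and> lam i \<le> Suc (nu i)"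
   proof
    fix i assume "i \<in> {1..n}"
    then have "nu i \<in> {lam i - 1..lam i}" using nu by (intro PiE_mem[of nu "{1..n}"]) auto
    then show "nu i \<le> lam i \<and> lam i \<le> Suc (nu i)" by auto
   qed
   have d: "decr n nu" and ext: "nu \<in> extensional {1..n}" using nu by (auto simp: PiE_iff)
   have "\<not> (\<forall>i\<in>{1..n}. nu i \<le> k)" using nu bnd d ext by (auto simp add: parts_def PiE_iff)
   then obtain i where i: "i \<in> {1..n}" "k < nu i" by (meson not_le)
   then have "Suc k \<le> nu 1" using decrD[OF d, of 1 i] by simp
   then have "(j, 1) \<in> (dgm n nu)\<inverse>" if "1 \<le> j" "j \<le> Suc k" for j using i that by (simp add: mem_dgm)
   then have "schur ((dgm n nu)\<inverse>) k y = 0" by (rule schur_eq_0_long_column)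
   then show "schur ((dgm n nu)\<inverse>) k y * y (Suc k) ^ (\<Sum>i=1..n. lam i - nu i) = 0" by simp
  qed
 qed
 finally show ?thesis .
qed

text \<open>Alternants take the place of the Schur polynomials in x, so no Vandermonde factor has to
  be cancelled. Removing the last y-variable produces a sum over vertical strips; after exchanging
  the two sums the inner one is \<open>alt_pieri\<close>.\<close>

theorem dual_cauchy_alt:
 "(\<Sum>lam\<in>parts n k. alt n (\<lambda>j. lam j + n - j) x * schur ((dgm n lam)\<inverse>) k y) =
  alt n (\<lambda>j. n - j) x * (\<Prod>i=1..n. \<Prod>j=1..k. 1 + x i * y j)"
proof (induction k)
 case 0
 define z :: "nat => nat" where "z = restrict (\<lambda>_. 0) {1..n}"
 have z: "z i = 0" if "1 \<le> i" "i \<le> n" for i using that by (simp add: z_def)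
 have "parts n 0 = {z}"
 proof
  show "parts n 0 \<subseteq> {z}" by (auto simp: parts_def PiE_iff extensional_def fun_eq_iff z_def)
  show "{z} \<subseteq> parts n 0" by (auto simp: parts_def decr_def z_def)
 qed
 moreover have "dgm n z = {}" by (auto simp: dgm_def z)
 moreover have "alt n (\<lambda>j. z j + n - j) x = alt n (\<lambda>j. n - j) x" unfolding alt_def by (rule Dt_cong) (simp add: z)
 ultimately show ?case by (simp add: schur_0)
next
 case (Suc k)
 let ?a = "\<lambda>lam. alt n (\<lambda>j. lam j + n - j) x"
 let ?R = "\<lambda>lam nu. \<forall>i\<in>{1..n}. nu i \<le> lam i \<and> lam i \<le> Suc (nu i)"
 let ?s = "\<lambda>nu. schur ((dgm n nu)\<inverse>) k y"
 let ?w = "\<lambda>lam nu. y (Suc k) ^ (\<Sum>i=1..n. lam i - nu i)"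
 have "(\<Sum>lam\<in>parts n (Suc k). ?a lam * schur ((dgm n lam)\<inverse>) (Suc k) y) =
   (\<Sum>lam\<in>parts n (Suc k). \<Sum>nu\<in>{nu \<in> parts n k. ?R lam nu}. ?a lam * (?s nu * ?w lam nu))"
  by (intro sum.cong refl, subst schur_converse_Suc) (auto simp: parts_def sum_distrib_left)
 also have "\<dots> = (\<Sum>nu\<in>parts n k. \<Sum>lam\<in>{lam \<in> parts n (Suc k). ?R lam nu}. ?a lam * (?s nu * ?w lam nu))" by (rule sum.swap_restrict) auto
 also have "\<dots> = (\<Sum>nu\<in>parts n k. ?s nu * ((\<Prod>i=1..n. 1 + x i * y (Suc k)) * ?a nu))"
 proof (intro sum.cong refl)
  fix nu assume nu: "nu \<in> parts n k"
  have dnu: "decr n nu" and bnu: "\<And>i. 1 \<le> i ==> i \<le> n ==> nu i \<le> k" using nu by (auto simp: parts_def)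
  let ?W = "\<Pi>\<^sub>E j\<in>{1..n}. {nu j, Suc (nu j)}"
  have W: "lam i = nu i \<or> lam i = Suc (nu i)" if "lam \<in> ?W" "1 \<le> i" "i \<le> n" for lam i using PiE_mem[OF that(1), of i] that by simp
  have "(\<Sum>lam\<in>{lam \<in> parts n (Suc k). ?R lam nu}. ?w lam nu * ?a lam) = (\<Sum>lam\<in>?W. ?w lam nu * ?a lam)"
  proof (rule sum.mono_neutral_left)
   show "finite ?W" by (auto intro: finite_PiE)
   show "{lam \<in> parts n (Suc k). ?R lam nu} \<subseteq> ?W"
   proof
    fix lam assume lam: "lam \<in> {lam \<in> parts n (Suc k). ?R lam nu}"
    then have "lam i \<in> {nu i, Suc (nu i)}" if "i \<in> {1..n}" for i using that by (force simp: le_Suc_eq)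
    with lam show "lam \<in> ?W" by (simp add: parts_def PiE_iff)
   qed
   show "\<forall>lam\<in>?W - {lam \<in> parts n (Suc k). ?R lam nu}. ?w lam nu * ?a lam = 0"
   proof
    fix lam assume lam: "lam \<in> ?W - {lam \<in> parts n (Suc k). ?R lam nu}"
    then have lW: "lam \<in> ?W" by blast
    have R: "?R lam nu"
    proof
     fix i assume "i \<in> {1..n}"
     then show "nu i \<le> lam i \<and> lam i \<le> Suc (nu i)" using W[OF lW, of i] by auto
    qed
    have "lam i \<le> Suc k" if "1 \<le> i" "i \<le> n" for i using W[OF lW that] bnu[OF that] by auto
    then have "lam \<in> {1..n} \<rightarrow>\<^sub>E {0..Suc k}" using lW by (auto simp: PiE_iff)
    then have "\<not> decr n lam" using lam R by (auto simp: parts_def)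
    \<comment> \<open>Monotonicity can only fail where \<open>nu i = nu (Suc i)\<close> and row i +
      1 alone is raised. The exponents i and i + 1, shifted by \<open>n - i\<close> and
      \<open>n - (i + 1)\<close>, then coincide.\<close>
    then obtain i where i: "1 \<le> i" "i < n" "\<not> lam (Suc i) \<le> lam i" using decrI_Suc[of n lam] by blast
    then have "lam i = nu i" "lam (Suc i) = Suc (nu i)" using W[OF lW, of i] W[OF lW, of "Suc i"] decrD[OF dnu, of i "Suc i"] by auto
    then have "?a lam = 0" by (intro alt_eq_0[of _ i "Suc i"]) (use i in auto)
    then show "?w lam nu * ?a lam = 0" by simp
   qed
  qed
  moreover have "(\<Sum>lam\<in>{lam \<in> parts n (Suc k). ?R lam nu}. ?a lam * (?s nu * ?w lam nu)) =
    ?s nu * (\<Sum>lam\<in>{lam \<in> parts n (Suc k). ?R lam nu}. ?w lam nu * ?a lam)"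
   unfolding sum_distrib_left by (intro sum.cong refl) (simp only: mult_ac)
  ultimately show "(\<Sum>lam\<in>{lam \<in> parts n (Suc k). ?R lam nu}. ?a lam * (?s nu * ?w lam nu)) =
    ?s nu * ((\<Prod>i=1..n. 1 + x i * y (Suc k)) * ?a nu)" by (simp only: alt_pieri)
 qed
 also have "\<dots> = (\<Prod>i=1..n. 1 + x i * y (Suc k)) * (\<Sum>nu\<in>parts n k. ?a nu * ?s nu)"
  unfolding sum_distrib_left by (intro sum.cong refl) (simp only: mult_ac)
 finally show ?case unfolding Suc.IH by (simp add: prod.distrib mult_ac)
qed

text \<open>In a Leibniz term, scaling x_i by q multiplies by \<open>q ^ l j\<close>, where j is the
  column in which the permutation uses row i. As i varies, every column occurs once.\<close>

lemma alt_eigen: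
 "(\<Sum>i=1..n. alt n l (x(i := q * x i))) = (\<Sum>j=1..n. q ^ l j) * alt n l x" proof -
 define Q where "Q = (\<Sum>j=1..n. q ^ l j)"
 have "(\<Sum>i=1..n. \<Prod>j=1..n. (x(i := q * x i)) (Suc (p (j - 1))) ^ l j) =
   (\<Sum>j=1..n. q ^ l j) * (\<Prod>j=1..n. x (Suc (p (j - 1))) ^ l j)" if p: "p permutes {0..<n}" for p proof -
  let ?P = "\<lambda>j. Suc (p (j - 1))"
  have P: "bij_betw ?P {1..n} {1..n}" proof -
   have "bij_betw (\<lambda>j. j - 1) {1..n} {0..<n}" by (rule bij_betw_byWitness[where f' = Suc]) auto
   moreover have "bij_betw p {0..<n} {0..<n}" using p by (rule permutes_imp_bij)
   moreover have "bij_betw Suc {0..<n} {1..n}" by (rule bij_betw_byWitness[where f' = "\<lambda>j. j - 1"]) auto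
   ultimately have "bij_betw (Suc \<circ> (p \<circ> (\<lambda>j. j - 1))) {1..n} {1..n}" by (blast intro: bij_betw_trans)
   then show ?thesis by (simp add: comp_def)
  qed
  have "(\<Sum>i=1..n. \<Prod>j=1..n. (x(i := q * x i)) (?P j) ^ l j) =
    (\<Sum>m=1..n. \<Prod>j=1..n. (x(?P m := q * x (?P m))) (?P j) ^ l j)" by (rule sum.reindex_bij_betw[OF P, symmetric])
  also have "\<dots> = (\<Sum>m=1..n. q ^ l m * (\<Prod>j=1..n. x (?P j) ^ l j))"
  proof (intro sum.cong refl)
   fix m assume m: "m \<in> {1..n}"
   have "(\<Prod>j=1..n. (x(?P m := q * x (?P m))) (?P j) ^ l j) =
     (\<Prod>j=1..n. (if j = m then q ^ l j else 1) * x (?P j) ^ l j)"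
   proof (intro prod.cong refl)
    fix j assume "j \<in> {1..n}"
    then have "?P j = ?P m \<longleftrightarrow> j = m" using bij_betw_imp_inj_on[OF P] m by (metis inj_onD)
    then show "(x(?P m := q * x (?P m))) (?P j) ^ l j = (if j = m then q ^ l j else 1) * x (?P j) ^ l j" by (simp add: power_mult_distrib)
   qed
   then show "(\<Prod>j=1..n. (x(?P m := q * x (?P m))) (?P j) ^ l j) = q ^ l m * (\<Prod>j=1..n. x (?P j) ^ l j)" using m by (simp add: prod.distrib)
  qed
  finally show ?thesis by (simp add: sum_distrib_right)
 qed
 then have key: "(\<Sum>i=1..n. \<Prod>j=1..n. (x(i := q * x i)) (Suc (p (j - 1))) ^ l j) =
   Q * (\<Prod>j=1..n. x (Suc (p (j - 1))) ^ l j)" if "p permutes {0..<n}" for p using that unfolding Q_def by blast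
 have "(\<Sum>i=1..n. alt n l (x(i := q * x i))) = (\<Sum>p | p permutes {0..<n}.
   \<Sum>i=1..n. signof p * (\<Prod>j=1..n. (x(i := q * x i)) (Suc (p (j - 1))) ^ l j))" unfolding alt_def Dt_leibniz by (rule sum.swap)
 also have "\<dots> = (\<Sum>p | p permutes {0..<n}. Q * (signof p * (\<Prod>j=1..n. x (Suc (p (j - 1))) ^ l j)))"
 proof (intro sum.cong refl)
  fix p assume "p \<in> {p. p permutes {0..<n}}"
  then show "(\<Sum>i=1..n. signof p * (\<Prod>j=1..n. (x(i := q * x i)) (Suc (p (j - 1))) ^ l j)) =
    Q * (signof p * (\<Prod>j=1..n. x (Suc (p (j - 1))) ^ l j))" unfolding sum_distrib_left[symmetric] by (subst key) auto
 qed
 also have "\<dots> = Q * alt n l x" unfolding alt_def Dt_leibniz by (rule sum_distrib_left[symmetric])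
 finally show ?thesis by (simp only: Q_def)
qed

definition wt :: "nat => nat => (nat => real) => (nat => real) => (nat => nat) => real" where
 "wt n k x y lam = schur (dgm n lam) n x * schur ((dgm n lam)\<inverse>) k y"

lemma sum_wt_alt:
 "vdm n x * (\<Sum>lam\<in>parts n k. wt n k x y lam * F lam) =
  (\<Sum>lam\<in>parts n k. alt n (\<lambda>j. lam j + n - j) x * schur ((dgm n lam)\<inverse>) k y * F lam)" unfolding sum_distrib_left
proof (intro sum.cong refl)
 fix lam assume "lam \<in> parts n k"
 then have "decr n lam" by (simp add: parts_def)
 from schur_vdm_eq_alt[OF this, of x]
 show "vdm n x * (wt n k x y lam * F lam) =
   alt n (\<lambda>j. lam j + n - j) x * schur ((dgm n lam)\<inverse>) k y * F lam" by (simp add: wt_def mult_ac flip: schur_vdm_eq_alt)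
qed

lemma vdm_eq_alt: "vdm n x = alt n (\<lambda>j. n - j) x" proof -
 have "schur (dgm n (\<lambda>_. 0)) n x = 1" proof -
  have "ssyt {} n = {\<lambda>b. undefined}" by (auto simp: ssyt_def)
  then show ?thesis by (simp add: schur_def dgm_def)
 qed
 then show ?thesis using schur_vdm_eq_alt[of n "\<lambda>_. 0" x] by (simp add: decr_def)
qed

lemma vdm_dual_cauchy:
 "vdm n x * (\<Sum>lam\<in>parts n k. wt n k x y lam) = vdm n x * (\<Prod>i=1..n. \<Prod>j=1..k. 1 + x i * y j)"
 using sum_wt_alt[of n x k y "\<lambda>_. 1"] dual_cauchy_alt[of n x k y] by (simp add: vdm_eq_alt)

text \<open>Conjugated by the Vandermonde product, the sum of the q-shifts is diagonal on Schur
  polynomials. The arbitrary function \<open>F\<close> allows a second application, which gives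
  second moments.\<close>

lemma vdm_operator:
 "vdm n x * (\<Sum>lam\<in>parts n k. wt n k x y lam * ((\<Sum>j=1..n. q ^ (lam j + n - j)) * F lam)) =
  (\<Sum>i=1..n. vdm n (x(i := q * x i)) * (\<Sum>lam\<in>parts n k. wt n k (x(i := q * x i)) y lam * F lam))" unfolding sum_wt_alt
 by (subst sum.swap, intro sum.cong refl, simp only: sum_distrib_right[symmetric] alt_eigen) (simp add: mult_ac)

section \<open>Contour integrals for the moments\<close>

text \<open>\<open>1 / (2 * pi * \<i>)\<close> times the contour integral over a circle, written as
  a plain integral over \<open>{0..1}\<close> so that linearity, bounds and limits are those of
  ordinary integrals.\<close>

definition CI :: "real => real => (complex => complex) => complex" where
 "CI a r f = integral {0..1} (\<lambda>t. f (circlepath (of_real a) r t) * (of_real r * exp (2 * of_real pi * \<i> * of_real t)))"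

lemma contour_integral_circlepath_CI:
 "contour_integral (circlepath (of_real a) r) f = 2 * pi * \<i> * CI a r f" proof -
 have "contour_integral (circlepath (of_real a) r) f = integral {0..1} (\<lambda>t. (2 * pi * \<i>) *
   (f (circlepath (of_real a) r t) * (of_real r * exp (2 * of_real pi * \<i> * of_real t))))"
  unfolding contour_integral_integral vector_derivative_circlepath by (intro integral_cong) (simp add: mult_ac)
 then show ?thesis by (simp add: CI_def)
qed

lemma circlepath_in_sphere: "0 \<le> r ==> circlepath z r t \<in> sphere z r" proof -
 have "norm (exp (2 * of_real pi * \<i> * of_real t :: complex)) = 1" using norm_exp_i_times[of "2 * pi * t"] by (simp add: mult_ac)
 then show "0 \<le> r ==> circlepath z r t \<in> sphere z r" by (simp add: circlepath dist_norm norm_mult)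
qed

lemma CI_cong: assumes "0 \<le> r" "\<And>v. v \<in> sphere (of_real a) r ==> f v = g v" shows "CI a r f = CI a r g" unfolding CI_def
 by (intro integral_cong arg_cong2[where f = "(*)"] refl assms(2) circlepath_in_sphere assms(1))

lemma CI_integrable: assumes "0 \<le> r" "continuous_on (sphere (of_real a) r) f"
 shows "(\<lambda>t. f (circlepath (of_real a) r t) * (of_real r * exp (2 * of_real pi * \<i> * of_real t)))
  integrable_on {0..1}" proof -
 have c: "continuous_on {0..1} (circlepath (complex_of_real a) r)" unfolding circlepath by (intro continuous_intros)
 show ?thesis by (intro integrable_continuous_real continuous_intros
     continuous_on_compose2[OF assms(2) c]) (use assms circlepath_in_sphere in auto)
qed

lemma CI_add: assumes "0 \<le> r" "continuous_on (sphere (of_real a) r) f" "continuous_on (sphere (of_real a) r) g"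
 shows "CI a r (\<lambda>v. f v + g v) = CI a r f + CI a r g" unfolding CI_def distrib_right using assms by (intro integral_add CI_integrable)

lemma CI_diff: assumes "0 \<le> r" "continuous_on (sphere (of_real a) r) f" "continuous_on (sphere (of_real a) r) g"
 shows "CI a r (\<lambda>v. f v - g v) = CI a r f - CI a r g" unfolding CI_def left_diff_distrib using assms by (intro integral_diff CI_integrable)

lemma CI_mult: "CI a r (\<lambda>v. c * f v) = c * CI a r f" unfolding CI_def mult.assoc by simp

lemma CI_sum: assumes "0 \<le> r" "\<And>i. i \<in> I ==> continuous_on (sphere (of_real a) r) (f i)" "finite I"
 shows "CI a r (\<lambda>v. \<Sum>i\<in>I. f i v) = (\<Sum>i\<in>I. CI a r (f i))" unfolding CI_def sum_distrib_right
 using assms by (intro integral_sum CI_integrable) auto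

lemma norm_CI_le: assumes "0 \<le> r" "continuous_on (sphere (of_real a) r) f" and "\<And>v. v \<in> sphere (of_real a) r ==> norm (f v) \<le> B"
 shows "norm (CI a r f) \<le> r * B" proof -
 have n: "norm (exp (2 * of_real pi * \<i> * of_real t :: complex)) = 1" for t using norm_exp_i_times[of "2 * pi * t"] by (simp add: mult_ac)
 have "norm (CI a r f) \<le> integral {0..1::real} (\<lambda>_. r * B)" unfolding CI_def
 proof (intro integral_norm_bound_integral CI_integrable assms(1,2))
  fix t :: real
  have "norm (f (circlepath (of_real a) r t)) * r \<le> B * r" using assms(1) by (intro mult_right_mono assms(3) circlepath_in_sphere)
  then show "norm (f (circlepath (of_real a) r t) * (of_real r * exp (2 * of_real pi * \<i> * of_real t))) \<le> r * B"
   using assms(1) n by (simp add: norm_mult mult.commute)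
 qed (rule integrable_const_ivl)
 then show ?thesis by simp
qed

lemma residue_quotient: assumes "open s" "z \<in> s" "g holomorphic_on s" and eq: "\<And>w. w \<in> s ==> w \<noteq> z ==> f w = g w / (w - z)"
 shows "residue f z = g z" proof -
 have "residue f z = residue (\<lambda>w. g w / (w - z)) z"
 proof (rule residue_cong)
  have "eventually (\<lambda>w. w \<in> s - {z}) (at z)" using assms(1,2) eventually_at_topological by blast
  then show "eventually (\<lambda>w. f w = g w / (w - z)) (at z)" by eventually_elim (use eq in auto)
 qed simp
 then show ?thesis using residue_simple[OF assms(1-3)] by simp
qed

text \<open>At 0 every factor of the product is 1, which leaves \<open>H 0\<close>. At
  \<open>X i\<close> the numerator (q - 1) X_i cancels the pole factor 1/v up to q - 1.\<close>

lemma CI_residue_sum: fixes X :: "nat => complex" and q :: complex assumes inj: "inj_on X {1..n}" and X0: "\<And>i. i \<in> {1..n} ==> X i \<noteq> 0"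
  and r: "0 < r" "r < R" and X: "\<And>i. i \<in> {1..n} ==> X i \<in> ball (of_real a) r"
  and a0: "0 \<in> ball (complex_of_real a) r" and H: "H holomorphic_on ball (of_real a) R"
 shows "CI a r (\<lambda>v. (\<Prod>i=1..n. (q * v - X i) / (v - X i)) * H v / v) =
  H 0 + (q - 1) * (\<Sum>i=1..n. (\<Prod>j\<in>{1..n} - {i}. (q * X i - X j) / (X i - X j)) * H (X i))" proof -
 let ?S = "ball (complex_of_real a) R"
 define P where "P = X ` {1..n}"
 define f where "f = (\<lambda>v. (\<Prod>i=1..n. (q * v - X i) / (v - X i)) * H v / v)"
 have fin: "finite (insert 0 P)" by (simp add: P_def)
 have bS: "ball (complex_of_real a) r \<subseteq> ?S" using r by (intro subset_ball) simp
 have PS: "insert 0 P \<subseteq> ball (of_real a) r" using X a0 by (auto simp: P_def)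
 have "contour_integral (circlepath (of_real a) r) f =
   2 * pi * \<i> * (\<Sum>p\<in>insert 0 P. winding_number (circlepath (of_real a) r) p * residue f p)"
 proof (rule Residue_theorem[OF _ _ fin])
  show "f holomorphic_on ?S - insert 0 P" unfolding f_def P_def by (intro holomorphic_intros holomorphic_on_subset[OF H]) auto
  show "path_image (circlepath (of_real a) r) \<subseteq> ?S - insert 0 P" using PS r by (auto simp: dist_norm)
  show "\<forall>z. z \<notin> ?S \<longrightarrow> winding_number (circlepath (of_real a) r) z = 0"
  proof (intro allI impI)
   fix z assume z: "z \<notin> ?S"
   show "winding_number (circlepath (of_real a) r) z = 0"
    by (rule winding_number_zero_outside[of _ "cball (of_real a) r"]) (use z r in auto)
  qed
 qed auto
 also have "(\<Sum>p\<in>insert 0 P. winding_number (circlepath (of_real a) r) p * residue f p) =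
   (\<Sum>p\<in>insert 0 P. residue f p)" by (intro sum.cong refl, subst winding_number_circlepath)
    (use PS in \<open>auto simp: dist_norm norm_minus_commute\<close>)
 also have "\<dots> = residue f 0 + (\<Sum>p\<in>P. residue f p)" using X0 by (subst sum.insert) (auto simp: P_def)
 also have "(\<Sum>p\<in>P. residue f p) = (\<Sum>i=1..n. residue f (X i))" unfolding P_def by (subst sum.reindex[OF inj]) simp
 also have "\<dots> = (\<Sum>i=1..n. (q - 1) * ((\<Prod>j\<in>{1..n} - {i}. (q * X i - X j) / (X i - X j)) * H (X i)))"
 proof (intro sum.cong refl)
  fix i assume i: "i \<in> {1..n}"
  define g where "g = (\<lambda>v. (q * v - X i) * (\<Prod>j\<in>{1..n} - {i}. (q * v - X j) / (v - X j)) * H v / v)"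
  have "residue f (X i) = g (X i)"
  proof (rule residue_quotient)
   show "open (?S - (insert 0 (X ` ({1..n} - {i}))))" by (intro open_Diff open_ball finite_imp_closed) auto
   show "X i \<in> ?S - (insert 0 (X ` ({1..n} - {i})))" using X0[OF i] X[OF i] bS inj_on_image_mem_iff[OF inj i, of "{1..n} - {i}"] by auto
   show "g holomorphic_on ?S - (insert 0 (X ` ({1..n} - {i})))"
    unfolding g_def by (intro holomorphic_intros holomorphic_on_subset[OF H]) auto
   show "f w = g w / (w - X i)" for w unfolding f_def g_def using i by (subst prod.remove[of _ i]) auto
  qed
  also have "\<dots> = (q - 1) * ((\<Prod>j\<in>{1..n} - {i}. (q * X i - X j) / (X i - X j)) * H (X i))" using X0[OF i] by (simp add: g_def field_simps)
  finally show "residue f (X i) = (q - 1) * ((\<Prod>j\<in>{1..n} - {i}. (q * X i - X j) / (X i - X j)) * H (X i))" .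
 qed
 also have "residue f 0 = H 0" proof -
  define g where "g = (\<lambda>v. (\<Prod>i=1..n. (q * v - X i) / (v - X i)) * H v)"
  have "residue f 0 = g 0"
  proof (rule residue_quotient)
   show "open (?S - P)" by (intro open_Diff open_ball finite_imp_closed) (simp add: P_def)
   show "0 \<in> ?S - P" using subsetD[OF bS a0] X0 by (auto simp: P_def)
   show "g holomorphic_on ?S - P" unfolding g_def P_def by (intro holomorphic_intros holomorphic_on_subset[OF H]) auto
  qed (simp add: f_def g_def)
  also have "\<dots> = H 0" using X0 by (simp add: g_def)
  finally show ?thesis .
 qed
 finally have "2 * pi * \<i> * CI a r f = 2 * pi * \<i> * (H 0 +
   (\<Sum>i=1..n. (q - 1) * ((\<Prod>j\<in>{1..n} - {i}. (q * X i - X j) / (X i - X j)) * H (X i))))" unfolding contour_integral_circlepath_CI .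
 then show ?thesis by (simp add: f_def sum_distrib_left)
qed

text \<open>Cross-multiplied, so that the induction runs without distinctness; the quotient form
  follows in \<open>vdm_update_ratio\<close>.\<close>

lemma vdm_update: assumes "i \<in> {1..n}" shows "vdm n (x(i := z)) * (\<Prod>j\<in>{1..n} - {i}. x i - x j) = vdm n x * (\<Prod>j\<in>{1..n} - {i}. z - x j)"
 using assms
proof (induction n)
 case (Suc n)
 show ?case
 proof (cases "i = Suc n")
  case True
  have "vdm n (x(i := z)) = vdm n x" unfolding vdm_def by (intro prod.cong) (auto simp: True)
  moreover have "{1..Suc n} - {i} = {1..n}" by (auto simp: True)
  moreover have "(\<Prod>j=1..n. (x(i := z)) j - z) = (\<Prod>j=1..n. x j - z)" by (intro prod.cong) (auto simp: True)
  moreover have "(\<Prod>j=1..n. x j - w) = (- 1) ^ n * (\<Prod>j=1..n. w - x j)" for w proof -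
   have "(\<Prod>j=1..n. x j - w) = (\<Prod>j=1..n. (- 1) * (w - x j))" by (intro prod.cong) auto
   also have "\<dots> = (- 1) ^ n * (\<Prod>j=1..n. w - x j)" by (subst prod.distrib) simp
   finally show ?thesis .
  qed
  ultimately have "vdm (Suc n) (x(i := z)) = vdm n x * ((- 1) ^ n * (\<Prod>j=1..n. z - x j))"
   and "vdm (Suc n) x = vdm n x * ((- 1) ^ n * (\<Prod>j=1..n. x i - x j))" unfolding vdm_Suc True by (simp_all only: fun_upd_same)
  then show ?thesis using \<open>{1..Suc n} - {i} = {1..n}\<close> by (simp only: mult_ac)
 next
  case False
  with Suc have i: "i \<in> {1..n}" by auto
  have e: "{1..Suc n} - {i} = insert (Suc n) ({1..n} - {i})" using False by auto
  have p: "(\<Prod>j=1..n. x j - w) = (x i - w) * (\<Prod>j\<in>{1..n} - {i}. x j - w)" for w using i by (subst prod.remove[of _ i]) auto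
  have p': "(\<Prod>j=1..n. (x(i := z)) j - w) = (z - w) * (\<Prod>j\<in>{1..n} - {i}. x j - w)" for w using i by (subst prod.remove[of _ i]) auto
  have "vdm (Suc n) (x(i := z)) * (\<Prod>j\<in>{1..Suc n} - {i}. x i - x j) =
    (vdm n (x(i := z)) * (\<Prod>j\<in>{1..n} - {i}. x i - x j)) * ((z - x (Suc n)) * (x i - x (Suc n)) *
     (\<Prod>j\<in>{1..n} - {i}. x j - x (Suc n)))" unfolding e vdm_Suc using False p' by simp
  also have "\<dots> = vdm (Suc n) x * (\<Prod>j\<in>{1..Suc n} - {i}. z - x j)" unfolding e vdm_Suc Suc.IH[OF i] using p by simp
  finally show ?thesis .
 qed
qed simp

lemma vdm_nonzero: "inj_on x {1..n} ==> vdm n x \<noteq> 0" unfolding vdm_def by (auto dest: inj_onD)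

lemma vdm_update_ratio: assumes "i \<in> {1..n}" "inj_on x {1..n}"
 shows "vdm n (x(i := z)) = vdm n x * (\<Prod>j\<in>{1..n} - {i}. (z - x j) / (x i - x j))" proof -
 have ne: "(\<Prod>j\<in>{1..n} - {i}. x i - x j) \<noteq> 0"
 proof
  assume "(\<Prod>j\<in>{1..n} - {i}. x i - x j) = 0"
  then have "\<exists>j\<in>{1..n} - {i}. x i - x j = 0" by (simp only: prod_zero_iff finite_Diff finite_atLeastAtMost)
  then obtain j where "j \<in> {1..n} - {i}" "x i = x j" by force
  then show False using inj_onD[OF assms(2), of i j] assms(1) by blast
 qed
 show ?thesis unfolding prod_dividef times_divide_eq_right by (rule iffD2[OF nonzero_eq_divide_eq[OF ne]], rule vdm_update[OF assms(1)])
qed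

section \<open>Expectations and the contour integral for the mean\<close>

definition Zf :: "nat => nat => (nat => real) => (nat => real) => real" where
 "Zf n k x y = (\<Prod>i=1..n. \<Prod>j=1..k. 1 + x i * y j)"

text \<open>The expectation under \<open>mu\<close>, transported to partitions
  (\<open>mu_weight_dgm\<close>). The variables are kept free because the shift operator changes
  them.\<close>

definition EE :: "nat => nat => (nat => real) => (nat => real) => ((nat => nat) => real) => real" where
 "EE n k x y F = (\<Sum>lam\<in>parts n k. wt n k x y lam * F lam) / Zf n k x y"

definition Sq :: "nat => real => (nat => nat) => real" where
 "Sq n q lam = (\<Sum>j=1..n. q ^ (lam j + n - j))"

text \<open>\<open>Sq\<close> is the eigenvalue of the shift operator. The summand 1 matches the
  residue at 0 in \<open>CI_residue_sum\<close>, so the mean of \<open>Yq\<close> is one contour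
  integral.\<close>

definition Yq :: "nat => real => (nat => nat) => real" where
 "Yq n q lam = 1 + (q - 1) * Sq n q lam"

lemma Zf_pos: assumes "\<And>i. i \<in> {1..n} ==> 0 \<le> x i" "\<And>j. j \<in> {1..k} ==> 0 \<le> y j" shows "0 < Zf n k x y"
 unfolding Zf_def using assms by (intro prod_pos ballI) (auto intro!: add_pos_nonneg mult_nonneg_nonneg)

lemma Zf_update: assumes i: "i \<in> {1..n}" and pos: "\<And>j. j \<in> {1..k} ==> 1 + x i * y j \<noteq> 0"
 shows "Zf n k (x(i := z)) y = Zf n k x y * (\<Prod>j=1..k. (1 + z * y j) / (1 + x i * y j))" proof -
 have "Zf n k (x(i := z)) y = (\<Prod>j=1..k. 1 + z * y j) * (\<Prod>m\<in>{1..n} - {i}. \<Prod>j=1..k. 1 + x m * y j)"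
  unfolding Zf_def using i by (subst prod.remove[of _ i]) auto
 moreover have "Zf n k x y = (\<Prod>j=1..k. 1 + x i * y j) * (\<Prod>m\<in>{1..n} - {i}. \<Prod>j=1..k. 1 + x m * y j)"
  unfolding Zf_def using i by (subst prod.remove[of _ i]) auto
 moreover have "(\<Prod>j=1..k. 1 + x i * y j) \<noteq> 0" using pos by simp
 ultimately show ?thesis by (simp add: prod_dividef)
qed

text \<open>The first product is the ratio of Vandermonde products, the second the ratio of
  normalizations after x_i is scaled by q. On the right \<open>F\<close> is averaged under the
  shifted variables.\<close>

lemma EE_operator: assumes x: "\<And>i. i \<in> {1..n} ==> 0 < x i" "inj_on x {1..n}" and y: "\<And>j. j \<in> {1..k} ==> 0 \<le> y j" and q: "0 < q"
 shows "EE n k x y (\<lambda>lam. Sq n q lam * F lam) =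
  (\<Sum>i=1..n. (\<Prod>j\<in>{1..n} - {i}. (q * x i - x j) / (x i - x j)) *
    (\<Prod>j=1..k. (1 + q * x i * y j) / (1 + x i * y j)) * EE n k (x(i := q * x i)) y F)" proof -
 have V: "vdm n x \<noteq> 0" by (rule vdm_nonzero[OF x(2)])
 have Z: "0 < Zf n k x y" using x y by (intro Zf_pos) (auto intro: less_imp_le)
 have "EE n k x y (\<lambda>lam. Sq n q lam * F lam) * (vdm n x * Zf n k x y) =
   vdm n x * (\<Sum>lam\<in>parts n k. wt n k x y lam * (Sq n q lam * F lam))" using Z by (simp add: EE_def)
 also have "\<dots> = (\<Sum>i=1..n. vdm n (x(i := q * x i)) * (\<Sum>lam\<in>parts n k. wt n k (x(i := q * x i)) y lam * F lam))"
  unfolding Sq_def by (rule vdm_operator)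
 also have "\<dots> = (\<Sum>i=1..n. (\<Prod>j\<in>{1..n} - {i}. (q * x i - x j) / (x i - x j)) *
    (\<Prod>j=1..k. (1 + q * x i * y j) / (1 + x i * y j)) * EE n k (x(i := q * x i)) y F * (vdm n x * Zf n k x y))"
 proof (intro sum.cong refl)
  fix i assume i: "i \<in> {1..n}"
  have Z': "0 < Zf n k (x(i := q * x i)) y" using x y q by (intro Zf_pos) (auto intro: less_imp_le)
  have p: "1 + x i * y j \<noteq> 0" if "j \<in> {1..k}" for j using mult_nonneg_nonneg[of "x i" "y j"] x(1)[OF i] y[OF that] by linarith
  have "(\<Sum>lam\<in>parts n k. wt n k (x(i := q * x i)) y lam * F lam) =
    EE n k (x(i := q * x i)) y F * Zf n k (x(i := q * x i)) y" using Z' by (simp add: EE_def)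
  also have "Zf n k (x(i := q * x i)) y = Zf n k x y * (\<Prod>j=1..k. (1 + q * x i * y j) / (1 + x i * y j))"
   by (rule Zf_update[where x = x, OF i p])
  finally show "vdm n (x(i := q * x i)) * (\<Sum>lam\<in>parts n k. wt n k (x(i := q * x i)) y lam * F lam) =
    (\<Prod>j\<in>{1..n} - {i}. (q * x i - x j) / (x i - x j)) *
    (\<Prod>j=1..k. (1 + q * x i * y j) / (1 + x i * y j)) * EE n k (x(i := q * x i)) y F * (vdm n x * Zf n k x y)"
   unfolding vdm_update_ratio[OF i x(2)] by (simp only: mult_ac)
 qed
 also have "\<dots> = (\<Sum>i=1..n. (\<Prod>j\<in>{1..n} - {i}. (q * x i - x j) / (x i - x j)) *
    (\<Prod>j=1..k. (1 + q * x i * y j) / (1 + x i * y j)) * EE n k (x(i := q * x i)) y F) * (vdm n x * Zf n k x y)"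
  by (rule sum_distrib_right[symmetric])
 finally show ?thesis using V Z by simp
qed

text \<open>The weights of \<open>EE_operator\<close> extended to a complex variable v, with every
  x_i kept in the product; the omitted index i becomes the pole at x_i.\<close>

definition Rr :: "nat => nat => real => (nat => real) => (nat => real) => complex => complex" where
 "Rr n k q x y v =
   (\<Prod>i=1..n. (of_real q * v - of_real (x i)) / (v - of_real (x i))) *
   (\<Prod>j=1..k. (1 + of_real q * v * of_real (y j)) / (1 + v * of_real (y j)))"

text \<open>All contours are circles with centre M and radius M + e. They enclose [0, 2 M], hence 0
  and all x_i, but reach left only to -e and so avoid the poles -1/y_j as long as e y_j is
  small.\<close>

lemma Re_ge_of_mem_cball: assumes "v \<in> cball (complex_of_real M) (M + e)" shows "- e \<le> Re v" "norm v \<le> 2 * \<bar>M\<bar> + e" proof -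
 have d: "norm (v - of_real M) \<le> M + e" using assms by (simp add: dist_norm norm_minus_commute)
 then show "- e \<le> Re v" using abs_Re_le_cmod[of "v - of_real M"] by simp
 show "norm v \<le> 2 * \<bar>M\<bar> + e" using norm_triangle_sub[of v "of_real M"] d by simp
qed

lemma norm_one_plus_ge: assumes "- e \<le> Re v" "0 \<le> y" "e * y \<le> 1 / 2" shows "1 / 2 \<le> norm (1 + v * of_real y)" proof -
 have "- (1 / 2) \<le> - e * y" using assms by simp
 also have "\<dots> \<le> Re v * y" using assms by (intro mult_right_mono) auto
 finally have "1 / 2 \<le> Re (1 + v * of_real y)" by simp
 then show ?thesis using complex_Re_le_cmod order_trans by blast
qed

lemma of_real_mem_ball: assumes "- e < t" "t < 2 * M + e" shows "of_real t \<in> ball (complex_of_real M) (M + e)" proof -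
 have "dist (complex_of_real M) (of_real t) = \<bar>M - t\<bar>" by (metis dist_norm norm_of_real of_real_diff)
 then show ?thesis using assms by simp
qed

lemma dist_sphere_ge: assumes "v \<in> sphere (complex_of_real M) (M + e)" "0 \<le> t" "t \<le> 2 * M" shows "e \<le> norm (v - of_real t)" proof -
 have "M + e = norm (v - of_real M)" using assms by (simp add: dist_norm norm_minus_commute)
 also have "\<dots> \<le> norm (v - of_real t) + norm (complex_of_real (t - M))"
  using norm_triangle_ineq[of "v - of_real t" "complex_of_real (t - M)"] by simp
 also have "norm (complex_of_real (t - M)) = \<bar>t - M\<bar>" by (rule norm_of_real)
 finally show ?thesis using assms(2,3) by linarith
qed

lemma schur_tendsto: assumes "\<And>i. ((\<lambda>e. x e i) \<longlongrightarrow> x0 i) F" shows "((\<lambda>e. schur D n (x e)) \<longlongrightarrow> schur D n x0) F"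
 unfolding schur_def by (intro tendsto_intros assms)

lemma EE_tendsto: assumes "\<And>i. ((\<lambda>e. x e i) \<longlongrightarrow> x0 i) F" "Zf n k x0 y \<noteq> 0" shows "((\<lambda>e. EE n k (x e) y f) \<longlongrightarrow> EE n k x0 y f) F"
 unfolding EE_def wt_def
proof (intro tendsto_intros schur_tendsto assms)
 show "((\<lambda>e. Zf n k (x e) y) \<longlongrightarrow> Zf n k x0 y) F" unfolding Zf_def by (intro tendsto_intros assms)
qed

text \<open>Two perturbed variables collide for at most one value of the parameter; \<open>F\<close>
  collects these finitely many values. The value 0 is left out of the exclusion because only
  positive parameters matter.\<close>

lemma eventually_perturbed_inj: fixes x :: "nat => real" shows "eventually (\<lambda>e. inj_on (\<lambda>i. x i + e * real i) {1..n}) (at_right 0)" proof -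
 define F where "F = (\<lambda>(i, j). (x j - x i) / (real i - real j)) ` ({1..n} \<times> {1..n})"
 have "eventually (\<lambda>e. e \<in> - (F - {0})) (nhds 0)"
 proof (rule eventually_nhds_in_open)
  have "finite F" by (simp add: F_def)
  then show "open (- (F - {0}))" by (intro open_Compl finite_imp_closed finite_Diff)
 qed simp
 then have "eventually (\<lambda>e. e \<in> - (F - {0})) (at_right 0)" by (metis eventually_nhds_conv_at filter_leD at_within_le_nhds)
 moreover have "eventually (\<lambda>e::real. 0 < e) (at_right 0)" by (rule eventually_at_right_less)
 ultimately show ?thesis
 proof eventually_elim
  case (elim e)
  show ?case
  proof (rule inj_onI, rule ccontr)
   fix i j assume ij: "i \<in> {1..n}" "j \<in> {1..n}" "x i + e * real i = x j + e * real j" "i \<noteq> j"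
   then have "e = (x j - x i) / (real i - real j)" by (simp add: field_simps)
   then have "e \<in> F" unfolding F_def using ij by force
   then show False using elim by simp
  qed
 qed
qed

lemma tendsto_perturbed: "((\<lambda>e. x i + e * real i) \<longlongrightarrow> x i) (at_right (0::real))" by (rule tendsto_eq_intros refl | simp)+

text \<open>Cancelling the Vandermonde product in \<open>vdm_dual_cauchy\<close> requires distinct
  variables; both sides are continuous in x, so the perturbed case suffices.\<close>

lemma EE_one: assumes x: "\<And>i. i \<in> {1..n} ==> 0 \<le> x i" and y: "\<And>j. j \<in> {1..k} ==> 0 \<le> y j" shows "EE n k x y (\<lambda>_. 1) = 1" proof -
 have "((\<lambda>e. EE n k (\<lambda>i. x i + e * real i) y (\<lambda>_. 1)) \<longlongrightarrow> EE n k x y (\<lambda>_. 1)) (at_right 0)"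
  using Zf_pos[of n x k y] x y by (intro EE_tendsto tendsto_perturbed) auto
 moreover
 have "eventually (\<lambda>e. EE n k (\<lambda>i. x i + e * real i) y (\<lambda>_. 1) = 1) (at_right 0)"
  using eventually_perturbed_inj[of x n] eventually_at_right_less[of 0]
 proof eventually_elim
  case (elim e)
  have "vdm n (\<lambda>i. x i + e * real i) \<noteq> 0" by (rule vdm_nonzero[OF elim(1)])
  moreover have "0 < Zf n k (\<lambda>i. x i + e * real i) y" using x y elim(2) by (intro Zf_pos) auto
  ultimately show ?case using vdm_dual_cauchy[of n "\<lambda>i. x i + e * real i" k y, folded Zf_def] by (simp add: EE_def)
 qed
 from tendsto_eventually[OF this]
 have "((\<lambda>e. EE n k (\<lambda>i. x i + e * real i) y (\<lambda>_. 1)) \<longlongrightarrow> 1) (at_right 0)" .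
 ultimately show ?thesis by (rule tendsto_unique[OF trivial_limit_at_right_real])
qed

lemma EE_add: "EE n k x y (\<lambda>lam. F lam + G lam) = EE n k x y F + EE n k x y G"
 by (simp add: EE_def distrib_left sum.distrib add_divide_distrib)

lemma EE_cmult: "EE n k x y (\<lambda>lam. c * F lam) = c * EE n k x y F" by (simp add: EE_def sum_distrib_left mult.left_commute)

lemma holomorphic_Phi: assumes "\<And>j. j \<in> {1..k} ==> 0 \<le> y j \<and> e * y j < 1" "R \<le> M + e"
 shows "(\<lambda>v. \<Prod>j=1..k. (1 + of_real q * v * of_real (y j)) / (1 + v * of_real (y j)))
  holomorphic_on ball (complex_of_real M) R"
proof (intro holomorphic_intros)
 fix j v assume j: "j \<in> {1..k}" and v: "v \<in> ball (complex_of_real M) R"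
 have "- e < Re v" using v assms(2) abs_Re_le_cmod[of "v - of_real M"] by (simp add: dist_norm norm_minus_commute)
 then have "- e * y j \<le> Re v * y j" using assms(1)[OF j] by (intro mult_right_mono) auto
 then have "0 < Re (1 + v * of_real (y j))" using assms(1)[OF j] by simp
 then show "1 + v * of_real (y j) \<noteq> 0" by fastforce
qed

lemma EE_Yq_eq_CI_distinct: assumes M: "0 < M" and e: "0 < e" and q: "0 < q"
  and x: "\<And>i. i \<in> {1..n} ==> 0 < x i \<and> x i < 2 * M + e" "inj_on x {1..n}" and y: "\<And>j. j \<in> {1..k} ==> 0 \<le> y j \<and> e * y j \<le> 1 / 4"
 shows "of_real (EE n k x y (Yq n q)) = CI M (M + e) (\<lambda>v. Rr n k q x y v / v)" proof -
 define H :: "complex => complex" where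
  "H = (\<lambda>v. \<Prod>j=1..k. (1 + of_real q * v * of_real (y j)) / (1 + v * of_real (y j)))"
 have "CI M (M + e) (\<lambda>v. (\<Prod>i=1..n. (of_real q * v - of_real (x i)) / (v - of_real (x i))) * H v / v) =
   H 0 + (of_real q - 1) * (\<Sum>i=1..n. (\<Prod>j\<in>{1..n} - {i}.
    (of_real q * of_real (x i) - of_real (x j)) / (of_real (x i) - of_real (x j))) * H (of_real (x i)))"
 proof (rule CI_residue_sum)
  show "inj_on (\<lambda>i. complex_of_real (x i)) {1..n}" by (intro inj_onI) (metis inj_onD of_real_eq_iff x(2))
  show "0 < M + e" "M + e < M + 2 * e" using M e by auto
  show "complex_of_real (x i) \<noteq> 0" "complex_of_real (x i) \<in> ball (complex_of_real M) (M + e)"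
   if "i \<in> {1..n}" for i using x(1)[OF that] e of_real_mem_ball[of e "x i" M] by auto
  show "0 \<in> ball (complex_of_real M) (M + e)" using M e by simp
  show "H holomorphic_on ball (complex_of_real M) (M + 2 * e)"
   unfolding H_def by (rule holomorphic_Phi[where e = "2 * e"]) (use y in fastforce)+
 qed
 also have "H 0 = 1" by (simp add: H_def)
 also have "1 + (of_real q - 1) * (\<Sum>i=1..n. (\<Prod>j\<in>{1..n} - {i}.
    (of_real q * of_real (x i) - of_real (x j)) / (of_real (x i) - of_real (x j))) * H (of_real (x i))) =
   complex_of_real (1 + (q - 1) * (\<Sum>i=1..n. (\<Prod>j\<in>{1..n} - {i}. (q * x i - x j) / (x i - x j)) *
    (\<Prod>j=1..k. (1 + q * x i * y j) / (1 + x i * y j)) * 1))" by (simp add: H_def)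
 also have "(\<Sum>i=1..n. (\<Prod>j\<in>{1..n} - {i}. (q * x i - x j) / (x i - x j)) *
    (\<Prod>j=1..k. (1 + q * x i * y j) / (1 + x i * y j)) * 1) = EE n k x y (\<lambda>lam. Sq n q lam * 1)"
  by (subst EE_operator, use x y q in \<open>simp_all\<close>) (intro sum.cong refl, subst EE_one, use x y q in \<open>auto intro: less_imp_le\<close>)
 also have "1 + (q - 1) * EE n k x y (\<lambda>lam. Sq n q lam * 1) = EE n k x y (Yq n q)" proof -
  have "EE n k x y (\<lambda>lam. 1 + (q - 1) * Sq n q lam) = EE n k x y (\<lambda>_. 1) + (q - 1) * EE n k x y (Sq n q)" by (simp only: EE_add EE_cmult)
  then show ?thesis using EE_one[of n x k y] x y by (fastforce simp: Yq_def[abs_def] less_imp_le)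
 qed
 finally show ?thesis by (simp add: Rr_def H_def)
qed

lemma continuous_on_Rr: assumes e: "0 < e" and x: "\<And>i. i \<in> {1..n} ==> 0 \<le> x i \<and> x i < 2 * M + e"
  and y: "\<And>j. j \<in> {1..k} ==> 0 \<le> y j \<and> e * y j \<le> 1 / 4" shows "continuous_on (sphere (complex_of_real M) (M + e)) (Rr n k q x y)"
 unfolding Rr_def
proof (intro continuous_intros ballI)
 fix i v assume i: "i \<in> {1..n}" and v: "v \<in> sphere (complex_of_real M) (M + e)"
 show "v - of_real (x i) \<noteq> 0" using of_real_mem_ball[of e "x i" M] x[OF i] e v by auto
next
 fix j v assume j: "j \<in> {1..k}" and v: "v \<in> sphere (complex_of_real M) (M + e)"
 have "1 / 2 \<le> norm (1 + v * of_real (y j))" by (rule norm_one_plus_ge[of e]) (use y[OF j] Re_ge_of_mem_cball(1)[of v M e] v in auto)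
 then show "1 + v * of_real (y j) \<noteq> 0" by auto
qed

lemma zero_notin_sphere: "0 < M ==> 0 < e ==> v \<in> sphere (complex_of_real M) (M + e) ==> v \<noteq> 0" by auto

text \<open>Both sides are continuous at 0 in the perturbation parameter: the left one as a finite
  sum of polynomials over a nonzero normalization, the right one as an integral over a fixed circle
  that the moving poles do not reach.\<close>

theorem EE_Yq_eq_CI: assumes M: "0 < M" and e: "0 < e" and q: "0 < q" and x: "\<And>i. i \<in> {1..n} ==> 0 \<le> x i \<and> x i \<le> 2 * M"
  and y: "\<And>j. j \<in> {1..k} ==> 0 \<le> y j \<and> e * y j \<le> 1 / 4" shows "of_real (EE n k x y (Yq n q)) = CI M (M + e) (\<lambda>v. Rr n k q x y v / v)" proof -
 define xe where "xe = (\<lambda>d i. x i + d * real i)"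
 \<comment> \<open>Gives \<open>d0 * i \<le> e / 2\<close> for all \<open>i \<le> n\<close>, so the
   perturbed variables stay inside the circle uniformly.\<close>
 define d0 where "d0 = e / (2 * (real n + 1))"
 have d0: "0 < d0" "d0 * real i < e" if "i \<le> n" for i proof -
  show "0 < d0" using e by (simp add: d0_def)
  then have "d0 * real i \<le> d0 * (real n + 1)" using that by (intro mult_left_mono) auto
  also have "\<dots> = e / 2" by (simp add: d0_def field_simps)
  finally show "d0 * real i < e" using e by simp
 qed
 have xe: "0 \<le> xe d i \<and> xe d i < 2 * M + e" if "i \<in> {1..n}" "d \<in> {0..d0}" for d i proof -
  have "d * real i \<le> d0 * real i" using that by (intro mult_right_mono) auto
  moreover have "d0 * real i < e" using d0(2) that(1) by simp
  moreover have "0 \<le> d * real i" using that by simp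
  ultimately show ?thesis using x[OF that(1)] unfolding xe_def by linarith
 qed
 define f where "f = (\<lambda>d t. Rr n k q (xe d) y (circlepath (of_real M) (M + e) t) / circlepath (of_real M) (M + e) t *
   (of_real (M + e) * exp (2 * of_real pi * \<i> * of_real t)))"
 have sph: "circlepath (complex_of_real M) (M + e) t \<in> sphere (of_real M) (M + e)" for t using M e by (intro circlepath_in_sphere) simp
 have "continuous_on {0..d0} (\<lambda>d. integral (cbox 0 1) (f d))"
 proof (rule integral_continuous_on_param)
  have ne1: "circlepath (complex_of_real M) (M + e) t \<noteq> 0" for t using zero_notin_sphere[OF M e sph] .
  have ne2: "circlepath (complex_of_real M) (M + e) t - of_real (xe d i) \<noteq> 0"
   if "i \<in> {1..n}" "d \<in> {0..d0}" for t d i using of_real_mem_ball[of e "xe d i" M] xe[OF that] e sph[of t] by auto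
  have ne3: "1 + circlepath (complex_of_real M) (M + e) t * of_real (y j) \<noteq> 0" if "j \<in> {1..k}" for t j proof -
   have "1 / 2 \<le> norm (1 + circlepath (complex_of_real M) (M + e) t * of_real (y j))" by (rule norm_one_plus_ge[of e])
      (use y[OF that] Re_ge_of_mem_cball(1)[of _ M e] sph[of t] in auto)
   then show ?thesis by auto
  qed
  have c: "continuous_on A (\<lambda>p. circlepath (complex_of_real M) (M + e) (snd p))" for A :: "(real \<times> real) set"
   unfolding circlepath by (intro continuous_intros)
  show "continuous_on ({0..d0} \<times> cbox 0 1) (\<lambda>(d, t). f d t)" unfolding f_def case_prod_unfold Rr_def
   by (intro continuous_intros c) (use ne1 ne2 ne3 in \<open>auto simp: xe_def intro!: continuous_intros\<close>)
 qed
 then have cont: "continuous_on {0..d0} (\<lambda>d. CI M (M + e) (\<lambda>v. Rr n k q (xe d) y v / v))" by (simp add: CI_def f_def)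
 have d0': "0 < d0" using d0(1)[of 0] by simp
 have "((\<lambda>d. CI M (M + e) (\<lambda>v. Rr n k q (xe d) y v / v)) \<longlongrightarrow> CI M (M + e) (\<lambda>v. Rr n k q (xe 0) y v / v)) (at 0 within {0..d0})"
  using cont d0' by (auto simp: continuous_on_def)
 moreover have "at 0 within {0..d0} = at_right 0" using d0' by (simp add: at_within_Icc_at_right)
 ultimately have 1: "((\<lambda>d. CI M (M + e) (\<lambda>v. Rr n k q (xe d) y v / v)) \<longlongrightarrow> CI M (M + e) (\<lambda>v. Rr n k q x y v / v)) (at_right 0)"
  by (simp add: xe_def)
 have 2: "((\<lambda>d. complex_of_real (EE n k (xe d) y (Yq n q))) \<longlongrightarrow> of_real (EE n k x y (Yq n q))) (at_right 0)"
 proof (intro tendsto_of_real EE_tendsto)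
  show "((\<lambda>d. xe d i) \<longlongrightarrow> x i) (at_right 0)" for i unfolding xe_def by (rule tendsto_perturbed)
  show "Zf n k x y \<noteq> 0" using Zf_pos[of n x k y] x y by fastforce
 qed
 have "eventually (\<lambda>d. d \<in> {0<..<d0}) (at_right 0)" using d0' by (rule eventually_at_right_real)
 then have "eventually (\<lambda>d. of_real (EE n k (xe d) y (Yq n q)) = CI M (M + e) (\<lambda>v. Rr n k q (xe d) y v / v)) (at_right 0)"
  using eventually_perturbed_inj[of x n]
 proof eventually_elim
  case (elim d)
  show ?case
  proof (rule EE_Yq_eq_CI_distinct[OF M e q _ _ y])
   fix i assume i: "i \<in> {1..n}"
   have "0 < xe d i" using x[OF i] i elim(1) by (auto simp: xe_def intro: add_nonneg_pos)
   then show "0 < xe d i \<and> xe d i < 2 * M + e" using xe[OF i, of d] elim(1) by auto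
  qed (use elim in \<open>simp_all add: xe_def\<close>)
 qed
 then have "((\<lambda>d. CI M (M + e) (\<lambda>v. Rr n k q (xe d) y v / v)) \<longlongrightarrow> of_real (EE n k x y (Yq n q))) (at_right 0)"
  using 2 by (rule Lim_transform_eventually[rotated])
 then show ?thesis using 1 tendsto_unique trivial_limit_at_right_real by blast
qed

section \<open>The variance as a double contour integral\<close>

definition kap :: "real => complex => complex => complex" where
 "kap q w v = of_real q * (w - v)\<^sup>2 / ((w - of_real q * v) * (of_real q * w - v))"

text \<open>\<open>kap q w v\<close> is the factor by which \<open>Rr\<close> at w changes when the
  variable x_i = v is replaced by q v. That it differs from 1 only at order (q - 1)^2 is the source
  of concentration.\<close>

lemma kap_minus_one: assumes "w - of_real q * v \<noteq> 0" "of_real q * w - v \<noteq> 0"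
 shows "kap q w v - 1 = (of_real q - 1)\<^sup>2 * w * v / ((w - of_real q * v) * (of_real q * w - v))"
 using assms by (simp add: kap_def divide_simps) (simp add: power2_eq_square algebra_simps)

lemma norm_minus_mult_ge: fixes w v :: complex and d K :: real assumes "2 * d \<le> norm (w - v)" "\<bar>q - 1\<bar> * K \<le> d" "norm v \<le> K" "norm w \<le> K"
 shows "d \<le> norm (w - of_real q * v)" "d \<le> norm (of_real q * w - v)" proof -
 have b: "norm (of_real (q - 1) * u) \<le> d" if "norm u \<le> K" for u :: complex proof -
  have "norm (of_real (q - 1) * u) = \<bar>q - 1\<bar> * norm u" by (simp only: norm_mult norm_of_real)
  also have "\<dots> \<le> \<bar>q - 1\<bar> * K" using that by (intro mult_left_mono) auto
  finally show ?thesis using assms(2) by simp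
 qed
 have "norm (w - v) \<le> norm (w - of_real q * v) + norm (of_real (q - 1) * v)"
  using norm_triangle_ineq[of "w - of_real q * v" "of_real (q - 1) * v"] by (simp add: algebra_simps)
 then show "d \<le> norm (w - of_real q * v)" using b[OF assms(3)] assms(1) by linarith
 have "norm (w - v) \<le> norm (of_real q * w - v) + norm (of_real (q - 1) * w)"
  using norm_triangle_ineq4[of "of_real q * w - v" "of_real (q - 1) * w"] by (simp add: algebra_simps)
 then show "d \<le> norm (of_real q * w - v)" using b[OF assms(4)] assms(1) by linarith
qed

text \<open>Applying the operator to \<open>Yq\<close> leaves means with one shifted variable; on
  the outer circle these are integrals of \<open>Rr\<close> times \<open>kap\<close>, and the sum
  over i is again a residue sum over the inner circle. So the second moment is the double integral
  of R(v) R(w) \<open>kap q w v\<close> / (v w), and the squared mean is the same integral without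
  \<open>kap\<close>.\<close>

lemma EE_variance_distinct: assumes M: "0 < M" and e: "0 < e" and q: "0 < q" "\<bar>q - 1\<bar> * (2 * M + 2 * e) \<le> e / 4"
  and x: "\<And>i. i \<in> {1..n} ==> 0 < x i \<and> x i < 2 * M \<and> q * x i \<le> 2 * M" "inj_on x {1..n}"
  and y: "\<And>j. j \<in> {1..k} ==> 0 \<le> y j \<and> (2 * e) * y j \<le> 1 / 4" and B: "\<And>v. v \<in> sphere (of_real M) (M + e) ==> norm (Rr n k q x y v) \<le> B"
   "\<And>v. v \<in> sphere (of_real M) (M + 2 * e) ==> norm (Rr n k q x y v) \<le> B"
 shows "\<bar>EE n k x y (\<lambda>lam. Yq n q lam * Yq n q lam) - EE n k x y (Yq n q) * EE n k x y (Yq n q)\<bar>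
  \<le> (M + e) * (M + 2 * e) * B\<^sup>2 * (q - 1)\<^sup>2 * (16 / e\<^sup>2)" proof -
 let ?S1 = "sphere (complex_of_real M) (M + e)" and ?S2 = "sphere (complex_of_real M) (M + 2 * e)"
 let ?R = "Rr n k q x y"
 define Phi :: "complex => complex" where
  "Phi = (\<lambda>v. \<Prod>j=1..k. (1 + of_real q * v * of_real (y j)) / (1 + v * of_real (y j)))"
 define C :: "nat => real" where
  "C = (\<lambda>i. (\<Prod>j\<in>{1..n} - {i}. (q * x i - x j) / (x i - x j)) *
    (\<Prod>j=1..k. (1 + q * x i * y j) / (1 + x i * y j)))"
 let ?X = "\<lambda>i. complex_of_real (x i)"
 have y': "0 \<le> y j \<and> e * y j \<le> 1 / 4" if "j \<in> {1..k}" for j using y[OF that] mult_nonneg_nonneg[of e "y j"] e by auto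
 have x1: "0 \<le> x i \<and> x i \<le> 2 * M" "0 \<le> x i \<and> x i < 2 * M + e" "0 \<le> x i \<and> x i < 2 * M + 2 * e"
  if "i \<in> {1..n}" for i using x(1)[OF that] e by auto
 have R1: "continuous_on ?S1 ?R" by (rule continuous_on_Rr[OF e x1(2) y'])
 have e2: "0 < 2 * e" using e by simp
 have R2: "continuous_on ?S2 ?R" by (rule continuous_on_Rr[where e = "2 * e", OF e2 x1(3) y]) auto
 have r1: "0 \<le> M + e" and r2: "0 \<le> M + 2 * e" using M e by auto
 have w0: "w \<noteq> 0" if "w \<in> ?S2" for w using zero_notin_sphere[OF M e2 that] .
 have v0: "v \<noteq> 0" if "v \<in> ?S1" for v using zero_notin_sphere[OF M e that] .
 \<comment> \<open>The residue computation on the inner circle needs \<open>kap\<close> holomorphic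
   on a larger disc, here of radius M + 3/2 e. That disc has distance e/2 from the outer circle, and
   the hypothesis on q uses up at most half of it.\<close>
 have far: "e / 4 \<le> norm (w - of_real q * v)" "e / 4 \<le> norm (of_real q * w - v)"
  if w: "w \<in> ?S2" and v: "v \<in> ball (of_real M) (M + 3 / 2 * e)" for w v proof -
  have nw: "norm w \<le> 2 * M + 2 * e" using Re_ge_of_mem_cball(2)[of w M "2 * e"] w M by auto
  have nv: "norm v \<le> 2 * M + 2 * e" using Re_ge_of_mem_cball(2)[of v M "3 / 2 * e"] v M e by auto
  have "norm (w - of_real M) \<le> norm (w - v) + norm (v - of_real M)" using norm_triangle_ineq[of "w - v" "v - of_real M"] by simp
  then have "2 * (e / 4) \<le> norm (w - v)" using w v by (simp add: dist_norm norm_minus_commute)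
  from norm_minus_mult_ge[OF this q(2) nv nw]
  show "e / 4 \<le> norm (w - of_real q * v)" "e / 4 \<le> norm (of_real q * w - v)" .
 qed
 have far0: "w - of_real q * v \<noteq> 0" "of_real q * w - v \<noteq> 0"
  if w: "w \<in> ?S2" and v: "v \<in> ball (of_real M) (M + 3 / 2 * e)" for w v using far[OF that] e by auto
 have Xb: "?X i \<in> ball (of_real M) (M + 3 / 2 * e)" "?X i \<in> ball (of_real M) (M + e)" if "i \<in> {1..n}" for i
  using x(1)[OF that] e of_real_mem_ball[of "3 / 2 * e" "x i" M] of_real_mem_ball[of e "x i" M] by auto
 have S1b: "v \<in> ball (of_real M) (M + 3 / 2 * e)" if "v \<in> ?S1" for v using that e by auto
 have RT: "Rr n k q (x(i := q * x i)) y w = ?R w * kap q w (?X i)" if i: "i \<in> {1..n}" and w: "w \<in> ?S2" for i w proof -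
  have ne: "w - ?X i \<noteq> 0" using of_real_mem_ball[of "2 * e" "x i" M] x(1)[OF i] w e by auto
  note f0 = far0[OF w Xb(1)[OF i]]
  let ?P = "\<Prod>j\<in>{1..n} - {i}. (of_real q * w - ?X j) / (w - ?X j)"
  have "Rr n k q (x(i := q * x i)) y w =
    (of_real q * w - of_real (q * x i)) / (w - of_real (q * x i)) * ?P * Phi w"
   unfolding Rr_def Phi_def using i by (subst prod.remove[of _ i]) auto
  moreover have "?R w = (of_real q * w - ?X i) / (w - ?X i) * ?P * Phi w"
   unfolding Rr_def Phi_def using i by (subst prod.remove[of _ i]) auto
  moreover have "(of_real q * w - of_real (q * x i)) / (w - of_real (q * x i)) =
    (of_real q * w - ?X i) / (w - ?X i) * kap q w (?X i)"
   using ne f0 by (simp add: kap_def divide_simps) (simp add: power2_eq_square algebra_simps)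
  ultimately show ?thesis by (simp only: mult_ac)
 qed
 have inner: "CI M (M + e) (\<lambda>v. ?R v * kap q w v / v) =
   1 + (of_real q - 1) * (\<Sum>i=1..n. of_real (C i) * kap q w (?X i))" if w: "w \<in> ?S2" for w proof -
  have res: "CI M (M + e) (\<lambda>v. (\<Prod>i=1..n. (of_real q * v - ?X i) / (v - ?X i)) * (Phi v * kap q w v) / v) =
    Phi 0 * kap q w 0 + (of_real q - 1) * (\<Sum>i=1..n. (\<Prod>j\<in>{1..n} - {i}.
    (of_real q * ?X i - ?X j) / (?X i - ?X j)) * (Phi (?X i) * kap q w (?X i)))"
  proof (rule CI_residue_sum)
   show "inj_on ?X {1..n}" by (intro inj_onI) (metis inj_onD of_real_eq_iff x(2))
   show "0 < M + e" "M + e < M + 3 / 2 * e" using M e by auto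
   show "?X i \<noteq> 0" if "i \<in> {1..n}" for i using x(1)[OF that] by auto
   show "?X i \<in> ball (of_real M) (M + e)" if "i \<in> {1..n}" for i by (rule Xb(2)[OF that])
   show "0 \<in> ball (complex_of_real M) (M + e)" using M e by simp
   show "(\<lambda>v. Phi v * kap q w v) holomorphic_on ball (of_real M) (M + 3 / 2 * e)" unfolding Phi_def kap_def
   proof (intro holomorphic_on_mult holomorphic_Phi[where e = "2 * e"] holomorphic_on_divide)
    show "0 \<le> y j \<and> 2 * e * y j < 1" if "j \<in> {1..k}" for j using y[OF that] by auto
    show "(w - of_real q * v) * (of_real q * w - v) \<noteq> 0" if "v \<in> ball (of_real M) (M + 3 / 2 * e)" for v using far0[OF w that] by simp
   qed (use e in \<open>auto intro!: holomorphic_intros\<close>)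
  qed
  \<comment> \<open>The pole at 0 contributes exactly the constant term, because
    \<open>kap q w 0 = 1\<close>.\<close>
  have P0: "Phi 0 * kap q w 0 = 1" using w0[OF w] q by (simp add: Phi_def kap_def power2_eq_square)
  have Ci: "(\<Prod>j\<in>{1..n} - {i}. (of_real q * ?X i - ?X j) / (?X i - ?X j)) * (Phi (?X i) * kap q w (?X i)) =
    of_real (C i) * kap q w (?X i)" for i by (simp add: C_def Phi_def)
  have "(\<lambda>v. ?R v * kap q w v / v) =
    (\<lambda>v. (\<Prod>i=1..n. (of_real q * v - ?X i) / (v - ?X i)) * (Phi v * kap q w v) / v)" by (simp only: Rr_def Phi_def mult.assoc)
  then show ?thesis by (simp only: res P0 Ci)
 qed
 define J where "J = (\<lambda>w. 1 + (of_real q - 1) * (\<Sum>i=1..n. of_real (C i) * kap q w (?X i)))"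
 have kc: "continuous_on ?S2 (\<lambda>w. kap q w (?X i))" if "i \<in> {1..n}" for i
  unfolding kap_def using far0[OF _ Xb(1)[OF that]] by (intro continuous_intros) auto
 have Jc: "continuous_on ?S2 J" unfolding J_def by (intro continuous_intros kc)
 have Rw: "continuous_on ?S2 (\<lambda>w. ?R w / w)" using w0 by (intro continuous_intros R2) auto
 \<comment> \<open>The same mean over either circle; multiplying the two forms presents its square
   as a double integral over the same contours as the second moment.\<close>
 have E1: "complex_of_real (EE n k x y (Yq n q)) = CI M (M + e) (\<lambda>v. ?R v / v)" by (rule EE_Yq_eq_CI[OF M e q(1) x1(1) y'])
 have E2: "complex_of_real (EE n k x y (Yq n q)) = CI M (M + 2 * e) (\<lambda>v. ?R v / v)" by (rule EE_Yq_eq_CI[OF M e2 q(1) x1(1) y])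
 have "EE n k x y (\<lambda>lam. Yq n q lam * Yq n q lam) =
   EE n k x y (Yq n q) + (q - 1) * EE n k x y (\<lambda>lam. Sq n q lam * Yq n q lam)" proof -
  have "(\<lambda>lam. Yq n q lam * Yq n q lam) = (\<lambda>lam. Yq n q lam + (q - 1) * (Sq n q lam * Yq n q lam))" by (auto simp: Yq_def algebra_simps)
  then show ?thesis by (simp only: EE_add EE_cmult)
 qed
 also have "EE n k x y (\<lambda>lam. Sq n q lam * Yq n q lam) = (\<Sum>i=1..n. C i * EE n k (x(i := q * x i)) y (Yq n q))"
  unfolding C_def by (rule EE_operator) (use x y q in auto)
 finally have "complex_of_real (EE n k x y (\<lambda>lam. Yq n q lam * Yq n q lam)) =
   CI M (M + 2 * e) (\<lambda>w. ?R w / w) + (of_real q - 1) * (\<Sum>i=1..n. of_real (C i) *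
    CI M (M + 2 * e) (\<lambda>w. Rr n k q (x(i := q * x i)) y w / w))" proof -
  have "complex_of_real (EE n k (x(i := q * x i)) y (Yq n q)) =
    CI M (M + 2 * e) (\<lambda>w. Rr n k q (x(i := q * x i)) y w / w)" if "i \<in> {1..n}" for i
   by (rule EE_Yq_eq_CI[OF M e2 q(1) _ y]) (use x q that in \<open>auto intro: less_imp_le\<close>)
  moreover assume "EE n k x y (\<lambda>lam. Yq n q lam * Yq n q lam) = EE n k x y (Yq n q) +
   (q - 1) * (\<Sum>i=1..n. C i * EE n k (x(i := q * x i)) y (Yq n q))"
  ultimately show ?thesis by (simp add: E2)
 qed
 also have "(\<Sum>i=1..n. of_real (C i) * CI M (M + 2 * e) (\<lambda>w. Rr n k q (x(i := q * x i)) y w / w)) =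
   (\<Sum>i=1..n. CI M (M + 2 * e) (\<lambda>w. of_real (C i) * (?R w / w * kap q w (?X i))))"
 proof (intro sum.cong refl)
  fix i assume i: "i \<in> {1..n}"
  have "CI M (M + 2 * e) (\<lambda>w. Rr n k q (x(i := q * x i)) y w / w) = CI M (M + 2 * e) (\<lambda>w. ?R w / w * kap q w (?X i))"
   by (rule CI_cong[OF r2]) (simp add: RT[OF i])
  then show "of_real (C i) * CI M (M + 2 * e) (\<lambda>w. Rr n k q (x(i := q * x i)) y w / w) =
   CI M (M + 2 * e) (\<lambda>w. of_real (C i) * (?R w / w * kap q w (?X i)))" by (simp only: CI_mult)
 qed
 also have "\<dots> = CI M (M + 2 * e) (\<lambda>w. \<Sum>i=1..n. of_real (C i) * (?R w / w * kap q w (?X i)))"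
  by (rule CI_sum[symmetric, OF r2]) (intro continuous_on_mult continuous_on_const Rw kc | simp)+
 also have "CI M (M + 2 * e) (\<lambda>w. ?R w / w) + (of_real q - 1) * \<dots> = CI M (M + 2 * e) (\<lambda>w. ?R w / w * J w)" proof -
  have "CI M (M + 2 * e) (\<lambda>w. ?R w / w + (of_real q - 1) * (\<Sum>i=1..n. of_real (C i) * (?R w / w * kap q w (?X i)))) =
    CI M (M + 2 * e) (\<lambda>w. ?R w / w) + (of_real q - 1) * CI M (M + 2 * e) (\<lambda>w. \<Sum>i=1..n. of_real (C i) * (?R w / w * kap q w (?X i)))"
   unfolding CI_mult[symmetric] by (rule CI_add[OF r2]) (intro continuous_on_mult continuous_on_sum continuous_on_const Rw kc | simp)+
  moreover have "(\<lambda>w. ?R w / w + (of_real q - 1) * (\<Sum>i=1..n. of_real (C i) * (?R w / w * kap q w (?X i)))) =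
    (\<lambda>w. ?R w / w * J w)"
  proof
   fix w
   have "(\<Sum>i=1..n. of_real (C i) * (?R w / w * kap q w (?X i))) = ?R w / w * (\<Sum>i=1..n. of_real (C i) * kap q w (?X i))"
    unfolding sum_distrib_left by (intro sum.cong refl) (simp only: mult_ac)
   then show "?R w / w + (of_real q - 1) * (\<Sum>i=1..n. of_real (C i) * (?R w / w * kap q w (?X i))) = ?R w / w * J w"
    unfolding J_def by (simp only: distrib_left mult_1_right mult_1_left mult_ac)
  qed
  ultimately show ?thesis by simp
 qed
 finally have EY2: "complex_of_real (EE n k x y (\<lambda>lam. Yq n q lam * Yq n q lam)) = CI M (M + 2 * e) (\<lambda>w. ?R w / w * J w)" .
 define c1 where "c1 = CI M (M + e) (\<lambda>v. ?R v / v)"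
 have "complex_of_real (EE n k x y (Yq n q) * EE n k x y (Yq n q)) = c1 * CI M (M + 2 * e) (\<lambda>w. ?R w / w)" using E1 E2 by (simp add: c1_def)
 also have "\<dots> = CI M (M + 2 * e) (\<lambda>w. c1 * (?R w / w))" by (rule CI_mult[symmetric])
 finally have diff: "complex_of_real (EE n k x y (\<lambda>lam. Yq n q lam * Yq n q lam) - EE n k x y (Yq n q) * EE n k x y (Yq n q)) =
   CI M (M + 2 * e) (\<lambda>w. ?R w / w * J w - c1 * (?R w / w))" unfolding of_real_diff EY2
  by (subst CI_diff[OF r2]) (intro continuous_on_mult continuous_on_const Rw Jc | simp)+
 have B0: "0 \<le> B" by (rule order_trans[OF norm_ge_zero B(1)[OF circlepath_in_sphere[OF r1, of _ 0]]])
 have bnd: "norm (?R w / w * J w - c1 * (?R w / w)) \<le> B * ((M + e) * (B * ((q - 1)\<^sup>2 * (16 / e\<^sup>2))))"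
  if w: "w \<in> ?S2" for w proof -
  have kv: "continuous_on ?S1 (\<lambda>v. kap q w v)" unfolding kap_def using far0[OF w S1b] by (intro continuous_intros) auto
  have "J w - c1 = CI M (M + e) (\<lambda>v. ?R v * kap q w v / v - ?R v / v)" unfolding J_def inner[OF w, symmetric] c1_def using v0
   by (intro CI_diff[OF r1, symmetric] continuous_intros R1 kv) auto
  also have "\<dots> = CI M (M + e) (\<lambda>v. w * (?R v * (of_real q - 1)\<^sup>2 / ((w - of_real q * v) * (of_real q * w - v))))"
  proof (rule CI_cong[OF r1])
   fix v assume v: "v \<in> ?S1"
   have "?R v * kap q w v / v - ?R v / v = ?R v * (kap q w v - 1) / v" by (simp add: diff_divide_distrib right_diff_distrib)
   also have "\<dots> = w * (?R v * (of_real q - 1)\<^sup>2 / ((w - of_real q * v) * (of_real q * w - v)))"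
    unfolding kap_minus_one[OF far0[OF w S1b[OF v]]] using v0[OF v] by simp
   finally show "?R v * kap q w v / v - ?R v / v =
    w * (?R v * (of_real q - 1)\<^sup>2 / ((w - of_real q * v) * (of_real q * w - v)))" .
  qed
  also have "\<dots> = w * CI M (M + e) (\<lambda>v. ?R v * (of_real q - 1)\<^sup>2 / ((w - of_real q * v) * (of_real q * w - v)))" by (rule CI_mult)
  finally have J: "J w - c1 = w * CI M (M + e) (\<lambda>v. ?R v * (of_real q - 1)\<^sup>2 / ((w - of_real q * v) * (of_real q * w - v)))" .
  have cin: "norm (CI M (M + e) (\<lambda>v. ?R v * (of_real q - 1)\<^sup>2 / ((w - of_real q * v) * (of_real q * w - v))))
    \<le> (M + e) * (B * ((q - 1)\<^sup>2 * (16 / e\<^sup>2)))"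
  proof (rule norm_CI_le[OF r1])
   show "continuous_on ?S1 (\<lambda>v. ?R v * (of_real q - 1)\<^sup>2 / ((w - of_real q * v) * (of_real q * w - v)))"
    using far0[OF w S1b] by (intro continuous_intros R1) auto
   fix v assume v: "v \<in> ?S1"
   have nq: "norm ((complex_of_real q - 1)\<^sup>2) = (q - 1)\<^sup>2" by (metis norm_of_real norm_power of_real_1 of_real_diff power2_abs)
   have "(e / 4) * (e / 4) \<le> norm (w - of_real q * v) * norm (of_real q * w - v)" using far[OF w S1b[OF v]] e by (intro mult_mono) auto
   then have "(q - 1)\<^sup>2 / (norm (w - of_real q * v) * norm (of_real q * w - v)) \<le> (q - 1)\<^sup>2 / ((e / 4) * (e / 4))"
    using e by (intro frac_le mult_pos_pos) auto
   also have "\<dots> = (q - 1)\<^sup>2 * (16 / e\<^sup>2)" using e by (simp add: power2_eq_square)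
   finally have "norm (?R v) * ((q - 1)\<^sup>2 / (norm (w - of_real q * v) * norm (of_real q * w - v))) \<le> B * ((q - 1)\<^sup>2 * (16 / e\<^sup>2))"
    using B0 B(1)[OF v] by (intro mult_mono) auto
   then show "norm (?R v * (of_real q - 1)\<^sup>2 / ((w - of_real q * v) * (of_real q * w - v))) \<le> B * ((q - 1)\<^sup>2 * (16 / e\<^sup>2))"
    by (simp add: norm_mult norm_divide nq)
  qed
  have "?R w / w * J w - c1 * (?R w / w) = ?R w / w * (J w - c1)" by (simp only: left_diff_distrib mult.commute)
  also have "\<dots> = ?R w * CI M (M + e) (\<lambda>v. ?R v * (of_real q - 1)\<^sup>2 / ((w - of_real q * v) * (of_real q * w - v)))"
   unfolding J using w0[OF w] by simp
  finally have "norm (?R w / w * J w - c1 * (?R w / w)) = norm (?R w) *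
    norm (CI M (M + e) (\<lambda>v. ?R v * (of_real q - 1)\<^sup>2 / ((w - of_real q * v) * (of_real q * w - v))))" by (simp only: norm_mult)
  also have "\<dots> \<le> B * ((M + e) * (B * ((q - 1)\<^sup>2 * (16 / e\<^sup>2))))" using B(2)[OF w] cin B0 by (intro mult_mono) auto
  finally show ?thesis .
 qed
 have "norm (CI M (M + 2 * e) (\<lambda>w. ?R w / w * J w - c1 * (?R w / w))) \<le>
   (M + 2 * e) * (B * ((M + e) * (B * ((q - 1)\<^sup>2 * (16 / e\<^sup>2)))))" by (rule norm_CI_le[OF r2 _ bnd]) (intro continuous_intros Rw Jc, simp)
 also have "\<dots> = (M + e) * (M + 2 * e) * B\<^sup>2 * (q - 1)\<^sup>2 * (16 / e\<^sup>2)" by (simp only: power2_eq_square mult_ac)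
 finally show ?thesis unfolding diff[symmetric] norm_of_real .
qed

text \<open>Every factor is 1 + (q - 1) times a bounded quantity, hence at most an exponential. The
  total exponent is of order |q - 1| (n + k), which stays bounded for q = exp(s/n) and k of order
  n.\<close>

lemma norm_Rr_le: assumes M: "0 < M" and e: "0 < e" "e \<le> e'" and q: "0 < q" and x: "\<And>i. i \<in> {1..n} ==> 0 \<le> x i \<and> x i \<le> 2 * M"
  and y: "\<And>j. j \<in> {1..k} ==> 0 \<le> y j \<and> e' * y j \<le> 1 / 4 \<and> y j \<le> Y" and v: "v \<in> sphere (of_real M) (M + e')"
 shows "norm (Rr n k q x y v) \<le> exp (\<bar>q - 1\<bar> * (2 * M + e') * (real n / e + real k * (2 * Y)))" proof -
 have nv: "norm v \<le> 2 * M + e'" using Re_ge_of_mem_cball(2)[of v M e'] v M by auto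
 have K0: "0 \<le> 2 * M + e'" using M e by simp
 have 1: "norm (\<Prod>i=1..n. (of_real q * v - of_real (x i)) / (v - of_real (x i))) \<le> exp (\<bar>q - 1\<bar> * (2 * M + e') / e) ^ n" proof -
  have "norm (\<Prod>i=1..n. (of_real q * v - of_real (x i)) / (v - of_real (x i))) \<le>
    (\<Prod>i=1..n. exp (\<bar>q - 1\<bar> * (2 * M + e') / e))" unfolding prod_norm[symmetric]
  proof (intro prod_mono conjI norm_ge_zero)
   fix i assume i: "i \<in> {1..n}"
   have d: "e \<le> norm (v - of_real (x i))" using dist_sphere_ge[OF v, of "x i"] x[OF i] e by simp
   then have ne: "v - of_real (x i) \<noteq> 0" using e by auto
   have "(of_real q * v - of_real (x i)) / (v - of_real (x i)) = 1 + of_real (q - 1) * v / (v - of_real (x i))"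
    using ne by (simp add: field_simps)
   then have "norm ((of_real q * v - of_real (x i)) / (v - of_real (x i))) \<le> 1 + norm (of_real (q - 1) * v / (v - of_real (x i)))"
    by (metis norm_one norm_triangle_ineq)
   also have "norm (of_real (q - 1) * v / (v - of_real (x i))) = \<bar>q - 1\<bar> * norm v / norm (v - of_real (x i))"
    by (simp only: norm_mult norm_divide norm_of_real)
   also have "\<dots> \<le> \<bar>q - 1\<bar> * (2 * M + e') / e" using d nv e K0 by (intro frac_le mult_mono) auto
   also have "1 + \<dots> \<le> exp (\<bar>q - 1\<bar> * (2 * M + e') / e)" by (rule exp_ge_add_one_self)
   finally show "norm ((of_real q * v - of_real (x i)) / (v - of_real (x i))) \<le> exp (\<bar>q - 1\<bar> * (2 * M + e') / e)" by simp
  qed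
  then show ?thesis by simp
 qed
 have 2: "norm (\<Prod>j=1..k. (1 + of_real q * v * of_real (y j)) / (1 + v * of_real (y j))) \<le> exp (\<bar>q - 1\<bar> * (2 * M + e') * (2 * Y)) ^ k"
 proof -
  have "norm (\<Prod>j=1..k. (1 + of_real q * v * of_real (y j)) / (1 + v * of_real (y j))) \<le>
    (\<Prod>j=1..k. exp (\<bar>q - 1\<bar> * (2 * M + e') * (2 * Y)))" unfolding prod_norm[symmetric]
  proof (intro prod_mono conjI norm_ge_zero)
   fix j assume j: "j \<in> {1..k}"
   have d: "1 / 2 \<le> norm (1 + v * of_real (y j))" by (rule norm_one_plus_ge[of e']) (use y[OF j] Re_ge_of_mem_cball(1)[of v M e'] v in auto)
   then have ne: "1 + v * of_real (y j) \<noteq> 0" by auto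
   have "(1 + of_real q * v * of_real (y j)) / (1 + v * of_real (y j)) = 1 + of_real (q - 1) * v * of_real (y j) / (1 + v * of_real (y j))"
    using ne by (simp add: field_simps)
   then have "norm ((1 + of_real q * v * of_real (y j)) / (1 + v * of_real (y j))) \<le> 1 + norm (of_real (q - 1) * v * of_real (y j) / (1 + v * of_real (y j)))"
    by (metis norm_one norm_triangle_ineq)
   also have "norm (of_real (q - 1) * v * of_real (y j) / (1 + v * of_real (y j))) = \<bar>q - 1\<bar> * norm v * \<bar>y j\<bar> / norm (1 + v * of_real (y j))"
    by (simp only: norm_mult norm_divide norm_of_real)
   also have "\<dots> \<le> \<bar>q - 1\<bar> * (2 * M + e') * Y / (1 / 2)" using d nv y[OF j] K0 by (intro frac_le mult_mono) auto
   also have "\<bar>q - 1\<bar> * (2 * M + e') * Y / (1 / 2) = \<bar>q - 1\<bar> * (2 * M + e') * (2 * Y)" by simp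
   also have "1 + \<dots> \<le> exp (\<bar>q - 1\<bar> * (2 * M + e') * (2 * Y))" by (rule exp_ge_add_one_self)
   finally show "norm ((1 + of_real q * v * of_real (y j)) / (1 + v * of_real (y j))) \<le> exp (\<bar>q - 1\<bar> * (2 * M + e') * (2 * Y))" by simp
  qed
  then show ?thesis by simp
 qed
 have "norm (Rr n k q x y v) \<le> exp (\<bar>q - 1\<bar> * (2 * M + e') / e) ^ n * exp (\<bar>q - 1\<bar> * (2 * M + e') * (2 * Y)) ^ k"
  unfolding Rr_def norm_mult by (intro mult_mono 1 2) auto
 also have "\<dots> = exp (\<bar>q - 1\<bar> * (2 * M + e') * (real n / e + real k * (2 * Y)))"
  by (simp add: exp_of_nat_mult[symmetric] exp_add[symmetric] algebra_simps add_divide_distrib)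
 finally show ?thesis .
qed

text \<open>The strict bound \<open>x i < M\<close> survives a small perturbation, and then
  \<open>q < 2\<close> keeps the shifted variables below 2 M, inside both circles.\<close>

theorem EE_variance: assumes M: "0 < M" and e: "0 < e" and q: "0 < q" "q < 2" "\<bar>q - 1\<bar> * (2 * M + 2 * e) \<le> e / 4"
  and x: "\<And>i. i \<in> {1..n} ==> 0 \<le> x i \<and> x i < M" and y: "\<And>j. j \<in> {1..k} ==> 0 \<le> y j \<and> (2 * e) * y j \<le> 1 / 4 \<and> y j \<le> Y"
  and B: "exp (\<bar>q - 1\<bar> * (2 * M + 2 * e) * (real n / e + real k * (2 * Y))) \<le> B" and Y: "0 \<le> Y"
 shows "\<bar>EE n k x y (\<lambda>lam. Yq n q lam * Yq n q lam) - EE n k x y (Yq n q) * EE n k x y (Yq n q)\<bar>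
  \<le> (M + e) * (M + 2 * e) * B\<^sup>2 * (q - 1)\<^sup>2 * (16 / e\<^sup>2)" proof -
 define xe where "xe = (\<lambda>d i. x i + d * real i)"
 have Z: "Zf n k x y \<noteq> 0" using Zf_pos[of n x k y] x y by fastforce
 have xt: "((\<lambda>d. xe d i) \<longlongrightarrow> x i) (at_right 0)" for i unfolding xe_def by (rule tendsto_perturbed)
 have lim: "((\<lambda>d. \<bar>EE n k (xe d) y (\<lambda>lam. Yq n q lam * Yq n q lam) - EE n k (xe d) y (Yq n q) * EE n k (xe d) y (Yq n q)\<bar>) \<longlongrightarrow>
   \<bar>EE n k x y (\<lambda>lam. Yq n q lam * Yq n q lam) - EE n k x y (Yq n q) * EE n k x y (Yq n q)\<bar>) (at_right 0)"
  by (intro tendsto_intros EE_tendsto xt Z)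
 have "eventually (\<lambda>d. \<forall>i\<in>{1..n}. xe d i < M) (at_right 0)"
 proof (rule eventually_ball_finite)
  show "\<forall>i\<in>{1..n}. eventually (\<lambda>d. xe d i < M) (at_right 0)" using order_tendstoD(2)[OF xt] x by blast
 qed simp
 then have "eventually (\<lambda>d. \<bar>EE n k (xe d) y (\<lambda>lam. Yq n q lam * Yq n q lam) - EE n k (xe d) y (Yq n q) * EE n k (xe d) y (Yq n q)\<bar>
   \<le> (M + e) * (M + 2 * e) * B\<^sup>2 * (q - 1)\<^sup>2 * (16 / e\<^sup>2)) (at_right 0)"
  using eventually_perturbed_inj[of x n] eventually_at_right_less[of 0]
 proof eventually_elim
  case (elim d)
  have pos: "0 < xe d i \<and> xe d i < M" if "i \<in> {1..n}" for i using that x[OF that] elim by (auto simp: xe_def intro: add_nonneg_pos)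
  have y2: "0 \<le> y j \<and> e' * y j \<le> 1 / 4 \<and> y j \<le> Y" if "j \<in> {1..k}" "0 \<le> e'" "e' \<le> 2 * e" for j e'
   using y[OF that(1)] mult_right_mono[OF that(3), of "y j"] by auto
  have bound: "norm (Rr n k q (xe d) y v) \<le> B"
   if "v \<in> sphere (of_real M) (M + e')" "e \<le> e'" "e' \<le> 2 * e" for v e' proof -
   have "norm (Rr n k q (xe d) y v) \<le> exp (\<bar>q - 1\<bar> * (2 * M + e') * (real n / e + real k * (2 * Y)))"
   proof (rule norm_Rr_le[OF M e that(2) q(1) _ _ that(1)])
    show "0 \<le> xe d i \<and> xe d i \<le> 2 * M" if "i \<in> {1..n}" for i using pos[OF that] M by auto
    show "0 \<le> y j \<and> e' * y j \<le> 1 / 4 \<and> y j \<le> Y" if "j \<in> {1..k}" for j by (rule y2[OF that]) (use e \<open>e \<le> e'\<close> \<open>e' \<le> 2 * e\<close> in auto)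
   qed
   also have "\<dots> \<le> exp (\<bar>q - 1\<bar> * (2 * M + 2 * e) * (real n / e + real k * (2 * Y)))"
    using that e Y by (intro iffD2[OF exp_le_cancel_iff] mult_right_mono mult_left_mono add_nonneg_nonneg) auto
   finally show ?thesis using B by simp
  qed
  show ?case
  proof (rule EE_variance_distinct[OF M e q(1,3)])
   show "0 < xe d i \<and> xe d i < 2 * M \<and> q * xe d i \<le> 2 * M" if "i \<in> {1..n}" for i using pos[OF that] q M mult_mono[of q 2 "xe d i" M] by auto
   show "inj_on (xe d) {1..n}" using elim(2) by (simp add: xe_def)
   show "0 \<le> y j \<and> 2 * e * y j \<le> 1 / 4" if "j \<in> {1..k}" for j using y[OF that] by auto
  qed (use bound e in auto)
 qed
 then show ?thesis using tendsto_upperbound[OF lim] by simp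
qed

section \<open>Piecewise smooth functions\<close>

lemma integrable_bounded_cofinite_continuous: fixes F :: "real => 'a::euclidean_space"
 assumes "finite P" "continuous_on ({0..1} - P) F" "\<And>s. s \<in> {0..1} - P ==> norm (F s) \<le> B" shows "F integrable_on {0..1}" proof -
 have neg: "negligible (({0..1} - ({0..1} - P)) \<union> (({0..1} - P) - {0..1}) :: real set)"
  by (rule negligible_subset[of P]) (use assms(1) in auto)
 have "F integrable_on ({0..1} - P)"
 proof (rule measurable_bounded_by_integrable_imp_integrable)
  show S: "{0..1} - P \<in> sets lebesgue" using assms(1) by (auto simp: finite_imp_closed)
  show "F \<in> borel_measurable (lebesgue_on ({0..1} - P))" by (rule continuous_imp_measurable_on_sets_lebesgue[OF assms(2) S])
  have "(\<lambda>s::real. B) integrable_on {0..1}" by (rule integrable_const_ivl)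
  then show "(\<lambda>s. B) integrable_on ({0..1} - P)" using integrable_spike_set_eq[OF neg] by blast
 qed (use assms(3) in auto)
 then show ?thesis using integrable_spike_set_eq[OF neg] by blast
qed

lemma has_integral_step: fixes F :: "real => 'a::euclidean_space" assumes n: "0 < n" and m: "m \<le> n"
 shows "((\<lambda>s. F (of_int \<lceil>real n * s\<rceil> / real n)) has_integral (\<Sum>j=1..m. F (real j / real n)) /\<^sub>R real n)
  {0..real m / real n}" using m
proof (induction m)
 case (Suc m)
 let ?g = "\<lambda>s. F (of_int \<lceil>real n * s\<rceil> / real n)"
 have "((\<lambda>_. F (real (Suc m) / real n)) has_integral (real (Suc m) / real n - real m / real n) *\<^sub>R F (real (Suc m) / real n))
   {real m / real n..real (Suc m) / real n}"
  using has_integral_const_real[of "F (real (Suc m) / real n)" "real m / real n" "real (Suc m) / real n"] n by (simp add: divide_right_mono)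
 also have "real (Suc m) / real n - real m / real n = inverse (real n)" by (simp add: add_divide_distrib inverse_eq_divide)
 finally have "((\<lambda>_. F (real (Suc m) / real n)) has_integral F (real (Suc m) / real n) /\<^sub>R real n)
   {real m / real n..real (Suc m) / real n}" .
 then have "(?g has_integral F (real (Suc m) / real n) /\<^sub>R real n) {real m / real n..real (Suc m) / real n}"
 proof (rule has_integral_spike_finite[of "{real m / real n}", rotated 2])
  fix s assume s: "s \<in> {real m / real n..real (Suc m) / real n} - {real m / real n}"
  then have "real m < real n * s" "real n * s \<le> real (Suc m)" using n by (auto simp: field_simps)
  then have "\<lceil>real n * s\<rceil> = int (Suc m)" by (intro ceiling_unique) auto
  then show "?g s = F (real (Suc m) / real n)" by simp
 qed simp
 then show ?case using has_integral_combine[OF _ _ Suc.IH, of "real (Suc m) / real n"] Suc.prems n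
  by (auto simp: divide_right_mono scaleR_add_right)
qed (auto intro: has_integral_refl)

text \<open>The sums are integrals of step functions that converge pointwise off \<open>P\<close>,
  so dominated convergence applies. On the finite set \<open>P\<close> the step functions are
  replaced by \<open>F\<close> itself to have convergence everywhere; the bound has to cover
  \<open>P\<close> because sample points may fall there.\<close>

lemma riemann_sums_tendsto: fixes F :: "real => 'a::euclidean_space"
 assumes P: "finite P" "0 \<in> P" "1 \<in> P" and cont: "continuous_on ({0..1} - P) F" and B: "\<And>s. s \<in> {0..1} ==> norm (F s) \<le> B"
 shows "(\<lambda>n. (\<Sum>j=1..n. F (real j / real n)) /\<^sub>R real n) \<longlonglongrightarrow> integral {0..1} F" proof -
 define g where "g = (\<lambda>n s. if s \<in> P then F s else F (of_int \<lceil>real (Suc n) * s\<rceil> / real (Suc n)))"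
 have rng: "of_int \<lceil>real (Suc n) * s\<rceil> / real (Suc n) \<in> {0..1}" if "s \<in> {0..1}" for s n proof -
  have "real (Suc n) * s \<le> real (Suc n)" using that by (simp add: mult_left_le)
  then have "\<lceil>real (Suc n) * s\<rceil> \<le> int (Suc n)" by (simp add: ceiling_le_iff)
  then have "of_int \<lceil>real (Suc n) * s\<rceil> \<le> real (Suc n)" by linarith
  moreover have "0 \<le> real (Suc n) * s" using that by (intro mult_nonneg_nonneg) auto
  then have "0 \<le> real_of_int \<lceil>real (Suc n) * s\<rceil>" using le_of_int_ceiling order_trans by blast
  ultimately show ?thesis by (simp add: divide_le_eq)
 qed
 have int: "(g n has_integral (\<Sum>j=1..Suc n. F (real j / real (Suc n))) /\<^sub>R real (Suc n)) {0..1}" for n proof -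
  have "((\<lambda>s. F (of_int \<lceil>real (Suc n) * s\<rceil> / real (Suc n))) has_integral
    (\<Sum>j=1..Suc n. F (real j / real (Suc n))) /\<^sub>R real (Suc n)) {0..real (Suc n) / real (Suc n)}" by (rule has_integral_step) auto
  then have "((\<lambda>s. F (of_int \<lceil>real (Suc n) * s\<rceil> / real (Suc n))) has_integral
    (\<Sum>j=1..Suc n. F (real j / real (Suc n))) /\<^sub>R real (Suc n)) {0..1}" by simp
  then show ?thesis by (rule has_integral_spike_finite[OF P(1), rotated]) (simp add: g_def)
 qed
 have "(\<lambda>n. integral {0..1} (g n)) \<longlonglongrightarrow> integral {0..1} F"
 proof (rule dominated_convergence(2))
  show "g n integrable_on {0..1}" for n using int by blast
  show "(\<lambda>_. B) integrable_on {0..1::real}" by (rule integrable_const_ivl)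
  show "norm (g n s) \<le> B" if "s \<in> {0..1}" for n s using B[OF that] B[OF rng[OF that]] by (simp add: g_def)
  show "(\<lambda>n. g n s) \<longlonglongrightarrow> F s" if s: "s \<in> {0..1}" for s
  proof (cases "s \<in> P")
   case False
   have op: "open ({0<..<1} - P)" using P(1) by (intro open_Diff finite_imp_closed) auto
   have "{0<..<1} - P = {0..1} - P" using P(2,3) by (auto simp: order.strict_iff_order)
   with op cont False s have "isCont F s" by (metis DiffI continuous_on_eq_continuous_at)
   moreover have "(\<lambda>n. of_int \<lceil>real (Suc n) * s\<rceil> / real (Suc n)) \<longlonglongrightarrow> s"
   proof (rule real_tendsto_sandwich)
    show "eventually (\<lambda>n. s \<le> of_int \<lceil>real (Suc n) * s\<rceil> / real (Suc n)) sequentially"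
     by (intro always_eventually allI) (simp add: pos_le_divide_eq mult.commute del: of_nat_Suc)
    show "eventually (\<lambda>n. of_int \<lceil>real (Suc n) * s\<rceil> / real (Suc n) \<le> s + 1 / real (Suc n)) sequentially"
    proof (intro always_eventually allI)
     fix n
     have "of_int \<lceil>real (Suc n) * s\<rceil> \<le> real (Suc n) * s + 1" by linarith
     then have "of_int \<lceil>real (Suc n) * s\<rceil> / real (Suc n) \<le> (real (Suc n) * s + 1) / real (Suc n)" by (rule divide_right_mono) simp
     then show "of_int \<lceil>real (Suc n) * s\<rceil> / real (Suc n) \<le> s + 1 / real (Suc n)" by (simp add: add_divide_distrib del: of_nat_Suc)
    qed
    show "(\<lambda>n. s + 1 / real (Suc n)) \<longlonglongrightarrow> s"
     using tendsto_add[OF tendsto_const LIMSEQ_inverse_real_of_nat, of s] by (simp add: inverse_eq_divide)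
   qed simp
   ultimately show ?thesis using False isCont_tendsto_compose by (fastforce simp: g_def)
  qed (simp add: g_def)
 qed
 then have "(\<lambda>n. (\<Sum>j=1..Suc n. F (real j / real (Suc n))) /\<^sub>R real (Suc n)) \<longlonglongrightarrow> integral {0..1} F" by (simp only: integral_unique[OF int])
 then show ?thesis by (rule LIMSEQ_imp_Suc)
qed

lemma integral_ge_subinterval: fixes F :: "real => real"
 assumes "F integrable_on {0..1}" "\<And>s. s \<in> {0..1} ==> 0 \<le> F s" "{u..v} \<subseteq> {0..1}" "u \<le> v"
  and "finite P" "\<And>s. s \<in> {u..v} - P ==> G s \<le> F s" "G integrable_on {u..v}" shows "integral {u..v} G \<le> integral {0..1} F" proof -
 have i: "F integrable_on {u..v}" by (rule integrable_on_subinterval[OF assms(1,3)])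
 define G' where "G' = (\<lambda>s. if s \<in> P then F s else G s)"
 have "integral {u..v} G = integral {u..v} G'" by (rule integral_spike[of P]) (use assms(5) in \<open>auto simp: G'_def\<close>)
 also have "\<dots> \<le> integral {u..v} F"
 proof (rule integral_le[OF _ i])
  show "G' integrable_on {u..v}" by (rule integrable_spike[OF assms(7), of P]) (use assms(5) in \<open>auto simp: G'_def\<close>)
 qed (use assms(6) in \<open>auto simp: G'_def\<close>)
 also have "\<dots> \<le> integral {0..1} F" by (rule integral_subset_le[OF assms(3) i assms(1)]) (use assms(2) in auto)
 finally show ?thesis .
qed

text \<open>What is used of a nonnegative piecewise \<open>C\<^sup>1\<close> function: \<open>K\<close> is the closure of its essential
 range, \<open>P\<close> contains the break points, and the last two conditions say that poles of
 \<open>1 / (x - f s)\<^sup>2\<close> and of \<open>1 / f s\<close> on \<open>K\<close> are not integrable.\<close>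

locale pfun = fixes f :: "real => real" and P K :: "real set" and M :: real assumes finP: "finite P" "0 \<in> P" "1 \<in> P"
  and contf: "continuous_on ({0..1} - P) f" and nonneg: "\<And>s. s \<in> {0..1} ==> 0 \<le> f s" and Mpos: "0 < M" and bounded: "\<And>s. s \<in> {0..1} ==> f s \<le> M"
  and compactK: "compact K" and K_sub: "K \<subseteq> {0..M}" and fK: "\<And>s. s \<in> {0..1} - P ==> f s \<in> K"
  and sing: "\<And>x B. x \<in> K ==> \<exists>e>0. B < integral {0..1} (\<lambda>s. 1 / ((f s - x)\<^sup>2 + e\<^sup>2))" and sing0: "(\<exists>d>0. \<forall>s\<in>{0..1} - P. f s = 0 \<or> d \<le> f s) \<or>
   (\<forall>B. \<exists>e>0. B < integral {0..1} (\<lambda>s. f s / ((f s)\<^sup>2 + e\<^sup>2)))" and nontriv: "\<exists>s\<in>{0..1} - P. 0 < f s"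

lemma consecutive_points: fixes P :: "real set" assumes P: "finite P" "0 \<in> P" "1 \<in> P" and s: "s \<in> {0..1} - P"
 shows "\<exists>a\<in>P. \<exists>b\<in>P. a < s \<and> s < b \<and> {a<..<b} \<inter> P = {}" proof -
 define A where "A = {p\<in>P. p < s}"
 define B where "B = {p\<in>P. s < p}"
 have "0 \<noteq> s" "s \<noteq> 1" using P s by auto
 moreover have "0 \<le> s" "s \<le> 1" using s by auto
 ultimately have "0 < s \<and> s < 1" by (blast intro: order_le_neq_trans)
 then have "0 \<in> A" "1 \<in> B" using P by (auto simp: A_def B_def)
 then have A: "finite A" "A \<noteq> {}" and B: "finite B" "B \<noteq> {}" using P(1) by (auto simp: A_def B_def)
 have a: "Max A \<in> A" and b: "Min B \<in> B" using A B by auto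
 have "{Max A<..<Min B} \<inter> P = {}"
 proof (rule ccontr)
  assume "{Max A<..<Min B} \<inter> P \<noteq> {}"
  then obtain p where p: "p \<in> P" "Max A < p" "p < Min B" by auto
  then have "p \<noteq> s" using s by auto
  then have "p \<in> A \<or> p \<in> B" using p(1) unfolding A_def B_def by (auto simp: neq_iff)
  then show False using p Max_ge[OF A(1), of p] Min_le[OF B(1), of p] by auto
 qed
 then show ?thesis using a b by (auto simp: A_def B_def)
qed

lemma C1_differentiable_on_Icc_lipschitz: fixes h :: "real => real" assumes "h C1_differentiable_on {a..b}"
 obtains D L where "\<And>x. x \<in> {a..b} ==> (h has_real_derivative D x) (at x)" "continuous_on {a..b} D"
  "0 < L" "\<And>x. x \<in> {a..b} ==> \<bar>D x\<bar> \<le> L" "\<And>x y. x \<in> {a..b} ==> y \<in> {a..b} ==> \<bar>h x - h y\<bar> \<le> L * \<bar>x - y\<bar>" proof -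
 obtain D where D: "\<And>x. x \<in> {a..b} ==> (h has_vector_derivative D x) (at x)" "continuous_on {a..b} D"
  using assms unfolding C1_differentiable_on_def by blast
 have "bounded (D ` {a..b})" by (intro compact_imp_bounded compact_continuous_image D(2)) simp
 then obtain L where L: "0 < L" "\<And>x. x \<in> {a..b} ==> \<bar>D x\<bar> \<le> L" unfolding bounded_pos by auto
 have d: "(h has_real_derivative D x) (at x)" if "x \<in> {a..b}" for x
  using D(1)[OF that] by (simp add: has_real_derivative_iff_has_vector_derivative)
 have "\<bar>h x - h y\<bar> \<le> L * \<bar>x - y\<bar>" if "x \<in> {a..b}" "y \<in> {a..b}" for x y proof -
  have "norm (h x - h y) \<le> L * norm (x - y)" by (rule field_differentiable_bound[of "{a..b}" h D L])
     (use that L d in \<open>auto intro: has_field_derivative_at_within\<close>)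
  then show ?thesis by simp
 qed
 with d D(2) L that show ?thesis by blast
qed

text \<open>\<open>K\<close> is the union of the images of the C^1 extensions on the closed pieces,
  so it also contains one-sided limits at the break points. The Lipschitz bounds of these extensions
  give both non-integrability conditions.\<close>

theorem pfun_of_piecewise_C1: assumes pw: "piecewise_C1 f" and nn: "\<And>s. s \<in> {0..1} ==> 0 \<le> f s" and nt: "\<not> negligible {s\<in>{0..1}. f s \<noteq> 0}"
 shows "\<exists>P K M. pfun f P K M" proof -
 obtain P where Pd: "finite P \<and> {0, 1} \<subseteq> P \<and> P \<subseteq> {0..1} \<and>
    (\<forall>a\<in>P. \<forall>b\<in>P. a < b \<and> {a<..<b} \<inter> P = {} \<longrightarrow>
      (\<exists>h. h C1_differentiable_on {a..b} \<and> (\<forall>s\<in>{a<..<b}. h s = f s)))" using pw unfolding piecewise_C1_def by (rule exE)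
 then have P: "finite P" "{0, 1} \<subseteq> P" "P \<subseteq> {0..1}" by simp_all
 have pc: "\<exists>h. h C1_differentiable_on {a..b} \<and> (\<forall>s\<in>{a<..<b}. h s = f s)"
  if "a \<in> P" "b \<in> P" "a < b" "{a<..<b} \<inter> P = {}" for a b using Pd[THEN conjunct2, THEN conjunct2, THEN conjunct2] that by simp
 define C where "C = {(a, b). a \<in> P \<and> b \<in> P \<and> a < b \<and> {a<..<b} \<inter> P = {}}"
 have finC: "finite C" by (rule finite_subset[of _ "P \<times> P"]) (use P(1) in \<open>auto simp: C_def\<close>)
 have "\<forall>p\<in>C. \<exists>h. h C1_differentiable_on {fst p..snd p} \<and> (\<forall>s\<in>{fst p<..<snd p}. h s = f s)" using pc by (auto simp: C_def)
 from bchoice[OF this] obtain H where HH: "\<forall>p\<in>C. H p C1_differentiable_on {fst p..snd p} \<and> (\<forall>s\<in>{fst p<..<snd p}. H p s = f s)" by (rule exE)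
 have H: "H (a, b) C1_differentiable_on {a..b}" if "(a, b) \<in> C" for a b using bspec[OF HH that] by simp
 have Hf: "H (a, b) s = f s" if "(a, b) \<in> C" "s \<in> {a<..<b}" for a b s using bspec[OF HH that(1)] that(2) by simp
 have CI: "a < b" "0 \<le> a" "b \<le> 1" "{a<..<b} \<inter> P = {}" "{a..b} \<subseteq> {0..1}" if "(a, b) \<in> C" for a b using that P(3) by (auto simp: C_def)
 have ex: "\<exists>a b. (a, b) \<in> C \<and> a < s \<and> s < b" if s01: "s \<in> {0..1} - P" for s proof -
  obtain a b where "a \<in> P" "b \<in> P" "a < s" "s < b" "{a<..<b} \<inter> P = {}" using consecutive_points[OF P(1) _ _ s01] P(2) by blast
  then have "(a, b) \<in> C" "a < s" "s < b" by (auto simp: C_def)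
  then show ?thesis by blast
 qed
 define K where "K = (\<Union>p\<in>C. H p ` {fst p..snd p})"
 have Hc: "continuous_on {a..b} (H (a, b))" if "(a, b) \<in> C" for a b using H[OF that] by (rule C1_differentiable_imp_continuous_on)
 have compK: "compact K" unfolding K_def using finC Hc by (intro compact_UN compact_continuous_image) auto
 have fK: "f s \<in> K" if s: "s \<in> {0..1} - P" for s proof -
  obtain a b where ab: "(a, b) \<in> C" "a < s" "s < b" using ex[OF s] by blast
  then have "f s = H (a, b) s" using Hf by simp
  then show ?thesis unfolding K_def using ab by (intro UN_I[of "(a, b)"]) auto
 qed
 have H0: "0 \<le> H (a, b) s" if ab: "(a, b) \<in> C" and s: "s \<in> {a..b}" for a b s proof -
  have "s \<in> closure {a<..<b}" using s CI(1)[OF ab] by simp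
  moreover have "closure {a<..<b} \<subseteq> {s \<in> {a..b}. 0 \<le> H (a, b) s}"
  proof (rule closure_minimal)
   show "{a<..<b} \<subseteq> {s \<in> {a..b}. 0 \<le> H (a, b) s}" using Hf[OF ab] nn CI(2,3)[OF ab] by auto
   show "closed {s \<in> {a..b}. 0 \<le> H (a, b) s}" proof -
    have "{s \<in> {a..b}. 0 \<le> H (a, b) s} = {a..b} \<inter> H (a, b) -` {0..}" by auto
    then show ?thesis using continuous_closed_preimage[OF Hc[OF ab] closed_atLeastAtMost closed_atLeast[of 0]] by simp
   qed
  qed
  ultimately show ?thesis by blast
 qed
 obtain M0 where M0: "\<And>x. x \<in> K ==> x \<le> M0" using compact_imp_bounded[OF compK] unfolding bounded_iff by (metis abs_le_D1 real_norm_def)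
 \<comment> \<open>The values at break points are unrelated to the pieces but may be sampled as
   \<open>f (i / n)\<close>; the bound has to include them.\<close>
 define M where "M = Max (insert 1 (insert M0 (f ` P)))"
 have finM: "finite (insert 1 (insert M0 (f ` P)))" using P(1) by simp
 have M1: "1 \<le> M" "M0 \<le> M" "\<And>s. s \<in> P ==> f s \<le> M" unfolding M_def by (rule Max_ge[OF finM], simp)+
 have contf: "continuous_on ({0..1} - P) f"
 proof (rule continuous_at_imp_continuous_on, rule ballI)
  fix s assume s: "s \<in> {0..1} - P"
  obtain a b where ab: "(a, b) \<in> C" "a < s" "s < b" using ex[OF s] by blast
  have "continuous_on {a<..<b} (H (a, b))" by (rule continuous_on_subset[OF Hc[OF ab(1)]]) auto
  then have "continuous_on {a<..<b} f" using continuous_on_cong[OF refl, of "{a<..<b}" f "H (a, b)"] Hf[OF ab(1)] by simp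
  then show "isCont f s" using ab by (simp add: continuous_on_eq_continuous_at)
 qed
 have intf: "(\<lambda>s. F (f s)) integrable_on {0..1}" if F: "continuous_on {0..} F" for F :: "real => real" proof -
  have "compact (F ` K)" using F compK H0 by (intro compact_continuous_image continuous_on_subset[OF F]) (auto simp: K_def)
  then obtain B where B: "\<And>y. y \<in> F ` K ==> norm y \<le> B" using compact_imp_bounded bounded_iff by metis
  show ?thesis
  proof (rule integrable_bounded_cofinite_continuous[OF P(1)])
   show "continuous_on ({0..1} - P) (\<lambda>s. F (f s))" by (rule continuous_on_compose2[OF F contf]) (use nn in auto)
   show "norm (F (f s)) \<le> B" if "s \<in> {0..1} - P" for s using B fK[OF that] by blast
  qed
 qed
 have sing: "\<exists>e>0. B < integral {0..1} (\<lambda>s. 1 / ((f s - x)\<^sup>2 + e\<^sup>2))" if x: "x \<in> K" for x B proof -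
  obtain a b s0 where ab: "(a, b) \<in> C" and s0: "s0 \<in> {a..b}" "x = H (a, b) s0" using x unfolding K_def by auto
  obtain L where L: "0 < L" "\<And>s. s \<in> {a..b} ==> \<bar>H (a, b) s - x\<bar> \<le> L * \<bar>s - s0\<bar>"
   using C1_differentiable_on_Icc_lipschitz[OF H[OF ab]] s0 by metis
  \<comment> \<open>The first bound lets an interval of length e fit into the piece on one side of
    \<open>s0\<close>. On it |f - x| \<le> L e, so the integral is at least 1 / ((L^2 + 1) e), and
    the second bound makes this exceed B.\<close>
  define e where "e = min ((b - a) / 2) (1 / ((L\<^sup>2 + 1) * (\<bar>B\<bar> + 1)))"
  have L2: "0 < L\<^sup>2 + 1" by (simp add: add_nonneg_pos)
  have "0 < e" using CI(1)[OF ab] L2 by (simp add: e_def)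
  moreover have "e \<le> (b - a) / 2" "e \<le> 1 / ((L\<^sup>2 + 1) * (\<bar>B\<bar> + 1))" unfolding e_def by (rule min.cobounded1, rule min.cobounded2)
  ultimately have e: "0 < e" "e \<le> (b - a) / 2" "e \<le> 1 / ((L\<^sup>2 + 1) * (\<bar>B\<bar> + 1))" .
  obtain u where u: "{u..u + e} \<subseteq> {a..b}" "\<And>s. s \<in> {u..u + e} ==> \<bar>s - s0\<bar> \<le> e"
  proof (cases "s0 + e \<le> b")
   case True
   then show ?thesis using that[of s0] s0 by auto
  next
   case False
   then show ?thesis using that[of "s0 - e"] s0 e by auto
  qed
  have "\<bar>B\<bar> + 1 \<le> 1 / ((L\<^sup>2 + 1) * e)" proof -
   have "(\<bar>B\<bar> + 1) * ((L\<^sup>2 + 1) * e) \<le> 1" using e(3) L2 by (simp add: pos_le_divide_eq mult_ac)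
   then show ?thesis using L2 e(1) by (simp add: pos_le_divide_eq)
  qed
  also have "1 / ((L\<^sup>2 + 1) * e) = integral {u..u + e} (\<lambda>s. 1 / (L\<^sup>2 * e\<^sup>2 + e\<^sup>2))" proof -
   have "L\<^sup>2 * e\<^sup>2 + e\<^sup>2 = ((L\<^sup>2 + 1) * e) * e" by (simp add: power2_eq_square algebra_simps)
   then show ?thesis using e(1) by simp
  qed
  also have "\<dots> \<le> integral {0..1} (\<lambda>s. 1 / ((f s - x)\<^sup>2 + e\<^sup>2))"
  proof (rule integral_ge_subinterval[where P = P])
   show "(\<lambda>s. 1 / ((f s - x)\<^sup>2 + e\<^sup>2)) integrable_on {0..1}" by (rule intf[of "\<lambda>y. 1 / ((y - x)\<^sup>2 + e\<^sup>2)"])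
      (use e(1) in \<open>auto intro!: continuous_intros simp: sum_power2_eq_zero_iff\<close>)
   show "{u..u + e} \<subseteq> {0..1}" using u(1) CI(5)[OF ab] by blast
   show "1 / (L\<^sup>2 * e\<^sup>2 + e\<^sup>2) \<le> 1 / ((f s - x)\<^sup>2 + e\<^sup>2)" if s: "s \<in> {u..u + e} - P" for s proof -
    have sab: "s \<in> {a..b}" using u(1) s by blast
    moreover have "a \<noteq> s" "s \<noteq> b" using ab s by (auto simp: C_def)
    moreover have "a \<le> s" "s \<le> b" using sab by auto
    ultimately have "a < s \<and> s < b" by (blast intro: order_le_neq_trans)
    then have "s \<in> {a<..<b}" by simp
    then have "f s = H (a, b) s" using Hf[OF ab] by simp
    then have "\<bar>f s - x\<bar> \<le> L * \<bar>s - s0\<bar>" using L(2)[OF sab] by simp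
    also have "\<dots> \<le> L * e" using u(2) s L(1) by (intro mult_left_mono) auto
    finally have "(f s - x)\<^sup>2 \<le> (L * e)\<^sup>2" by (rule power2_le_iff_abs_le[THEN iffD2, rotated]) (use L e in simp)
    then show ?thesis using e(1) by (intro divide_left_mono mult_pos_pos add_nonneg_pos) (auto simp: power_mult_distrib)
   qed
  qed (use e P(1) in auto)
  finally show ?thesis using e(1) by (intro exI[of _ e]) auto
 qed
 \<comment> \<open>Either some extension takes both the value 0 and a positive value, and the
   integral diverges logarithmically, or each extension vanishes identically or nowhere on its
   closed piece, and compactness gives a gap above 0.\<close>
 have sing0: "(\<exists>d>0. \<forall>s\<in>{0..1} - P. f s = 0 \<or> d \<le> f s) \<or>
   (\<forall>B. \<exists>e>0. B < integral {0..1} (\<lambda>s. f s / ((f s)\<^sup>2 + e\<^sup>2)))"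
 proof (cases "\<exists>a b s1 s2. (a, b) \<in> C \<and> s1 \<in> {a..b} \<and> s2 \<in> {a..b} \<and> H (a, b) s1 = 0 \<and> 0 < H (a, b) s2")
  case True
  then obtain a b s1 s2 where ab: "(a, b) \<in> C" and s: "s1 \<in> {a..b}" "s2 \<in> {a..b}" and h: "H (a, b) s1 = 0" "0 < H (a, b) s2" by blast
  define h where "h = H (a, b)"
  define m where "m = h s2"
  have m: "0 < m" using h by (simp add: m_def h_def)
  obtain D L where D: "\<And>x. x \<in> {a..b} ==> (h has_real_derivative D x) (at x)" "continuous_on {a..b} D"
   and L: "0 < L" "\<And>x. x \<in> {a..b} ==> \<bar>D x\<bar> \<le> L" using C1_differentiable_on_Icc_lipschitz[OF H[OF ab]] unfolding h_def by metis
  define u v where "u = min s1 s2" and "v = max s1 s2"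
  have uv: "u \<le> v" "{u..v} \<subseteq> {a..b}" using s by (auto simp: u_def v_def)
  have hc: "continuous_on {u..v} h" using continuous_on_subset[OF Hc[OF ab] uv(2)] by (simp add: h_def)
  \<comment> \<open>The derivative of ln(h^2 + e^2) / 2 is h h' / (h^2 + e^2). Its increase between
    \<open>s1\<close> and \<open>s2\<close> is the logarithm on the left, and |h'| \<le> L turns
    this into a bound on the integral without h'.\<close>
  have lower: "ln ((m\<^sup>2 + e\<^sup>2) / e\<^sup>2) / (2 * L) \<le> integral {0..1} (\<lambda>s. f s / ((f s)\<^sup>2 + e\<^sup>2))" if e: "0 < e" for e proof -
   have pos: "0 < (h s)\<^sup>2 + e\<^sup>2" for s using e by (simp add: add_nonneg_pos)
   let ?G = "\<lambda>s. ln ((h s)\<^sup>2 + e\<^sup>2) / 2" and ?g = "\<lambda>s. h s * D s / ((h s)\<^sup>2 + e\<^sup>2)"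
   have FTC: "(?g has_integral (?G v - ?G u)) {u..v}"
   proof (rule fundamental_theorem_of_calculus[OF uv(1)])
    fix s assume "s \<in> {u..v}"
    then have "(h has_real_derivative D s) (at s)" using D(1) uv(2) by blast
    then have "(?G has_real_derivative ?g s) (at s)" using pos[of s] by (auto intro!: derivative_eq_intros simp: divide_simps)
    then show "(?G has_vector_derivative ?g s) (at s within {u..v})"
     by (simp add: has_real_derivative_iff_has_vector_derivative has_vector_derivative_at_within)
   qed
   have int1: "(\<lambda>s. L * (h s / ((h s)\<^sup>2 + e\<^sup>2))) integrable_on {u..v}"
    by (rule integrable_continuous_real) (intro continuous_intros hc, use pos in \<open>auto simp: less_imp_neq[symmetric]\<close>)
   have "\<bar>?G v - ?G u\<bar> \<le> integral {u..v} (\<lambda>s. L * (h s / ((h s)\<^sup>2 + e\<^sup>2)))" proof -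
    have "norm (integral {u..v} ?g) \<le> integral {u..v} (\<lambda>s. L * (h s / ((h s)\<^sup>2 + e\<^sup>2)))"
    proof (rule integral_norm_bound_integral[OF _ int1])
     show "?g integrable_on {u..v}" using FTC by blast
     fix s assume s: "s \<in> {u..v}"
     then have "0 \<le> h s" "\<bar>D s\<bar> \<le> L" using H0[OF ab, of s] L(2) uv(2) by (auto simp: h_def)
     then have "\<bar>D s\<bar> * (h s / ((h s)\<^sup>2 + e\<^sup>2)) \<le> L * (h s / ((h s)\<^sup>2 + e\<^sup>2))" using pos[of s] by (intro mult_right_mono) auto
     then show "norm (?g s) \<le> L * (h s / ((h s)\<^sup>2 + e\<^sup>2))" using \<open>0 \<le> h s\<close> pos[of s] by (simp add: abs_mult mult.commute)
    qed
    then show ?thesis using integral_unique[OF FTC] by simp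
   qed
   also have "\<dots> = L * integral {u..v} (\<lambda>s. h s / ((h s)\<^sup>2 + e\<^sup>2))" by (rule integral_mult_right)
   also have "\<dots> \<le> L * integral {0..1} (\<lambda>s. f s / ((f s)\<^sup>2 + e\<^sup>2))"
   proof (intro mult_left_mono integral_ge_subinterval[where P = P])
    show "(\<lambda>s. f s / ((f s)\<^sup>2 + e\<^sup>2)) integrable_on {0..1}" by (rule intf[of "\<lambda>y. y / (y\<^sup>2 + e\<^sup>2)"])
       (use e in \<open>auto intro!: continuous_intros simp: sum_power2_eq_zero_iff\<close>)
    show "{u..v} \<subseteq> {0..1}" using uv(2) CI(5)[OF ab] by blast
    show "(\<lambda>s. h s / ((h s)\<^sup>2 + e\<^sup>2)) integrable_on {u..v}"
     by (rule integrable_continuous_real) (intro continuous_intros hc, use pos in \<open>auto simp: less_imp_neq[symmetric]\<close>)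
    show "h s / ((h s)\<^sup>2 + e\<^sup>2) \<le> f s / ((f s)\<^sup>2 + e\<^sup>2)" if s: "s \<in> {u..v} - P" for s proof -
     have sab: "s \<in> {a..b}" using uv(2) s by blast
     moreover have "a \<noteq> s" "s \<noteq> b" using ab s by (auto simp: C_def)
     moreover have "a \<le> s" "s \<le> b" using sab by auto
    ultimately have "a < s \<and> s < b" by (blast intro: order_le_neq_trans)
    then have "s \<in> {a<..<b}" by simp
     then have "f s = h s" using Hf[OF ab] by (simp add: h_def)
     then show ?thesis by simp
    qed
   qed (use L nn uv P in auto)
   finally have "\<bar>?G v - ?G u\<bar> \<le> L * integral {0..1} (\<lambda>s. f s / ((f s)\<^sup>2 + e\<^sup>2))" .
   moreover have "\<bar>?G v - ?G u\<bar> = \<bar>?G s2 - ?G s1\<bar>" by (cases "s1 \<le> s2") (auto simp: u_def v_def min_def max_def)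
   moreover have "?G s2 - ?G s1 = ln ((m\<^sup>2 + e\<^sup>2) / e\<^sup>2) / 2"
    using e m h by (simp add: m_def h_def ln_div add_nonneg_pos diff_divide_distrib sum_power2_eq_zero_iff)
   ultimately have "ln ((m\<^sup>2 + e\<^sup>2) / e\<^sup>2) / 2 \<le> L * integral {0..1} (\<lambda>s. f s / ((f s)\<^sup>2 + e\<^sup>2))" by linarith
   then show ?thesis using L(1) by (simp add: field_simps)
  qed
  have "\<exists>e>0. B < integral {0..1} (\<lambda>s. f s / ((f s)\<^sup>2 + e\<^sup>2))" for B proof -
   \<comment> \<open>Solves ln((m / e)^2) = 2 L (|B| + 1).\<close>
   define e where "e = m / exp (L * (\<bar>B\<bar> + 1))"
   have e: "0 < e" using m by (simp add: e_def)
   have "2 * (L * (\<bar>B\<bar> + 1)) = ln ((m / e)\<^sup>2)" using m by (simp add: e_def ln_realpow)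
   also have "\<dots> \<le> ln ((m\<^sup>2 + e\<^sup>2) / e\<^sup>2)" using m e by (intro iffD2[OF ln_le_cancel_iff]) (auto simp: power_divide divide_simps add_pos_pos)
   finally have "\<bar>B\<bar> + 1 \<le> ln ((m\<^sup>2 + e\<^sup>2) / e\<^sup>2) / (2 * L)" using L(1) by (simp add: pos_le_divide_eq mult_ac)
   with lower[OF e] e show ?thesis by (intro exI[of _ e]) auto
  qed
  then show ?thesis by blast
 next
  case False
  have "\<exists>d>0. \<forall>p\<in>C. \<forall>s\<in>{fst p<..<snd p}. f s = 0 \<or> d \<le> f s" proof -
   have "\<exists>d>0. \<forall>s\<in>{fst p<..<snd p}. f s = 0 \<or> d \<le> f s" if p: "p \<in> C" for p
   proof (cases "\<exists>s\<in>{fst p..snd p}. H p s = 0")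
    case True
    then have "H p s = 0" if "s \<in> {fst p..snd p}" for s using False p that H0[of "fst p" "snd p" s]
     by (metis less_eq_real_def prod.collapse)
    then show ?thesis using Hf[of "fst p" "snd p"] p by (intro exI[of _ 1]) auto
   next
    case nz: False
    have "compact (H p ` {fst p..snd p})" "H p ` {fst p..snd p} \<noteq> {}" using Hc[of "fst p" "snd p"] CI(1)[of "fst p" "snd p"] p
     by (auto intro!: compact_continuous_image)
    from compact_attains_inf[OF this] obtain s0 where s0: "s0 \<in> {fst p..snd p}"
     "\<And>s. s \<in> {fst p..snd p} ==> H p s0 \<le> H p s" by auto
    have "0 < H p s0" using H0[of "fst p" "snd p" s0] s0(1) nz p by (metis less_eq_real_def prod.collapse)
    moreover have "H p s0 \<le> f s" if "s \<in> {fst p<..<snd p}" for s using s0(2)[of s] that Hf[of "fst p" "snd p" s] p by auto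
    ultimately show ?thesis by blast
   qed
   then obtain d where d: "\<And>p. p \<in> C ==> 0 < d p \<and> (\<forall>s\<in>{fst p<..<snd p}. f s = 0 \<or> d p \<le> f s)" by metis
   have "0 < Min (insert 1 (d ` C))" using finC d by auto
   moreover have "Min (insert 1 (d ` C)) \<le> d p" if "p \<in> C" for p using finC that by (intro Min_le) auto
   ultimately show ?thesis using d order_trans by (intro exI[of _ "Min (insert 1 (d ` C))"]) blast
  qed
  then obtain d where d: "0 < d" "\<And>p s. p \<in> C ==> s \<in> {fst p<..<snd p} ==> f s = 0 \<or> d \<le> f s" by blast
  have "f s = 0 \<or> d \<le> f s" if "s \<in> {0..1} - P" for s using ex[OF that] d(2) by fastforce
  then show ?thesis using d(1) by blast
 qed
 have "\<exists>s\<in>{0..1} - P. 0 < f s"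
 proof (rule ccontr)
  assume n: "\<not> (\<exists>s\<in>{0..1} - P. 0 < f s)"
  have "{s\<in>{0..1}. f s \<noteq> 0} \<subseteq> P"
  proof (rule subsetI, rule ccontr)
   fix s assume s: "s \<in> {s\<in>{0..1}. f s \<noteq> 0}" "s \<notin> P"
   then have "0 < f s" using nn[of s] by auto
   then show False using n s by blast
  qed
  then show False using nt negligible_finite[OF P(1)] negligible_subset by blast
 qed
 moreover have "K \<subseteq> {0..M}" using M0 M1(2) H0 by (fastforce simp: K_def)
 moreover have "f s \<le> M" if "s \<in> {0..1}" for s using that M1 M0[OF fK[of s]] by (cases "s \<in> P") auto
 ultimately have "pfun f P K M" using P contf nn M1 compK fK sing sing0 by unfold_locales auto
 then show ?thesis by blast
qed

section \<open>The transform through which \<open>f\<close> and \<open>g\<close> both enter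
  G\<close>

definition Uf :: "(real => real) => complex => complex" where
 "Uf f z = integral {0..1} (\<lambda>s. of_real (f s) * z / (1 - of_real (f s) * z))"

definition U1 :: "(real => real) => complex => complex" where
 "U1 f z = integral {0..1} (\<lambda>s. of_real (f s) / (1 - of_real (f s) * z)\<^sup>2)"

text \<open>The imaginary part of \<open>Uf f\<close> at radius r and angle t, divided by sin t, as
  a function of c = cos t; see \<open>Uf_polar\<close>.\<close>

definition Af :: "(real => real) => real => real => real" where
 "Af f r c = integral {0..1} (\<lambda>s. f s * r / (1 - 2 * (f s * r) * c + (f s * r)\<^sup>2))"

text \<open>The measure of the set where \<open>f\<close> does not vanish; its negative is the limit
  of \<open>Uf f (-1 / w)\<close> as w tends to 0 in the closed right half-plane.\<close>

definition pos_mass :: "(real => real) => real" where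
 "pos_mass f = integral {0..1} (\<lambda>s. if f s = 0 then 0 else 1)"

definition DK :: "real set => complex set" where
 "DK K = {z. \<forall>x\<in>K. 1 - of_real x * z \<noteq> 0}"

lemma has_field_derivative_quadratic_bound: fixes F :: "complex => complex"
 assumes "0 < d" "\<And>w. w \<in> ball z d ==> norm (F w - F z - D * (w - z)) \<le> C * (norm (w - z))\<^sup>2" shows "(F has_field_derivative D) (at z)"
 unfolding has_field_derivative_iff
proof (rule LIM_zero_cancel)
 show "((\<lambda>w. (F w - F z) / (w - z) - D) \<longlongrightarrow> 0) (at z)"
 proof (rule Lim_null_comparison)
  have "eventually (\<lambda>w. w \<in> ball z d \<and> w \<noteq> z \<and> w \<in> UNIV) (at z)" using assms(1) by (rule eventually_at_ball')
  then show "eventually (\<lambda>w. norm ((F w - F z) / (w - z) - D) \<le> C * norm (w - z)) (at z)"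
  proof eventually_elim
   case (elim w)
   then have "(F w - F z) / (w - z) - D = (F w - F z - D * (w - z)) / (w - z)" by (simp add: field_simps)
   then show ?case using assms(2)[of w] elim by (simp add: norm_divide divide_le_eq power2_eq_square mult.assoc)
  qed
  show "((\<lambda>w. C * norm (w - z)) \<longlongrightarrow> 0) (at z)" by (rule tendsto_eq_intros refl | simp)+
 qed
qed

lemma quadratic_denominator_pos: fixes y c :: real assumes "0 \<le> y" "c < 1" shows "0 < 1 - 2 * y * c + y\<^sup>2" proof -
 have "1 - 2 * y * c + y\<^sup>2 = (1 - y)\<^sup>2 + 2 * (y * (1 - c))" by (simp add: power2_eq_square algebra_simps)
 moreover have "0 < (1 - y)\<^sup>2 + 2 * (y * (1 - c))"
 proof (cases "y = 0")
  case False
  then have "0 < y * (1 - c)" using assms by simp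
  then show ?thesis by (simp add: add_nonneg_pos)
 qed simp
 ultimately show ?thesis by simp
qed

context pfun
begin

lemma integ: fixes F :: "real => 'a::euclidean_space" assumes "continuous_on K F" shows "(\<lambda>s. F (f s)) integrable_on {0..1}" proof -
 have "compact (F ` K)" using assms compactK by (rule compact_continuous_image)
 then obtain B where B: "\<And>y. y \<in> F ` K ==> norm y \<le> B" using compact_imp_bounded bounded_iff by metis
 show ?thesis
 proof (rule integrable_bounded_cofinite_continuous[OF finP(1)])
  show "continuous_on ({0..1} - P) (\<lambda>s. F (f s))" by (rule continuous_on_compose2[OF assms contf]) (use fK in auto)
  show "norm (F (f s)) \<le> B" if "s \<in> {0..1} - P" for s using B fK[OF that] by blast
 qed
qed

lemma integ_nonneg: fixes F :: "real => 'a::euclidean_space" assumes "continuous_on {0..} F" shows "(\<lambda>s. F (f s)) integrable_on {0..1}"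
 by (rule integ, rule continuous_on_subset[OF assms]) (use K_sub in auto)

lemma integral_mono_f: fixes F G :: "real => real" assumes "(\<lambda>s. F (f s)) integrable_on {0..1}" "(\<lambda>s. G (f s)) integrable_on {0..1}"
  "\<And>x. 0 \<le> x ==> x \<le> M ==> F x \<le> G x" shows "integral {0..1} (\<lambda>s. F (f s)) \<le> integral {0..1} (\<lambda>s. G (f s))"
 by (rule integral_le[OF assms(1,2)]) (use nonneg bounded assms(3) in auto)

lemma integral_pos: fixes F :: "real => real" assumes F: "continuous_on {0..} F" and nn: "\<And>x. 0 \<le> x ==> 0 \<le> F x" and pos: "\<And>x. 0 < x ==> 0 < F x"
 shows "0 < integral {0..1} (\<lambda>s. F (f s))" proof -
 obtain s0 where s0: "s0 \<in> {0..1} - P" "0 < f s0" using nontriv by blast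
 have op: "open ({0<..<1} - P)" using finP(1) by (intro open_Diff finite_imp_closed) auto
 have eq: "{0<..<1} - P = {0..1} - P" using finP by (auto simp: order.strict_iff_order)
 have c: "continuous_on ({0..1} - P) (\<lambda>s. F (f s))" by (rule continuous_on_compose2[OF F contf]) (use nonneg in auto)
 have "isCont (\<lambda>s. F (f s)) s0" using c s0(1) op unfolding eq by (simp add: continuous_on_eq_continuous_at)
 then have "eventually (\<lambda>s. F (f s0) / 2 < F (f s)) (nhds s0)"
  using pos[OF s0(2)] by (intro order_tendstoD(1)[where y = "F (f s0)"]) (auto simp: isCont_def tendsto_at_iff_tendsto_nhds[of "\<lambda>s. F (f s)" s0])
 moreover have "eventually (\<lambda>s. s \<in> {0<..<1} - P) (nhds s0)" by (rule eventually_nhds_in_open[OF op]) (use s0(1) eq in auto)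
 ultimately have "eventually (\<lambda>s. F (f s0) / 2 < F (f s) \<and> s \<in> {0<..<1} - P) (nhds s0)" by (rule eventually_conj)
 then obtain d where d: "0 < d" "\<And>s. dist s s0 < d ==> F (f s0) / 2 < F (f s) \<and> s \<in> {0<..<1} - P" unfolding eventually_nhds_metric by blast
 have sub: "{s0..s0 + d / 2} \<subseteq> {0..1}"
 proof
  fix s assume "s \<in> {s0..s0 + d / 2}"
  then have "dist s s0 < d" using d(1) by (auto simp: dist_real_def)
  then show "s \<in> {0..1}" using d(2)[of s] by auto
 qed
 have "0 < integral {s0..s0 + d / 2} (\<lambda>_. F (f s0) / 2)" using d(1) pos[OF s0(2)] by simp
 also have "\<dots> \<le> integral {0..1} (\<lambda>s. F (f s))"
 proof (rule integral_ge_subinterval[where P = "{}"])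
  show "(\<lambda>s. F (f s)) integrable_on {0..1}" by (rule integ_nonneg[OF F])
  show "F (f s0) / 2 \<le> F (f s)" if "s \<in> {s0..s0 + d / 2} - {}" for s using d(2)[of s] that d(1) by (auto simp: dist_real_def)
 qed (use sub d(1) nn nonneg in auto)
 finally show ?thesis .
qed

text \<open>A uniform distance from the poles 1/x exists because \<open>K\<close> is compact; this
  holds in particular for x near 0, where 1 - x z is near 1.\<close>

lemma DK_nbhd: assumes "z \<in> DK K"
 obtains m where "0 < m" "\<And>x w. x \<in> K ==> w \<in> ball z m ==> m \<le> norm (1 - of_real x * w)" proof -
 have "\<exists>m0>0. \<forall>x\<in>K. m0 \<le> norm (1 - of_real x * z)"
 proof (cases "K = {}")
  case False
  have "compact ((\<lambda>x. norm (1 - of_real x * z)) ` K)" by (intro compact_continuous_image continuous_intros compactK)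
  from compact_attains_inf[OF this] False obtain x0 where x0: "x0 \<in> K"
   "\<And>x. x \<in> K ==> norm (1 - of_real x0 * z) \<le> norm (1 - of_real x * z)" by auto
  have "0 < norm (1 - of_real x0 * z)" using assms x0(1) by (auto simp: DK_def)
  with x0 show ?thesis by blast
 qed (auto intro: exI[of _ 1])
 then obtain m0 where m0: "0 < m0" "\<And>x. x \<in> K ==> m0 \<le> norm (1 - of_real x * z)" by blast
 \<comment> \<open>Solves m + M m = m0: moving z by less than m changes 1 - x z by at most M
   m.\<close>
 define m where "m = m0 / (1 + M)"
 have "m * (1 + M) = m0" using Mpos by (simp add: m_def)
 then have "m + M * m = m0" by (simp add: algebra_simps)
 moreover have "0 < m" using m0(1) Mpos by (simp add: m_def)
 ultimately have m: "0 < m" "m + M * m = m0" by simp_all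
 have "m \<le> norm (1 - of_real x * w)" if x: "x \<in> K" and w: "w \<in> ball z m" for x w proof -
  have "norm (of_real x * (w - z)) = \<bar>x\<bar> * norm (w - z)" by (simp only: norm_mult norm_of_real)
  also have "\<dots> \<le> M * m" using x K_sub w by (intro mult_mono) (auto simp: dist_norm norm_minus_commute)
  finally have "norm (of_real x * (w - z)) \<le> M * m" .
  moreover have "norm (1 - of_real x * z) \<le> norm (1 - of_real x * w) + norm (of_real x * (w - z))"
   using norm_triangle_ineq[of "1 - of_real x * w" "of_real x * (w - z)"] by (simp add: algebra_simps)
  ultimately show ?thesis using m0(2)[OF x] m(2) by linarith
 qed
 with m(1) that show ?thesis by blast
qed

lemma open_DK: "open (DK K)" unfolding open_contains_ball
proof
 fix z assume "z \<in> DK K"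
 from DK_nbhd[OF this] obtain m where m: "0 < m"
  "\<And>x w. x \<in> K ==> w \<in> ball z m ==> m \<le> norm (1 - of_real x * w)" by blast
 have "ball z m \<subseteq> DK K"
 proof
  fix w assume w: "w \<in> ball z m"
  have "1 - of_real x * w \<noteq> 0" if "x \<in> K" for x using m(2)[OF that w] m(1) by auto
  then show "w \<in> DK K" by (simp add: DK_def)
 qed
 then show "\<exists>e>0. ball z e \<subseteq> DK K" using m(1) by blast
qed

lemma zero_DK: "0 \<in> DK K" by (simp add: DK_def)

lemma nonreal_DK: assumes "Im z \<noteq> 0" shows "z \<in> DK K" proof -
 have "1 - of_real x * z \<noteq> 0" for x
 proof
  assume h: "1 - of_real x * z = 0"
  then have "Im (1 - of_real x * z) = 0" by simp
  then have "x = 0" using assms by simp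
  then show False using h by simp
 qed
 then show ?thesis by (simp add: DK_def)
qed

lemma U_integrable: assumes "z \<in> DK K" shows "(\<lambda>s. of_real (f s) * z / (1 - of_real (f s) * z)) integrable_on {0..1}"
  "(\<lambda>s. of_real (f s) / (1 - of_real (f s) * z)\<^sup>2) integrable_on {0..1}" proof -
 have ne: "1 - of_real x * z \<noteq> 0" if "x \<in> K" for x using assms that by (auto simp: DK_def)
 show "(\<lambda>s. of_real (f s) * z / (1 - of_real (f s) * z)) integrable_on {0..1}"
  by (rule integ[of "\<lambda>x. of_real x * z / (1 - of_real x * z)"]) (use ne in \<open>intro continuous_intros; simp\<close>)
 show "(\<lambda>s. of_real (f s) / (1 - of_real (f s) * z)\<^sup>2) integrable_on {0..1}"
  by (rule integ[of "\<lambda>x. of_real x / (1 - of_real x * z)\<^sup>2"]) (use ne in \<open>intro continuous_intros; simp\<close>)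
qed

text \<open>The second-order remainder of the kernel is x^2 (w - z)^2 / ((1 - x z)^2 (1 - x w)),
  which \<open>DK_nbhd\<close> bounds uniformly in x. Differentiation under the integral is thus one
  explicit estimate.\<close>

lemma Uf_has_field_derivative: assumes z: "z \<in> DK K" shows "(Uf f has_field_derivative U1 f z) (at z)" proof -
 obtain m where m: "0 < m" "\<And>x w. x \<in> K ==> w \<in> ball z m ==> m \<le> norm (1 - of_real x * w)" using DK_nbhd[OF z] by blast
 show ?thesis
 proof (rule has_field_derivative_quadratic_bound[OF m(1), where C = "M\<^sup>2 / m ^ 3"])
  fix w assume w: "w \<in> ball z m"
  have wD: "w \<in> DK K" proof -
   have "1 - of_real x * w \<noteq> 0" if "x \<in> K" for x using m(2)[OF that w] m(1) by auto
   then show ?thesis by (simp add: DK_def)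
  qed
  let ?I = "\<lambda>s. of_real (f s) * w / (1 - of_real (f s) * w) - of_real (f s) * z / (1 - of_real (f s) * z)
    - of_real (f s) / (1 - of_real (f s) * z)\<^sup>2 * (w - z)"
  have i3: "(\<lambda>s. of_real (f s) / (1 - of_real (f s) * z)\<^sup>2 * (w - z)) integrable_on {0..1}"
   using integrable_on_mult_left[OF U_integrable(2)[OF z]] by blast
  note ii = U_integrable(1)[OF wD] U_integrable(1)[OF z] i3
  have iI: "?I integrable_on {0..1}" by (intro integrable_diff ii)
  have eqI: "Uf f w - Uf f z - U1 f z * (w - z) = integral {0..1} ?I" proof -
   have "U1 f z * (w - z) = integral {0..1} (\<lambda>s. of_real (f s) / (1 - of_real (f s) * z)\<^sup>2 * (w - z))"
    unfolding U1_def by (rule integral_mult_left[symmetric])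
   then show ?thesis unfolding Uf_def by (simp only: integral_diff[OF ii(1,2)] integral_diff[OF integrable_diff[OF ii(1,2)] ii(3)])
  qed
  \<comment> \<open>At a break point \<open>f s\<close> may lie outside \<open>K\<close> and no
    bound is available; the majorant copies the integrand there, which does not affect the
    integral.\<close>
  have "norm (Uf f w - Uf f z - U1 f z * (w - z)) \<le> integral {0..1} (\<lambda>s. if s \<in> P then norm (?I s) else M\<^sup>2 / m ^ 3 * (norm (w - z))\<^sup>2)"
   unfolding eqI
  proof (rule integral_norm_bound_integral[OF iI])
   show "(\<lambda>s. if s \<in> P then norm (?I s) else M\<^sup>2 / m ^ 3 * (norm (w - z))\<^sup>2) integrable_on {0..1}"
    by (rule integrable_spike[OF integrable_const_ivl negligible_finite[OF finP(1)]]) auto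
   fix s :: real assume s: "s \<in> {0..1}"
   show "norm (?I s) \<le> (if s \<in> P then norm (?I s) else M\<^sup>2 / m ^ 3 * (norm (w - z))\<^sup>2)"
   proof (cases "s \<in> P")
    case False
    let ?x = "complex_of_real (f s)"
    have xK: "f s \<in> K" using fK s False by blast
    have n1: "m \<le> norm (1 - ?x * w)" and n2: "m \<le> norm (1 - ?x * z)" using m(2)[OF xK w] m(2)[OF xK, of z] m(1) by auto
    have ne: "1 - ?x * w \<noteq> 0" "1 - ?x * z \<noteq> 0" using n1 n2 m(1) by auto
    have "?I s = ?x\<^sup>2 * (w - z)\<^sup>2 / ((1 - ?x * z)\<^sup>2 * (1 - ?x * w))"
     using ne by (simp add: divide_simps) (simp add: power2_eq_square algebra_simps)
    then have "norm (?I s) = (f s)\<^sup>2 * (norm (w - z))\<^sup>2 / ((norm (1 - ?x * z))\<^sup>2 * norm (1 - ?x * w))"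
     by (simp add: norm_mult norm_divide norm_power)
    also have "\<dots> \<le> M\<^sup>2 * (norm (w - z))\<^sup>2 / (m\<^sup>2 * m)" using n1 n2 m(1) xK K_sub by (intro frac_le mult_mono power_mono) auto
    finally show ?thesis using False by (simp add: power3_eq_cube power2_eq_square)
   qed simp
  qed
  also have "\<dots> = integral {0..1::real} (\<lambda>s. M\<^sup>2 / m ^ 3 * (norm (w - z))\<^sup>2)"
  proof (rule integral_spike[OF negligible_finite[OF finP(1)]])
   fix s assume "s \<in> {0..1} - P"
   then have "s \<notin> P" by blast
   then show "M\<^sup>2 / m ^ 3 * (norm (w - z))\<^sup>2 = (if s \<in> P then norm (?I s) else M\<^sup>2 / m ^ 3 * (norm (w - z))\<^sup>2)" by (simp only: if_False)
  qed
  finally show "norm (Uf f w - Uf f z - U1 f z * (w - z)) \<le> M\<^sup>2 / m ^ 3 * (norm (w - z))\<^sup>2" by simp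
 qed
qed

lemma Uf_zero: "Uf f 0 = 0" by (simp add: Uf_def)

lemma Uf_cnj: "Uf f (cnj z) = cnj (Uf f z)" proof -
 have "Uf f (cnj z) = integral {0..1} (\<lambda>s. cnj (of_real (f s) * z / (1 - of_real (f s) * z)))"
  unfolding Uf_def by (intro integral_cong) simp
 then show ?thesis by (simp add: Uf_def integral_cnj)
qed

lemma A_continuous: fixes r c :: real assumes "0 < r" "c < 1" shows "continuous_on {0..} (\<lambda>x. x * r / (1 - 2 * (x * r) * c + (x * r)\<^sup>2))"
proof (intro continuous_intros ballI)
 fix x :: real assume "x \<in> {0..}"
 then have "0 \<le> x * r" using assms(1) by simp
 from quadratic_denominator_pos[OF this assms(2)]
 show "1 - 2 * (x * r) * c + (x * r)\<^sup>2 \<noteq> 0" by simp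
qed

end

lemma cos_less_one: "sin (t::real) \<noteq> 0 ==> cos t < 1"
proof (rule ccontr)
 assume s: "sin t \<noteq> 0" and "\<not> cos t < 1"
 then have "cos t = 1" using cos_le_one[of t] by linarith
 then show False using s sin_cos_squared_add[of t] by simp
qed

text \<open>Here Q = y (c + i s) lies on the ray at the given angle and D = |1 - Q|^2. The last
  identity comes from Q / (1 - Q)^2 = W (1 + W) with W = Q / (1 - Q).\<close>

lemma geometric_kernel: fixes y c s :: real assumes h: "s\<^sup>2 + c\<^sup>2 = 1" and D: "1 - 2 * y * c + y\<^sup>2 \<noteq> 0"
 defines "D \<equiv> 1 - 2 * y * c + y\<^sup>2" and "Q \<equiv> Complex (y * c) (y * s)"
 shows "1 - Q \<noteq> 0" "Q / (1 - Q) = Complex ((y * c - y\<^sup>2) / D) (s * (y / D))"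
  "Re (Q / (1 - Q)\<^sup>2) = c * (y / D) - 2 * s\<^sup>2 * (y / D)\<^sup>2" proof -
 have D0: "D \<noteq> 0" using D by (simp add: D_def)
 show ne: "1 - Q \<noteq> 0"
 proof
  assume "1 - Q = 0"
  then have z: "1 - y * c = 0" "y * s = 0" by (auto simp: Q_def complex_eq_iff)
  have "(1 - y * c)\<^sup>2 + (y * s)\<^sup>2 = 1 - 2 * y * c + y\<^sup>2 * (s\<^sup>2 + c\<^sup>2)" by (simp add: power2_eq_square algebra_simps)
  then have "(1 - y * c)\<^sup>2 + (y * s)\<^sup>2 = 1 - 2 * y * c + y\<^sup>2" unfolding h by simp
  then show False using D unfolding z by simp
 qed
 define W where "W = Complex ((y * c - y\<^sup>2) / D) (s * (y / D))"
 have "(y * c - y\<^sup>2) * (1 - y * c) + s * y * (y * s) = y * c * D + y\<^sup>2 * ((s\<^sup>2 + c\<^sup>2) - 1)"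
  unfolding D_def by (simp add: power2_eq_square algebra_simps)
 then have 1: "(y * c - y\<^sup>2) * (1 - y * c) + s * y * (y * s) = y * c * D" unfolding h by simp
 have 2: "(y * c - y\<^sup>2) * (- (y * s)) + s * y * (1 - y * c) = y * s * D" unfolding D_def by (simp add: power2_eq_square algebra_simps)
 have "Re (W * (1 - Q)) = ((y * c - y\<^sup>2) * (1 - y * c) + s * y * (y * s)) / D" by (simp add: W_def Q_def add_divide_distrib)
 then have R: "Re (W * (1 - Q)) = y * c" unfolding 1 using D0 by simp
 have "Im (W * (1 - Q)) = ((y * c - y\<^sup>2) * (- (y * s)) + s * y * (1 - y * c)) / D"
  by (simp add: W_def Q_def add_divide_distrib diff_divide_distrib algebra_simps)
 then have I: "Im (W * (1 - Q)) = y * s" unfolding 2 using D0 by simp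
 have "W * (1 - Q) = Q" using R I by (simp add: Q_def complex_eq_iff)
 then show W: "Q / (1 - Q) = W" using ne by (simp add: divide_eq_eq)
 have "Q / (1 - Q)\<^sup>2 = W * (1 + W)" unfolding W[symmetric] using ne by (simp add: power2_eq_square divide_simps)
 also have "Re \<dots> = (y * c - y\<^sup>2) / D + ((y * c - y\<^sup>2) / D)\<^sup>2 - (s * (y / D))\<^sup>2" by (simp add: W_def power2_eq_square algebra_simps)
 also have "\<dots> = c * (y / D) - 2 * s\<^sup>2 * (y / D)\<^sup>2" proof -
  have "(y * c - y\<^sup>2) * D + (y * c - y\<^sup>2)\<^sup>2 - (s * y)\<^sup>2 =
    c * y * D - 2 * s\<^sup>2 * y\<^sup>2 + y\<^sup>2 * ((s\<^sup>2 + c\<^sup>2) - 1)" unfolding D_def by (simp add: power2_eq_square algebra_simps)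
  then have "(y * c - y\<^sup>2) * D + (y * c - y\<^sup>2)\<^sup>2 - (s * y)\<^sup>2 = c * y * D - 2 * s\<^sup>2 * y\<^sup>2" unfolding h by simp
  then show ?thesis using D0 by (simp add: divide_simps power2_eq_square)
 qed
 finally show "Re (Q / (1 - Q)\<^sup>2) = c * (y / D) - 2 * s\<^sup>2 * (y / D)\<^sup>2" .
qed

context pfun
begin

lemma integral_Re_Im: fixes F :: "real => complex" assumes "F integrable_on {0..1}"
 shows "Re (integral {0..1} F) = integral {0..1} (\<lambda>s. Re (F s))" "Im (integral {0..1} F) = integral {0..1} (\<lambda>s. Im (F s))"
 using integral_linear[OF assms bounded_linear_Re] integral_linear[OF assms bounded_linear_Im] by (simp_all add: comp_def)

text \<open>The first term of the second identity is proportional to the imaginary part. Where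
  imaginary parts cancel, only the negative square term remains, and this will give the strict
  monotonicity along the curve.\<close>

lemma Uf_polar: assumes r: "0 < r" and t: "sin t \<noteq> 0"
 defines "z \<equiv> of_real r * cis t" shows "Im (Uf f z) = sin t * Af f r (cos t)"
  "Re (z * U1 f z) = cos t * Af f r (cos t) -
   2 * (sin t)\<^sup>2 * integral {0..1} (\<lambda>s. (f s * r / (1 - 2 * (f s * r) * cos t + (f s * r)\<^sup>2))\<^sup>2)" proof -
 have z: "z \<in> DK K" using r t by (intro nonreal_DK) (simp add: z_def)
 have c1: "cos t < 1" by (rule cos_less_one[OF t])
 let ?a = "\<lambda>x. x * r / (1 - 2 * (x * r) * cos t + (x * r)\<^sup>2)"
 have k: "Im (of_real (f s) * z / (1 - of_real (f s) * z)) = sin t * ?a (f s)"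
  "Re (z * (of_real (f s) / (1 - of_real (f s) * z)\<^sup>2)) = cos t * ?a (f s) - 2 * (sin t)\<^sup>2 * (?a (f s))\<^sup>2"
  if s: "s \<in> {0..1}" for s proof -
  have D: "1 - 2 * (f s * r) * cos t + (f s * r)\<^sup>2 \<noteq> 0" using quadratic_denominator_pos[of "f s * r" "cos t"] nonneg[OF s] r c1 by simp
  have Q: "of_real (f s) * z = Complex (f s * r * cos t) (f s * r * sin t)" by (simp add: z_def complex_eq_iff)
  note g = geometric_kernel[OF sin_cos_squared_add D]
  show "Im (of_real (f s) * z / (1 - of_real (f s) * z)) = sin t * ?a (f s)" using g(2) unfolding Q by simp
  have e: "z * (of_real (f s) / (1 - of_real (f s) * z)\<^sup>2) = (of_real (f s) * z) / (1 - of_real (f s) * z)\<^sup>2" by (simp add: mult.commute)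
  show "Re (z * (of_real (f s) / (1 - of_real (f s) * z)\<^sup>2)) = cos t * ?a (f s) - 2 * (sin t)\<^sup>2 * (?a (f s))\<^sup>2"
   unfolding e unfolding Q by (rule g(3))
 qed
 have ac: "continuous_on {0..} ?a" by (rule A_continuous[OF r c1])
 have i1: "(\<lambda>s. ?a (f s)) integrable_on {0..1}" by (rule integ_nonneg[OF ac])
 have i2: "(\<lambda>s. (?a (f s))\<^sup>2) integrable_on {0..1}" by (rule integ_nonneg[of "\<lambda>x. (?a x)\<^sup>2"]) (intro continuous_on_power ac)
 have "Im (Uf f z) = integral {0..1} (\<lambda>s. sin t * ?a (f s))"
  unfolding Uf_def integral_Re_Im(2)[OF U_integrable(1)[OF z]] by (rule integral_cong) (rule k(1))
 then show "Im (Uf f z) = sin t * Af f r (cos t)" by (simp only: Af_def integral_mult_right)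
 have zU: "z * U1 f z = integral {0..1} (\<lambda>s. z * (of_real (f s) / (1 - of_real (f s) * z)\<^sup>2))"
  unfolding U1_def by (rule integral_mult_right[symmetric])
 have "Re (z * U1 f z) = integral {0..1} (\<lambda>s. cos t * ?a (f s) - 2 * (sin t)\<^sup>2 * (?a (f s))\<^sup>2)"
  unfolding zU integral_Re_Im(1)[OF integrable_on_mult_right[OF U_integrable(2)[OF z]]] by (rule integral_cong) (rule k(2))
 also have "\<dots> = integral {0..1} (\<lambda>s. cos t * ?a (f s)) - integral {0..1} (\<lambda>s. 2 * (sin t)\<^sup>2 * (?a (f s))\<^sup>2)"
  by (rule integral_diff[OF integrable_on_mult_right[OF i1] integrable_on_mult_right[OF i2]])
 finally show "Re (z * U1 f z) = cos t * Af f r (cos t) -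
   2 * (sin t)\<^sup>2 * integral {0..1} (\<lambda>s. (?a (f s))\<^sup>2)" by (simp only: Af_def integral_mult_right)
qed

lemma square_kernel_integral_pos: assumes r: "0 < r" and c1: "c < 1"
 shows "0 < integral {0..1} (\<lambda>s. (f s * r / (1 - 2 * (f s * r) * c + (f s * r)\<^sup>2))\<^sup>2)"
proof (rule integral_pos[of "\<lambda>x. (x * r / (1 - 2 * (x * r) * c + (x * r)\<^sup>2))\<^sup>2"])
 show "continuous_on {0..} (\<lambda>x. (x * r / (1 - 2 * (x * r) * c + (x * r)\<^sup>2))\<^sup>2)" by (intro continuous_on_power A_continuous r c1)
 fix x :: real assume "0 < x"
 then show "0 < (x * r / (1 - 2 * (x * r) * c + (x * r)\<^sup>2))\<^sup>2" using r quadratic_denominator_pos[of "x * r" c] c1 by simp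
qed simp

text \<open>The denominator decreases in the cosine. This is what allows only one sign change of the
  imaginary part on a vertical segment.\<close>

lemma Af_strict_mono: assumes r: "0 < r" and c: "c1 < c2" "c2 < 1" shows "Af f r c1 < Af f r c2" proof -
 let ?a = "\<lambda>c x. x * r / (1 - 2 * (x * r) * c + (x * r)\<^sup>2)"
 have ac: "continuous_on {0..} (?a c1)" "continuous_on {0..} (?a c2)" by (rule A_continuous; use r c in simp)+
 have lt: "?a c1 x < ?a c2 x" if "0 < x" for x
 proof (rule divide_strict_left_mono)
  have y: "0 < x * r" using that r by simp
  then have "2 * (x * r) * c1 < 2 * (x * r) * c2" using c by (intro mult_strict_left_mono) auto
  then show "1 - 2 * (x * r) * c2 + (x * r)\<^sup>2 < 1 - 2 * (x * r) * c1 + (x * r)\<^sup>2" by linarith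
  show "0 < x * r" using that r by simp
  show "0 < (1 - 2 * (x * r) * c1 + (x * r)\<^sup>2) * (1 - 2 * (x * r) * c2 + (x * r)\<^sup>2)"
   using y c by (intro mult_pos_pos quadratic_denominator_pos) auto
 qed
 have "0 < integral {0..1} (\<lambda>s. ?a c2 (f s) - ?a c1 (f s))"
 proof (rule integral_pos[of "\<lambda>x. ?a c2 x - ?a c1 x"])
  show "continuous_on {0..} (\<lambda>x. ?a c2 x - ?a c1 x)" by (intro continuous_on_diff ac)
  show "0 \<le> ?a c2 x - ?a c1 x" if "0 \<le> x" for x using lt[of x] that by (cases "x = 0") auto
 qed (use lt in simp)
 also have "\<dots> = Af f r c2 - Af f r c1" unfolding Af_def by (rule integral_diff) (rule integ_nonneg[OF ac(2)], rule integ_nonneg[OF ac(1)])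
 finally show ?thesis by simp
qed

lemma Af_nonpos_arg_le: assumes r: "0 < r" and c: "c \<le> 0" shows "0 \<le> Af f r c" "Af f r c \<le> M * r" proof -
 have ac: "continuous_on {0..} (\<lambda>x. x * r / (1 - 2 * (x * r) * c + (x * r)\<^sup>2))" by (rule A_continuous) (use r c in auto)
 have D: "1 \<le> 1 - 2 * (x * r) * c + (x * r)\<^sup>2" if "0 \<le> x" for x proof -
  have "0 \<le> 2 * (x * r)" using that r by simp
  then have "2 * (x * r) * c \<le> 0" using c by (rule mult_nonneg_nonpos)
  then show ?thesis using zero_le_power2[of "x * r"] by linarith
 qed
 show "0 \<le> Af f r c" unfolding Af_def
 proof (rule integral_nonneg[OF integ_nonneg[OF ac]])
  fix s :: real assume "s \<in> {0..1}"
  then show "0 \<le> f s * r / (1 - 2 * (f s * r) * c + (f s * r)\<^sup>2)" using nonneg[of s] r D[of "f s"] by (intro divide_nonneg_nonneg) auto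
 qed
 have "Af f r c \<le> integral {0..1::real} (\<lambda>s. M * r)" unfolding Af_def
 proof (rule integral_le[OF integ_nonneg[OF ac] integrable_const_ivl])
  fix s :: real assume s: "s \<in> {0..1}"
  have "f s * r / (1 - 2 * (f s * r) * c + (f s * r)\<^sup>2) \<le> f s * r / 1"
   using D[OF nonneg[OF s]] nonneg[OF s] r by (intro divide_left_mono) auto
  also have "\<dots> \<le> M * r" using bounded[OF s] r by simp
  finally show "f s * r / (1 - 2 * (f s * r) * c + (f s * r)\<^sup>2) \<le> M * r" .
 qed
 then show "Af f r c \<le> M * r" by simp
qed

text \<open>If r = 1/x for some x in \<open>K\<close>, the denominator at y is r^2 (y - x)^2 + 2 y r
  (1 - c). For c close to 1 this is at most r^2 ((y - x)^2 + e^2), so \<open>Af\<close> dominates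
  the integral that \<open>sing\<close> makes arbitrarily large.\<close>

lemma Af_bounded_imp_DK: assumes r: "0 < r" and B: "\<And>c. 0 < c ==> c < 1 ==> Af f r c \<le> B" shows "of_real r \<in> DK K"
proof (rule ccontr)
 assume "of_real r \<notin> DK K"
 then obtain x where x: "x \<in> K" "1 - complex_of_real x * of_real r = 0" by (auto simp: DK_def)
 have "complex_of_real (x * r) = of_real 1" using x(2) by simp
 then have xr: "x * r = 1" by (simp only: of_real_eq_iff)
 then have "x \<noteq> 0" by auto
 moreover have "0 \<le> x" using x(1) K_sub by auto
 ultimately have x0: "0 < x" by simp
 obtain e where e: "0 < e" "2 * r\<^sup>2 * \<bar>B\<bar> + 4 / x\<^sup>2 < integral {0..1} (\<lambda>s. 1 / ((f s - x)\<^sup>2 + e\<^sup>2))" using sing[OF x(1)] by blast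
 \<comment> \<open>Close enough to 1 that 2 M (1 - c) \<le> r e^2, but bounded below to stay in the
   open unit interval.\<close>
 define c where "c = max (1 / 2) (1 - r * e\<^sup>2 / (2 * M))"
 have re: "0 < r * e\<^sup>2 / (2 * M)" using r e(1) Mpos by simp
 have c: "0 < c" "c < 1" "2 * M * (1 - c) \<le> r * e\<^sup>2" proof -
  show "0 < c" by (simp add: c_def)
  show "c < 1" using re by (simp add: c_def)
  have "1 - c \<le> r * e\<^sup>2 / (2 * M)" by (simp add: c_def)
  then show "2 * M * (1 - c) \<le> r * e\<^sup>2" using Mpos by (simp add: pos_le_divide_eq mult.commute)
 qed
 have ac: "continuous_on {0..} (\<lambda>x. x * r / (1 - 2 * (x * r) * c + (x * r)\<^sup>2))" by (rule A_continuous[OF r c(2)])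
 \<comment> \<open>Below x / 2 the left side is at most 4 / x^2. Above it, y r \<ge> 1/2, so the
   numerator of the kernel of \<open>Af\<close> is bounded below.\<close>
 have key: "1 / ((y - x)\<^sup>2 + e\<^sup>2) \<le> 2 * r\<^sup>2 * (y * r / (1 - 2 * (y * r) * c + (y * r)\<^sup>2)) + 4 / x\<^sup>2"
  if y: "0 \<le> y" "y \<le> M" for y
 proof (cases "y < x / 2")
  case True
  have "(x / 2)\<^sup>2 \<le> (y - x)\<^sup>2" using True x0 power_mono[of "x / 2" "x - y" 2] by (simp add: power2_commute)
  then have "(x / 2)\<^sup>2 \<le> (y - x)\<^sup>2 + e\<^sup>2" by (simp add: add_increasing2)
  then have "1 / ((y - x)\<^sup>2 + e\<^sup>2) \<le> 1 / (x / 2)\<^sup>2" using x0 by (intro divide_left_mono mult_pos_pos add_nonneg_pos) (use e in auto)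
  also have "\<dots> = 4 / x\<^sup>2" by (simp add: power_divide)
  also have "\<dots> \<le> 2 * r\<^sup>2 * (y * r / (1 - 2 * (y * r) * c + (y * r)\<^sup>2)) + 4 / x\<^sup>2"
   using quadratic_denominator_pos[of "y * r" c] y r c by simp
  finally show ?thesis .
 next
  case False
  have D: "1 - 2 * (y * r) * c + (y * r)\<^sup>2 = r\<^sup>2 * (y - x)\<^sup>2 + 2 * y * r * (1 - c)" proof -
   have "r\<^sup>2 * (y - x)\<^sup>2 = (y * r - x * r)\<^sup>2" by (simp add: power2_eq_square algebra_simps)
   then show ?thesis unfolding xr by (simp add: power2_eq_square algebra_simps)
  qed
  have D0: "0 < 1 - 2 * (y * r) * c + (y * r)\<^sup>2" using quadratic_denominator_pos[of "y * r" c] y r c by simp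
  have "2 * y * r * (1 - c) = (2 * y * (1 - c)) * r" by simp
  also have "\<dots> \<le> (2 * M * (1 - c)) * r" using y c r by (intro mult_right_mono mult_left_mono) auto
  also have "\<dots> \<le> (r * e\<^sup>2) * r" using c(3) r by (intro mult_right_mono) auto
  finally have "1 - 2 * (y * r) * c + (y * r)\<^sup>2 \<le> r\<^sup>2 * ((y - x)\<^sup>2 + e\<^sup>2)" unfolding D by (simp add: power2_eq_square algebra_simps)
  then have "1 / (r\<^sup>2 * ((y - x)\<^sup>2 + e\<^sup>2)) \<le> 1 / (1 - 2 * (y * r) * c + (y * r)\<^sup>2)"
   using D0 by (intro divide_left_mono) (auto intro: less_le_trans mult_pos_pos)
  moreover have "1 / 2 \<le> y * r" proof -
   have "x / 2 * r \<le> y * r" using False r by (intro mult_right_mono) auto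
   then show ?thesis using xr by simp
  qed
  ultimately have "1 / 2 * (1 / (r\<^sup>2 * ((y - x)\<^sup>2 + e\<^sup>2))) \<le> y * r * (1 / (1 - 2 * (y * r) * c + (y * r)\<^sup>2))" by (intro mult_mono) auto
  then have "2 * r\<^sup>2 * (1 / 2 * (1 / (r\<^sup>2 * ((y - x)\<^sup>2 + e\<^sup>2)))) \<le> 2 * r\<^sup>2 * (y * r * (1 / (1 - 2 * (y * r) * c + (y * r)\<^sup>2)))"
   by (intro mult_left_mono) auto
  moreover have "2 * r\<^sup>2 * (1 / 2 * (1 / (r\<^sup>2 * ((y - x)\<^sup>2 + e\<^sup>2)))) = 1 / ((y - x)\<^sup>2 + e\<^sup>2)" using r by simp
  ultimately have "1 / ((y - x)\<^sup>2 + e\<^sup>2) \<le> 2 * r\<^sup>2 * (y * r / (1 - 2 * (y * r) * c + (y * r)\<^sup>2))" by simp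
  also have "\<dots> \<le> \<dots> + 4 / x\<^sup>2" by simp
  finally show ?thesis .
 qed
 have ic: "continuous_on {0..} (\<lambda>y. 2 * r\<^sup>2 * (y * r / (1 - 2 * (y * r) * c + (y * r)\<^sup>2)) + 4 / x\<^sup>2)"
  by (intro continuous_on_add continuous_on_mult continuous_on_const ac)
 have "integral {0..1} (\<lambda>s. 1 / ((f s - x)\<^sup>2 + e\<^sup>2)) \<le>
   integral {0..1} (\<lambda>s. 2 * r\<^sup>2 * (f s * r / (1 - 2 * (f s * r) * c + (f s * r)\<^sup>2)) + 4 / x\<^sup>2)"
 proof (rule integral_mono_f[OF _ integ_nonneg[OF ic] key])
  show "(\<lambda>s. 1 / ((f s - x)\<^sup>2 + e\<^sup>2)) integrable_on {0..1}" by (rule integ_nonneg[of "\<lambda>y. 1 / ((y - x)\<^sup>2 + e\<^sup>2)"])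
     (use e(1) in \<open>auto intro!: continuous_intros simp: sum_power2_eq_zero_iff\<close>)
 qed
 also have "\<dots> = 2 * r\<^sup>2 * Af f r c + 4 / x\<^sup>2"
  unfolding Af_def integral_add[OF integrable_on_mult_right[OF integ_nonneg[OF ac]] integrable_const_ivl]
   integral_mult_right by simp
 also have "\<dots> \<le> 2 * r\<^sup>2 * \<bar>B\<bar> + 4 / x\<^sup>2" using B[OF c(1,2)] by (intro add_right_mono mult_left_mono) auto
 finally show False using e(2) by simp
qed

lemma small_neg_DK: assumes "0 \<le> r" shows "- of_real r \<in> DK K" proof -
 have "1 - complex_of_real x * (- of_real r) \<noteq> 0" if "x \<in> K" for x proof -
  have "0 \<le> x" using that K_sub by auto
  then have "0 < 1 + x * r" using assms by (simp add: add_pos_nonneg)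
  then have "complex_of_real (1 + x * r) \<noteq> 0" by (simp only: of_real_eq_0_iff)
  then show ?thesis by simp
 qed
 then show ?thesis unfolding DK_def by blast
qed

end

section \<open>The transform near zero and near infinity\<close>

context pfun
begin

lemma Af_small: assumes r: "0 < r" "4 * M * r \<le> 1" and c: "0 < c" "c < 1" shows "Af f r c \<le> 2 * M * r" proof -
 have ac: "continuous_on {0..} (\<lambda>x. x * r / (1 - 2 * (x * r) * c + (x * r)\<^sup>2))" by (rule A_continuous) (use r c in auto)
 have "Af f r c \<le> integral {0..1::real} (\<lambda>s. 2 * M * r)" unfolding Af_def
 proof (rule integral_le[OF integ_nonneg[OF ac] integrable_const_ivl])
  fix s :: real assume s: "s \<in> {0..1}"
  have y: "0 \<le> f s * r" "f s * r \<le> M * r" using nonneg[OF s] bounded[OF s] r by auto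
  have "2 * (f s * r) * c \<le> 2 * (f s * r) * 1" using y(1) c by (intro mult_left_mono) auto
  then have "1 / 2 \<le> 1 - 2 * (f s * r) * c + (f s * r)\<^sup>2" using y(2) r(2) zero_le_power2[of "f s * r"] by linarith
  then have "f s * r / (1 - 2 * (f s * r) * c + (f s * r)\<^sup>2) \<le> M * r / (1 / 2)" using y by (intro frac_le) auto
  then show "f s * r / (1 - 2 * (f s * r) * c + (f s * r)\<^sup>2) \<le> 2 * M * r" by simp
 qed
 then show ?thesis by simp
qed

lemma reg_integrable: "0 < r ==> (\<lambda>s. f s / ((f s)\<^sup>2 + r\<^sup>2)) integrable_on {0..1}" by (rule integ_nonneg[of "\<lambda>x. x / (x\<^sup>2 + r\<^sup>2)"])
   (auto intro!: continuous_intros simp: sum_power2_eq_zero_iff)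

lemma reg_mono: assumes "0 < r" "r \<le> e" shows "integral {0..1} (\<lambda>s. f s / ((f s)\<^sup>2 + e\<^sup>2)) \<le> integral {0..1} (\<lambda>s. f s / ((f s)\<^sup>2 + r\<^sup>2))"
proof (rule integral_le)
 fix s :: real assume s: "s \<in> {0..1}"
 have "r\<^sup>2 \<le> e\<^sup>2" using assms by (intro power_mono) auto
 moreover have "0 < (f s)\<^sup>2 + r\<^sup>2" using assms(1) by (simp add: add_nonneg_pos)
 ultimately show "f s / ((f s)\<^sup>2 + e\<^sup>2) \<le> f s / ((f s)\<^sup>2 + r\<^sup>2)" using nonneg[OF s] by (intro frac_le) auto
qed (use assms reg_integrable in auto)

text \<open>After multiplication by r^2 the denominator is at most (x + r)^2 \<le> 2 (x^2 + r^2),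
  uniformly in the angle. This links \<open>Af\<close> at large radius to the regularized integral
  in \<open>sing0\<close>.\<close>

lemma Af_large: assumes r: "0 < r" and c: "-1 \<le> c" "c < 1" shows "r / 2 * integral {0..1} (\<lambda>s. f s / ((f s)\<^sup>2 + r\<^sup>2)) \<le> Af f (1 / r) c"
proof -
 have ac: "continuous_on {0..} (\<lambda>x. x * (1 / r) / (1 - 2 * (x * (1 / r)) * c + (x * (1 / r))\<^sup>2))" by (rule A_continuous) (use r c in auto)
 have "integral {0..1} (\<lambda>s. r / 2 * (f s / ((f s)\<^sup>2 + r\<^sup>2))) \<le> Af f (1 / r) c" unfolding Af_def
 proof (rule integral_le[OF integrable_on_mult_right[OF reg_integrable[OF r]] integ_nonneg[OF ac]])
  fix s :: real assume s: "s \<in> {0..1}"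
  let ?x = "f s"
  have x: "0 \<le> ?x" by (rule nonneg[OF s])
  have D: "0 < 1 - 2 * (?x * (1 / r)) * c + (?x * (1 / r))\<^sup>2" using quadratic_denominator_pos[of "?x * (1 / r)" c] x r c by simp
  have "- (2 * (?x * r)) * c \<le> 2 * (?x * r) * 1" using mult_left_mono[of "- c" 1 "2 * (?x * r)"] x r c by simp
  moreover have "0 \<le> (?x - r)\<^sup>2" by simp
  ultimately have "r\<^sup>2 - 2 * (?x * r) * c + ?x\<^sup>2 \<le> 2 * (?x\<^sup>2 + r\<^sup>2)" by (simp add: power2_diff algebra_simps)
  moreover have "r\<^sup>2 * (1 - 2 * (?x * (1 / r)) * c + (?x * (1 / r))\<^sup>2) = r\<^sup>2 - 2 * (?x * r) * c + ?x\<^sup>2"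
   using r by (simp add: power2_eq_square field_simps)
  ultimately have le: "r\<^sup>2 * (1 - 2 * (?x * (1 / r)) * c + (?x * (1 / r))\<^sup>2) \<le> 2 * (?x\<^sup>2 + r\<^sup>2)" by linarith
  have "r / 2 * (?x / (?x\<^sup>2 + r\<^sup>2)) = r * ?x / (2 * (?x\<^sup>2 + r\<^sup>2))" by simp
  also have "\<dots> \<le> r * ?x / (r\<^sup>2 * (1 - 2 * (?x * (1 / r)) * c + (?x * (1 / r))\<^sup>2))" using le x r D by (intro frac_le mult_pos_pos) auto
  also have "\<dots> = ?x * (1 / r) / (1 - 2 * (?x * (1 / r)) * c + (?x * (1 / r))\<^sup>2)" using r by (simp add: power2_eq_square)
  finally show "r / 2 * (?x / (?x\<^sup>2 + r\<^sup>2)) \<le> ?x * (1 / r) / (1 - 2 * (?x * (1 / r)) * c + (?x * (1 / r))\<^sup>2)" .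
 qed
 then show ?thesis by (simp only: integral_mult_right)
qed

text \<open>The indicator of f > 0 is not a continuous function of \<open>f\<close>; it is obtained
  as the bounded limit of f / (f + 1/n).\<close>

lemma pos_mass_integrable: "(\<lambda>s. if f s = 0 then 0 else 1 :: real) integrable_on {0..1}"
proof (rule dominated_convergence(1))
 show "(\<lambda>s. f s / (f s + 1 / real (Suc n))) integrable_on {0..1}" for n
 proof (rule integ_nonneg[of "\<lambda>x. x / (x + 1 / real (Suc n))"], intro continuous_intros ballI)
  fix x :: real assume "x \<in> {0..}"
  then have "0 < x + 1 / real (Suc n)" by (intro add_nonneg_pos) auto
  then show "x + 1 / real (Suc n) \<noteq> 0" by simp
 qed
 show "(\<lambda>_. 1 :: real) integrable_on {0..1::real}" by (rule integrable_const_ivl)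
 show "norm (f s / (f s + 1 / real (Suc n))) \<le> 1" if "s \<in> {0..1}" for n s using nonneg[OF that] by (simp add: divide_le_eq add_nonneg_pos)
 show "(\<lambda>n. f s / (f s + 1 / real (Suc n))) \<longlonglongrightarrow> (if f s = 0 then 0 else 1)" if "s \<in> {0..1}" for s
 proof (cases "f s = 0")
  case False
  have "(\<lambda>n. f s / (f s + 1 / real (Suc n))) \<longlonglongrightarrow> f s / (f s + 0)"
   using LIMSEQ_inverse_real_of_nat False by (intro tendsto_intros) (auto simp: inverse_eq_divide)
  then show ?thesis using False by simp
 qed simp
qed

lemma neg_inverse_DK: "-1 / w \<in> DK K ==> w \<noteq> 0 ==> x \<in> K ==> of_real x + w \<noteq> 0"
proof
 assume h: "-1 / w \<in> DK K" "w \<noteq> 0" "x \<in> K" "of_real x + w = 0"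
 then have "of_real x = - w" by (simp add: eq_neg_iff_add_eq_0)
 then have "1 - of_real x * (-1 / w) = 0" using h(2) by simp
 then show False using h(1,3) unfolding DK_def by blast
qed

lemma Uf_neg_inverse: assumes "w \<noteq> 0" shows "Uf f (-1 / w) = integral {0..1} (\<lambda>s. - (of_real (f s) / (of_real (f s) + w)))" unfolding Uf_def
proof (rule integral_cong)
 fix s
 have "1 - of_real (f s) * (-1 / w) = (of_real (f s) + w) / w" using assms by (simp add: field_simps)
 then show "of_real (f s) * (-1 / w) / (1 - of_real (f s) * (-1 / w)) = - (of_real (f s) / (of_real (f s) + w))" using assms by simp
qed

lemma norm_right_half_plane: assumes "0 \<le> x" "0 \<le> Re w" shows "norm (complex_of_real x / (of_real x + w)) \<le> 1" proof -
 have "x \<le> Re (of_real x + w)" using assms by simp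
 also have "\<dots> \<le> norm (of_real x + w)" by (rule complex_Re_le_cmod)
 finally show ?thesis using assms by (simp add: norm_divide divide_le_eq_1)
qed

lemma right_half_plane_DK: assumes "0 \<le> Re w" "w \<noteq> 0" shows "-1 / w \<in> DK K" proof -
 have "1 - of_real x * (-1 / w) \<noteq> 0" if "x \<in> K" for x
 proof
  assume "1 - of_real x * (-1 / w) = 0"
  then have "w = - of_real x" using assms(2) by (simp add: field_simps eq_neg_iff_add_eq_0 add.commute)
  moreover have "0 \<le> x" using that K_sub by auto
  ultimately show False using assms by (cases "x = 0") auto
 qed
 then show ?thesis unfolding DK_def by blast
qed

lemma V_integrable: assumes "-1 / w \<in> DK K" "w \<noteq> 0" shows "(\<lambda>s. - (of_real (f s) / (of_real (f s) + w))) integrable_on {0..1}"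
 by (rule integ[of "\<lambda>x. - (of_real x / (of_real x + w))"]) (use neg_inverse_DK[OF assms] in \<open>intro continuous_intros; simp\<close>)

lemma norm_V_le: assumes "0 \<le> Re w" "w \<noteq> 0" shows "norm (Uf f (-1 / w)) \<le> 1" proof -
 have "norm (integral {0..1} (\<lambda>s. - (of_real (f s) / (of_real (f s) + w)))) \<le> integral {0..1::real} (\<lambda>_. 1)"
  by (rule integral_norm_bound_integral[OF V_integrable[OF right_half_plane_DK[OF assms] assms(2)]])
    (use norm_right_half_plane nonneg assms in auto)
 then show ?thesis unfolding Uf_neg_inverse[OF assms(2)] by simp
qed

lemma bounded_linear_complex_of_real: "bounded_linear complex_of_real" by (rule bounded_linear_of_real)

lemma V_tendsto: assumes w: "w \<longlonglongrightarrow> 0" "\<And>n. 0 \<le> Re (w n)" "\<And>n. w n \<noteq> 0" shows "(\<lambda>n. Uf f (-1 / w n)) \<longlonglongrightarrow> - of_real (pos_mass f)" proof -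
 have "(\<lambda>n. integral {0..1} (\<lambda>s. - (of_real (f s) / (of_real (f s) + w n)))) \<longlonglongrightarrow>
   integral {0..1} (\<lambda>s. - of_real (if f s = 0 then 0 else 1) :: complex)"
 proof (rule dominated_convergence(2))
  show "(\<lambda>s. - (of_real (f s) / (of_real (f s) + w n))) integrable_on {0..1}" for n
   by (rule V_integrable[OF right_half_plane_DK[OF w(2,3)] w(3)])
  show "(\<lambda>_. 1 :: real) integrable_on {0..1::real}" by (rule integrable_const_ivl)
  show "norm (- (complex_of_real (f s) / (of_real (f s) + w n))) \<le> 1" if "s \<in> {0..1}" for n s
   using norm_right_half_plane[OF nonneg[OF that] w(2)] by simp
  show "(\<lambda>n. - (complex_of_real (f s) / (of_real (f s) + w n))) \<longlonglongrightarrow> - of_real (if f s = 0 then 0 else 1)"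
   if "s \<in> {0..1}" for s
  proof (cases "f s = 0")
   case False
   have "(\<lambda>n. - (complex_of_real (f s) / (of_real (f s) + w n))) \<longlonglongrightarrow> - (of_real (f s) / (of_real (f s) + 0))"
    using False by (intro tendsto_intros w(1)) auto
   then show ?thesis using False by simp
  qed simp
 qed
 moreover have "integral {0..1} (\<lambda>s. - of_real (if f s = 0 then 0 else 1) :: complex) = - of_real (pos_mass f)"
  unfolding integral_neg pos_mass_def using integral_linear[OF pos_mass_integrable bounded_linear_complex_of_real] by (simp add: comp_def)
 ultimately show ?thesis unfolding Uf_neg_inverse[OF w(3)] by simp
qed

text \<open>With a gap above 0 the point w may approach 0 from any direction off the poles.
  \<open>V_tendsto\<close> instead stays in the right half-plane, where |x + w| \<ge> x.\<close>

lemma V_gap: assumes d: "0 < d" "\<And>s. s \<in> {0..1} - P ==> f s = 0 \<or> d \<le> f s" and w: "-1 / w \<in> DK K" "w \<noteq> 0" "norm w \<le> d / 2"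
 shows "norm (Uf f (-1 / w) + of_real (pos_mass f)) \<le> 2 * norm w / d" proof -
 let ?I = "\<lambda>s. - (of_real (f s) / (of_real (f s) + w))"
 let ?J = "\<lambda>s. complex_of_real (if f s = 0 then 0 else 1)"
 have iJ: "?J integrable_on {0..1}" using integrable_linear[OF pos_mass_integrable bounded_linear_complex_of_real] by (simp add: comp_def)
 have mJ: "of_real (pos_mass f) = integral {0..1} ?J" unfolding pos_mass_def
  using integral_linear[OF pos_mass_integrable bounded_linear_complex_of_real] by (simp add: comp_def)
 define J' where "J' = (\<lambda>s. if s \<in> P then - ?I s else ?J s)"
 have iJ': "J' integrable_on {0..1}" by (rule integrable_spike[OF iJ negligible_finite[OF finP(1)]]) (simp add: J'_def)
 have mJ': "of_real (pos_mass f) = integral {0..1} J'"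
  unfolding mJ by (rule integral_spike[OF negligible_finite[OF finP(1)]]) (simp add: J'_def)
 note iI = V_integrable[OF w(1,2)]
 have "Uf f (-1 / w) + of_real (pos_mass f) = integral {0..1} (\<lambda>s. ?I s + J' s)"
  unfolding Uf_neg_inverse[OF w(2)] mJ' by (rule integral_add[OF iI iJ', symmetric])
 moreover have "norm (integral {0..1} (\<lambda>s. ?I s + J' s)) \<le> integral {0..1::real} (\<lambda>_. 2 * norm w / d)"
 proof (rule integral_norm_bound_integral[OF integrable_add[OF iI iJ'] integrable_const_ivl])
  fix s :: real assume s: "s \<in> {0..1}"
  show "norm (?I s + J' s) \<le> 2 * norm w / d"
  proof (cases "s \<in> P \<or> f s = 0")
   case True
   then show ?thesis using d(1) by (auto simp: J'_def)
  next
   case False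
   then have x: "d \<le> f s" "f s \<noteq> 0" "s \<notin> P" using d(2)[of s] s by auto
   have n: "d / 2 \<le> norm (complex_of_real (f s) + w)" using norm_diff_ineq[of "complex_of_real (f s)" w] x(1) d(1) w(3) by simp
   then have ne: "complex_of_real (f s) + w \<noteq> 0" using d(1) by auto
   then have "?I s + J' s = w / (of_real (f s) + w)" using x by (simp add: J'_def field_simps)
   then have "norm (?I s + J' s) = norm w / norm (complex_of_real (f s) + w)" by (simp add: norm_divide)
   also have "\<dots> \<le> norm w / (d / 2)" using n d(1) by (intro divide_left_mono mult_pos_pos) (use ne in auto)
   also have "\<dots> = 2 * norm w / d" by simp
   finally show ?thesis .
  qed
 qed
 ultimately show ?thesis by simp
qed

lemma pos_mass_nonneg: "0 \<le> pos_mass f" unfolding pos_mass_def by (rule integral_nonneg[OF pos_mass_integrable]) auto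

end

section \<open>The root equation in logarithmic coordinates\<close>

text \<open>In the coordinate \<open>z = exp \<zeta>\<close>, \<open>hF\<close> is \<open>G_fun f g c z\<close> and \<open>hD\<close> its derivative. \<open>Th x\<close> is the
 height at which the imaginary part of \<open>hF\<close> changes sign on the vertical line through \<open>x\<close>; it is
 \<open>0\<close> or \<open>pi\<close> where there is no sign change.\<close>

definition hF :: "(real => real) => (real => real) => real => complex => complex" where
 "hF f g c \<zeta> = Uf f (exp \<zeta>) - of_real c * Uf g (- exp (- \<zeta>))"

definition hD :: "(real => real) => (real => real) => real => complex => complex" where
 "hD f g c \<zeta> = exp \<zeta> * U1 f (exp \<zeta>) - of_real c * (exp (- \<zeta>) * U1 g (- exp (- \<zeta>)))"

definition Th :: "(real => real) => (real => real) => real => real => real" where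
 "Th f g c x = Sup (insert 0 {t. 0 < t \<and> t < pi \<and> 0 < Im (hF f g c (Complex x t))})"

definition zeta :: "(real => real) => (real => real) => real => real => complex" where
 "zeta f g c x = Complex x (Th f g c x)"

definition tt :: "(real => real) => (real => real) => real => real => real" where
 "tt f g c x = Re (hF f g c (zeta f g c x))"

text \<open>The imaginary part of \<open>hF\<close> divided by sin t, with k = cos t. The second
  argument carries the opposite cosine because -1/z has angle pi - t.\<close>

definition bb :: "(real => real) => (real => real) => real => real => real => real" where
 "bb f g c x k = Af f (exp x) k - c * Af g (exp (- x)) (- k)"

lemma exp_Complex: "exp (Complex x t) = of_real (exp x) * cis t" by (simp add: exp_eq_polar)

lemma neg_exp_Complex: "- exp (- Complex x t) = of_real (exp (- x)) * cis (pi - t)" proof -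
 have "- Complex x t = Complex (- x) (- t)" by (simp add: complex_eq_iff)
 then have "- exp (- Complex x t) = - (of_real (exp (- x)) * cis (- t))" by (simp only: exp_Complex)
 then show ?thesis by (simp add: complex_eq_iff)
qed

lemma exp_i_pi_minus: "exp (\<i> * of_real pi - \<zeta>) = - exp (- \<zeta>)" using exp_add[of "\<i> * of_real pi" "- \<zeta>"] by simp

lemma neg_exp_i_pi_minus: "- exp (- (\<i> * of_real pi - \<zeta>)) = exp \<zeta>" using exp_i_pi_minus[of "\<i> * of_real pi - \<zeta>"] by simp

lemma (in pfun) U1_cnj: "U1 f (cnj z) = cnj (U1 f z)" proof -
 have "U1 f (cnj z) = integral {0..1} (\<lambda>s. cnj (of_real (f s) / (1 - of_real (f s) * z)\<^sup>2))" unfolding U1_def by (intro integral_cong) simp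
 then show ?thesis by (simp add: U1_def integral_cnj)
qed

locale fgpair = F: pfun f P K M + G: pfun g Q L N
 for f P K M g Q L N + fixes c :: real assumes cpos: "0 < c"
begin

abbreviation "hh \<equiv> hF f g c"
abbreviation "hd' \<equiv> hD f g c"
abbreviation "ze \<equiv> zeta f g c"
abbreviation "th \<equiv> Th f g c"
abbreviation "tc \<equiv> tt f g c"

definition Dm :: "complex set" where
 "Dm = {\<zeta>. exp \<zeta> \<in> DK K \<and> - exp (- \<zeta>) \<in> DK L}"

lemma open_Dm: "open Dm" proof -
 have "Dm = exp -` DK K \<inter> (\<lambda>\<zeta>. - exp (- \<zeta>)) -` DK L" by (auto simp: Dm_def)
 then show ?thesis by (auto intro!: open_Int open_vimage F.open_DK G.open_DK continuous_intros)
qed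

lemma hF_deriv: assumes "\<zeta> \<in> Dm" shows "(hh has_field_derivative hd' \<zeta>) (at \<zeta>)" proof -
 have 1: "((\<lambda>\<zeta>. Uf f (exp \<zeta>)) has_field_derivative U1 f (exp \<zeta>) * exp \<zeta>) (at \<zeta>)"
  by (rule DERIV_chain2[OF F.Uf_has_field_derivative DERIV_exp]) (use assms in \<open>simp add: Dm_def\<close>)
 have "((\<lambda>\<zeta>. - exp (- \<zeta>)) has_field_derivative exp (- \<zeta>)) (at \<zeta>)" by (auto intro!: derivative_eq_intros)
 from DERIV_chain2[OF G.Uf_has_field_derivative this]
 have 2: "((\<lambda>\<zeta>. Uf g (- exp (- \<zeta>))) has_field_derivative U1 g (- exp (- \<zeta>)) * exp (- \<zeta>)) (at \<zeta>)" using assms by (simp add: Dm_def)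
 show ?thesis unfolding hF_def[abs_def] hD_def by (rule derivative_eq_intros 1 2 refl)+ simp
qed

lemma hF_holomorphic: "hh holomorphic_on Dm"
 using hF_deriv open_Dm by (meson field_differentiable_def holomorphic_on_def field_differentiable_at_within)

lemma strip_Dm: assumes "0 < t" "t < pi" shows "Complex x t \<in> Dm" proof -
 have s: "sin t > 0" using assms by (rule sin_gt_zero)
 then have "Im (exp (Complex x t)) \<noteq> 0" "Im (- exp (- Complex x t)) \<noteq> 0" unfolding neg_exp_Complex exp_Complex by auto
 then show ?thesis using F.nonreal_DK G.nonreal_DK by (simp add: Dm_def)
qed

text \<open>The square terms of \<open>Uf_polar\<close> for \<open>f\<close> and for
  \<open>g\<close> enter with the same sign and form p. Hence at an interior zero of the imaginary
  part the derivative has real part -p < 0.\<close>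

lemma polar: assumes "0 < t" "t < pi" shows "Im (hh (Complex x t)) = sin t * bb f g c x (cos t)"
  "\<exists>p>0. Re (hd' (Complex x t)) = cos t * bb f g c x (cos t) - p" proof -
 have s: "sin t > 0" using assms by (rule sin_gt_zero)
 have ss: "sin (pi - t) = sin t" "cos (pi - t) = - cos t" by simp_all
 have e: "0 < exp x" "0 < exp (- x)" by simp_all
 have st: "sin t \<noteq> 0" "sin (pi - t) \<noteq> 0" using s by simp_all
 note p1 = F.Uf_polar[OF e(1) st(1)] and p2 = G.Uf_polar[OF e(2) st(2), unfolded ss]
 show "Im (hh (Complex x t)) = sin t * bb f g c x (cos t)" unfolding hF_def neg_exp_Complex exp_Complex bb_def using p1(1) p2(1)
  by (simp add: right_diff_distrib)
 define X where "X = integral {0..1} (\<lambda>s. (f s * exp x / (1 - 2 * (f s * exp x) * cos t + (f s * exp x)\<^sup>2))\<^sup>2)"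
 define Y where "Y = integral {0..1} (\<lambda>s. (g s * exp (- x) / (1 - 2 * (g s * exp (- x)) * - cos t + (g s * exp (- x))\<^sup>2))\<^sup>2)"
 have "0 < X" unfolding X_def by (rule F.square_kernel_integral_pos[OF e(1) cos_less_one[OF st(1)]])
 moreover have "0 < Y" unfolding Y_def by (rule G.square_kernel_integral_pos[OF e(2) cos_less_one[OF st(2), unfolded ss]])
 ultimately have pp: "0 < 2 * (sin t)\<^sup>2 * X + c * (2 * (sin t)\<^sup>2 * Y)" using s cpos by (intro add_pos_pos mult_pos_pos) auto
 have h: "hd' (Complex x t) = (of_real (exp x) * cis t) * U1 f (of_real (exp x) * cis t)
   + of_real c * ((of_real (exp (- x)) * cis (pi - t)) * U1 g (of_real (exp (- x)) * cis (pi - t)))" proof -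
  have e: "exp (- Complex x t) = - (of_real (exp (- x)) * cis (pi - t))" by (simp only: neg_exp_Complex[symmetric] minus_minus)
  show ?thesis unfolding hD_def neg_exp_Complex unfolding e exp_Complex by simp
 qed
 have "Re (hd' (Complex x t)) = Re ((of_real (exp x) * cis t) * U1 f (of_real (exp x) * cis t))
   + c * Re ((of_real (exp (- x)) * cis (pi - t)) * U1 g (of_real (exp (- x)) * cis (pi - t)))"
  unfolding h plus_complex.sel Re_complex_of_real Im_complex_of_real times_complex.sel(1)[of "of_real c"] by simp
 also have "\<dots> = (cos t * Af f (exp x) (cos t) - 2 * (sin t)\<^sup>2 * X)
   + c * (- cos t * Af g (exp (- x)) (- cos t) - 2 * (sin t)\<^sup>2 * Y)" unfolding p1(2) p2(2) X_def Y_def ..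
 also have "\<dots> = cos t * bb f g c x (cos t) - (2 * (sin t)\<^sup>2 * X + c * (2 * (sin t)\<^sup>2 * Y))" by (simp add: bb_def algebra_simps)
 finally show "\<exists>p>0. Re (hd' (Complex x t)) = cos t * bb f g c x (cos t) - p" using pp by blast
qed

lemma bb_strict_mono: assumes "-1 < k1" "k1 < k2" "k2 < 1" shows "bb f g c x k1 < bb f g c x k2" proof -
 have "Af f (exp x) k1 < Af f (exp x) k2" using assms by (intro F.Af_strict_mono) auto
 moreover have "Af g (exp (- x)) (- k2) < Af g (exp (- x)) (- k1)" using assms by (intro G.Af_strict_mono) auto
 then have "c * Af g (exp (- x)) (- k2) < c * Af g (exp (- x)) (- k1)" using cpos by simp
 ultimately show ?thesis by (simp add: bb_def)
qed

lemma cos_range: "0 < t ==> t < pi ==> -1 < cos t \<and> cos t < 1" using cos_monotone_0_pi[of 0 t] cos_monotone_0_pi[of t pi] by simp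

text \<open>\<open>bb\<close> strictly increases with the cosine, hence strictly decreases with the
  height.\<close>

lemma sign_propagates: assumes "0 < t1" "t1 < t2" "t2 < pi" "0 \<le> Im (hh (Complex x t2))" shows "0 < Im (hh (Complex x t1))" proof -
 have s: "0 < sin t1" "0 < sin t2" using assms by (auto intro: sin_gt_zero)
 have p1: "Im (hh (Complex x t1)) = sin t1 * bb f g c x (cos t1)" by (rule polar(1)) (use assms in auto)
 have p2: "Im (hh (Complex x t2)) = sin t2 * bb f g c x (cos t2)" by (rule polar(1)) (use assms in auto)
 have "0 \<le> bb f g c x (cos t2)" using assms(4) s unfolding p2 by (simp add: zero_le_mult_iff)
 also have "\<dots> < bb f g c x (cos t1)"
  using assms cos_range[of t1] cos_range[of t2] cos_monotone_0_pi[of t1 t2] by (intro bb_strict_mono) auto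
 finally show ?thesis unfolding p1 using s by simp
qed

lemma Th_set_bdd: "bdd_above (insert 0 {t. 0 < t \<and> t < pi \<and> 0 < Im (hh (Complex x t))})" by (rule bdd_aboveI[of _ pi]) auto

lemma Th_range: "0 \<le> th x" "th x \<le> pi" unfolding Th_def by (rule cSup_upper[OF _ Th_set_bdd], simp, rule cSup_least) auto

lemma Im_pos_below: assumes "0 < t" "t < th x" shows "0 < Im (hh (Complex x t))" proof -
 obtain t2 where t2: "t2 \<in> insert 0 {t. 0 < t \<and> t < pi \<and> 0 < Im (hh (Complex x t))}" "t < t2"
  using less_cSupE[of t "insert 0 {t. 0 < t \<and> t < pi \<and> 0 < Im (hh (Complex x t))}"] assms(2) unfolding Th_def by blast
 then show ?thesis using sign_propagates[of t t2 x] assms(1) by auto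
qed

lemma Im_neg_above: assumes "th x < t" "t < pi" shows "Im (hh (Complex x t)) < 0"
proof (rule ccontr)
 assume "\<not> Im (hh (Complex x t)) < 0"
 then have h: "0 \<le> Im (hh (Complex x t))" by simp
 define t' where "t' = (th x + t) / 2"
 have t': "th x < t'" "t' < t" using assms(1) by (auto simp: t'_def)
 then have "0 < t'" using Th_range(1)[of x] by simp
 have "0 < Im (hh (Complex x t'))" by (rule sign_propagates[OF \<open>0 < t'\<close> t'(2) assms(2) h])
 then have "t' \<le> th x" unfolding Th_def using \<open>0 < t'\<close> t' assms by (intro cSup_upper[OF _ Th_set_bdd]) auto
 then show False using t'(1) by simp
qed

lemma Th_eqI: assumes "0 \<le> T" "T \<le> pi" "\<And>t. 0 < t ==> t < T ==> 0 \<le> Im (hh (Complex x t))"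
  "\<And>t. T < t ==> t < pi ==> Im (hh (Complex x t)) \<le> 0" shows "th x = T"
proof (rule ccontr)
 assume "th x \<noteq> T"
 then consider "th x < T" | "T < th x" by linarith
 then show False
 proof cases
  case 1
  define t where "t = (th x + T) / 2"
  have "th x < t" "t < T" using 1 by (auto simp: t_def)
  then show False using Im_neg_above[of x t] assms(2) assms(3)[of t] Th_range(1)[of x] by simp
 next
  case 2
  define t where "t = (th x + T) / 2"
  have "t < th x" "T < t" using 2 by (auto simp: t_def)
  then show False using Im_pos_below[of t x] assms(1) assms(4)[of t] Th_range(2)[of x] by simp
 qed
qed

lemma isCont_Im_hF_fst: assumes "0 < t" "t < pi" shows "isCont (\<lambda>x. Im (hh (Complex x t))) x" proof -
 have "isCont (hh) (Complex x t)" using hF_deriv[OF strip_Dm[OF assms]] by (rule DERIV_isCont)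
 moreover have "isCont (\<lambda>x. Complex x t) x" unfolding Complex_eq by (intro continuous_intros)
 ultimately have "isCont (\<lambda>x. hh (Complex x t)) x" by (rule isCont_o2[rotated])
 then show ?thesis unfolding isCont_def by (rule tendsto_Im)
qed

text \<open>At a height strictly between 0 and pi that differs from \<open>th x\<close>, the
  imaginary part has a strict sign, which persists for nearby abscissas and keeps their sign change
  on the same side.\<close>

lemma Th_isCont: "isCont (th) x" unfolding isCont_def
proof (rule order_tendstoI)
 fix a assume a: "a < th x"
 show "eventually (\<lambda>y. a < th y) (at x)"
 proof (cases "a < 0")
  case True
  then show ?thesis using Th_range(1) by (intro always_eventually allI) (rule less_le_trans)
 next
  case False
  define t where "t = (a + th x) / 2"
  have t: "a < t" "t < th x" using a by (auto simp: t_def)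
  have t0: "0 < t" "t < pi" using t False Th_range(2)[of x] by auto
  have "0 < Im (hh (Complex x t))" by (rule Im_pos_below[OF t0(1) t(2)])
  then have "eventually (\<lambda>y. 0 < Im (hh (Complex y t))) (at x)"
   using isCont_Im_hF_fst[OF t0, of x] unfolding isCont_def by (rule order_tendstoD(1)[rotated])
  then show ?thesis
  proof eventually_elim
   case (elim y)
   have "t \<le> th y" using Im_neg_above[of y t] elim t0(2) by fastforce
   then show ?case using t(1) by simp
  qed
 qed
next
 fix a assume a: "th x < a"
 show "eventually (\<lambda>y. th y < a) (at x)"
 proof (cases "pi < a")
  case True
  then show ?thesis using Th_range(2) by (intro always_eventually allI) (rule le_less_trans)
 next
  case False
  define t where "t = (a + th x) / 2"
  have t: "th x < t" "t < a" using a by (auto simp: t_def)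
  have t0: "0 < t" "t < pi" using t False Th_range(1)[of x] by auto
  have "Im (hh (Complex x t)) < 0" by (rule Im_neg_above[OF t(1) t0(2)])
  then have "eventually (\<lambda>y. Im (hh (Complex y t)) < 0) (at x)"
   using isCont_Im_hF_fst[OF t0, of x] unfolding isCont_def by (rule order_tendstoD(2)[rotated])
  then show ?thesis
  proof eventually_elim
   case (elim y)
   have "th y \<le> t" using Im_pos_below[of t y] elim t0(1) by fastforce
   then show ?case using t(2) by simp
  qed
 qed
qed

text \<open>With \<open>th x = 0\<close> the function \<open>bb\<close> is negative at every height,
  so the term of \<open>f\<close> is bounded by that of \<open>g\<close>, which is bounded for
  nonnegative cosine. \<open>Af_bounded_imp_DK\<close> then excludes a pole: the curve is regular on
  the real line.\<close>

lemma Th_zero_Dm: assumes "th x = 0" shows "of_real x \<in> Dm" proof -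
 have e: "0 < exp x" "0 < exp (- x)" by simp_all
 have "of_real (exp x) \<in> DK K"
 proof (rule F.Af_bounded_imp_DK[OF e(1)])
  fix k :: real assume k: "0 < k" "k < 1"
  have t: "0 < arccos k" "arccos k < pi" "cos (arccos k) = k" using k arccos_lt_bounded[of k] by auto
  have "Im (hh (Complex x (arccos k))) < 0" using Im_neg_above[of x "arccos k"] assms t by simp
  then have "bb f g c x k < 0" unfolding polar(1)[OF t(1,2)] t(3) using sin_gt_zero[OF t(1,2)] by (simp add: mult_less_0_iff)
  then have "Af f (exp x) k \<le> c * Af g (exp (- x)) (- k)" by (simp add: bb_def)
  also have "\<dots> \<le> c * (N * exp (- x))" using G.Af_nonpos_arg_le(2)[OF e(2), of "- k"] k cpos by (intro mult_left_mono) auto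
  finally show "Af f (exp x) k \<le> c * (N * exp (- x))" .
 qed
 moreover have "- of_real (exp (- x)) \<in> DK L" by (rule G.small_neg_DK) simp
 ultimately show ?thesis by (simp add: Dm_def exp_of_real flip: of_real_minus)
qed

end

text \<open>The reflection of the picture: zeta -> i pi - zeta, that is z -> -1/z, with
  \<open>f\<close>, \<open>g\<close> and \<open>c\<close>, \<open>1 / c\<close> exchanged. It maps
  the curve to the curve, height 0 to height pi and the left end to the right end.\<close>

lemma fgpair_dual: "fgpair f P K M g Q L N c ==> fgpair g Q L N f P K M (1 / c)" unfolding fgpair_def fgpair_axioms_def by simp

lemma hF_dual: "c \<noteq> 0 ==> hF g f (1 / c) (\<i> * of_real pi - \<zeta>) = - hF f g c \<zeta> / of_real c"
 unfolding hF_def neg_exp_i_pi_minus unfolding exp_i_pi_minus by (simp add: field_simps)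

lemma hD_dual: "c \<noteq> 0 ==> hD g f (1 / c) (\<i> * of_real pi - \<zeta>) = hD f g c \<zeta> / of_real c" proof -
 assume "c \<noteq> 0"
 have e: "exp (- (\<i> * of_real pi - \<zeta>)) = - exp \<zeta>" using arg_cong[OF neg_exp_i_pi_minus[of \<zeta>], of uminus] unfolding minus_minus .
 show ?thesis unfolding hD_def neg_exp_i_pi_minus unfolding e exp_i_pi_minus using \<open>c \<noteq> 0\<close> by (simp add: diff_divide_distrib)
qed

lemma Complex_dual: "\<i> * of_real pi - Complex x t = Complex (- x) (pi - t)" by (simp add: complex_eq_iff)

context fgpair
begin

lemma Th_dual: "Th g f (1 / c) x = pi - th (- x)" proof -
 interpret D: fgpair g Q L N f P K M "1 / c" by (rule fgpair_dual) unfold_locales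
 have h: "hF g f (1 / c) (Complex x t) = - hh (Complex (- x) (pi - t)) / of_real c" for t
  using hF_dual[of c g f "Complex (- x) (pi - t)"] cpos by (simp add: Complex_dual)
 show ?thesis
 proof (rule D.Th_eqI)
  show "0 \<le> pi - th (- x)" "pi - th (- x) \<le> pi" using Th_range[of "- x"] by auto
 next
  fix t assume "0 < t" "t < pi - th (- x)"
  then show "0 \<le> Im (hF g f (1 / c) (Complex x t))" unfolding h using Im_neg_above[of "- x" "pi - t"] cpos by (simp add: divide_nonpos_pos)
 next
  fix t assume "pi - th (- x) < t" "t < pi"
  then show "Im (hF g f (1 / c) (Complex x t)) \<le> 0" unfolding h using Im_pos_below[of "pi - t" "- x"] cpos by simp
 qed
qed

lemma Dm_dual: "\<zeta> \<in> Dm \<longleftrightarrow> \<i> * of_real pi - \<zeta> \<in> fgpair.Dm L K" proof -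
 interpret D: fgpair g Q L N f P K M "1 / c" by (rule fgpair_dual) unfold_locales
 show ?thesis unfolding D.Dm_def Dm_def using exp_i_pi_minus[of \<zeta>] exp_i_pi_minus[of "\<i> * of_real pi - \<zeta>"] by auto
qed

lemma zeta_dual: "\<i> * of_real pi - ze x = zeta g f (1 / c) (- x)" unfolding zeta_def Th_dual Complex_dual by simp

lemma zeta_Dm: "ze x \<in> Dm" proof -
 interpret D: fgpair g Q L N f P K M "1 / c" by (rule fgpair_dual) unfold_locales
 consider "th x = 0" | "0 < th x" "th x < pi" | "th x = pi" using Th_range[of x] by linarith
 then show ?thesis
 proof cases
  case 1
  then show ?thesis using Th_zero_Dm[OF 1] by (simp add: zeta_def complex_of_real_def)
 next
  case 2
  then show ?thesis unfolding zeta_def by (rule strip_Dm)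
 next
  case 3
  then have "Th g f (1 / c) (- x) = 0" by (simp add: Th_dual)
  from D.Th_zero_Dm[OF this] this have "zeta g f (1 / c) (- x) \<in> D.Dm" by (simp add: zeta_def complex_of_real_def)
  then show ?thesis unfolding Dm_dual zeta_dual .
 qed
qed

lemma real_hF: "Im (hh (of_real x)) = 0" "Im (hd' (of_real x)) = 0" proof -
 have "cnj (hh (of_real x)) = hh (of_real x)" "cnj (hd' (of_real x)) = hd' (of_real x)" unfolding hF_def hD_def
  by (simp_all add: F.Uf_cnj[symmetric] G.Uf_cnj[symmetric] F.U1_cnj[symmetric] G.U1_cnj[symmetric] exp_cnj)
 then show "Im (hh (of_real x)) = 0" "Im (hd' (of_real x)) = 0" by (simp_all add: complex_eq_iff)
qed

lemma Im_hF_vertical_deriv: assumes "Complex x t \<in> Dm"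
 shows "((\<lambda>t. Im (hh (Complex x t))) has_real_derivative Re (hd' (Complex x t))) (at t)" proof -
 have "((\<lambda>t. Complex x t) has_vector_derivative \<i>) (at t)" unfolding Complex_eq by (auto intro!: derivative_eq_intros)
 from field_vector_diff_chain_at[OF this hF_deriv[OF assms]]
 have "((\<lambda>t. hh (Complex x t)) has_vector_derivative \<i> * hd' (Complex x t)) (at t)" by (simp add: comp_def)
 from bounded_linear.has_vector_derivative[OF bounded_linear_Im this]
 show ?thesis by (simp add: has_real_derivative_iff_has_vector_derivative)
qed

text \<open>The vertical derivative of the imaginary part is the real part of \<open>hD\<close>. The
  imaginary part vanishes at height 0 and is negative above, so this derivative cannot be
  positive.\<close>

lemma real_on_curve_0: assumes "th x = 0" shows "Im (hh (ze x)) = 0" "Im (hd' (ze x)) = 0" "Re (hd' (ze x)) \<le> 0" proof -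
 have z: "ze x = of_real x" using assms by (simp add: zeta_def complex_of_real_def)
 show i: "Im (hh (ze x)) = 0" "Im (hd' (ze x)) = 0" unfolding z by (rule real_hF)+
 show "Re (hd' (ze x)) \<le> 0"
 proof (rule ccontr)
  assume "\<not> Re (hd' (ze x)) \<le> 0"
  then have "0 < Re (hd' (Complex x 0))" unfolding z by (simp add: complex_of_real_def)
  moreover have "Complex x 0 \<in> Dm" using Th_zero_Dm[OF assms] by (simp add: complex_of_real_def)
  ultimately obtain d where d: "0 < d" "\<And>h. 0 < h ==> h < d ==> Im (hh (Complex x 0)) < Im (hh (Complex x (0 + h)))"
   using DERIV_pos_inc_right[OF Im_hF_vertical_deriv] by blast
  define h where "h = min (d / 2) (pi / 2)"
  have h: "0 < h" "h < d" "h < pi" using d(1) pi_gt_zero by (auto simp: h_def min_def)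
  have "Im (hh (Complex x h)) < 0" using Im_neg_above[of x h] assms h by simp
  then show False using d(2)[OF h(1,2)] i(1) unfolding z by (simp add: complex_of_real_def)
 qed
qed

text \<open>At interior heights the sign change and continuity give the zero, and
  \<open>polar\<close> the strict inequality. At height 0 the derivative is real, so nonpositive and
  nonzero means negative; height pi is the dual case.\<close>

lemma real_on_curve:
 "Im (hh (ze x)) = 0"
 "hd' (ze x) \<noteq> 0 ==> Re (hd' (ze x)) < 0" proof -
 interpret D: fgpair g Q L N f P K M "1 / c" by (rule fgpair_dual) unfold_locales
 have "Im (hh (ze x)) = 0 \<and> (hd' (ze x) \<noteq> 0 \<longrightarrow> Re (hd' (ze x)) < 0)" proof -
  consider "th x = 0" | "0 < th x" "th x < pi" | "th x = pi" using Th_range[of x] by linarith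
  then show ?thesis
  proof cases
   case 1
   then show ?thesis using real_on_curve_0[OF 1] by (auto simp: complex_eq_iff)
  next
   case 2
   let ?T = "th x"
   have cont: "isCont (\<lambda>t. Im (hh (Complex x t))) ?T" using Im_hF_vertical_deriv[OF strip_Dm[OF 2]] by (rule DERIV_isCont)
   have "\<not> 0 < Im (hh (Complex x ?T))"
   proof
    assume "0 < Im (hh (Complex x ?T))"
    then have "eventually (\<lambda>t. 0 < Im (hh (Complex x t))) (at ?T)" using cont unfolding isCont_def by (rule order_tendstoD(1)[rotated])
    then have "eventually (\<lambda>t. 0 < Im (hh (Complex x t))) (at_right ?T)" by (rule filter_leD[OF at_le, rotated]) simp
    moreover have "eventually (\<lambda>t. t \<in> {?T<..<pi}) (at_right ?T)" by (rule eventually_at_right_real[OF 2(2)])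
    ultimately have "eventually (\<lambda>t. False) (at_right ?T)" by eventually_elim (use Im_neg_above in fastforce)
    then show False by simp
   qed
   moreover have "\<not> Im (hh (Complex x ?T)) < 0"
   proof
    assume "Im (hh (Complex x ?T)) < 0"
    then have "eventually (\<lambda>t. Im (hh (Complex x t)) < 0) (at ?T)" using cont unfolding isCont_def by (rule order_tendstoD(2)[rotated])
    then have "eventually (\<lambda>t. Im (hh (Complex x t)) < 0) (at_left ?T)" by (rule filter_leD[OF at_le, rotated]) simp
    moreover have "eventually (\<lambda>t. t \<in> {0<..<?T}) (at_left ?T)" by (rule eventually_at_left_real[OF 2(1)])
    ultimately have "eventually (\<lambda>t. False) (at_left ?T)" by eventually_elim (use Im_pos_below in fastforce)
    then show False by simp
   qed
   ultimately have i: "Im (hh (Complex x ?T)) = 0" by linarith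
   then have "bb f g c x (cos ?T) = 0" using polar(1)[OF 2] sin_gt_zero[OF 2] by simp
   then have "Re (hd' (Complex x ?T)) < 0" using polar(2)[OF 2, of x] by auto
   with i show ?thesis by (simp add: zeta_def)
  next
   case 3
   then have T: "Th g f (1 / c) (- x) = 0" by (simp add: Th_dual)
   have c0: "c \<noteq> 0" using cpos by simp
   have 1: "hF g f (1 / c) (zeta g f (1 / c) (- x)) = - hh (ze x) / of_real c" using hF_dual[OF c0, of g f "ze x"] unfolding zeta_dual .
   have 2: "hD g f (1 / c) (zeta g f (1 / c) (- x)) = hd' (ze x) / of_real c" using hD_dual[OF c0, of g f "ze x"] unfolding zeta_dual .
   show ?thesis using D.real_on_curve_0[OF T] cpos unfolding 1 2 by (auto simp: complex_eq_iff divide_le_0_iff less_le)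
  qed
 qed
 then show "Im (hh (ze x)) = 0"
  "hd' (ze x) \<noteq> 0 ==> Re (hd' (ze x)) < 0" by auto
qed

end

section \<open>The curve parametrized by the real values of G\<close>

lemma decreasing_finite_exceptions: fixes F :: "real => real" assumes "finite S" "a < b" "continuous_on {a..b} F"
  "\<And>x. a < x ==> x < b ==> x \<notin> S ==> \<exists>y. DERIV F x :> y \<and> y < 0" shows "F b < F a" using assms
proof (induction S arbitrary: a b rule: finite_induct)
 case empty
 show ?case by (rule DERIV_neg_imp_decreasing_open[OF empty.prems(1) _ empty.prems(2)], rule empty.prems(3)) simp_all
next
 case (insert s S)
 show ?case
 proof (cases "a < s \<and> s < b")
  case True
  have "F s < F a"
  proof (rule insert.IH)
   show "continuous_on {a..s} F" by (rule continuous_on_subset[OF insert.prems(2)]) (use True in auto)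
   show "\<exists>y. DERIV F x :> y \<and> y < 0" if "a < x" "x < s" "x \<notin> S" for x by (rule insert.prems(3)) (use that True in simp_all)
  qed (use True in simp)
  moreover have "F b < F s"
  proof (rule insert.IH)
   show "continuous_on {s..b} F" by (rule continuous_on_subset[OF insert.prems(2)]) (use True in auto)
   show "\<exists>y. DERIV F x :> y \<and> y < 0" if "s < x" "x < b" "x \<notin> S" for x by (rule insert.prems(3)) (use that True in simp_all)
  qed (use True in simp)
  ultimately show ?thesis by simp
 next
  case False
  show ?thesis
  proof (rule insert.IH[OF insert.prems(1,2)])
   fix x assume x: "a < x" "x < b" "x \<notin> S"
   then have "x \<noteq> s" using False by blast
   with x show "\<exists>y. DERIV F x :> y \<and> y < 0" by (intro insert.prems(3)) simp_all
  qed
 qed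
qed

context fgpair
begin

lemma zeta_isCont: "isCont (ze) x" unfolding zeta_def[abs_def] Complex_eq by (intro continuous_intros Th_isCont)

lemma hF_zeta_isCont: "isCont (\<lambda>x. hh (ze x)) x" using isCont_o2[OF zeta_isCont DERIV_isCont[OF hF_deriv[OF zeta_Dm]]] .

lemma tt_isCont: "isCont (tc) x" unfolding tt_def[abs_def] isCont_def by (rule tendsto_Re) (use hF_zeta_isCont in \<open>simp add: isCont_def\<close>)

lemma hF_zeta: "hh (ze x) = of_real (tc x)" using real_on_curve(1)[of x] by (simp add: tt_def complex_eq_iff)

lemma hD_eq_deriv: "\<zeta> \<in> Dm ==> deriv (hh) \<zeta> = hd' \<zeta>" using hF_deriv by (rule DERIV_imp_deriv)

lemma hD_holomorphic: "hd' holomorphic_on Dm" using holomorphic_deriv[OF hF_holomorphic open_Dm] hD_eq_deriv by (rule holomorphic_transform)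

definition crit :: "real set" where
 "crit = {x. hd' (ze x) = 0}"

text \<open>Zeros of the holomorphic \<open>hD\<close> are isolated unless it vanishes near the
  point. In that case \<open>hF\<close> would be locally constant with imaginary part 0, against the
  strict sign directly above or below the curve.\<close>

lemma eventually_not_crit: "eventually (\<lambda>y. y \<notin> crit) (at x)"
proof (cases "x \<in> crit")
 case False
 have "isCont (hd') (ze x)" using hD_holomorphic open_Dm zeta_Dm holomorphic_on_imp_continuous_on by (metis continuous_on_eq_continuous_at)
 from isCont_o2[OF zeta_isCont this] have "((\<lambda>y. hd' (ze y)) \<longlongrightarrow> hd' (ze x)) (at x)" by (simp add: isCont_def)
 then have "eventually (\<lambda>y. hd' (ze y) \<noteq> 0) (at x)" using False by (intro tendsto_imp_eventually_ne) (auto simp: crit_def)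
 then show ?thesis by (simp add: crit_def)
next
 case True
 let ?z = "ze x"
 obtain e where e: "0 < e" "ball ?z e \<subseteq> Dm" using open_Dm zeta_Dm open_contains_ball by blast
 have "\<exists>b\<in>ball ?z e. hd' b \<noteq> 0"
 proof (rule ccontr)
  assume "\<not> (\<exists>b\<in>ball ?z e. hd' b \<noteq> 0)"
  then have "(hh has_field_derivative 0) (at w within ball ?z e)" if "w \<in> ball ?z e" for w
   using hF_deriv[of w] that e(2) by (metis has_field_derivative_at_within subsetD)
  then obtain k where k: "\<And>w. w \<in> ball ?z e ==> hh w = k" using has_field_derivative_zero_constant[OF convex_ball] by metis
  have Imk: "Im k = 0" using k[of ?z] e(1) real_on_curve(1)[of x] by simp
  \<comment> \<open>Small enough for a vertical step to stay in the ball and, on at least one side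
    of the curve, in the strip.\<close>
  define d where "d = min (e / 2) (pi / 4)"
  have d: "0 < d" "d < e" "d < pi / 2" using e(1) pi_gt_zero by (auto simp: d_def min_def)
  show False
  proof (cases "th x \<le> pi / 2")
   case True
   have "dist ?z (Complex x (th x + d)) = d" using d(1) by (simp add: zeta_def dist_norm cmod_def)
   then have "Im (hh (Complex x (th x + d))) = 0" using k Imk d(2) by simp
   moreover have "Im (hh (Complex x (th x + d))) < 0" by (rule Im_neg_above) (use d True in auto)
   ultimately show False by simp
  next
   case False
   have "dist ?z (Complex x (th x - d)) = d" using d(1) by (simp add: zeta_def dist_norm cmod_def)
   then have "Im (hh (Complex x (th x - d))) = 0" using k Imk d(2) by simp
   moreover have "0 < Im (hh (Complex x (th x - d)))" by (rule Im_pos_below) (use d False in auto)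
   ultimately show False by simp
  qed
 qed
 then obtain b where b: "b \<in> ball ?z e" "hd' b \<noteq> 0" by blast
 have zb: "?z \<in> ball ?z e" "hd' ?z = 0" using e(1) True by (auto simp: crit_def)
 obtain r where r: "0 < r" "\<And>w. w \<in> ball ?z r - {?z} ==> hd' w \<noteq> 0"
  using isolated_zeros[OF holomorphic_on_subset[OF hD_holomorphic e(2)] open_ball connected_ball zb b] by metis
 have "eventually (\<lambda>y. ze y \<in> ball ?z r) (at x)" using zeta_isCont[of x] r(1) unfolding isCont_def by (intro topological_tendstoD) auto
 moreover have "eventually (\<lambda>y. y \<noteq> x) (at x)" by (rule eventually_neq_at_within)
 ultimately show ?thesis
 proof eventually_elim
  case (elim y)
  then have "ze y \<in> ball ?z r - {?z}" by (simp add: zeta_def)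
  then show ?case using r(2) by (simp add: crit_def)
 qed
qed

lemma finite_crit: "finite (crit \<inter> {a..b})"
proof (rule ccontr)
 assume "infinite (crit \<inter> {a..b})"
 then obtain x where "x islimpt (crit \<inter> {a..b})" using Heine_Borel_imp_Bolzano_Weierstrass[OF compact_Icc, of "crit \<inter> {a..b}" a b] by auto
 then have "x islimpt crit" by (rule islimpt_subset) auto
 then have "frequently (\<lambda>y. y \<in> crit) (at x)" by (simp add: islimpt_conv_frequently_at)
 then show False using eventually_not_crit[of x] by (simp add: frequently_def)
qed

lemma local_inverse: assumes "x \<notin> crit"
 obtains gi r where "0 < r" "ball (ze x) r \<subseteq> Dm"
  "\<And>w. w \<in> ball (ze x) r ==> gi (hh w) = w"
  "(gi has_field_derivative 1 / hd' (ze x)) (at (of_real (tc x)))" proof -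
 let ?z = "ze x"
 have d: "deriv (hh) ?z \<noteq> 0" using assms hD_eq_deriv[OF zeta_Dm] by (simp add: crit_def)
 obtain r where r: "0 < r" "ball ?z r \<subseteq> Dm" "open (hh ` ball ?z r)" "inj_on (hh) (ball ?z r)"
  using has_complex_derivative_locally_invertible[OF hF_holomorphic zeta_Dm open_Dm d] by metis
 obtain gi where gi: "gi holomorphic_on (hh ` ball ?z r)"
  "\<And>w. w \<in> ball ?z r ==> deriv (hh) w * deriv gi (hh w) = 1"
  "\<And>w. w \<in> ball ?z r ==> gi (hh w) = w"
  using holomorphic_has_inverse[OF holomorphic_on_subset[OF hF_holomorphic r(2)] open_ball r(4)] by metis
 have zb: "?z \<in> ball ?z r" using r(1) by simp
 have "(gi has_field_derivative deriv gi (hh ?z)) (at (hh ?z))" by (rule holomorphic_derivI[OF gi(1) r(3)]) (use zb in blast)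
 moreover have "deriv gi (hh ?z) = 1 / hd' ?z" using gi(2)[OF zb] d unfolding hD_eq_deriv[OF zeta_Dm] by (simp add: field_simps)
 ultimately show ?thesis using that[OF r(1,2) gi(3)] by (simp add: hF_zeta)
qed

text \<open>The real part of the local inverse of \<open>hF\<close>, restricted to real values,
  inverts \<open>tc\<close> and has derivative Re (1 / hD) < 0. So \<open>tc\<close> is
  differentiable although \<open>th\<close> is only known to be continuous.\<close>

lemma tt_deriv_neg: assumes "x \<notin> crit" shows "\<exists>y. DERIV (tc) x :> y \<and> y < 0" proof -
 let ?h = "hd' (ze x)"
 have h0: "?h \<noteq> 0" using assms by (simp add: crit_def)
 then have hneg: "Re ?h < 0" by (rule real_on_curve(2))
 obtain gi r where gi: "0 < r" "ball (ze x) r \<subseteq> Dm"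
  "\<And>w. w \<in> ball (ze x) r ==> gi (hh w) = w"
  "(gi has_field_derivative 1 / ?h) (at (of_real (tc x)))" using local_inverse[OF assms] by metis
 define R where "R = (\<lambda>t. Re (gi (of_real t)))"
 have "((\<lambda>t. gi (of_real t)) has_vector_derivative 1 / ?h) (at (tc x))" using has_vector_derivative_real_field[OF gi(4)] .
 from bounded_linear.has_vector_derivative[OF bounded_linear_Re this]
 have dR: "DERIV R (tc x) :> Re (1 / ?h)" unfolding R_def by (simp add: has_real_derivative_iff_has_vector_derivative)
 have neg: "Re (1 / ?h) < 0" using hneg h0 by (simp add: Re_divide divide_less_0_iff complex_neq_0 add_pos_nonneg)
 have "eventually (\<lambda>y. ze y \<in> ball (ze x) r) (nhds x)" proof -
  have "(ze \<longlongrightarrow> ze x) (nhds x)" using zeta_isCont[of x] by (simp add: isCont_def tendsto_at_iff_tendsto_nhds)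
  then show ?thesis using gi(1) by (intro topological_tendstoD) auto
 qed
 then obtain d where d: "0 < d" "\<And>y. dist y x < d ==> ze y \<in> ball (ze x) r" unfolding eventually_nhds_metric by blast
 have RR: "R (tc y) = y" if "dist y x < d" for y unfolding R_def hF_zeta[symmetric] gi(3)[OF d(2)[OF that]] by (simp add: zeta_def)
 have "DERIV (tc) x :> inverse (Re (1 / ?h))"
 proof (rule DERIV_inverse_function[where f = R and g = "tc" and x = x and a = "x - d" and b = "x + d", OF dR])
  show "Re (1 / ?h) \<noteq> 0" "x - d < x" "x < x + d" using neg d(1) by auto
  show "R (tc y) = y" if "x - d < y" "y < x + d" for y by (rule RR) (use that in \<open>simp add: dist_real_def abs_less_iff\<close>)
 qed (rule tt_isCont)
 then show ?thesis using neg by (intro exI[of _ "inverse (Re (1 / ?h))"]) simp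
qed

lemma tt_strict_decreasing: "a < b ==> tc b < tc a" by (rule decreasing_finite_exceptions[OF finite_crit[of a b]])
   (use tt_deriv_neg tt_isCont in \<open>auto intro: continuous_at_imp_continuous_on\<close>)

lemma tt_less_iff: "tc a < tc b \<longleftrightarrow> b < a" using tt_strict_decreasing by (metis less_asym linorder_less_linear)

lemma inj_tt: "inj (tc)" by (rule injI) (metis tt_less_iff linorder_less_linear less_irrefl)

text \<open>The abscissa of the curve point with a given value of G; it is meaningful only on the
  range of \<open>tc\<close> (\<open>tt_surj\<close>).\<close>

definition XX :: "real => real" where "XX = the_inv_into UNIV (tc)"

lemma XX_tt [simp]: "XX (tc x) = x" unfolding XX_def by (rule the_inv_into_f_f[OF inj_tt]) simp

lemma XX_isCont: "isCont XX (tc x)" by (rule isCont_inverse_function[of 1]) (auto simp: tt_isCont)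

end

section \<open>The two ends of the curve\<close>

lemma (in pfun) V_eps: assumes "0 < e" shows "\<exists>d>0. \<forall>w. w \<noteq> 0 \<and> norm w < d \<and> 0 \<le> Re w \<longrightarrow> norm (Uf f (-1 / w) + of_real (pos_mass f)) < e"
proof -
 have "((\<lambda>w. Uf f (-1 / w)) \<longlongrightarrow> - of_real (pos_mass f)) (at 0 within {w. 0 \<le> Re w})" unfolding tendsto_at_iff_sequentially comp_def
 proof (intro allI impI)
  fix X assume X: "\<forall>i. X i \<in> {w. 0 \<le> Re w} - {0}" "X \<longlonglongrightarrow> 0"
  show "(\<lambda>i. Uf f (-1 / X i)) \<longlonglongrightarrow> - of_real (pos_mass f)" by (rule V_tendsto[OF X(2)]) (use X(1) in auto)
 qed
 then have "eventually (\<lambda>w. dist (Uf f (-1 / w)) (- of_real (pos_mass f)) < e) (at 0 within {w. 0 \<le> Re w})" using assms by (rule tendstoD)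
 then show ?thesis by (auto simp: eventually_at dist_norm)
qed

context fgpair
begin

lemma neg_exp_eq: "- exp (- \<zeta>) = -1 / exp \<zeta>" for \<zeta> :: complex by (simp add: exp_minus inverse_eq_divide)

lemma near_left_Dm: assumes "M * exp x < 1" "0 \<le> a" "a \<le> th x" shows "Complex x a \<in> Dm" proof -
 consider "a = th x" | "0 < a" "a < pi" | "a = 0" using assms Th_range[of x] by linarith
 then show ?thesis
 proof cases
  case 1
  then show ?thesis using zeta_Dm[of x] by (simp add: zeta_def)
 next
  case 3
  have "of_real (exp x) \<in> DK K" proof -
   have "1 - complex_of_real y * of_real (exp x) \<noteq> 0" if "y \<in> K" for y proof -
    have "y * exp x \<le> M * exp x" using that F.K_sub by auto
    then have "y * exp x < 1" using assms(1) by linarith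
    then have "1 - y * exp x \<noteq> 0" by linarith
    then have "complex_of_real (1 - y * exp x) \<noteq> 0" using of_real_eq_0_iff by blast
    then show ?thesis by simp
   qed
   then show ?thesis unfolding DK_def by blast
  qed
  moreover have "- of_real (exp (- x)) \<in> DK L" by (rule G.small_neg_DK) simp
  moreover have "Complex x a = of_real x" using 3 by (simp add: complex_of_real_def)
  ultimately show ?thesis by (simp add: Dm_def exp_of_real flip: of_real_minus)
 qed (rule strip_Dm)
qed

text \<open>As exp x tends to 0, \<open>Af f\<close> is of order exp x. If \<open>g\<close> has no
  gap above 0, \<open>sing0\<close> and \<open>Af_large\<close> make \<open>Af g\<close> exceed
  every multiple of exp x, so \<open>bb\<close> is eventually negative at each fixed height. With a
  gap, \<open>V_gap\<close> controls all heights instead.\<close>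

lemma left_end_dichotomy:
 "(th \<longlongrightarrow> 0) at_bot \<or> (\<exists>d>0. \<forall>s\<in>{0..1} - Q. g s = 0 \<or> d \<le> g s)"
proof (rule disjCI)
 assume "\<not> (\<exists>d>0. \<forall>s\<in>{0..1} - Q. g s = 0 \<or> d \<le> g s)"
 then have unb: "\<exists>e>0. B < integral {0..1} (\<lambda>s. g s / ((g s)\<^sup>2 + e\<^sup>2))" for B using G.sing0 by blast
 show "(th \<longlongrightarrow> 0) at_bot"
 proof (rule order_tendstoI)
  fix a :: real assume "a < 0"
  then show "eventually (\<lambda>x. a < th x) at_bot" using Th_range(1) by (intro always_eventually allI) (rule less_le_trans)
 next
  fix a :: real assume a: "0 < a"
  define t where "t = min (a / 2) (pi / 4)"
  have t: "0 < t" "t < pi / 2" "t < a" using a pi_gt_zero by (auto simp: t_def min_def)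
  have t': "0 < t" "t < pi" using t by auto
  have ct: "0 < cos t" "cos t < 1" using t cos_gt_zero[of t] cos_range[OF t'] by auto
  \<comment> \<open>The constant makes c (exp x / 2) (4 M / c) equal to 2 M exp x, the bound of
    \<open>Af_small\<close>.\<close>
  obtain e where e: "0 < e" "4 * M / c < integral {0..1} (\<lambda>s. g s / ((g s)\<^sup>2 + e\<^sup>2))" using unb by blast
  define x0 where "x0 = min (ln e) (ln (1 / (4 * M)))"
  show "eventually (\<lambda>x. th x < a) at_bot" unfolding eventually_at_bot_linorder
  proof (intro exI[of _ x0] allI impI)
   fix x assume "x \<le> x0"
   then have "exp x \<le> exp (ln e)" "exp x \<le> exp (ln (1 / (4 * M)))" by (auto simp: x0_def)
   then have x: "exp x \<le> e" "exp x \<le> 1 / (4 * M)" using e(1) F.Mpos by simp_all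
   have "4 * M * exp x \<le> 1" using x(2) F.Mpos by (simp add: pos_le_divide_eq mult.commute)
   from F.Af_small[OF exp_gt_zero this ct] have 1: "Af f (exp x) (cos t) \<le> 2 * M * exp x" .
   have "4 * M / c < integral {0..1} (\<lambda>s. g s / ((g s)\<^sup>2 + (exp x)\<^sup>2))" using e(2) G.reg_mono[OF exp_gt_zero x(1)] by simp
   then have "exp x / 2 * (4 * M / c) < exp x / 2 * integral {0..1} (\<lambda>s. g s / ((g s)\<^sup>2 + (exp x)\<^sup>2))" by (intro mult_strict_left_mono) auto
   also have "\<dots> \<le> Af g (1 / exp x) (- cos t)" by (rule G.Af_large) (use ct in auto)
   finally have lt: "exp x / 2 * (4 * M / c) < Af g (1 / exp x) (- cos t)" .
   have ee: "1 / exp x = exp (- x)" by (simp add: exp_minus inverse_eq_divide)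
   from mult_strict_left_mono[OF lt cpos]
   have "c * (exp x / 2 * (4 * M / c)) < c * Af g (exp (- x)) (- cos t)" unfolding ee .
   moreover have "c * (exp x / 2 * (4 * M / c)) = 2 * M * exp x" using cpos by simp
   ultimately have "bb f g c x (cos t) < 0" using 1 by (simp add: bb_def)
   then have "Im (hh (Complex x t)) < 0" unfolding polar(1)[OF t'] using sin_gt_zero[OF t'] by (simp add: mult_less_0_iff)
   then have "\<not> t < th x" using Im_pos_below[OF t(1)] by fastforce
   then show "th x < a" using t(3) by simp
  qed
 qed
qed

lemma exp_at_bot: "0 < e ==> eventually (\<lambda>x. exp x < (e::real)) at_bot" using exp_at_bot by (rule order_tendstoD(2))

lemma Uf_small: "0 < e ==> eventually (\<lambda>x. \<forall>a. norm (Uf f (exp (Complex x a))) < e) at_bot" proof -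
 assume e: "0 < e"
 have "isCont (Uf f) 0" using F.Uf_has_field_derivative[OF F.zero_DK] by (rule DERIV_isCont)
 then have "eventually (\<lambda>z. dist (Uf f z) (Uf f 0) < e) (at 0)" unfolding isCont_def using e by (rule tendstoD)
 then obtain d where d: "0 < d" "\<And>z. z \<noteq> 0 ==> dist z 0 < d ==> norm (Uf f z) < e" unfolding eventually_at by (auto simp: F.Uf_zero)
 show ?thesis using exp_at_bot[OF d(1)] by eventually_elim (auto intro!: d(2))
qed

lemma left_end_value: assumes e: "0 < e" shows "eventually (\<lambda>x. \<bar>tc x - c * pos_mass g\<bar> < e) at_bot" proof -
 have "eventually (\<lambda>x. norm (Uf g (- exp (- ze x)) + of_real (pos_mass g)) < e / (2 * c)) at_bot" using left_end_dichotomy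
 proof
  assume T: "(th \<longlongrightarrow> 0) at_bot"
  obtain d where d: "0 < d" "\<And>w. w \<noteq> 0 ==> norm w < d ==> 0 \<le> Re w ==> norm (Uf g (-1 / w) + of_real (pos_mass g)) < e / (2 * c)"
   using G.V_eps[of "e / (2 * c)"] e cpos by auto
  have "eventually (\<lambda>x. th x < pi / 2) at_bot" using T by (rule order_tendstoD(2)) simp
  with exp_at_bot[OF d(1)] show ?thesis
  proof eventually_elim
   case (elim x)
   show ?case unfolding neg_exp_eq
   proof (rule d(2))
    have "0 \<le> cos (th x)" using elim Th_range(1)[of x] by (intro cos_ge_zero) auto
    then show "0 \<le> Re (exp (ze x))" by (simp add: zeta_def Re_exp)
   qed (use elim in \<open>auto simp: zeta_def\<close>)
  qed
 next
  assume "\<exists>d>0. \<forall>s\<in>{0..1} - Q. g s = 0 \<or> d \<le> g s"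
  then obtain d where d: "0 < d" "\<And>s. s \<in> {0..1} - Q ==> g s = 0 \<or> d \<le> g s" by blast
  have "eventually (\<lambda>x. exp x < min (d / 2) (e * d / (4 * c))) at_bot" using d(1) e cpos by (intro exp_at_bot) simp
  then show ?thesis
  proof eventually_elim
   case (elim x)
   have zL: "-1 / exp (ze x) \<in> DK L" using zeta_Dm[of x] by (simp add: Dm_def neg_exp_eq)
   have "norm (Uf g (-1 / exp (ze x)) + of_real (pos_mass g)) \<le> 2 * norm (exp (ze x)) / d"
   proof (rule G.V_gap[OF d(1) _ zL])
    show "g s = 0 \<or> d \<le> g s" if "s \<in> {0..1} - Q" for s using d(2)[OF that] .
   qed (use elim in \<open>auto simp: zeta_def\<close>)
   also have "\<dots> = 2 * exp x / d" by (simp add: zeta_def)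
   also have "\<dots> < e / (2 * c)" proof -
    have "exp x < e * d / (4 * c)" using elim by simp
    then show ?thesis using d(1) cpos by (simp add: field_simps)
   qed
   finally show ?case by (simp add: neg_exp_eq)
  qed
 qed
 moreover have "eventually (\<lambda>x. \<forall>a. norm (Uf f (exp (Complex x a))) < e / 2) at_bot" using e by (intro Uf_small) simp
 ultimately show ?thesis
 proof eventually_elim
  case (elim x)
  have "complex_of_real (tc x - c * pos_mass g) =
    Uf f (exp (ze x)) - of_real c * (Uf g (- exp (- ze x)) + of_real (pos_mass g))"
   unfolding of_real_diff hF_zeta[symmetric] hF_def by (simp add: algebra_simps)
  then have "norm (complex_of_real (tc x - c * pos_mass g)) \<le>
    norm (Uf f (exp (ze x))) + norm (of_real c * (Uf g (- exp (- ze x)) + of_real (pos_mass g)))" by (metis norm_triangle_ineq4)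
  also have "norm (of_real c * (Uf g (- exp (- ze x)) + of_real (pos_mass g))) =
    c * norm (Uf g (- exp (- ze x)) + of_real (pos_mass g))" using cpos by (simp add: norm_mult)
  also have "norm (Uf f (exp (ze x))) + c * norm (Uf g (- exp (- ze x)) + of_real (pos_mass g)) < e / 2 + c * (e / (2 * c))"
   using elim cpos by (intro add_strict_mono mult_strict_left_mono) (auto simp: zeta_def)
  also have "\<dots> = e" using cpos by simp
  finally show ?case unfolding norm_of_real .
 qed
qed

text \<open>Either the height tends to 0 and \<open>phi\<close> is bounded on the segment, or G has
  the same limit on the whole vertical segment below the curve. In both cases the segment
  contributes asymptotically height times \<open>phi\<close> at the curve point.\<close>

lemma left_end_potential: fixes phi :: "complex => complex" assumes e: "0 < e" and phi: "continuous_on UNIV phi"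
 shows "eventually (\<lambda>x. \<forall>a. 0 \<le> a \<and> a \<le> th x \<longrightarrow>
  th x * norm (phi (hh (Complex x a)) - phi (of_real (tc x))) \<le> e) at_bot" using left_end_dichotomy
proof
 assume T: "(th \<longlongrightarrow> 0) at_bot"
 \<comment> \<open>For height below pi/2 the point exp zeta is in the right half-plane, where
   \<open>norm_V_le\<close> bounds the part of \<open>g\<close> by c; the part of \<open>f\<close>
   is eventually below 1.\<close>
 have "compact (phi ` cball 0 (1 + c))" by (intro compact_continuous_image continuous_on_subset[OF phi]) auto
 then obtain B where B: "\<And>y. y \<in> phi ` cball 0 (1 + c) ==> norm y \<le> B" using compact_imp_bounded bounded_iff by metis
 have "phi 0 \<in> phi ` cball 0 (1 + c)" using cpos by (intro imageI) simp
 from order_trans[OF norm_ge_zero B[OF this]] have B0: "0 \<le> B" .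
 have "eventually (\<lambda>x. th x < min (pi / 2) (e / (2 * B + 1))) at_bot" using T e B0 by (intro order_tendstoD(2)[OF T]) simp
 moreover have "eventually (\<lambda>x. \<forall>a. norm (Uf f (exp (Complex x a))) < 1) at_bot" by (rule Uf_small) simp
 ultimately show ?thesis
 proof eventually_elim
  case (elim x)
  have bound: "norm (phi (hh (Complex x a))) \<le> B" if a: "0 \<le> a" "a \<le> th x" for a proof -
   have "0 \<le> cos a" using elim a by (intro cos_ge_zero) auto
   then have "norm (Uf g (-1 / exp (Complex x a))) \<le> 1" by (intro G.norm_V_le) (auto simp: Re_exp)
   then have "norm (of_real c * Uf g (- exp (- Complex x a))) \<le> c" using cpos unfolding neg_exp_eq by (simp add: norm_mult)
   moreover have "norm (Uf f (exp (Complex x a))) < 1" using elim by blast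
   ultimately have "norm (hh (Complex x a)) \<le> 1 + c"
    unfolding hF_def using norm_triangle_ineq4[of "Uf f (exp (Complex x a))" "of_real c * Uf g (- exp (- Complex x a))"] by linarith
   then show ?thesis by (intro B imageI) simp
  qed
  show ?case
  proof (intro allI impI)
   fix a assume a: "0 \<le> a \<and> a \<le> th x"
   have "norm (phi (of_real (tc x))) \<le> B" using bound[of "th x"] Th_range(1)[of x] by (simp add: hF_zeta zeta_def[symmetric])
   then have "norm (phi (hh (Complex x a)) - phi (of_real (tc x))) \<le> 2 * B"
    using bound[of a] a norm_triangle_ineq4[of "phi (hh (Complex x a))" "phi (of_real (tc x))"] by linarith
   then have "th x * norm (phi (hh (Complex x a)) - phi (of_real (tc x))) \<le> e / (2 * B + 1) * (2 * B + 1)"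
    using elim B0 e Th_range(1)[of x] by (intro mult_mono) auto
   also have "\<dots> = e" using B0 by simp
   finally show "th x * norm (phi (hh (Complex x a)) - phi (of_real (tc x))) \<le> e" .
  qed
 qed
next
 assume "\<exists>d>0. \<forall>s\<in>{0..1} - Q. g s = 0 \<or> d \<le> g s"
 then obtain d where d: "0 < d" "\<And>s. s \<in> {0..1} - Q ==> g s = 0 \<or> d \<le> g s" by blast
 let ?l = "complex_of_real (c * pos_mass g)"
 have "isCont phi ?l" using phi by (simp add: continuous_on_eq_continuous_at)
 then obtain r where r: "0 < r" "\<And>w. dist w ?l < r ==> dist (phi w) (phi ?l) < e / (2 * pi)"
  using e unfolding continuous_at_eps_delta by (metis divide_pos_pos mult_pos_pos pi_gt_zero zero_less_numeral)
 have "eventually (\<lambda>x. exp x < min (d / 2) (r * d / (4 * c))) at_bot" using d(1) r(1) cpos by (intro exp_at_bot) simp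
 moreover have "eventually (\<lambda>x. \<forall>a. norm (Uf f (exp (Complex x a))) < r / 2) at_bot" using r(1) by (intro Uf_small) simp
 moreover have "eventually (\<lambda>x. exp x < 1 / M) at_bot" using F.Mpos by (intro exp_at_bot) simp
 ultimately show ?thesis
 proof eventually_elim
  case (elim x)
  have near: "dist (phi (hh (Complex x a))) (phi ?l) < e / (2 * pi)" if a: "0 \<le> a" "a \<le> th x" for a
  proof (rule r(2))
   have "M * exp x < 1" using elim F.Mpos by (simp add: pos_less_divide_eq mult.commute)
   then have "Complex x a \<in> Dm" using a by (rule near_left_Dm)
   then have zL: "-1 / exp (Complex x a) \<in> DK L" by (simp add: Dm_def neg_exp_eq)
   have "norm (Uf g (-1 / exp (Complex x a)) + of_real (pos_mass g)) \<le> 2 * norm (exp (Complex x a)) / d"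
   proof (rule G.V_gap[OF d(1) _ zL])
    show "g s = 0 \<or> d \<le> g s" if "s \<in> {0..1} - Q" for s using d(2)[OF that] .
   qed (use elim in auto)
   also have "\<dots> = 2 * exp x / d" by simp
   also have "\<dots> < r / (2 * c)" proof -
    have "exp x < r * d / (4 * c)" using elim by simp
    then show ?thesis using d(1) cpos by (simp add: field_simps)
   qed
   finally have "c * norm (Uf g (- exp (- Complex x a)) + of_real (pos_mass g)) < r / 2" using cpos by (simp add: neg_exp_eq field_simps)
   moreover have "norm (Uf f (exp (Complex x a))) < r / 2" using elim by blast
   moreover have "dist (hh (Complex x a)) ?l = norm (Uf f (exp (Complex x a)) -
     of_real c * (Uf g (- exp (- Complex x a)) + of_real (pos_mass g)))" unfolding dist_norm hF_def by (simp add: algebra_simps)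
   moreover have "\<dots> \<le> norm (Uf f (exp (Complex x a))) + c * norm (Uf g (- exp (- Complex x a)) + of_real (pos_mass g))"
    using norm_triangle_ineq4[of "Uf f (exp (Complex x a))" "of_real c * (Uf g (- exp (- Complex x a)) + of_real (pos_mass g))"] cpos
    by (simp add: norm_mult)
   ultimately show "dist (hh (Complex x a)) ?l < r" by linarith
  qed
  show ?case
  proof (intro allI impI)
   fix a assume a: "0 \<le> a \<and> a \<le> th x"
   have "dist (phi (of_real (tc x))) (phi ?l) < e / (2 * pi)"
    using near[of "th x"] Th_range(1)[of x] by (simp add: hF_zeta zeta_def[symmetric])
   then have "norm (phi (hh (Complex x a)) - phi (of_real (tc x))) \<le> e / (2 * pi) + e / (2 * pi)"
    using near[of a] a dist_triangle2[of "phi (hh (Complex x a))" "phi (of_real (tc x))" "phi ?l"]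
    unfolding dist_norm[of "phi (hh (Complex x a))" "phi (of_real (tc x))", symmetric] by linarith
   then have "th x * norm (phi (hh (Complex x a)) - phi (of_real (tc x))) \<le> pi * (e / (2 * pi) + e / (2 * pi))"
    using Th_range[of x] by (intro mult_mono) auto
   also have "\<dots> = e" by (simp add: field_simps)
   finally show "th x * norm (phi (hh (Complex x a)) - phi (of_real (tc x))) \<le> e" .
  qed
 qed
qed

end

section \<open>Primitives on a star-shaped domain and integration along the curve\<close>

lemma open_star_hull: fixes a :: "'a::real_normed_vector" assumes "open S" shows "open {x. closed_segment a x \<subseteq> S}"
 unfolding open_contains_ball
proof
 fix x assume "x \<in> {x. closed_segment a x \<subseteq> S}"
 then have sub: "closed_segment a x \<subseteq> S" by simp
 obtain e where e: "0 < e" "(\<Union>z\<in>closed_segment a x. ball z e) \<subseteq> S"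
  using compact_subset_open_imp_ball_epsilon_subset[OF compact_segment assms sub] by metis
 have "ball x e \<subseteq> {x. closed_segment a x \<subseteq> S}"
 proof (intro subsetI CollectI)
  fix y w assume y: "y \<in> ball x e" and w: "w \<in> closed_segment a y"
  obtain u where u: "w = (1 - u) *\<^sub>R a + u *\<^sub>R y" "0 \<le> u" "u \<le> 1" using w by (auto simp: in_segment)
  define z where "z = (1 - u) *\<^sub>R a + u *\<^sub>R x"
  have "dist z w = norm (u *\<^sub>R (x - y))" by (simp add: z_def u(1) dist_norm scaleR_right_diff_distrib)
  also have "\<dots> = u * norm (x - y)" using u(2) by simp
  also have "\<dots> \<le> 1 * norm (x - y)" using u by (intro mult_right_mono) auto
  also have "\<dots> < e" using y by (simp add: dist_norm)
  finally have "w \<in> ball z e" by simp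
  moreover have "z \<in> closed_segment a x" using u by (auto simp: z_def in_segment)
  ultimately show "w \<in> S" using e(2) by blast
 qed
 then show "\<exists>e>0. ball x e \<subseteq> {x. closed_segment a x \<subseteq> S}" using e(1) by blast
qed

context fgpair
begin

text \<open>\<open>Dm\<close> can surround poles on the real line, so primitives are taken on its
  part visible from the centre of the strip. This part still contains every point of
  \<open>Dm\<close> with imaginary part in [0, pi] (\<open>SH_I\<close>), in particular the
  curve.\<close>

definition SH :: "complex set" where
 "SH = {\<zeta>. closed_segment (Complex 0 (pi / 2)) \<zeta> \<subseteq> Dm}"

lemma open_SH: "open SH" unfolding SH_def by (rule open_star_hull[OF open_Dm])

lemma center_Dm: "Complex 0 (pi / 2) \<in> Dm" by (rule strip_Dm) auto

lemma SH_sub_Dm: "SH \<subseteq> Dm" unfolding SH_def by auto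

lemma starlike_SH: "starlike SH" unfolding starlike_def
proof (intro bexI ballI subsetI)
 show "Complex 0 (pi / 2) \<in> SH" using center_Dm by (simp add: SH_def)
 fix x y assume x: "x \<in> SH" and y: "y \<in> closed_segment (Complex 0 (pi / 2)) x"
 then have "closed_segment (Complex 0 (pi / 2)) y \<subseteq> closed_segment (Complex 0 (pi / 2)) x"
  by (intro closed_segment_subset convex_closed_segment) auto
 then show "y \<in> SH" using x by (auto simp: SH_def)
qed

text \<open>All points of the segment except possibly its end have imaginary part strictly between 0
  and pi, where there are no poles.\<close>

lemma SH_I: assumes "Complex x t \<in> Dm" "0 \<le> t" "t \<le> pi" shows "Complex x t \<in> SH" unfolding SH_def
proof (intro CollectI subsetI)
 fix w assume "w \<in> closed_segment (Complex 0 (pi / 2)) (Complex x t)"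
 then obtain u where u: "w = (1 - u) *\<^sub>R Complex 0 (pi / 2) + u *\<^sub>R Complex x t" "0 \<le> u" "u \<le> 1" by (auto simp: in_segment)
 show "w \<in> Dm"
 proof (cases "u = 1")
  case True
  then show ?thesis using u(1) assms(1) by simp
 next
  case False
  then have u1: "u < 1" using u(3) by simp
  have w: "w = Complex (u * x) ((1 - u) * (pi / 2) + u * t)" unfolding u(1) by (simp add: complex_eq_iff)
  have "0 < (1 - u) * (pi / 2)" using u1 by simp
  moreover have "0 \<le> u * t" using u(2) assms(2) by simp
  moreover have "u * t \<le> u * pi" using u(2) assms(3) by (intro mult_left_mono)
  moreover have "(1 - u) * (pi / 2) + u * pi < pi" proof -
   have "(1 - u) * (pi / 2) < (1 - u) * pi" using u1 by simp
   then show ?thesis by (simp add: algebra_simps)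
  qed
  ultimately show ?thesis unfolding w by (intro strip_Dm) linarith+
 qed
qed

lemma zeta_SH: "ze x \<in> SH" unfolding zeta_def by (rule SH_I) (use zeta_Dm[of x] Th_range[of x] in \<open>auto simp: zeta_def\<close>)

lemma primitive_exists: assumes "\<And>z. (phi has_field_derivative phi' z) (at z)"
 shows "\<exists>Psi. \<forall>z\<in>SH. (Psi has_field_derivative phi (hh z)) (at z)"
proof (rule holomorphic_starlike_primitive[where k = "{}"])
 have d: "((\<lambda>z. phi (hh z)) has_field_derivative phi' (hh z) * hd' z) (at z)" if "z \<in> SH" for z
  using DERIV_chain2[OF assms hF_deriv] that SH_sub_Dm by blast
 show "continuous_on SH (\<lambda>z. phi (hh z))" by (rule continuous_at_imp_continuous_on) (use d DERIV_isCont in blast)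
 show "(\<lambda>z. phi (hh z)) field_differentiable at z" if "z \<in> SH - {}" for z using d[of z] that unfolding field_differentiable_def by blast
qed (simp_all add: starlike_SH open_SH)

text \<open>The condition on p makes the real line up to p free of poles; there
  \<open>phi (hF ...)\<close> is real, so \<open>Im Psi\<close> is constant. A mean value estimate
  on the vertical segment up to the curve, with \<open>left_end_potential\<close>, compares
  \<open>Im Psi\<close> at its two ends.\<close>

lemma left_end_limit: assumes Psi: "\<And>z. z \<in> SH ==> (Psi has_field_derivative phi (hh z)) (at z)"
  and cont: "continuous_on UNIV phi" and real: "\<And>t. Im (phi (of_real t)) = 0" and p: "M * exp p < 1"
 shows "((\<lambda>x. Im (Psi (ze x)) - th x * Re (phi (of_real (tc x)))) \<longlongrightarrow> Im (Psi (of_real p))) at_bot"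
proof (rule tendstoI)
 fix e :: real assume e: "0 < e"
 have rSH: "of_real y \<in> SH" if "y \<le> p" for y proof -
  have "M * exp y \<le> M * exp p" using that F.Mpos by simp
  then have "M * exp y < 1" using p by linarith
  then have "Complex y 0 \<in> Dm" by (rule near_left_Dm) (use Th_range in auto)
  then show ?thesis using SH_I[of y 0] by (simp add: complex_of_real_def)
 qed
 have const: "Im (Psi (of_real x)) = Im (Psi (of_real p))" if "x \<le> p" for x proof -
  have "\<exists>k. \<forall>y\<in>{x..p}. Im (Psi (of_real y)) = k"
  proof (rule has_field_derivative_zero_constant)
   fix y assume y: "y \<in> {x..p}"
   have "((\<lambda>y. Psi (of_real y)) has_vector_derivative phi (hh (of_real y))) (at y)"
    by (rule has_vector_derivative_real_field[OF Psi[OF rSH]]) (use y in simp)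
   from bounded_linear.has_vector_derivative[OF bounded_linear_Im this]
   have "((\<lambda>y. Im (Psi (of_real y))) has_real_derivative Im (phi (hh (of_real y)))) (at y)"
    by (simp add: has_real_derivative_iff_has_vector_derivative)
   moreover have "hh (of_real y) = of_real (Re (hh (of_real y)))" using real_hF(1)[of y] by (simp add: complex_eq_iff)
   then have "Im (phi (hh (of_real y))) = 0" by (metis real)
   ultimately show "((\<lambda>y. Im (Psi (of_real y))) has_real_derivative 0) (at y within {x..p})" by (simp add: has_field_derivative_at_within)
  qed simp
  then show ?thesis using that by force
 qed
 have "eventually (\<lambda>x. x \<le> p) at_bot" by (rule eventually_le_at_bot)
 with left_end_potential[OF half_gt_zero[OF e] cont]
 show "eventually (\<lambda>x. dist (Im (Psi (ze x)) - th x * Re (phi (of_real (tc x)))) (Im (Psi (of_real p))) < e) at_bot"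
 proof eventually_elim
  case (elim x)
  let ?T = "th x" and ?v = "phi (of_real (tc x))"
  show ?case
  proof (cases "?T = 0")
   case True
   then have "ze x = of_real x" by (simp add: zeta_def complex_of_real_def)
   then show ?thesis using const[OF elim(2)] True e by simp
  next
   case False
   then have T: "0 < ?T" using Th_range(1)[of x] by simp
   let ?seg = "closed_segment (of_real x) (ze x)"
   have Mx: "M * exp x < 1" proof -
    have "M * exp x \<le> M * exp p" using elim(2) F.Mpos by simp
    then show ?thesis using p by linarith
   qed
   have pts: "\<exists>a. w = Complex x a \<and> 0 \<le> a \<and> a \<le> ?T" if wseg: "w \<in> ?seg" for w proof -
    obtain u where u: "w = (1 - u) *\<^sub>R of_real x + u *\<^sub>R ze x" "0 \<le> u" "u \<le> 1" using wseg unfolding in_segment by blast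
    have "w = Complex x (u * ?T)" unfolding u(1) zeta_def by (simp add: complex_eq_iff algebra_simps)
    moreover have "u * ?T \<le> 1 * ?T" using u T by (intro mult_right_mono) auto
    ultimately show ?thesis using u T by (intro exI[of _ "u * ?T"]) simp
   qed
   have bound: "norm ((Psi (ze x) - ?v * ze x) - (Psi (of_real x) - ?v * of_real x))
     \<le> (e / 2 / ?T) * norm (ze x - of_real x)"
   proof (rule field_differentiable_bound[where S = ?seg and f' = "\<lambda>w. phi (hh w) - ?v"])
    fix w assume "w \<in> ?seg"
    then obtain a where a: "w = Complex x a" "0 \<le> a" "a \<le> ?T" using pts by blast
    have "w \<in> SH" unfolding a(1) using Th_range(2)[of x] a by (intro SH_I near_left_Dm[OF Mx]) auto
    then have "((\<lambda>w. Psi w - ?v * w) has_field_derivative phi (hh w) - ?v) (at w)" by (auto intro!: derivative_eq_intros Psi)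
    then show "((\<lambda>w. Psi w - ?v * w) has_field_derivative phi (hh w) - ?v) (at w within ?seg)" by (rule has_field_derivative_at_within)
    have "?T * norm (phi (hh w) - ?v) \<le> e / 2" using elim(1) a by simp
    then show "norm (phi (hh w) - ?v) \<le> e / 2 / ?T" using T by (simp add: pos_le_divide_eq mult.commute)
   qed auto
   have zx: "ze x - of_real x = \<i> * of_real ?T" by (simp add: zeta_def complex_eq_iff)
   have "norm (ze x - of_real x) = ?T" unfolding zx using T by (simp add: norm_mult)
   then have bound2: "norm ((Psi (ze x) - ?v * ze x) - (Psi (of_real x) - ?v * of_real x)) \<le> e / 2" using bound T by simp
   have "Im ((Psi (ze x) - ?v * ze x) - (Psi (of_real x) - ?v * of_real x)) =
     Im (Psi (ze x)) - ?T * Re ?v - Im (Psi (of_real p))" using const[OF elim(2)] by (simp add: real zeta_def)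
   then have "\<bar>Im (Psi (ze x)) - ?T * Re ?v - Im (Psi (of_real p))\<bar> \<le> e / 2" using bound2 abs_Im_le_cmod order_trans by metis
   then show ?thesis using e by (simp add: dist_real_def)
  qed
 qed
qed

lemma tt_dual: "tt g f (1 / c) x = - tc (- x) / c" proof -
 have "hF g f (1 / c) (zeta g f (1 / c) x) = - hh (ze (- x)) / of_real c"
  using hF_dual[of c g f "ze (- x)"] cpos unfolding zeta_dual by simp
 then show ?thesis using cpos by (simp add: tt_def)
qed

lemma tt_at_bot: "(tc \<longlongrightarrow> c * pos_mass g) at_bot" by (rule tendstoI) (use left_end_value in \<open>simp add: dist_real_def\<close>)

lemma tt_at_top: "(tc \<longlongrightarrow> - pos_mass f) at_top" proof -
 interpret D: fgpair g Q L N f P K M "1 / c" by (rule fgpair_dual) unfold_locales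
 have "((\<lambda>x. tt g f (1 / c) (- x)) \<longlongrightarrow> 1 / c * pos_mass f) at_top" by (rule filterlim_compose[OF D.tt_at_bot filterlim_uminus_at_bot_at_top])
 then have "((\<lambda>x. - c * tt g f (1 / c) (- x)) \<longlongrightarrow> - c * (1 / c * pos_mass f)) at_top" by (intro tendsto_intros)
 then show ?thesis using cpos by (simp add: tt_dual)
qed

lemma right_end_limit: assumes Psi: "\<And>z. z \<in> SH ==> (Psi has_field_derivative phi (hh z)) (at z)"
  and cont: "continuous_on UNIV phi" and real: "\<And>t. Im (phi (of_real t)) = 0" and p: "N * exp (- q) < 1"
 shows "((\<lambda>x. Im (Psi (ze x)) - th x * Re (phi (of_real (tc x)))) \<longlongrightarrow>
  Im (Psi (of_real q + \<i> * of_real pi)) - pi * Re (phi (of_real (- pos_mass f)))) at_top" proof -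
 interpret D: fgpair g Q L N f P K M "1 / c" by (rule fgpair_dual) unfold_locales
 have c0: "c \<noteq> 0" using cpos by simp
 \<comment> \<open>The signs and the factor in \<open>phi'\<close> undo those of
   \<open>hF_dual\<close>, so \<open>Psi'\<close> is a primitive of the dual integrand and the left
   end of the dual pair applies.\<close>
 define Psi' where "Psi' = (\<lambda>w. - Psi (\<i> * of_real pi - w))"
 define phi' where "phi' = (\<lambda>w. phi (- of_real c * w))"
 have SHd: "\<i> * of_real pi - w \<in> SH" if "w \<in> D.SH" for w unfolding SH_def
 proof (intro CollectI subsetI)
  fix z assume "z \<in> closed_segment (Complex 0 (pi / 2)) (\<i> * of_real pi - w)"
  then obtain u where u: "z = (1 - u) *\<^sub>R Complex 0 (pi / 2) + u *\<^sub>R (\<i> * of_real pi - w)" "0 \<le> u" "u \<le> 1" by (auto simp: in_segment)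
  have "\<i> * of_real pi - z = (1 - u) *\<^sub>R Complex 0 (pi / 2) + u *\<^sub>R w" unfolding u(1) by (simp add: complex_eq_iff algebra_simps)
  then have "\<i> * of_real pi - z \<in> closed_segment (Complex 0 (pi / 2)) w" using u(2,3) by (auto simp: in_segment)
  then have "\<i> * of_real pi - z \<in> D.Dm" using that by (auto simp: D.SH_def)
  then show "z \<in> Dm" unfolding Dm_dual .
 qed
 have dPsi: "(Psi' has_field_derivative phi' (hF g f (1 / c) w)) (at w)" if "w \<in> D.SH" for w proof -
  have "(Psi' has_field_derivative phi (hh (\<i> * of_real pi - w))) (at w)" proof -
   have "((\<lambda>w. \<i> * of_real pi - w) has_field_derivative -1) (at w)" by (auto intro!: derivative_eq_intros)
   from DERIV_minus[OF DERIV_chain2[where f = Psi and g = "\<lambda>w. \<i> * of_real pi - w", OF Psi[OF SHd[OF that]] this]]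
   show ?thesis by (simp add: Psi'_def)
  qed
  moreover have "- of_real c * hF g f (1 / c) w = hh (\<i> * of_real pi - w)" using hF_dual[OF c0, of g f "\<i> * of_real pi - w"] c0 by simp
  ultimately show ?thesis unfolding phi'_def by simp
 qed
 have 1: "((\<lambda>x. Im (Psi' (zeta g f (1 / c) x)) - Th g f (1 / c) x * Re (phi' (of_real (tt g f (1 / c) x)))) \<longlongrightarrow> Im (Psi' (of_real (- q)))) at_bot"
 proof (rule D.left_end_limit[OF dPsi])
  show "continuous_on UNIV phi'" unfolding phi'_def by (intro continuous_on_compose2[OF cont] continuous_intros) auto
  show "Im (phi' (of_real t)) = 0" for t using real[of "- c * t"] by (simp add: phi'_def)
 qed (use p in auto)
 have z': "\<i> * of_real pi - zeta g f (1 / c) (- x) = ze x" for x unfolding zeta_dual[symmetric] by simp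
 have "((\<lambda>x. - Im (Psi (ze x)) - (pi - th x) * Re (phi (of_real (tc x)))) \<longlongrightarrow> - Im (Psi (\<i> * of_real pi - of_real (- q)))) at_top"
  using filterlim_compose[OF 1 filterlim_uminus_at_bot_at_top] c0 by (simp add: Psi'_def z' Th_dual tt_dual phi'_def)
 moreover have "((\<lambda>x. pi * Re (phi (of_real (tc x)))) \<longlongrightarrow> pi * Re (phi (of_real (- pos_mass f)))) at_top"
 proof (intro tendsto_intros tendsto_Re)
  have "isCont phi (of_real (- pos_mass f))" using cont by (simp add: continuous_on_eq_continuous_at)
  then show "((\<lambda>x. phi (of_real (tc x))) \<longlongrightarrow> phi (of_real (- pos_mass f))) at_top"
   by (rule isCont_tendsto_compose) (intro tendsto_of_real tt_at_top)
 qed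
 ultimately have "((\<lambda>x. - (- Im (Psi (ze x)) - (pi - th x) * Re (phi (of_real (tc x)))) - pi * Re (phi (of_real (tc x))))
   \<longlongrightarrow> - (- Im (Psi (\<i> * of_real pi - of_real (- q)))) - pi * Re (phi (of_real (- pos_mass f)))) at_top" by (intro tendsto_diff tendsto_minus)
 then show ?thesis by (simp add: algebra_simps)
qed

lemma tt_bounds: "- pos_mass f < tc x" "tc x < c * pos_mass g" proof -
 have "- pos_mass f \<le> tc (x + 1)" by (rule tendsto_upperbound[OF tt_at_top])
    (auto intro!: eventually_mono[OF eventually_gt_at_top[of "x + 1"]] less_imp_le tt_strict_decreasing)
 then show "- pos_mass f < tc x" using tt_strict_decreasing[of x "x + 1"] by simp
 have "tc (x - 1) \<le> c * pos_mass g" by (rule tendsto_lowerbound[OF tt_at_bot])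
    (auto intro!: eventually_mono[OF eventually_at_bot_dense[THEN iffD2, of "\<lambda>y. y < x - 1"]] less_imp_le tt_strict_decreasing)
 then show "tc x < c * pos_mass g" using tt_strict_decreasing[of "x - 1" x] by simp
qed

lemma tt_surj: assumes "- pos_mass f < t" "t < c * pos_mass g" shows "tc (XX t) = t" proof -
 have "eventually (\<lambda>x. tc x < t) at_top" using tt_at_top assms(1) by (rule order_tendstoD(2))
 then obtain b where b: "\<And>x. b \<le> x ==> tc x < t" unfolding eventually_at_top_linorder by blast
 have "eventually (\<lambda>x. t < tc x) at_bot" using tt_at_bot assms(2) by (rule order_tendstoD(1))
 then obtain a where a: "\<And>x. x \<le> a ==> t < tc x" unfolding eventually_at_bot_linorder by blast
 have "\<exists>x. min a b \<le> x \<and> x \<le> b \<and> tc x = t"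
  by (rule IVT2') (use a[of "min a b"] b[of b] tt_isCont in \<open>auto intro!: continuous_at_imp_continuous_on less_imp_le\<close>)
 then show ?thesis by auto
qed

text \<open>\<open>J\<close> results from integration by parts. Differentiated in t = G, the terms
  with 1 / hD cancel because \<open>phi\<close> is real on real arguments, and only the height times
  the derivative of \<open>phi\<close> is left. The minus sign in \<open>E\<close> reflects that
  \<open>tc\<close> decreases.\<close>

lemma curve_integral: assumes Psi: "\<And>z. z \<in> SH ==> (Psi has_field_derivative phi (hh z)) (at z)"
  and dphi: "\<And>z. (phi has_field_derivative phi' z) (at z)" and real: "\<And>t. Im (phi (of_real t)) = 0" and x: "x1 < x2"
 defines "J \<equiv> \<lambda>x. Im (Psi (ze x)) - th x * Re (phi (of_real (tc x)))"
 shows "((\<lambda>t. th (XX t) * Re (phi' (of_real t))) has_integral (J x2 - J x1)) {tc x2..tc x1}" proof -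
 define E where "E = (\<lambda>t. - J (XX t))"
 have onto: "\<exists>x. x1 \<le> x \<and> x \<le> x2 \<and> tc x = t" if "t \<in> {tc x2..tc x1}" for t
  by (rule IVT2') (use that x tt_isCont in \<open>auto intro!: continuous_at_imp_continuous_on\<close>)
 have "((\<lambda>t. th (XX t) * Re (phi' (of_real t))) has_integral (E (tc x1) - E (tc x2))) {tc x2..tc x1}"
 proof (rule fundamental_theorem_of_calculus_strong[where S = "tc ` (crit \<inter> {x1..x2})"])
  show "finite (tc ` (crit \<inter> {x1..x2}))" using finite_crit by simp
  show "tc x2 \<le> tc x1" using tt_strict_decreasing[OF x] by simp
  show "continuous_on {tc x2..tc x1} E"
  proof (rule continuous_at_imp_continuous_on, rule ballI)
   fix t assume "t \<in> {tc x2..tc x1}"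
   then obtain x where x: "tc x = t" using onto by blast
   have JC: "isCont J x" for x proof -
    have "isCont (\<lambda>x. Psi (ze x)) x" using isCont_o2[OF zeta_isCont DERIV_isCont[OF Psi[OF zeta_SH]]] .
    moreover have "isCont (\<lambda>x. phi (of_real (tc x))) x" by (rule isCont_o2[OF _ DERIV_isCont[OF dphi]]) (intro continuous_intros tt_isCont)
    ultimately show ?thesis unfolding J_def isCont_def by (intro tendsto_intros tendsto_Im tendsto_Re Th_isCont[unfolded isCont_def])
   qed
   have "isCont (\<lambda>t. - J (XX t)) (tc x)" by (intro continuous_minus isCont_o2[OF XX_isCont]) (rule JC)
   then show "isCont E t" unfolding E_def x .
  qed
  fix t assume t: "t \<in> {tc x2..tc x1} - tc ` (crit \<inter> {x1..x2})"
  then obtain x where x: "x1 \<le> x" "x \<le> x2" "tc x = t" using onto by blast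
  then have nc: "x \<notin> crit" using t by auto
  let ?h = "hd' (ze x)"
  obtain gi r where gi: "0 < r" "ball (ze x) r \<subseteq> Dm"
   "\<And>w. w \<in> ball (ze x) r ==> gi (hh w) = w"
   "(gi has_field_derivative 1 / ?h) (at (of_real (tc x)))" using local_inverse[OF nc] by metis
  note gi4 = gi(4)[unfolded x(3)]
  have gt: "gi (of_real t) = ze x" using gi(3)[of "ze x"] gi(1) hF_zeta[of x] x(3) by simp
  \<comment> \<open>A local copy of \<open>E\<close> through the holomorphic inverse
    \<open>gi\<close>; \<open>E\<close> itself is written with \<open>th\<close> and offers no
    derivative directly.\<close>
  define E' where "E' = (\<lambda>t. Im (gi (of_real t)) * Re (phi (of_real t)) - Im (Psi (gi (of_real t))))"
  have v1: "((\<lambda>t. gi (of_real t)) has_vector_derivative 1 / ?h) (at t)" by (rule has_vector_derivative_real_field[OF gi4])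
  have v2: "((\<lambda>t. Psi (gi (of_real t))) has_vector_derivative phi (of_real t) * (1 / ?h)) (at t)" proof -
   have "(Psi has_field_derivative phi (hh (gi (of_real t)))) (at (gi (of_real t)))" unfolding gt by (rule Psi[OF zeta_SH])
   from DERIV_chain2[OF this gi4]
   have "((\<lambda>w. Psi (gi w)) has_field_derivative phi (of_real t) * (1 / ?h)) (at (of_real t))" unfolding gt hF_zeta x(3) .
   then show ?thesis by (rule has_vector_derivative_real_field)
  qed
  have v3: "((\<lambda>t. phi (of_real t)) has_vector_derivative phi' (of_real t)) (at t)" by (rule has_vector_derivative_real_field[OF dphi])
  note d1 = bounded_linear.has_vector_derivative[OF bounded_linear_Im v1, folded has_real_derivative_iff_has_vector_derivative]
   and d2 = bounded_linear.has_vector_derivative[OF bounded_linear_Im v2, folded has_real_derivative_iff_has_vector_derivative]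
   and d3 = bounded_linear.has_vector_derivative[OF bounded_linear_Re v3, folded has_real_derivative_iff_has_vector_derivative]
  have "(E' has_real_derivative (Im (1 / ?h) * Re (phi (of_real t)) + Re (phi' (of_real t)) * Im (gi (of_real t)) - Im (phi (of_real t) * (1 / ?h)))) (at t)"
   unfolding E'_def by (intro DERIV_diff DERIV_mult d1 d2 d3)
  moreover have "Im (phi (of_real t) * (1 / ?h)) = Im (1 / ?h) * Re (phi (of_real t))"
   using real[of t] by (simp only: times_complex.sel mult_zero_left add_0_right mult.commute)
  moreover have "Im (gi (of_real t)) = th (XX t)" using gt XX_tt[of x] x(3) by (simp add: zeta_def)
  ultimately have dE': "(E' has_vector_derivative th (XX t) * Re (phi' (of_real t))) (at t)"
   by (simp add: has_real_derivative_iff_has_vector_derivative mult.commute)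
  have "eventually (\<lambda>s. E' s = E s) (nhds t)" proof -
   have "isCont (\<lambda>s. ze (XX s)) t" unfolding x(3)[symmetric] by (rule isCont_o2[OF XX_isCont]) (rule zeta_isCont)
   then have "((\<lambda>s. ze (XX s)) \<longlongrightarrow> ze (XX t)) (nhds t)" by (simp add: isCont_def tendsto_at_iff_tendsto_nhds[of "\<lambda>s. ze (XX s)" t])
   then have "eventually (\<lambda>s. ze (XX s) \<in> ball (ze x) r) (nhds t)" using gi(1) x(3) by (intro topological_tendstoD) auto
   moreover have "eventually (\<lambda>s. s \<in> {- pos_mass f<..<c * pos_mass g}) (nhds t)"
    by (rule eventually_nhds_in_open) (use tt_bounds[of x] x(3) in auto)
   ultimately show ?thesis
   proof eventually_elim
    case (elim s)
    have s: "tc (XX s) = s" using elim by (intro tt_surj) auto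
    have "gi (of_real s) = ze (XX s)" using gi(3)[OF elim(1)] unfolding hF_zeta s .
    then show ?case unfolding E'_def E_def J_def s by (simp add: zeta_def)
   qed
  qed
  then obtain T where T: "open T" "t \<in> T" "\<And>s. s \<in> T ==> E' s = E s" unfolding eventually_nhds by blast
  show "(E has_vector_derivative th (XX t) * Re (phi' (of_real t))) (at t)" by (rule has_vector_derivative_transform_within_open[OF dE' T])
 qed
 then show ?thesis by (simp add: E_def)
qed

end

context fgpair
begin

lemma Th_XX_bounded: "\<bar>th (XX t)\<bar> \<le> pi" using Th_range[of "XX t"] by simp

text \<open>Exhausts the range of \<open>tc\<close> by the images of [-n, n]; the boundary terms
  converge by the two end limits, and the integrals by dominated convergence, as the heights are at
  most pi.\<close>

lemma total_integral: assumes Psi: "\<And>z. z \<in> SH ==> (Psi has_field_derivative phi (hh z)) (at z)"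
  and dphi: "\<And>z. (phi has_field_derivative phi' z) (at z)" and real: "\<And>t. Im (phi (of_real t)) = 0"
  and cont: "continuous_on UNIV phi'" and pq: "M * exp p < 1" "N * exp (- q) < 1"
 shows "((\<lambda>t. th (XX t) * Re (phi' (of_real t))) has_integral
  (Im (Psi (of_real q + \<i> * of_real pi)) - pi * Re (phi (of_real (- pos_mass f))) - Im (Psi (of_real p))))
  {- pos_mass f..c * pos_mass g}" proof -
 let ?a = "- pos_mass f" and ?b = "c * pos_mass g"
 let ?G = "\<lambda>t. th (XX t) * Re (phi' (of_real t))"
 define J where "J = (\<lambda>x. Im (Psi (ze x)) - th x * Re (phi (of_real (tc x))))"
 define I where "I n = {tc (real n)..tc (- real n)}" for n :: nat
 define G' where "G' t = (if t \<in> {?a<..<?b} then ?G t else 0)" for t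
 define F where "F n t = (if t \<in> I n then ?G t else 0)" for n :: nat and t
 have cphi: "continuous_on UNIV phi" using dphi by (intro continuous_at_imp_continuous_on ballI DERIV_isCont)
 have I_sub: "I n \<subseteq> {?a<..<?b}" for n using tt_bounds(1)[of "real n"] tt_bounds(2)[of "- real n"] by (auto simp: I_def)
 have int: "(?G has_integral (J (real n) - J (- real n))) (I n)" if "0 < n" for n
  unfolding I_def J_def by (rule curve_integral[OF Psi dphi real]) (use that in auto)
 have Fint: "(F n has_integral (J (real n) - J (- real n))) {?a..?b}" if "0 < n" for n proof -
  have "I n \<subseteq> {?a..?b}" using I_sub[of n] by auto
  then show ?thesis unfolding F_def using has_integral_restrict[of "I n" "{?a..?b}" ?G] int[OF that] by blast
 qed
 have "compact ((\<lambda>t. Re (phi' (of_real t))) ` {?a..?b})"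
  by (intro compact_continuous_image continuous_intros continuous_on_compose2[OF cont]) auto
 then obtain B where B: "\<And>y. y \<in> (\<lambda>t. Re (phi' (of_real t))) ` {?a..?b} ==> norm y \<le> B" using compact_imp_bounded bounded_iff by metis
 have bd: "norm (?G t) \<le> pi * \<bar>B\<bar>" if "t \<in> {?a..?b}" for t proof -
  have "norm (Re (phi' (of_real t))) \<le> B" using B that by blast
  then have "norm (Re (phi' (of_real t))) \<le> \<bar>B\<bar>" by linarith
  then show ?thesis unfolding norm_mult using Th_XX_bounded[of t] by (intro mult_mono) auto
 qed
 \<comment> \<open>Indices start at \<open>Suc n\<close> because \<open>curve_integral\<close>
   requires a nondegenerate interval.\<close>
 have A: "F (Suc n) integrable_on {?a..?b}" for n using Fint[of "Suc n"] by blast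
 have H: "(\<lambda>_. pi * \<bar>B\<bar>) integrable_on {?a..?b}" by (rule integrable_const_ivl)
 have D: "norm (F (Suc n) t) \<le> pi * \<bar>B\<bar>" if "t \<in> {?a..?b}" for n t
 proof (cases "t \<in> I (Suc n)")
  case True
  then show ?thesis using bd[OF that] unfolding F_def by (simp only: if_True)
 next
  case False
  then show ?thesis unfolding F_def by simp
 qed
 have C: "(\<lambda>n. F (Suc n) t) \<longlonglongrightarrow> G' t" if "t \<in> {?a..?b}" for t
  proof (cases "t \<in> {?a<..<?b}")
   case True
   have "(\<lambda>n. tc (real (Suc n))) \<longlonglongrightarrow> ?a"
    by (rule filterlim_compose[OF tt_at_top]) (rule filterlim_compose[OF filterlim_real_sequentially filterlim_Suc])
   then have e1: "eventually (\<lambda>n. tc (real (Suc n)) < t) sequentially" by (rule order_tendstoD(2)) (use True in simp)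
   have "(\<lambda>n. tc (- real (Suc n))) \<longlonglongrightarrow> ?b" by (intro filterlim_compose[OF tt_at_bot] filterlim_compose[OF filterlim_uminus_at_bot_at_top]
     filterlim_compose[OF filterlim_real_sequentially filterlim_Suc])
   then have e2: "eventually (\<lambda>n. t < tc (- real (Suc n))) sequentially" by (rule order_tendstoD(1)) (use True in simp)
   have "eventually (\<lambda>n. F (Suc n) t = G' t) sequentially" using e1 e2 by eventually_elim (use True in \<open>auto simp: F_def I_def G'_def\<close>)
   then show ?thesis by (rule tendsto_eventually)
  next
   case False
   then have "F (Suc n) t = G' t" for n using I_sub[of "Suc n"] by (auto simp: F_def G'_def)
   then show ?thesis by simp
  qed
 note dc = dominated_convergence[OF A H D C]
 have "(\<lambda>n. J (real (Suc n)) - J (- real (Suc n))) \<longlonglongrightarrow>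
  (Im (Psi (of_real q + \<i> * of_real pi)) - pi * Re (phi (of_real (- pos_mass f)))) - Im (Psi (of_real p))"
 proof (rule tendsto_diff)
  show "(\<lambda>n. J (real (Suc n))) \<longlonglongrightarrow> Im (Psi (of_real q + \<i> * of_real pi)) - pi * Re (phi (of_real ?a))" unfolding J_def
   by (rule filterlim_compose[OF right_end_limit[OF Psi cphi real pq(2)]])
     (assumption | rule filterlim_compose[OF filterlim_real_sequentially filterlim_Suc])+
  show "(\<lambda>n. J (- real (Suc n))) \<longlonglongrightarrow> Im (Psi (of_real p))" unfolding J_def
   by (rule filterlim_compose[OF left_end_limit[OF Psi cphi real pq(1)]])
     (assumption | rule filterlim_compose[OF filterlim_uminus_at_bot_at_top]
     filterlim_compose[OF filterlim_real_sequentially filterlim_Suc])+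
 qed
 moreover have "integral {?a..?b} (F (Suc n)) = J (real (Suc n)) - J (- real (Suc n))" for n
  using Fint[of "Suc n"] by (intro integral_unique) simp
 ultimately have "integral {?a..?b} G' = Im (Psi (of_real q + \<i> * of_real pi)) - pi * Re (phi (of_real ?a)) - Im (Psi (of_real p))"
  using LIMSEQ_unique[OF dc(2)] by simp
 then have "(G' has_integral (Im (Psi (of_real q + \<i> * of_real pi)) - pi * Re (phi (of_real ?a)) - Im (Psi (of_real p)))) {?a..?b}"
  using integrable_integral[OF dc(1)] by simp
 then show ?thesis by (rule has_integral_spike_finite[where S = "{?a, ?b}", rotated 2]) (auto simp: G'_def)
qed

end

section \<open>The circle as a path in the closed strip\<close>

context fgpair
begin

text \<open>On the lower half circle 1/v lies in the closed upper half-plane, so its logarithm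
  \<open>Z\<close> runs in the strip 0 \<le> Im \<le> pi. Thus only values of \<open>Psi\<close> at
  the end points -ln (2 a + e) and -ln e + i pi remain.\<close>

lemma CI_lower_half: assumes Psi: "\<And>z. z \<in> SH ==> (Psi has_field_derivative phi (hh z)) (at z)"
  and a: "0 < a" "M \<le> 2 * a" and e: "0 < e" "e * N \<le> 1 / 2"
 defines "r \<equiv> a + e" shows "((\<lambda>t. phi (Uf f (1 / circlepath (of_real a) r t) - of_real c * Uf g (- circlepath (of_real a) r t)) /
    circlepath (of_real a) r t * (of_real r * exp (2 * of_real pi * \<i> * of_real t))) has_integral
   ((Psi (of_real (- ln e) + \<i> * of_real pi) - Psi (of_real (- ln (2 * a + e)))) / (2 * of_real pi * \<i>))) {1/2..1}" proof -
 let ?v = "circlepath (complex_of_real a) r"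
 \<comment> \<open>A logarithm of 1/v. The factor i turns the lower half circle into the right
   half-plane, away from the cut of \<open>Ln\<close>; i pi / 2 compensates.\<close>
 define Z where "Z t = \<i> * of_real (pi / 2) - Ln (\<i> * ?v t)" for t
 have r0: "0 < r" using a e by (simp add: r_def)
 have sph: "?v t \<in> sphere (of_real a) (a + e)" for t using circlepath_in_sphere[of r "of_real a" t] r0 by (simp add: r_def)
 have v0: "?v t \<noteq> 0" for t using zero_notin_sphere[OF a(1) e(1) sph] .
 have Imv: "Im (?v t) = r * sin (2 * pi * t)" for t by (simp add: circlepath exp_Euler Im_exp)
 have Rev: "Re (?v t) = a + r * cos (2 * pi * t)" for t by (simp add: circlepath exp_Euler Re_exp)
 have Imle: "Im (?v t) \<le> 0" if "t \<in> {1/2..1}" for t proof -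
  have "0 \<le> sin (2 * pi * t - pi)" using that by (intro sin_ge_zero) (auto simp: field_simps)
  then have "sin (2 * pi * t) \<le> 0" by (simp add: sin_diff)
  then show ?thesis unfolding Imv using r0 by (simp add: mult_nonneg_nonpos)
 qed
 have ivn: "\<i> * ?v t \<notin> \<real>\<^sub>\<le>\<^sub>0" if "t \<in> {1/2..1}" for t
 proof
  assume h: "\<i> * ?v t \<in> \<real>\<^sub>\<le>\<^sub>0"
  then have "Re (?v t) = 0" "- Im (?v t) \<le> 0" by (auto simp: complex_nonpos_Reals_iff)
  then show False using Imle[OF that] v0[of t] by (auto simp: complex_eq_iff)
 qed
 have expZ: "exp (Z t) = 1 / ?v t" for t proof -
  have "exp (Z t) = exp (\<i> * of_real (pi / 2)) / exp (Ln (\<i> * ?v t))" unfolding Z_def by (rule exp_diff)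
  also have "exp (Ln (\<i> * ?v t)) = \<i> * ?v t" using v0 by (intro exp_Ln) simp
  also have "exp (\<i> * of_real (pi / 2)) = \<i>" using cis_pi_half by (simp add: cis_conv_exp)
  finally show ?thesis by simp
 qed
 have expmZ: "exp (- Z t) = ?v t" for t using expZ[of t] by (simp add: exp_minus)
 have ZSH: "Z t \<in> SH" if t: "t \<in> {1/2..1}" for t proof -
  have "1 - of_real x * (1 / ?v t) \<noteq> 0" if "x \<in> K" for x
  proof
   assume h: "1 - of_real x * (1 / ?v t) = 0"
   have "0 \<le> x" "x \<le> 2 * a" using that F.K_sub a(2) by auto
   from dist_sphere_ge[OF sph[of t] this] have "?v t - of_real x \<noteq> 0" using e(1) by auto
   then show False using h v0[of t] by (simp add: field_simps)
  qed
  moreover have "1 - of_real x * (- ?v t) \<noteq> 0" if "x \<in> L" for x proof -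
   have x: "0 \<le> x" "x \<le> N" using that G.K_sub by auto
   then have "e * x \<le> e * N" using e(1) by (intro mult_left_mono) auto
   then have "e * x \<le> 1 / 2" using e(2) by simp
   moreover have "- e \<le> Re (?v t)" by (rule Re_ge_of_mem_cball(1)[of _ a]) (use sph[of t] in auto)
   ultimately have "1 / 2 \<le> norm (1 + ?v t * of_real x)" using x by (intro norm_one_plus_ge[of e]) auto
   then have "1 + ?v t * of_real x \<noteq> 0" by auto
   then show ?thesis by (simp add: mult.commute)
  qed
  ultimately have "Z t \<in> Dm" unfolding Dm_def DK_def mem_Collect_eq expZ expmZ by blast
  moreover have "\<bar>Im (Ln (\<i> * ?v t))\<bar> \<le> pi / 2" using Imle[OF t] v0[of t] by (subst Re_Ln_pos_le) auto
  then have "0 \<le> Im (Z t)" "Im (Z t) \<le> pi" by (auto simp: Z_def)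
  ultimately show ?thesis using SH_I[of "Re (Z t)" "Im (Z t)"] by simp
 qed
 have hFZ: "hh (Z t) = Uf f (1 / ?v t) - of_real c * Uf g (- ?v t)" for t by (simp add: hF_def expZ expmZ)
 have "((\<lambda>t. phi (hh (Z t)) * - (2 * of_real pi * \<i> * (of_real r * exp (2 * of_real pi * \<i> * of_real t)) / ?v t))
   has_integral (Psi (Z 1) - Psi (Z (1/2)))) {1/2..1}"
 proof (rule fundamental_theorem_of_calculus)
  fix t :: real assume t: "t \<in> {1/2..1}"
  have dv: "(?v has_vector_derivative 2 * of_real pi * \<i> * (of_real r * exp (2 * of_real pi * \<i> * of_real t))) (at t)"
   using has_vector_derivative_circlepath[of "of_real a" r t UNIV] by (simp add: mult_ac)
  have "((\<lambda>w. \<i> * of_real (pi / 2) - Ln (\<i> * w)) has_field_derivative - (1 / ?v t)) (at (?v t))"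
   using ivn[OF t] v0[of t] by (auto intro!: derivative_eq_intros simp: field_simps)
  from field_vector_diff_chain_at[OF dv this]
  have "(Z has_vector_derivative (2 * of_real pi * \<i> * (of_real r * exp (2 * of_real pi * \<i> * of_real t))) * - (1 / ?v t)) (at t)"
   by (simp add: o_def Z_def[abs_def])
  from field_vector_diff_chain_at[OF this Psi[OF ZSH[OF t]]]
  have "((\<lambda>t. Psi (Z t)) has_vector_derivative
    ((2 * of_real pi * \<i> * (of_real r * exp (2 * of_real pi * \<i> * of_real t))) * - (1 / ?v t)) * phi (hh (Z t))) (at t)"
   by (simp only: o_def)
  then have "((\<lambda>t. Psi (Z t)) has_vector_derivative
    phi (hh (Z t)) * - (2 * of_real pi * \<i> * (of_real r * exp (2 * of_real pi * \<i> * of_real t)) / ?v t)) (at t)" by (simp add: mult_ac)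
  then show "((\<lambda>t. Psi (Z t)) has_vector_derivative
    phi (hh (Z t)) * - (2 * of_real pi * \<i> * (of_real r * exp (2 * of_real pi * \<i> * of_real t)) / ?v t)) (at t within {1/2..1})"
   by (rule has_vector_derivative_at_within)
 qed simp
 from has_integral_mult_right[OF this, of "- 1 / (2 * of_real pi * \<i>)"]
 have 1: "((\<lambda>t. phi (hh (Z t)) / ?v t * (of_real r * exp (2 * of_real pi * \<i> * of_real t)))
   has_integral (- 1 / (2 * of_real pi * \<i>) * (Psi (Z 1) - Psi (Z (1/2))))) {1/2..1}" by (simp add: field_simps)
 have v1: "?v 1 = of_real (2 * a + e)" using Rev[of 1] Imv[of 1] by (simp add: complex_eq_iff r_def)
 have vh: "?v (1/2) = of_real (- e)" using Rev[of "1/2"] Imv[of "1/2"] by (simp add: complex_eq_iff r_def)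
 have Z1: "Z 1 = of_real (- ln (2 * a + e))" proof -
  have "0 < 2 * a + e" using a(1) e(1) by simp
  then have "Ln (of_real (2 * a + e) * \<i>) = of_real (ln (2 * a + e)) + Ln \<i>"
   using Ln_times_of_real[of "2 * a + e" \<i>] Ln_of_real[of "2 * a + e"] by (simp del: of_real_add)
  then show ?thesis unfolding Z_def v1 mult.commute[of \<i> "of_real (2 * a + e)"] by simp
 qed
 have "Z (1/2) = \<i> * of_real (pi / 2) - Ln (of_real e * (- \<i>))" unfolding Z_def vh by (simp add: mult.commute)
 also have "\<dots> = of_real (- ln e) + \<i> * of_real pi" using e(1) Ln_times_of_real[of e "- \<i>"] by (simp add: Ln_of_real Ln_minus_ii)
 finally have Zh: "Z (1/2) = of_real (- ln e) + \<i> * of_real pi" .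
 have eq: "- 1 / (2 * of_real pi * \<i>) * (Psi (Z 1) - Psi (Z (1/2))) =
  (Psi (of_real (- ln e) + \<i> * of_real pi) - Psi (of_real (- ln (2 * a + e)))) / (2 * of_real pi * \<i>)"
  unfolding Z1 Zh by (simp add: field_simps)
 show ?thesis using 1 unfolding eq hFZ .
qed

text \<open>By conjugation symmetry the full circle gives twice the real part of the lower half,
  which involves only \<open>Im Psi\<close> at the two end points. These are the boundary values in
  \<open>total_integral\<close>, so the circle is replaced by the curve.\<close>

lemma CI_eq_integral: assumes dphi: "\<And>z. (phi has_field_derivative phi' z) (at z)" and cnj: "\<And>z. phi (cnj z) = cnj (phi z)"
  and cont: "continuous_on UNIV phi'" and a: "0 < a" "M \<le> 2 * a" and e: "0 < e" "e * N \<le> 1 / 2"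
 shows "(\<lambda>t. th (XX t) * Re (phi' (of_real t))) integrable_on {- pos_mass f..c * pos_mass g}"
  "CI a (a + e) (\<lambda>v. phi (Uf f (1 / v) - of_real c * Uf g (- v)) / v) =
   of_real (Re (phi (of_real (- pos_mass f))) +
    integral {- pos_mass f..c * pos_mass g} (\<lambda>t. th (XX t) * Re (phi' (of_real t))) / pi)" proof -
 obtain Psi where Psi: "\<And>z. z \<in> SH ==> (Psi has_field_derivative phi (hh z)) (at z)" using primitive_exists[OF dphi] by blast
 have real: "Im (phi (of_real t)) = 0" for t using arg_cong[OF cnj[of "of_real t"], of Im] by simp
 have p: "M * exp (- ln (2 * a + e)) < 1" using a e by (simp add: exp_minus field_simps)
 have q: "N * exp (- (- ln e)) < 1" using e by (simp add: mult.commute)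
 define A where "A = (Psi (of_real (- ln e) + \<i> * of_real pi) - Psi (of_real (- ln (2 * a + e)))) / (2 * of_real pi * \<i>)"
 let ?v = "circlepath (complex_of_real a) (a + e)"
 define h where "h t = phi (Uf f (1 / ?v t) - of_real c * Uf g (- ?v t)) /
    ?v t * (of_real (a + e) * exp (2 * of_real pi * \<i> * of_real t))" for t
 note tot = total_integral[OF Psi dphi real cont p q]
 show "(\<lambda>t. th (XX t) * Re (phi' (of_real t))) integrable_on {- pos_mass f..c * pos_mass g}" using tot by blast
 have low: "(h has_integral A) {1/2..1}" unfolding h_def[abs_def] A_def by (rule CI_lower_half[OF Psi a e])
 have hc: "h (1 - t) = cnj (h t)" for t proof -
  have ex: "exp (2 * of_real pi * \<i> * of_real (1 - t)) = cnj (exp (2 * of_real pi * \<i> * of_real t))"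
   by (simp add: complex_eq_iff Re_exp Im_exp cos_diff sin_diff algebra_simps)
  have vc: "?v (1 - t) = cnj (?v t)" unfolding circlepath ex by simp
  have "1 / cnj (?v t) = cnj (1 / ?v t)" "- cnj (?v t) = cnj (- ?v t)" by simp_all
  then have "phi (Uf f (1 / cnj (?v t)) - of_real c * Uf g (- cnj (?v t))) =
    cnj (phi (Uf f (1 / ?v t) - of_real c * Uf g (- ?v t)))"
   by (simp only: F.Uf_cnj G.Uf_cnj cnj[symmetric] complex_cnj_diff complex_cnj_mult complex_cnj_complex_of_real)
  then show ?thesis unfolding h_def vc ex by simp
 qed
 have img: "(\<lambda>x. (1 / (-1)) *\<^sub>R x + - ((1 / (-1)) *\<^sub>R 1)) ` cbox (1/2) 1 = {0..1/2::real}"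
  by (auto simp: image_iff intro!: bexI[of _ "1 - x" for x])
 have "((\<lambda>t. h (1 - t)) has_integral A) {0..1/2}" using has_integral_affinity[of h A "1/2" 1 "-1" 1] low unfolding img by simp
 then have "((\<lambda>t. cnj (h t)) has_integral A) {0..1/2}" unfolding hc .
 then have up: "(h has_integral cnj A) {0..1/2}" using has_integral_linear[OF _ bounded_linear_cnj, of "\<lambda>t. cnj (h t)"] by (simp add: o_def)
 have "(h has_integral cnj A + A) {0..1}" by (rule has_integral_combine[OF _ _ up low]) auto
 moreover have "CI a (a + e) (\<lambda>v. phi (Uf f (1 / v) - of_real c * Uf g (- v)) / v) = integral {0..1} h" unfolding CI_def h_def ..
 ultimately have "CI a (a + e) (\<lambda>v. phi (Uf f (1 / v) - of_real c * Uf g (- v)) / v) = cnj A + A" by (simp add: integral_unique)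
 also have "\<dots> = of_real (2 * Re A)" by (simp add: complex_eq_iff)
 also have "2 * Re A = (Im (Psi (of_real (- ln e) + \<i> * of_real pi)) - Im (Psi (of_real (- ln (2 * a + e))))) / pi" proof -
  have "w / (2 * of_real pi * \<i>) = - \<i> * w / of_real (2 * pi)" for w :: complex by (simp add: field_simps)
  then show ?thesis unfolding A_def by (simp only: Re_divide_of_real) (simp add: field_simps)
 qed
 also have "\<dots> = Re (phi (of_real (- pos_mass f))) +
    integral {- pos_mass f..c * pos_mass g} (\<lambda>t. th (XX t) * Re (phi' (of_real t))) / pi"
  using integral_unique[OF tot] by (simp add: field_simps)
 finally show "CI a (a + e) (\<lambda>v. phi (Uf f (1 / v) - of_real c * Uf g (- v)) / v) =
   of_real (Re (phi (of_real (- pos_mass f))) +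
    integral {- pos_mass f..c * pos_mass g} (\<lambda>t. th (XX t) * Re (phi' (of_real t))) / pi)" .
qed

end

section \<open>Limits of exponential moments\<close>

text \<open>The telescoping estimate for a difference of products needs factors of norm at most 1;
  both kinds of factors are therefore scaled by exp(-d) first.\<close>

lemma norm_prod_minus_exp_le: fixes z :: "nat => complex" assumes "\<And>i. i \<in> I ==> norm (z i) \<le> d" "finite I"
 shows "norm ((\<Prod>i\<in>I. 1 + z i) - exp (\<Sum>i\<in>I. z i)) \<le> exp (real (card I) * d) * (real (card I) * (exp d * d\<^sup>2))" proof -
 let ?E = "\<lambda>i. complex_of_real (exp (- d))"
 have n1: "norm (1 + z i) \<le> exp d" if "i \<in> I" for i proof -
  have "norm (1 + z i) \<le> 1 + norm (z i)" using norm_triangle_ineq[of 1 "z i"] by simp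
  also have "\<dots> \<le> 1 + d" using assms(1)[OF that] by simp
  also have "\<dots> \<le> exp d" by (rule exp_ge_add_one_self)
  finally show ?thesis .
 qed
 have n2: "norm (exp (z i)) \<le> exp d" if "i \<in> I" for i
  using norm_exp[of "z i"] assms(1)[OF that] exp_le_cancel_iff[of "norm (z i)" d] by linarith
 have sc: "norm (w * ?E i) \<le> 1" if "norm w \<le> exp d" for w i
  using that by (simp add: norm_mult norm_divide exp_minus field_simps del: exp_of_real of_real_exp)
 have "norm ((\<Prod>i\<in>I. (1 + z i) * ?E i) - (\<Prod>i\<in>I. exp (z i) * ?E i)) \<le> (\<Sum>i\<in>I. norm ((1 + z i) * ?E i - exp (z i) * ?E i))"
  using sc n1 n2 by (intro norm_prod_diff) blast+
 also have "\<dots> \<le> (\<Sum>i\<in>I. exp (- d) * (exp d * d\<^sup>2))"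
 proof (rule sum_mono)
  fix i assume i: "i \<in> I"
  have d0: "0 \<le> d" using assms(1)[OF i] norm_ge_zero order_trans by blast
  have "norm (exp (z i) - (1 + z i)) \<le> exp (norm (z i)) * (norm (z i))\<^sup>2" using Taylor_exp_field[of "z i" 1] by (simp add: power2_eq_square)
  also have "\<dots> \<le> exp d * d\<^sup>2" using assms(1)[OF i] by (intro mult_mono power_mono) auto
  finally have "norm ((1 + z i) - exp (z i)) \<le> exp d * d\<^sup>2" by (simp add: norm_minus_commute)
  then show "norm ((1 + z i) * ?E i - exp (z i) * ?E i) \<le> exp (- d) * (exp d * d\<^sup>2)"
   unfolding left_diff_distrib[symmetric] norm_mult by (simp add: mult.commute)
 qed
 also have "\<dots> = real (card I) * d\<^sup>2" by (simp add: exp_minus)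
 finally have 1: "norm ((\<Prod>i\<in>I. (1 + z i) * ?E i) - (\<Prod>i\<in>I. exp (z i) * ?E i)) \<le> real (card I) * d\<^sup>2" .
 have "(\<Prod>i\<in>I. 1 + z i) - exp (\<Sum>i\<in>I. z i) =
   ((\<Prod>i\<in>I. (1 + z i) * ?E i) - (\<Prod>i\<in>I. exp (z i) * ?E i)) * of_real (exp (real (card I) * d))" proof -
  have "exp (- d) ^ card I * exp (real (card I) * d) = 1" unfolding exp_of_nat_mult[symmetric] exp_add[symmetric] by simp
  then have E1: "complex_of_real (exp (- d)) ^ card I * of_real (exp (real (card I) * d)) = 1"
   by (metis of_real_1 of_real_mult of_real_power)
  show ?thesis unfolding prod.distrib prod_constant left_diff_distrib mult.assoc E1 exp_sum[OF assms(2)] by simp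
 qed
 then have "norm ((\<Prod>i\<in>I. 1 + z i) - exp (\<Sum>i\<in>I. z i)) \<le> real (card I) * d\<^sup>2 * exp (real (card I) * d)"
  using mult_right_mono[OF 1, of "exp (real (card I) * d)"] by (simp add: norm_mult)
 also have "\<dots> \<le> exp (real (card I) * d) * (real (card I) * (exp d * d\<^sup>2))"
 proof (cases "I = {}")
  case False
  then obtain i where "i \<in> I" by blast
  then have "0 \<le> d" using assms(1) norm_ge_zero order_trans by blast
  then have "1 * d\<^sup>2 \<le> exp d * d\<^sup>2" by (intro mult_right_mono) auto
  then have "real (card I) * d\<^sup>2 \<le> real (card I) * (exp d * d\<^sup>2)" by (intro mult_left_mono) auto
  then show ?thesis by (simp add: mult.commute)
 qed simp
 finally show ?thesis .
qed

lemma prod_tendsto_exp: fixes w :: "nat => nat => complex" and d :: "nat => real" assumes d: "d \<longlonglongrightarrow> 0" "(\<lambda>n. real (m n) * d n) \<longlonglongrightarrow> sg"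
  and w: "\<And>n i. i \<in> {1..m n} ==> norm (w n i) \<le> W" and L: "(\<lambda>n. (\<Sum>i=1..m n. w n i) /\<^sub>R real (m n)) \<longlonglongrightarrow> L"
 shows "(\<lambda>n. \<Prod>i=1..m n. 1 + of_real (d n) * w n i) \<longlonglongrightarrow> exp (of_real sg * L)" proof -
 let ?B = "\<lambda>n. exp (real (m n) * (\<bar>d n\<bar> * W)) * (real (m n) * (exp (\<bar>d n\<bar> * W) * (\<bar>d n\<bar> * W)\<^sup>2))"
 have bnd: "norm ((\<Prod>i=1..m n. 1 + of_real (d n) * w n i) - exp (\<Sum>i=1..m n. of_real (d n) * w n i)) \<le> ?B n" for n
  using norm_prod_minus_exp_le[of "{1..m n}" "\<lambda>i. of_real (d n) * w n i" "\<bar>d n\<bar> * W"] w by (simp add: norm_mult mult_left_mono)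
 have B0: "?B \<longlonglongrightarrow> 0" proof -
  have md: "(\<lambda>n. real (m n) * \<bar>d n\<bar>) \<longlonglongrightarrow> \<bar>sg\<bar>" using tendsto_rabs[OF d(2)] by (simp add: abs_mult)
  have "(\<lambda>n. exp (real (m n) * \<bar>d n\<bar> * W) * (real (m n) * \<bar>d n\<bar> * (exp (\<bar>d n\<bar> * W) * (\<bar>d n\<bar> * W\<^sup>2)))) \<longlonglongrightarrow>
    exp (\<bar>sg\<bar> * W) * (\<bar>sg\<bar> * (exp (\<bar>0\<bar> * W) * (\<bar>0\<bar> * W\<^sup>2)))" by (intro tendsto_intros md d(1))
  then show ?thesis by (simp add: power2_eq_square mult_ac del: abs_mult_self_eq)
 qed
 have 1: "(\<lambda>n. (\<Prod>i=1..m n. 1 + of_real (d n) * w n i) - exp (\<Sum>i=1..m n. of_real (d n) * w n i)) \<longlonglongrightarrow> 0"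
  by (rule Lim_null_comparison[OF always_eventually[OF allI[OF bnd]] B0])
 have eq: "(\<Sum>i=1..m n. of_real (d n) * w n i) = of_real (real (m n) * d n) * ((\<Sum>i=1..m n. w n i) /\<^sub>R real (m n))" for n
  by (cases "m n = 0") (simp_all add: sum_distrib_left scaleR_conv_of_real field_simps)
 have 2: "(\<lambda>n. exp (\<Sum>i=1..m n. of_real (d n) * w n i)) \<longlonglongrightarrow> exp (of_real sg * L)" unfolding eq by (intro tendsto_intros d(2) L)
 show ?thesis using tendsto_add[OF 1 2] by simp
qed

text \<open>\<open>8 * (e * N) \<le> 1\<close> provides 2 e y_j \<le> 1/4 for the outer circle of
  radius a + 2 e. Below, the centre \<open>a = M + 1\<close> makes the x_i strictly smaller than a,
  as \<open>EE_variance\<close> demands.\<close>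

locale scaled_pair = fgpair f P K M g Q L N c for f P K M g Q L N c + fixes k :: "nat => nat" and s e :: real
 assumes k: "(\<lambda>n. real (k n) / real n) \<longlonglongrightarrow> c" and s: "0 < s" and e: "0 < e" "8 * (e * N) \<le> 1"
begin

abbreviation "xx \<equiv> \<lambda>n i. f (real i / real n)"
abbreviation "yy \<equiv> \<lambda>n j. g (real j / real (k n))"
abbreviation "qq \<equiv> \<lambda>n. exp (s / real n)"
abbreviation "a \<equiv> M + 1"

lemma xx_bounds: "i \<in> {1..n} ==> 0 \<le> xx n i \<and> xx n i \<le> M" by (auto intro!: F.nonneg F.bounded simp: divide_le_eq_1)

lemma yy_bounds: "j \<in> {1..k n} ==> 0 \<le> yy n j \<and> yy n j \<le> N" by (auto intro!: G.nonneg G.bounded simp: divide_le_eq_1)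

lemma e_mult_le: "y \<le> N ==> 8 * (e * y) \<le> 1" proof -
 assume "y \<le> N"
 then have "e * y \<le> e * N" using e(1) by (intro mult_left_mono) auto
 then show ?thesis using e(2) by linarith
qed

lemma q_tendsto: "(\<lambda>n. qq n - 1) \<longlonglongrightarrow> 0" proof -
 have "(\<lambda>n. s / real n) \<longlonglongrightarrow> 0" by (rule lim_const_over_n)
 then have "(\<lambda>n. qq n - 1) \<longlonglongrightarrow> exp 0 - 1" by (intro tendsto_intros)
 then show ?thesis by simp
qed

lemma nq_tendsto: "(\<lambda>n. real n * (qq n - 1)) \<longlonglongrightarrow> s" proof -
 have "((\<lambda>h::real. (exp h - 1) / h) \<longlongrightarrow> 1) (at 0)" using DERIV_exp[of "0::real"] by (simp add: DERIV_def)
 moreover have "filterlim (\<lambda>n. s / real n) (at 0) sequentially"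
  unfolding filterlim_at using s lim_const_over_n[of s] by (auto intro!: eventually_sequentiallyI[of 1])
 ultimately have "(\<lambda>n. (exp (s / real n) - 1) / (s / real n)) \<longlonglongrightarrow> 1" by (rule filterlim_compose)
 from tendsto_mult_left[OF this, of s] have "(\<lambda>n. s * ((qq n - 1) / (s / real n))) \<longlonglongrightarrow> s" by simp
 moreover have "s * ((qq n - 1) / (s / real n)) = real n * (qq n - 1)" for n using s by simp
 ultimately show ?thesis by simp
qed

lemma kq_tendsto: "(\<lambda>n. real (k n) * (qq n - 1)) \<longlonglongrightarrow> c * s" proof -
 have "(\<lambda>n. real (k n) / real n * (real n * (qq n - 1))) \<longlonglongrightarrow> c * s" by (intro tendsto_mult k nq_tendsto)
 then show ?thesis by (rule Lim_transform_eventually) (auto intro!: eventually_sequentiallyI[of 1])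
qed

lemma k_at_top: "filterlim k sequentially sequentially" proof -
 have 1: "filterlim (\<lambda>n. real (k n) / real n * real n) at_top sequentially"
  by (rule filterlim_tendsto_pos_mult_at_top[OF k cpos filterlim_real_sequentially])
 have 2: "eventually (\<lambda>n. real (k n) / real n * real n = real (k n)) sequentially" by (rule eventually_sequentiallyI[of 1]) simp
 have "filterlim (\<lambda>n. real (k n)) at_top sequentially" using 1 unfolding filterlim_cong[OF refl refl 2] .
 then show ?thesis using filterlim_sequentially_iff_filterlim_real by blast
qed

text \<open>Each factor is 1 + (q - 1) times a bounded term, and n (q - 1) tends to s, so the
  products become exponentials of Riemann sums. The 1 in the exponent comes from v / (v - x) = 1 +
  (x / v) / (1 - x / v).\<close>

lemma Rr_tendsto: assumes v: "v \<in> sphere (complex_of_real a) (a + e)"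
 shows "(\<lambda>n. Rr n (k n) (qq n) (xx n) (yy n) v) \<longlonglongrightarrow> exp (of_real s * (1 + (Uf f (1 / v) - of_real c * Uf g (- v))))" proof -
 have v0: "v \<noteq> 0" using zero_notin_sphere[OF _ e(1) v] F.Mpos by simp
 have nv: "norm v \<le> 2 * a + e" using Re_ge_of_mem_cball(2)[of v a e] v F.Mpos by auto
 have vx: "e \<le> norm (v - of_real x)" if "0 \<le> x" "x \<le> M" for x using dist_sphere_ge[OF v, of x] that F.Mpos by auto
 have vy: "1 / 2 \<le> norm (1 + v * of_real y)" if "0 \<le> y" "8 * (e * y) \<le> 1" for y
  using Re_ge_of_mem_cball(1)[of v a e] v that by (intro norm_one_plus_ge[of e]) auto
 have vy': "1 / 2 \<le> norm (1 + v * of_real y)" if "0 \<le> y" "y \<le> N" for y using that(1) e_mult_le[OF that(2)] by (rule vy)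
 have F1: "(\<lambda>n. (\<Sum>i=1..n. v / (v - of_real (xx n i))) /\<^sub>R real n) \<longlonglongrightarrow> integral {0..1} (\<lambda>t. v / (v - of_real (f t)))"
 proof (rule riemann_sums_tendsto[OF F.finP])
  show "continuous_on ({0..1} - P) (\<lambda>t. v / (v - of_real (f t)))"
  proof (intro continuous_intros F.contf ballI)
   fix t assume "t \<in> {0..1} - P"
   then show "v - of_real (f t) \<noteq> 0" using vx[of "f t"] F.nonneg[of t] F.bounded[of t] e by auto
  qed
  show "norm (v / (v - of_real (f t))) \<le> (2 * a + e) / e" if "t \<in> {0..1}" for t
   using vx[of "f t"] F.nonneg[OF that] F.bounded[OF that] e nv unfolding norm_divide by (intro frac_le) auto
 qed
 have G1: "(\<lambda>n. (\<Sum>j=1..n. v * of_real (g (real j / real n)) / (1 + v * of_real (g (real j / real n)))) /\<^sub>R real n) \<longlonglongrightarrow>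
   integral {0..1} (\<lambda>t. v * of_real (g t) / (1 + v * of_real (g t)))"
 proof (rule riemann_sums_tendsto[OF G.finP])
  show "continuous_on ({0..1} - Q) (\<lambda>t. v * of_real (g t) / (1 + v * of_real (g t)))"
  proof (intro continuous_intros G.contf ballI)
   fix t assume "t \<in> {0..1} - Q"
   then show "1 + v * of_real (g t) \<noteq> 0" using vy'[of "g t"] G.nonneg[of t] G.bounded[of t] by auto
  qed
  show "norm (v * of_real (g t) / (1 + v * of_real (g t))) \<le> (2 * a + e) * N / (1 / 2)" if "t \<in> {0..1}" for t proof -
   have "norm (v * complex_of_real (g t)) \<le> (2 * a + e) * N"
    unfolding norm_mult using nv G.nonneg[OF that] G.bounded[OF that] e F.Mpos by (intro mult_mono) auto
   then show ?thesis unfolding norm_divide using vy'[of "g t"] G.nonneg[OF that] G.bounded[OF that] e F.Mpos G.Mpos by (intro frac_le) auto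
  qed
 qed
 have G2: "(\<lambda>n. (\<Sum>j=1..k n. v * of_real (yy n j) / (1 + v * of_real (yy n j))) /\<^sub>R real (k n)) \<longlonglongrightarrow>
   integral {0..1} (\<lambda>t. v * of_real (g t) / (1 + v * of_real (g t)))" using filterlim_compose[OF G1 k_at_top] .
 have IF: "integral {0..1} (\<lambda>t. v / (v - of_real (f t))) = 1 + Uf f (1 / v)" proof -
  have DK: "1 / v \<in> DK K" unfolding DK_def
  proof (intro CollectI ballI)
   fix x assume "x \<in> K"
   then have "v - of_real x \<noteq> 0" using vx[of x] F.K_sub e by auto
   then show "1 - of_real x * (1 / v) \<noteq> 0" using v0 by (simp add: field_simps)
  qed
  have "integral {0..1} (\<lambda>t. v / (v - of_real (f t))) = integral {0..1} (\<lambda>t. 1 + of_real (f t) * (1 / v) / (1 - of_real (f t) * (1 / v)))"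
  proof (rule integral_cong)
   fix t :: real assume t: "t \<in> {0..1}"
   then have "v - of_real (f t) \<noteq> 0" using vx[of "f t"] F.nonneg[of t] F.bounded[of t] e by auto
   then show "v / (v - of_real (f t)) = 1 + of_real (f t) * (1 / v) / (1 - of_real (f t) * (1 / v))" using v0 by (simp add: divide_simps)
  qed
  also have "\<dots> = integral {0..1} (\<lambda>t::real. 1) + Uf f (1 / v)"
   unfolding Uf_def by (intro integral_add F.U_integrable(1)[OF DK]) (rule integrable_const_ivl)
  finally show ?thesis by simp
 qed
 have IG: "integral {0..1} (\<lambda>t. v * of_real (g t) / (1 + v * of_real (g t))) = - Uf g (- v)"
  unfolding Uf_def integral_neg[symmetric] by (intro integral_cong) (simp add: mult.commute)
 have P1: "(\<lambda>n. \<Prod>i=1..n. 1 + of_real (qq n - 1) * (v / (v - of_real (xx n i)))) \<longlonglongrightarrow> exp (of_real s * (1 + Uf f (1 / v)))"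
  unfolding IF[symmetric]
 proof (rule prod_tendsto_exp[where m = "\<lambda>n. n" and W = "(2 * a + e) / e", OF q_tendsto nq_tendsto _ F1])
  show "norm (v / (v - of_real (xx n i))) \<le> (2 * a + e) / e" if "i \<in> {1..n}" for n i
   using vx[of "xx n i"] xx_bounds[OF that] e nv unfolding norm_divide by (intro frac_le) auto
 qed
 have P2: "(\<lambda>n. \<Prod>j=1..k n. 1 + of_real (qq n - 1) * (v * of_real (yy n j) / (1 + v * of_real (yy n j)))) \<longlonglongrightarrow> exp (of_real (c * s) * (- Uf g (- v)))"
  unfolding IG[symmetric]
 proof (rule prod_tendsto_exp[where W = "(2 * a + e) * N / (1 / 2)", OF q_tendsto kq_tendsto _ G2])
  show "norm (v * of_real (yy n j) / (1 + v * of_real (yy n j))) \<le> (2 * a + e) * N / (1 / 2)" if "j \<in> {1..k n}" for n j proof -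
   have "norm (v * complex_of_real (yy n j)) \<le> (2 * a + e) * N"
    unfolding norm_mult using nv yy_bounds[OF that] e F.Mpos by (intro mult_mono) auto
   then show ?thesis unfolding norm_divide using vy'[of "yy n j"] yy_bounds[OF that] e F.Mpos G.Mpos by (intro frac_le) auto
  qed
 qed
 have "(\<Prod>i=1..n. 1 + of_real (qq n - 1) * (v / (v - of_real (xx n i)))) *
   (\<Prod>j=1..k n. 1 + of_real (qq n - 1) * (v * of_real (yy n j) / (1 + v * of_real (yy n j)))) =
   Rr n (k n) (qq n) (xx n) (yy n) v" for n unfolding Rr_def
 proof (intro arg_cong2[where f = "(*)"] prod.cong refl)
  fix i assume "i \<in> {1..n}"
  then have "v - of_real (xx n i) \<noteq> 0" using vx[of "xx n i"] xx_bounds[of i n] e by auto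
  then show "1 + of_real (qq n - 1) * (v / (v - of_real (xx n i))) = (of_real (qq n) * v - of_real (xx n i)) / (v - of_real (xx n i))"
   by (simp add: field_simps)
 next
  fix j assume "j \<in> {1..k n}"
  then have "1 + v * of_real (yy n j) \<noteq> 0" using vy'[of "yy n j"] yy_bounds[of j n] by auto
  then show "1 + of_real (qq n - 1) * (v * of_real (yy n j) / (1 + v * of_real (yy n j))) =
    (1 + of_real (qq n) * v * of_real (yy n j)) / (1 + v * of_real (yy n j))" by (simp add: field_simps)
 qed
 then have "(\<lambda>n. Rr n (k n) (qq n) (xx n) (yy n) v) \<longlonglongrightarrow> exp (of_real s * (1 + Uf f (1 / v))) * exp (of_real (c * s) * (- Uf g (- v)))"
  using tendsto_mult[OF P1 P2] by simp
 then show ?thesis by (simp add: exp_add[symmetric] algebra_simps)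
qed

end

context scaled_pair
begin

lemma a_pos: "0 < a" using F.Mpos by simp

lemma Rr_bound: assumes "e \<le> e'" "e' \<le> 2 * e"
 obtains B where "\<And>n v. v \<in> sphere (complex_of_real a) (a + e') ==> norm (Rr n (k n) (qq n) (xx n) (yy n) v) \<le> B"
  "\<And>n. exp (\<bar>qq n - 1\<bar> * (2 * a + e') * (real n / e + real (k n) * (2 * N))) \<le> B" proof -
 let ?B = "\<lambda>n. exp (\<bar>qq n - 1\<bar> * (2 * a + e') * (real n / e + real (k n) * (2 * N)))"
 have "(\<lambda>n. exp ((2 * a + e') * (\<bar>real n * (qq n - 1)\<bar> / e + \<bar>real (k n) * (qq n - 1)\<bar> * (2 * N)))) \<longlonglongrightarrow>
   exp ((2 * a + e') * (\<bar>s\<bar> / e + \<bar>c * s\<bar> * (2 * N)))" using e(1) by (intro tendsto_intros nq_tendsto kq_tendsto) auto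
 moreover have "exp ((2 * a + e') * (\<bar>real n * (qq n - 1)\<bar> / e + \<bar>real (k n) * (qq n - 1)\<bar> * (2 * N))) = ?B n" for n proof -
  have "\<bar>real m * (qq n - 1)\<bar> = real m * \<bar>qq n - 1\<bar>" for m by (simp add: abs_mult)
  then show ?thesis by (simp only: algebra_simps add_divide_distrib times_divide_eq_left times_divide_eq_right)
 qed
 ultimately have "convergent ?B" unfolding convergent_def by (simp only:) blast
 then have "Bseq ?B" by (rule convergent_imp_Bseq)
 then obtain B where B: "\<And>n. norm (?B n) \<le> B" unfolding Bseq_def by blast
 then have B': "?B n \<le> B" for n using B[of n] by simp
 show ?thesis
 proof (rule that)
  show "?B n \<le> B" for n by (rule B')
  fix n v assume v: "v \<in> sphere (complex_of_real a) (a + e')"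
  have "norm (Rr n (k n) (qq n) (xx n) (yy n) v) \<le> ?B n"
  proof (rule norm_Rr_le[OF a_pos e(1) assms(1) _ _ _ v])
   show "0 \<le> xx n i \<and> xx n i \<le> 2 * a" if "i \<in> {1..n}" for i using xx_bounds[OF that] F.Mpos by auto
   show "0 \<le> yy n j \<and> e' * yy n j \<le> 1 / 4 \<and> yy n j \<le> N" if "j \<in> {1..k n}" for j proof -
    have y: "0 \<le> yy n j" "yy n j \<le> N" using yy_bounds[OF that] by auto
    have "e' * yy n j \<le> (2 * e) * yy n j" using assms(2) y(1) by (rule mult_right_mono)
    then show ?thesis using y e_mult_le[OF y(2)] by simp
   qed
  qed simp
  then show "norm (Rr n (k n) (qq n) (xx n) (yy n) v) \<le> B" using B'[of n] by (rule order_trans)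
 qed
qed

text \<open>\<open>CI_eq_integral\<close> for phi(z) = exp(s (1 + z)), which is real on the real
  line.\<close>

definition LL :: real where
 "LL = exp (s * (1 - pos_mass f)) +
  integral {- pos_mass f..c * pos_mass g} (\<lambda>t. th (XX t) * (s * exp (s * (1 + t)))) / pi"

lemma exp_real_line: "exp (of_real s * (1 + complex_of_real t)) = of_real (exp (s * (1 + t)))" by (simp add: exp_of_real[symmetric])

lemma LL_eq_CI:
 "CI a (a + e) (\<lambda>v. exp (of_real s * (1 + (Uf f (1 / v) - of_real c * Uf g (- v)))) / v) = of_real LL"
 "(\<lambda>t. th (XX t) * (s * exp (s * (1 + t)))) integrable_on {- pos_mass f..c * pos_mass g}" proof -
 let ?phi = "\<lambda>z::complex. exp (of_real s * (1 + z))" and ?phi' = "\<lambda>z::complex. of_real s * exp (of_real s * (1 + z))"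
 have 1: "(?phi has_field_derivative ?phi' z) (at z)" for z by (auto intro!: derivative_eq_intros)
 have 2: "?phi (cnj z) = cnj (?phi z)" for z by (simp add: exp_cnj)
 have 3: "continuous_on UNIV ?phi'" by (intro continuous_intros)
 have 4: "M \<le> 2 * a" "e * N \<le> 1 / 2" using F.Mpos e by auto
 note CI = CI_eq_integral[of ?phi ?phi', OF 1 2 3 a_pos 4(1) e(1) 4(2)]
 have r: "Re (?phi (of_real t)) = exp (s * (1 + t))" "Re (?phi' (of_real t)) = s * exp (s * (1 + t))" for t
  unfolding exp_real_line by simp_all
 show "CI a (a + e) (\<lambda>v. exp (of_real s * (1 + (Uf f (1 / v) - of_real c * Uf g (- v)))) / v) = of_real LL"
  using CI(2) unfolding r LL_def by simp
 show "(\<lambda>t. th (XX t) * (s * exp (s * (1 + t)))) integrable_on {- pos_mass f..c * pos_mass g}" using CI(1) unfolding r .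
qed

lemma EE_Yq_tendsto: "(\<lambda>n. EE n (k n) (xx n) (yy n) (Yq n (qq n))) \<longlonglongrightarrow> LL" proof -
 let ?S = "sphere (complex_of_real a) (a + e)" and ?v = "circlepath (complex_of_real a) (a + e)"
 let ?d = "\<lambda>t. of_real (a + e) * exp (2 * of_real pi * \<i> * of_real t)"
 let ?R = "\<lambda>n v. Rr n (k n) (qq n) (xx n) (yy n) v"
 let ?E = "\<lambda>v. exp (of_real s * (1 + (Uf f (1 / v) - of_real c * Uf g (- v))))"
 obtain B where B: "\<And>n v. v \<in> ?S ==> norm (?R n v) \<le> B" proof -
  have "e \<le> e" "e \<le> 2 * e" using e by auto
  from Rr_bound[OF this] that show ?thesis by metis
 qed
 have ae: "0 \<le> a + e" using a_pos e by simp
 have sph: "?v t \<in> ?S" for t by (rule circlepath_in_sphere[OF ae])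
 have nd: "norm (?d t) = a + e" for t proof -
  have "norm (exp (2 * of_real pi * \<i> * of_real t :: complex)) = 1" using norm_exp_i_times[of "2 * pi * t"] by (simp add: mult_ac)
  then show ?thesis unfolding norm_mult norm_of_real using ae by simp
 qed
 have nv: "e \<le> norm (?v t)" for t using dist_sphere_ge[OF sph[of t], of 0] a_pos by simp
 have y4: "0 \<le> yy n j \<and> e * yy n j \<le> 1 / 4" if "j \<in> {1..k n}" for n j using yy_bounds[OF that] e_mult_le[of "yy n j"] by auto
 have int: "(\<lambda>t. ?R n (?v t) / ?v t * ?d t) integrable_on {0..1}" for n
 proof (rule CI_integrable[OF ae])
  have "continuous_on ?S (?R n)"
  proof (rule continuous_on_Rr[OF e(1) _ y4])
   show "0 \<le> xx n i \<and> xx n i < 2 * a + e" if "i \<in> {1..n}" for i using xx_bounds[OF that] F.Mpos e by auto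
  qed
  then show "continuous_on ?S (\<lambda>v. ?R n v / v)" using zero_notin_sphere[OF a_pos e(1)] by (intro continuous_intros) blast+
 qed
 have bnd: "norm (?R n (?v t) / ?v t * ?d t) \<le> B / e * (a + e)" for n t proof -
  have "norm (?R n (?v t)) \<le> B" by (rule B[OF sph])
  moreover from this have "0 \<le> B" using norm_ge_zero order_trans by blast
  ultimately have "norm (?R n (?v t)) / norm (?v t) \<le> B / e" using e(1) nv by (intro frac_le) auto
  then show ?thesis unfolding norm_mult[of "_ / _"] norm_divide nd using ae by (rule mult_right_mono)
 qed
 have lim: "(\<lambda>n. ?R n (?v t) / ?v t * ?d t) \<longlonglongrightarrow> ?E (?v t) / ?v t * ?d t" for t
  using Rr_tendsto[OF sph[of t]] nv[of t] e by (intro tendsto_mult tendsto_divide tendsto_const) auto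
 have "(\<lambda>n. integral {0..1} (\<lambda>t. ?R n (?v t) / ?v t * ?d t)) \<longlonglongrightarrow> integral {0..1} (\<lambda>t. ?E (?v t) / ?v t * ?d t)"
  by (rule dominated_convergence(2)[OF int integrable_const_ivl[of "B / e * (a + e)"] bnd lim])
 then have "(\<lambda>n. CI a (a + e) (\<lambda>v. ?R n v / v)) \<longlonglongrightarrow> of_real LL" unfolding LL_eq_CI(1)[symmetric] CI_def .
 moreover have "CI a (a + e) (\<lambda>v. ?R n v / v) = of_real (EE n (k n) (xx n) (yy n) (Yq n (qq n)))" for n
 proof (rule EE_Yq_eq_CI[symmetric, OF a_pos e(1)])
  show "0 \<le> xx n i \<and> xx n i \<le> 2 * a" if "i \<in> {1..n}" for i using xx_bounds[OF that] F.Mpos by auto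
 qed (use y4 in auto)
 ultimately have "(\<lambda>n. complex_of_real (EE n (k n) (xx n) (yy n) (Yq n (qq n)))) \<longlonglongrightarrow> of_real LL" by simp
 then show ?thesis by (simp only: tendsto_of_real_iff)
qed

text \<open>Variance plus squared bias. The variance bound carries (q - 1)^2, while \<open>B\<close>
  is independent of n by \<open>Rr_bound\<close>.\<close>

lemma EE_square_deviation_tendsto:
 "(\<lambda>n. EE n (k n) (xx n) (yy n) (\<lambda>lam. (Yq n (qq n) lam - LL)\<^sup>2)) \<longlonglongrightarrow> 0" proof -
 let ?E = "\<lambda>n F. EE n (k n) (xx n) (yy n) F"
 let ?Y = "\<lambda>n. Yq n (qq n)"
 obtain B where B: "\<And>n. exp (\<bar>qq n - 1\<bar> * (2 * a + 2 * e) * (real n / e + real (k n) * (2 * N))) \<le> B" proof -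
  have "e \<le> 2 * e" "2 * e \<le> 2 * e" using e by auto
  from Rr_bound[OF this] that show ?thesis by metis
 qed
 have var: "(\<lambda>n. ?E n (\<lambda>lam. ?Y n lam * ?Y n lam) - ?E n (?Y n) * ?E n (?Y n)) \<longlonglongrightarrow> 0"
 proof (rule Lim_null_comparison)
  have "(\<lambda>n. \<bar>qq n - 1\<bar> * (2 * a + 2 * e)) \<longlonglongrightarrow> \<bar>0\<bar> * (2 * a + 2 * e)" by (intro tendsto_intros q_tendsto)
  then have "eventually (\<lambda>n. \<bar>qq n - 1\<bar> * (2 * a + 2 * e) < e / 4) sequentially" by (rule order_tendstoD(2)) (use e in simp)
  moreover have "eventually (\<lambda>n. qq n - 1 < 1) sequentially" using q_tendsto by (rule order_tendstoD(2)) simp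
  ultimately show "eventually (\<lambda>n. norm (?E n (\<lambda>lam. ?Y n lam * ?Y n lam) - ?E n (?Y n) * ?E n (?Y n)) \<le>
    (a + e) * (a + 2 * e) * B\<^sup>2 * (qq n - 1)\<^sup>2 * (16 / e\<^sup>2)) sequentially"
  proof eventually_elim
   case (elim n)
   show ?case unfolding real_norm_def
   proof (rule EE_variance[OF a_pos e(1)])
    show "0 \<le> xx n i \<and> xx n i < a" if "i \<in> {1..n}" for i using xx_bounds[OF that] by auto
    show "0 \<le> yy n j \<and> 2 * e * yy n j \<le> 1 / 4 \<and> yy n j \<le> N" if "j \<in> {1..k n}" for j using yy_bounds[OF that] e_mult_le[of "yy n j"] by auto
    show "exp (\<bar>qq n - 1\<bar> * (2 * a + 2 * e) * (real n / e + real (k n) * (2 * N))) \<le> B" by (rule B)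
   qed (use elim G.Mpos in auto)
  qed
  have "(\<lambda>n. (a + e) * (a + 2 * e) * B\<^sup>2 * (qq n - 1)\<^sup>2 * (16 / e\<^sup>2)) \<longlonglongrightarrow> (a + e) * (a + 2 * e) * B\<^sup>2 * 0\<^sup>2 * (16 / e\<^sup>2)"
   by (intro tendsto_intros q_tendsto)
  then show "(\<lambda>n. (a + e) * (a + 2 * e) * B\<^sup>2 * (qq n - 1)\<^sup>2 * (16 / e\<^sup>2)) \<longlonglongrightarrow> 0" by simp
 qed
 have "?E n (\<lambda>lam. (?Y n lam - LL)\<^sup>2) =
   (?E n (\<lambda>lam. ?Y n lam * ?Y n lam) - ?E n (?Y n) * ?E n (?Y n)) + (?E n (?Y n) - LL)\<^sup>2" for n proof -
  have "?E n (\<lambda>lam. (?Y n lam - LL)\<^sup>2) = ?E n (\<lambda>lam. ?Y n lam * ?Y n lam + ((- 2 * LL) * ?Y n lam + LL\<^sup>2 * 1))"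
   by (intro arg_cong[where f = "?E n"] ext) (simp add: power2_eq_square algebra_simps)
  also have "\<dots> = ?E n (\<lambda>lam. ?Y n lam * ?Y n lam) + ((- 2 * LL) * ?E n (?Y n) + LL\<^sup>2 * ?E n (\<lambda>_. 1))" by (simp only: EE_add EE_cmult)
  also have "?E n (\<lambda>_. 1) = 1" using xx_bounds yy_bounds by (intro EE_one) auto
  finally show ?thesis by (simp add: power2_eq_square algebra_simps)
 qed
 moreover have "(\<lambda>n. (?E n (\<lambda>lam. ?Y n lam * ?Y n lam) - ?E n (?Y n) * ?E n (?Y n)) + (?E n (?Y n) - LL)\<^sup>2) \<longlonglongrightarrow> 0 + (LL - LL)\<^sup>2"
  by (intro tendsto_intros var EE_Yq_tendsto)
 ultimately show ?thesis by simp
qed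

end

section \<open>Convergence of the boundary\<close>

lemma continuous_times_integrable: fixes G h :: "real => real"
 assumes "continuous_on {a..b} G" "h integrable_on {a..b}" "\<And>t. t \<in> {a..b} ==> \<bar>h t\<bar> \<le> B" shows "(\<lambda>t. G t * h t) integrable_on {a..b}" proof -
 have "h absolutely_integrable_on {a..b}"
  by (rule absolutely_integrable_integrable_bound[where g = "\<lambda>_. B"]) (use assms in \<open>auto intro: integrable_const_ivl\<close>)
 moreover have "bounded (G ` {a..b})" using assms(1) compact_continuous_image compact_imp_bounded by blast
 ultimately have "(\<lambda>t. G t * h t) absolutely_integrable_on {a..b}"
  using assms(1) by (intro absolutely_integrable_bounded_measurable_product_real continuous_imp_measurable_on_sets_lebesgue) auto
 then show ?thesis by (simp add: absolutely_integrable_on_def)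
qed

lemma integral_abs_le: fixes h :: "real => real" assumes "h integrable_on {a..b}" "\<And>t. t \<in> {a..b} ==> \<bar>h t\<bar> \<le> B" "0 \<le> B" "a \<le> b"
 shows "\<bar>integral {a..b} h\<bar> \<le> B * (b - a)"
 using has_integral_bound_real[OF assms(3) finite.emptyI integrable_integral[OF assms(1)]] assms(2,4) by simp

text \<open>Polynomial approximation in y = exp(1 + t). Only exponents s > 0 have moments at hand,
  so the constant term must be avoided: G / y is approximated and then multiplied by y.\<close>

lemma exponential_approximation: fixes G :: "real => real" assumes "continuous_on {-1..C} G" "0 < e"
 obtains m a where "\<And>t. t \<in> {-1..C} ==> \<bar>G t - (\<Sum>i=1..m. a i * exp (real i * (1 + t)))\<bar> \<le> e" proof -
 let ?S = "{1..exp (1 + C)}"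
 have ln: "ln y - 1 \<in> {-1..C}" if "y \<in> ?S" for y using that ln_ge_iff[of y 0] ln_le_cancel_iff[of y "exp (1 + C)"] by auto
 have c1: "continuous_on ?S (\<lambda>y. G (ln y - 1) / y)" by (intro continuous_intros continuous_on_compose2[OF assms(1)]) (use ln in auto)
 have c2: "0 < e / exp (1 + C)" using assms(2) by simp
 obtain p where p: "real_polynomial_function p" "\<And>y. y \<in> ?S ==> \<bar>G (ln y - 1) / y - p y\<bar> < e / exp (1 + C)"
 proof (rule Stone_Weierstrass_real_polynomial_function[OF compact_Icc c1 c2])
  fix p assume "real_polynomial_function p" and "\<And>y. y \<in> ?S ==> \<bar>G (ln y - 1) / y - p y\<bar> < e / exp (1 + C)"
  then show ?thesis by (rule that)
 qed
 from p(1) obtain b n where b: "p = (\<lambda>x. \<Sum>i\<le>n. b i * x ^ i)" using real_polynomial_function_iff_sum by blast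
 show ?thesis
 proof (rule that)
  fix t assume t: "t \<in> {-1..C}"
  let ?y = "exp (1 + t)"
  have y: "?y \<in> ?S" using t by simp
  have "(\<Sum>i=1..Suc n. b (i - 1) * exp (real i * (1 + t))) = (\<Sum>i\<le>n. b i * exp (real (Suc i) * (1 + t)))"
   by (rule sum.reindex_bij_witness[of _ Suc "\<lambda>i. i - 1"]) auto
  also have "\<dots> = ?y * p ?y"
   unfolding b sum_distrib_left by (intro sum.cong refl) (simp add: exp_of_nat_mult[symmetric] exp_add[symmetric] algebra_simps)
  finally have "G t - (\<Sum>i=1..Suc n. b (i - 1) * exp (real i * (1 + t))) = ?y * (G (ln ?y - 1) / ?y - p ?y)"
   by (simp add: right_diff_distrib)
  then have "\<bar>G t - (\<Sum>i=1..Suc n. b (i - 1) * exp (real i * (1 + t)))\<bar> = ?y * \<bar>G (ln ?y - 1) / ?y - p ?y\<bar>" by (simp add: abs_mult)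
  also have "\<dots> \<le> exp (1 + C) * (e / exp (1 + C))" using p(2)[OF y] t by (intro mult_mono) auto
  finally show "\<bar>G t - (\<Sum>i=1..Suc n. b (i - 1) * exp (real i * (1 + t)))\<bar> \<le> e" by simp
 qed
qed

text \<open>Finitely many moments and one tolerance, so that a finite sum of second-moment bounds
  will control the bad event. The bound 1 fits a difference of two densities with values in
  [0, 1].\<close>

definition small_moments :: "real => nat => real => (real => real) => bool" where
 "small_moments C m d h \<longleftrightarrow> h integrable_on {-1..C} \<and> (\<forall>t\<in>{-1..C}. \<bar>h t\<bar> \<le> 1) \<and>
  (\<forall>i\<in>{1..m}. \<bar>integral {-1..C} (\<lambda>t. exp (real i * (1 + t)) * h t)\<bar> \<le> d)"

lemma small_moments_mono: "small_moments C m d h ==> m' \<le> m ==> d \<le> d' ==> small_moments C m' d' h"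
 unfolding small_moments_def by (meson atLeastAtMost_iff order_trans)

lemma continuous_small_moments: assumes G: "continuous_on {-1..C} G" and e: "0 < e" and C: "-1 \<le> C"
 obtains m d where "0 < d" "\<And>h. small_moments C m d h ==> \<bar>integral {-1..C} (\<lambda>t. G t * h t)\<bar> \<le> e" proof -
 \<comment> \<open>The approximation error over length C + 1 then costs at most e / 2; C + 2 stays
   positive even for C = -1.\<close>
 define e' where "e' = e / (2 * (C + 2))"
 have e': "0 < e'" using e C by (simp add: e'_def)
 obtain m a where a: "\<And>t. t \<in> {-1..C} ==> \<bar>G t - (\<Sum>i=1..m. a i * exp (real i * (1 + t)))\<bar> \<le> e'"
  using exponential_approximation[OF G e'] by blast
 define A where "A = 1 + (\<Sum>i=1..m. \<bar>a i\<bar>)"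
 have A: "1 \<le> A" by (simp add: A_def sum_nonneg)
 show ?thesis
 proof (rule that)
  show "0 < e / (2 * A)" using e A by simp
  fix h assume sm: "small_moments C m (e / (2 * A)) h"
  then have h: "h integrable_on {-1..C}" "\<And>t. t \<in> {-1..C} ==> \<bar>h t\<bar> \<le> 1"
   "\<And>i. i \<in> {1..m} ==> \<bar>integral {-1..C} (\<lambda>t. exp (real i * (1 + t)) * h t)\<bar> \<le> e / (2 * A)" by (auto simp: small_moments_def)
  let ?p = "\<lambda>t. \<Sum>i=1..m. a i * exp (real i * (1 + t))"
  have pc: "continuous_on {-1..C} ?p" by (intro continuous_intros)
  have i1: "(\<lambda>t. (G t - ?p t) * h t) integrable_on {-1..C}" by (rule continuous_times_integrable[OF _ h(1,2)]) (intro continuous_intros G)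
  have i2: "(\<lambda>t. exp (real i * (1 + t)) * h t) integrable_on {-1..C}" for i
   by (rule continuous_times_integrable[OF _ h(1,2)]) (intro continuous_intros)
  have b1: "\<bar>integral {-1..C} (\<lambda>t. (G t - ?p t) * h t)\<bar> \<le> e' * (C - -1)"
  proof (rule integral_abs_le[OF i1])
   fix t assume t: "t \<in> {-1..C}"
   have "\<bar>G t - ?p t\<bar> * \<bar>h t\<bar> \<le> e' * 1" using a[OF t] h(2)[OF t] by (intro mult_mono) auto
   then show "\<bar>(G t - ?p t) * h t\<bar> \<le> e'" by (simp add: abs_mult)
  qed (use e' C in auto)
  have "integral {-1..C} (\<lambda>t. ?p t * h t) = integral {-1..C} (\<lambda>t. \<Sum>i=1..m. a i * (exp (real i * (1 + t)) * h t))"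
   by (intro integral_cong) (simp add: sum_distrib_right mult.assoc)
  also have "\<dots> = (\<Sum>i=1..m. integral {-1..C} (\<lambda>t. a i * (exp (real i * (1 + t)) * h t)))"
   by (intro integral_sum integrable_on_mult_right i2) auto
  also have "\<dots> = (\<Sum>i=1..m. a i * integral {-1..C} (\<lambda>t. exp (real i * (1 + t)) * h t))" by simp
  finally have peq: "integral {-1..C} (\<lambda>t. ?p t * h t) = (\<Sum>i=1..m. a i * integral {-1..C} (\<lambda>t. exp (real i * (1 + t)) * h t))" .
  have "\<bar>integral {-1..C} (\<lambda>t. ?p t * h t)\<bar> \<le> (\<Sum>i=1..m. \<bar>a i * integral {-1..C} (\<lambda>t. exp (real i * (1 + t)) * h t)\<bar>)"
   unfolding peq by (rule sum_abs)
  also have "\<dots> \<le> (\<Sum>i=1..m. \<bar>a i\<bar> * (e / (2 * A)))" unfolding abs_mult by (intro sum_mono mult_left_mono h(3)) auto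
  also have "\<dots> \<le> A * (e / (2 * A))" unfolding sum_distrib_right[symmetric] using e A by (intro mult_right_mono) (auto simp: A_def)
  also have "\<dots> = e / 2" using A by simp
  finally have b2: "\<bar>integral {-1..C} (\<lambda>t. ?p t * h t)\<bar> \<le> e / 2" .
  have "integral {-1..C} (\<lambda>t. G t * h t) = integral {-1..C} (\<lambda>t. (G t - ?p t) * h t + ?p t * h t)"
   by (intro integral_cong) (simp add: algebra_simps)
  also have "\<dots> = integral {-1..C} (\<lambda>t. (G t - ?p t) * h t) + integral {-1..C} (\<lambda>t. ?p t * h t)"
   by (intro integral_add i1 continuous_times_integrable[OF pc h(1,2)])
  finally have Geq: "integral {-1..C} (\<lambda>t. G t * h t) = integral {-1..C} (\<lambda>t. (G t - ?p t) * h t) + integral {-1..C} (\<lambda>t. ?p t * h t)" .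
  have "C - -1 = C + 1" by simp
  then have "\<bar>integral {-1..C} (\<lambda>t. G t * h t)\<bar> \<le> e' * (C + 1) + e / 2"
   unfolding Geq using order_trans[OF abs_triangle_ineq add_mono[OF b1 b2]] by (simp only:)
  also have "e' * (C + 1) \<le> e' * (C + 2)" using e' by (intro mult_left_mono) auto
  also have "e' * (C + 2) = e / 2" using C by (simp add: e'_def field_simps)
  finally show "\<bar>integral {-1..C} (\<lambda>t. G t * h t)\<bar> \<le> e" by simp
 qed
qed

text \<open>The indicator of [-1, u] is replaced by the ramp \<open>r\<close>, which falls from 1 to
  0 on [u, u + e/2]. As |h| \<le> 1, the ramp costs at most e / 2; \<open>w\<close> cuts it off at
  C.\<close>

lemma small_moments_primitive: assumes u: "u \<in> {-1..C}" and e: "0 < e"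
 obtains m d where "0 < d" "\<And>h. small_moments C m d h ==> \<bar>integral {-1..u} h\<bar> \<le> e" proof -
 define r where "r t = max 0 (min 1 ((u + e / 2 - t) / (e / 2)))" for t
 have rc: "continuous_on A r" for A unfolding r_def using e by (intro continuous_intros) auto
 obtain m d where d: "0 < d" "\<And>h. small_moments C m d h ==> \<bar>integral {-1..C} (\<lambda>t. r t * h t)\<bar> \<le> e / 2"
 proof (rule continuous_small_moments[OF rc half_gt_zero[OF e], of C])
  show "-1 \<le> C" using u by simp
  fix m d assume "0 < d" and "\<And>h. small_moments C m d h ==> \<bar>integral {-1..C} (\<lambda>t. r t * h t)\<bar> \<le> e / 2"
  then show ?thesis by (rule that)
 qed
 show ?thesis
 proof (rule that[OF d(1)])
  fix h assume sm: "small_moments C m d h"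
  then have h: "h integrable_on {-1..C}" "\<And>t. t \<in> {-1..C} ==> \<bar>h t\<bar> \<le> 1" by (auto simp: small_moments_def)
  define w where "w = min (u + e / 2) C"
  have w: "u \<le> w" "w \<le> C" "w - u \<le> e / 2" using u e by (auto simp: w_def min_def)
  have i: "(\<lambda>t. r t * h t) integrable_on {-1..C}" by (rule continuous_times_integrable[OF rc h(1,2)])
  have "integral {-1..C} (\<lambda>t. r t * h t) = integral {-1..u} (\<lambda>t. r t * h t) + integral {u..C} (\<lambda>t. r t * h t)"
   using Henstock_Kurzweil_Integration.integral_combine[OF _ _ i, of u] u by auto
  also have "integral {u..C} (\<lambda>t. r t * h t) = integral {u..w} (\<lambda>t. r t * h t) + integral {w..C} (\<lambda>t. r t * h t)"
   by (rule Henstock_Kurzweil_Integration.integral_combine[symmetric]) (use w u in \<open>auto intro: integrable_on_subinterval[OF i]\<close>)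
  also have "integral {w..C} (\<lambda>t. r t * h t) = integral {w..C} (\<lambda>_. 0 :: real)"
  proof (rule integral_spike[of "{w}"])
   fix t assume "t \<in> {w..C} - {w}"
   then have "u + e / 2 - t \<le> 0" by (auto simp: w_def min_def split: if_splits)
   then have "(u + e / 2 - t) / (e / 2) \<le> 0" using e by (simp add: divide_nonpos_pos)
   then have "r t = 0" unfolding r_def by (simp add: max_def)
   then show "0 = r t * h t" by simp
  qed simp
  also have "integral {-1..u} (\<lambda>t. r t * h t) = integral {-1..u} h"
  proof (rule integral_cong)
   fix t assume "t \<in> {-1..u}"
   then have "1 \<le> (u + e / 2 - t) / (e / 2)" using e by (simp add: le_divide_eq)
   then have "r t = 1" by (simp add: r_def)
   then show "r t * h t = h t" by simp
  qed
  finally have eq: "integral {-1..u} h = integral {-1..C} (\<lambda>t. r t * h t) - integral {u..w} (\<lambda>t. r t * h t)" by simp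
  have "\<bar>integral {u..w} (\<lambda>t. r t * h t)\<bar> \<le> 1 * (w - u)"
  proof (rule integral_abs_le)
   show "(\<lambda>t. r t * h t) integrable_on {u..w}" by (rule integrable_on_subinterval[OF i]) (use u w in auto)
   fix t assume t: "t \<in> {u..w}"
   then have "\<bar>h t\<bar> \<le> 1" using u w by (intro h(2)) auto
   moreover have "\<bar>r t\<bar> \<le> 1" by (auto simp: r_def)
   ultimately have "\<bar>r t\<bar> * \<bar>h t\<bar> \<le> 1 * 1" by (intro mult_mono) auto
   then show "\<bar>r t * h t\<bar> \<le> 1" by (simp add: abs_mult)
  qed (use w in auto)
  from order_trans[OF abs_triangle_ineq4 add_mono[OF d(2)[OF sm] this]]
  have "\<bar>integral {-1..u} h\<bar> \<le> e / 2 + 1 * (w - u)" unfolding eq .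
  then show "\<bar>integral {-1..u} h\<bar> \<le> e" using w(3) by simp
 qed
qed

lemma abs_le_via: "\<bar>a - b\<bar> \<le> d ==> \<bar>b\<bar> \<le> x ==> \<bar>a\<bar> \<le> x + (d :: real)" by linarith

text \<open>Primitives of functions bounded by 1 are 1-Lipschitz, so smallness on a finite net of
  points u suffices, with the largest moment number and the least tolerance of the net.\<close>

lemma small_moments_uniform: assumes C: "-1 \<le> C" and e: "0 < e"
 obtains m d where "0 < d" "\<And>h u. small_moments C m d h ==> u \<in> {-1..C} ==> \<bar>integral {-1..u} h\<bar> \<le> e" proof -
 have "\<exists>m d. 0 < d \<and> (\<forall>h. small_moments C m d h \<longrightarrow> \<bar>integral {-1..u} h\<bar> \<le> e / 2)" if u: "u \<in> {-1..C}" for u proof -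
  show ?thesis
  proof (rule small_moments_primitive[OF u half_gt_zero[OF e]])
   fix m d assume "0 < d" and "\<And>h. small_moments C m d h ==> \<bar>integral {-1..u} h\<bar> \<le> e / 2"
   then show ?thesis by blast
  qed
 qed
 then obtain m d where md: "\<And>u. u \<in> {-1..C} ==> 0 < d u"
  "\<And>u h. u \<in> {-1..C} ==> small_moments C (m u) (d u) h ==> \<bar>integral {-1..u} h\<bar> \<le> e / 2" by metis
 have cov: "{-1..C} \<subseteq> (\<Union>u\<in>{-1..C}. ball u (e / 2))" using e by auto
 obtain U where U: "U \<subseteq> {-1..C}" "finite U" "{-1..C} \<subseteq> (\<Union>u\<in>U. ball u (e / 2))" by (rule compactE_image[OF compact_Icc _ cov]) auto
 have ne: "U \<noteq> {}" using U(3) C by auto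
 define m0 where "m0 = Max (m ` U)"
 define d0 where "d0 = Min (d ` U)"
 show ?thesis
 proof (rule that)
  show "0 < d0" using ne U md(1) by (auto simp: d0_def)
  fix h u assume sm: "small_moments C m0 d0 h" and u: "u \<in> {-1..C}"
  obtain v where v: "v \<in> U" "\<bar>v - u\<bar> < e / 2" using U(3) u by (auto simp: dist_real_def)
  have "small_moments C (m v) (d v) h" by (rule small_moments_mono[OF sm]) (use v U(2) in \<open>auto simp: m0_def d0_def\<close>)
  then have 1: "\<bar>integral {-1..v} h\<bar> \<le> e / 2" using md(2)[of v h] v(1) U(1) by auto
  have h: "h integrable_on {-1..C}" "\<And>t. t \<in> {-1..C} ==> \<bar>h t\<bar> \<le> 1" using sm by (auto simp: small_moments_def)
  have step: "\<bar>integral {-1..y} h - integral {-1..x} h\<bar> \<le> y - x" if "x \<in> {-1..C}" "y \<in> {-1..C}" "x \<le> y" for x y proof -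
   have eq: "integral {-1..x} h + integral {x..y} h = integral {-1..y} h" by (rule Henstock_Kurzweil_Integration.integral_combine)
      (use that in \<open>auto intro: integrable_on_subinterval[OF h(1)]\<close>)
   have "\<bar>integral {x..y} h\<bar> \<le> 1 * (y - x)" by (rule integral_abs_le) (use that h(2) in \<open>auto intro: integrable_on_subinterval[OF h(1)]\<close>)
   then show ?thesis unfolding eq[symmetric] by simp
  qed
  have 2: "\<bar>integral {-1..u} h - integral {-1..v} h\<bar> \<le> \<bar>v - u\<bar>" using step[of u v] step[of v u] u v(1) U(1) by (cases "u \<le> v") auto
  then show "\<bar>integral {-1..u} h\<bar> \<le> e" using abs_le_via[OF 2 1] v(2) by simp
 qed
qed

section \<open>The particle density of a diagram and probabilities from moments\<close>

definition pd :: "nat => (nat \<times> nat) set => real => real" where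
 "pd n D t = (if \<exists>i\<in>{1..n}. (particle D i - 1/2) / real n < t \<and> t < (particle D i + 1/2) / real n then 1 else 0)"

lemma rotated_boundary_eq: "rotated_boundary n D u = 1 + integral {-1..u} (\<lambda>t. 1 - 2 * pd n D t)"
 unfolding rotated_boundary_def pd_def by (intro arg_cong[where f = "\<lambda>x. 1 + x"] integral_cong) simp

definition lpt :: "nat => (nat => nat) => nat => real" where
 "lpt n lam i = (real (lam i) - real i) / real n"

text \<open>\<open>lam i - i\<close> strictly decreases in i, so the unit intervals of different
  particles meet at most in end points, and these are excluded.\<close>

lemma pd_eq_sum: assumes n: "0 < n" and lam: "lam \<in> parts n k" and t: "t \<notin> (\<Union>i\<in>{1..n}. {lpt n lam i, lpt n lam i + 1 / real n})"
 shows "pd n (dgm n lam) t = (\<Sum>i=1..n. if t \<in> {lpt n lam i..lpt n lam i + 1 / real n} then 1 else 0)" proof -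
 have iv: "(particle (dgm n lam) i - 1/2) / real n < t \<and> t < (particle (dgm n lam) i + 1/2) / real n \<longleftrightarrow>
   t \<in> {lpt n lam i..lpt n lam i + 1 / real n}" if "i \<in> {1..n}" for i proof -
  have "t \<noteq> lpt n lam i" "t \<noteq> lpt n lam i + 1 / real n" using t that by auto
  moreover have "(particle (dgm n lam) i - 1/2) / real n = lpt n lam i"
   "(particle (dgm n lam) i + 1/2) / real n = lpt n lam i + 1 / real n"
   using that row_length_dgm[of i n lam] by (simp_all add: particle_def lpt_def add_divide_distrib diff_divide_distrib)
  ultimately show ?thesis by (auto simp: order.order_iff_strict)
 qed
 have disj: False
  if ij: "i \<in> {1..n}" "j \<in> {1..n}" "i < j" "t \<in> {lpt n lam i..lpt n lam i + 1 / real n}"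
   "t \<in> {lpt n lam j..lpt n lam j + 1 / real n}" for i j proof -
  have "lam j \<le> lam i" using lam ij by (auto simp: parts_def intro: decrD)
  then have "real (lam j) - real j + 1 \<le> real (lam i) - real i" using ij(3) by simp
  then have "lpt n lam j + 1 / real n \<le> lpt n lam i"
   unfolding lpt_def add_divide_distrib[symmetric] using n by (intro divide_right_mono) auto
  then have "t = lpt n lam i" using ij(4,5) by auto
  then show False using t ij(1) by auto
 qed
 show ?thesis
 proof (cases "\<exists>i\<in>{1..n}. t \<in> {lpt n lam i..lpt n lam i + 1 / real n}")
  case True
  then obtain i where i: "i \<in> {1..n}" "t \<in> {lpt n lam i..lpt n lam i + 1 / real n}" by blast
  have "(if t \<in> {lpt n lam j..lpt n lam j + 1 / real n} then 1 else 0) = (if j = i then 1 else 0 :: real)" if "j \<in> {1..n}" for j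
   using disj[of i j] disj[of j i] i that by (cases i j rule: linorder_cases) auto
  then have "(\<Sum>j=1..n. if t \<in> {lpt n lam j..lpt n lam j + 1 / real n} then 1 else 0) = (\<Sum>j=1..n. if j = i then 1 else 0 :: real)"
   by (intro sum.cong) auto
  also have "\<dots> = 1" using i(1) by simp
  finally show ?thesis using True iv unfolding pd_def by (simp cong: bex_cong)
 next
  case False
  then have "pd n (dgm n lam) t = 0" unfolding pd_def using iv by (simp cong: bex_cong)
  moreover have "(\<Sum>j=1..n. if t \<in> {lpt n lam j..lpt n lam j + 1 / real n} then 1 else 0) = (0 :: real)"
   using False by (intro sum.neutral) auto
  ultimately show ?thesis by simp
 qed
qed

lemma pd_has_integral: assumes n: "0 < n" and lam: "lam \<in> parts n k" and C: "real k / real n \<le> C"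
  and F: "\<And>t. (F has_real_derivative F' t) (at t)"
 shows "((\<lambda>t. F' t * pd n (dgm n lam) t) has_integral (\<Sum>i=1..n. F (lpt n lam i + 1 / real n) - F (lpt n lam i))) {-1..C}" proof -
 let ?S = "\<Union>i\<in>{1..n}. {lpt n lam i, lpt n lam i + 1 / real n}"
 have "((\<lambda>t. \<Sum>i=1..n. if t \<in> {lpt n lam i..lpt n lam i + 1 / real n} then F' t else 0) has_integral
   (\<Sum>i=1..n. F (lpt n lam i + 1 / real n) - F (lpt n lam i))) {-1..C}"
 proof (rule has_integral_sum)
  fix i assume i: "i \<in> {1..n}"
  let ?I = "{lpt n lam i..lpt n lam i + 1 / real n}"
  have "lam i \<le> k" using lam i by (auto simp: parts_def)
  then have "real (lam i) - real i + 1 \<le> real k" using i by simp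
  then have "(real (lam i) - real i + 1) / real n \<le> real k / real n" by (intro divide_right_mono) auto
  then have "lpt n lam i + 1 / real n \<le> C" using C by (simp add: lpt_def add_divide_distrib)
  moreover have "- 1 \<le> lpt n lam i" proof -
   have "- real n / real n \<le> (real (lam i) - real i) / real n" using i by (intro divide_right_mono) auto
   then show ?thesis using n by (simp add: lpt_def)
  qed
  ultimately have sub: "?I \<subseteq> {-1..C}" by auto
  have "(F' has_integral (F (lpt n lam i + 1 / real n) - F (lpt n lam i))) ?I" by (intro fundamental_theorem_of_calculus)
     (auto simp: has_real_derivative_iff_has_vector_derivative[symmetric] intro: has_field_derivative_at_within[OF F])
  then show "((\<lambda>t. if t \<in> ?I then F' t else 0) has_integral (F (lpt n lam i + 1 / real n) - F (lpt n lam i))) {-1..C}"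
   using has_integral_restrict[OF sub] by blast
 qed simp
 then show ?thesis
 proof (rule has_integral_spike_finite[where S = ?S, rotated 2])
  fix t assume "t \<in> {-1..C} - ?S"
  then have "F' t * pd n (dgm n lam) t = (\<Sum>i=1..n. F' t * (if t \<in> {lpt n lam i..lpt n lam i + 1 / real n} then 1 else 0))"
   unfolding sum_distrib_left[symmetric] using pd_eq_sum[OF n lam, of t] by simp
  also have "\<dots> = (\<Sum>i=1..n. if t \<in> {lpt n lam i..lpt n lam i + 1 / real n} then F' t else 0)" by (intro sum.cong) auto
  finally show "F' t * pd n (dgm n lam) t = (\<Sum>i=1..n. if t \<in> {lpt n lam i..lpt n lam i + 1 / real n} then F' t else 0)" .
 qed simp
qed

lemma pd_integrable: assumes "0 < n" "lam \<in> parts n k" "real k / real n \<le> C" shows "pd n (dgm n lam) integrable_on {-1..C}"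
 using pd_has_integral[OF assms DERIV_ident] by (auto simp: integrable_on_def)

lemma pd_exp_moment: assumes n: "0 < n" and lam: "lam \<in> parts n k" and C: "real k / real n \<le> C"
 shows "((\<lambda>t. s * exp (s * (1 + t)) * pd n (dgm n lam) t) has_integral (Yq n (exp (s / real n)) lam - 1)) {-1..C}" proof -
 have "((\<lambda>t. exp (s * (1 + t))) has_real_derivative s * exp (s * (1 + t))) (at t)" for t by (auto intro!: derivative_eq_intros)
 from pd_has_integral[OF n lam C this]
 have "((\<lambda>t. s * exp (s * (1 + t)) * pd n (dgm n lam) t) has_integral
   (\<Sum>i=1..n. exp (s * (1 + (lpt n lam i + 1 / real n))) - exp (s * (1 + lpt n lam i)))) {-1..C}" .
 moreover have "exp (s * (1 + (lpt n lam i + 1 / real n))) - exp (s * (1 + lpt n lam i)) =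
   (exp (s / real n) - 1) * exp (s / real n) ^ (lam i + n - i)" if "i \<in> {1..n}" for i proof -
  have l: "s * (1 + lpt n lam i) = real (lam i + n - i) * (s / real n)" using that n by (simp add: lpt_def of_nat_diff field_simps)
  have l': "s * (1 + (lpt n lam i + 1 / real n)) = s * (1 + lpt n lam i) + s / real n" by (simp add: algebra_simps)
  show ?thesis unfolding l' l exp_add exp_of_nat_mult by (simp only: left_diff_distrib mult_1_left mult.commute)
 qed
 ultimately show ?thesis by (simp add: Yq_def Sq_def sum_distrib_left)
qed

lemma schur_nonneg: assumes "\<And>i. i \<in> {1..n} ==> 0 \<le> x i" shows "0 \<le> schur D n x" unfolding schur_def
proof (intro sum_nonneg prod_nonneg)
 fix T b assume "T \<in> ssyt D n" "b \<in> D"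
 then have "T b \<in> {1..n}" by (auto simp: ssyt_def)
 then show "0 \<le> x (T b)" by (rule assms)
qed

lemma mu_weight_dgm:
 "mu_weight f g n k (dgm n lam) =
  wt n k (\<lambda>i. f (real i / real n)) (\<lambda>j. g (real j / real k)) lam /
   Zf n k (\<lambda>i. f (real i / real n)) (\<lambda>j. g (real j / real k))" by (simp add: mu_weight_def wt_def Zf_def Let_def)

text \<open>Markov's inequality with a union bound: on each bad diagram at least one of the
  nonnegative functions reaches 1.\<close>

lemma measure_mu_le: assumes f: "\<And>s. s \<in> {0..1} ==> 0 \<le> f s" and g: "\<And>s. s \<in> {0..1} ==> 0 \<le> g s" and A: "A \<subseteq> young_diagrams n k"
  and S: "finite S" and F: "\<And>s lam. s \<in> S ==> 0 \<le> F s lam" and bad: "\<And>lam. lam \<in> parts n k ==> dgm n lam \<in> A ==> \<exists>s\<in>S. 1 \<le> F s lam"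
 shows "measure (mu f g n k) A \<le> (\<Sum>s\<in>S. EE n k (\<lambda>i. f (real i / real n)) (\<lambda>j. g (real j / real k)) (F s))" proof -
 let ?x = "\<lambda>i. f (real i / real n)" and ?y = "\<lambda>j. g (real j / real k)"
 let ?w = "\<lambda>lam. wt n k ?x ?y lam / Zf n k ?x ?y"
 have x: "0 \<le> ?x i" if "i \<in> {1..n}" for i using that by (intro f) (auto simp: divide_le_eq_1)
 have y: "0 \<le> ?y j" if "j \<in> {1..k}" for j using that by (intro g) (auto simp: divide_le_eq_1)
 have w0: "0 \<le> ?w lam" for lam using Zf_pos[of n ?x k ?y] x y schur_nonneg[of n ?x] schur_nonneg[of k ?y] by (simp add: wt_def)
 define B where "B = {lam \<in> parts n k. dgm n lam \<in> A}"
 have img: "young_diagrams n k = dgm n ` parts n k" using bij_betw_dgm_parts by (simp add: bij_betw_def)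
 have fin: "finite (young_diagrams n k)" unfolding img by simp
 have AB: "A = dgm n ` B" using A unfolding img B_def by auto
 have inj: "inj_on (dgm n) B" using bij_betw_dgm_parts[of n k] unfolding bij_betw_def by (auto simp: B_def intro: inj_on_subset)
 have "emeasure (mu f g n k) A = (\<Sum>D\<in>A. ennreal (mu_weight f g n k D))" unfolding mu_def by (rule emeasure_point_measure_finite[OF fin A])
 also have "\<dots> = (\<Sum>lam\<in>B. ennreal (?w lam))" unfolding AB by (subst sum.reindex[OF inj]) (simp add: mu_weight_dgm)
 also have "\<dots> = ennreal (\<Sum>lam\<in>B. ?w lam)" by (rule sum_ennreal) (rule w0)
 finally have "measure (mu f g n k) A = (\<Sum>lam\<in>B. ?w lam)" unfolding measure_def by (simp add: sum_nonneg w0)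
 also have "\<dots> \<le> (\<Sum>lam\<in>B. ?w lam * (\<Sum>s\<in>S. F s lam))"
 proof (rule sum_mono)
  fix lam assume "lam \<in> B"
  then obtain s where s: "s \<in> S" "1 \<le> F s lam" using bad by (auto simp: B_def)
  have "1 \<le> (\<Sum>s\<in>S. F s lam)" using s F member_le_sum[OF s(1), of "\<lambda>s. F s lam"] S by fastforce
  then show "?w lam \<le> ?w lam * (\<Sum>s\<in>S. F s lam)" using mult_left_mono[OF _ w0, of 1] by simp
 qed
 also have "\<dots> \<le> (\<Sum>lam\<in>parts n k. ?w lam * (\<Sum>s\<in>S. F s lam))"
 proof (rule sum_mono2)
  show "0 \<le> ?w lam * (\<Sum>s\<in>S. F s lam)" for lam by (intro mult_nonneg_nonneg w0 sum_nonneg F)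
 qed (auto simp: B_def)
 also have "\<dots> = (\<Sum>s\<in>S. EE n k ?x ?y (F s))" unfolding EE_def sum_distrib_left sum_divide_distrib by (subst sum.swap) simp
 finally show ?thesis .
qed

lemma (in pfun) pos_mass_le_1: "pos_mass f \<le> 1" proof -
 have "pos_mass f \<le> integral {0..1::real} (\<lambda>_. 1)"
  unfolding pos_mass_def by (intro integral_le pos_mass_integrable integrable_const_ivl) auto
 then show ?thesis by simp
qed

lemma EE_mono: assumes x: "\<And>i. i \<in> {1..n} ==> 0 \<le> x i" and y: "\<And>j. j \<in> {1..k} ==> 0 \<le> y j" and FG: "\<And>lam. lam \<in> parts n k ==> F lam \<le> G lam"
 shows "EE n k x y F \<le> EE n k x y G" unfolding EE_def
proof (intro divide_right_mono sum_mono mult_left_mono FG)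
 show "0 \<le> wt n k x y lam" for lam using x y schur_nonneg[of n x] schur_nonneg[of k y] by (simp add: wt_def)
 show "0 \<le> Zf n k x y" using Zf_pos[of n x k y] x y by (simp add: less_imp_le)
qed

lemma Yq_bounds: assumes q: "1 \<le> q" and lam: "lam \<in> parts n k"
 shows "1 + real n * (q - 1) \<le> Yq n q lam" "Yq n q lam \<le> 1 + real n * (q - 1) * q ^ (n + k)" proof -
 have "(\<Sum>j=1..n. 1) \<le> Sq n q lam" unfolding Sq_def by (intro sum_mono one_le_power q)
 from mult_left_mono[OF this, of "q - 1"] q show "1 + real n * (q - 1) \<le> Yq n q lam" by (simp add: Yq_def mult.commute)
 have "Sq n q lam \<le> (\<Sum>j=1..n. q ^ (n + k))" unfolding Sq_def
 proof (intro sum_mono power_increasing q)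
  fix j assume "j \<in> {1..n}"
  then have "lam j \<le> k" using lam by (auto simp: parts_def)
  then show "lam j + n - j \<le> n + k" by simp
 qed
 from mult_left_mono[OF this, of "q - 1"] q show "Yq n q lam \<le> 1 + real n * (q - 1) * q ^ (n + k)" by (simp add: Yq_def mult_ac)
qed

text \<open>Crude deterministic bounds on \<open>Yq\<close> passed to the limit. They will determine
  the total mass of the limiting density as s tends to 0.\<close>

lemma (in scaled_pair) LL_bounds: "s \<le> LL - 1" "LL - 1 \<le> s * exp (s * (1 + c))" proof -
 let ?E = "\<lambda>n. EE n (k n) (xx n) (yy n)"
 have x: "0 \<le> xx n i" if "i \<in> {1..n}" for n i using xx_bounds[OF that] by simp
 have y: "0 \<le> yy n j" if "j \<in> {1..k n}" for n j using yy_bounds[OF that] by simp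
 have q: "1 \<le> qq n" for n using s by simp
 have const: "?E n (\<lambda>_. b) = b" for n b using EE_cmult[of n "k n" "xx n" "yy n" b "\<lambda>_. 1"] EE_one[of n "xx n" "k n" "yy n"] x y by simp
 have lo: "1 + real n * (qq n - 1) \<le> ?E n (Yq n (qq n))" for n
  using EE_mono[of n "xx n" "k n" "yy n" "\<lambda>_. 1 + real n * (qq n - 1)" "Yq n (qq n)"] x y Yq_bounds(1)[OF q] by (simp only: const)
 have hi: "?E n (Yq n (qq n)) \<le> 1 + real n * (qq n - 1) * qq n ^ (n + k n)" for n
  using EE_mono[of n "xx n" "k n" "yy n" "Yq n (qq n)" "\<lambda>_. 1 + real n * (qq n - 1) * qq n ^ (n + k n)"] x y Yq_bounds(2)[OF q]
  by (simp only: const)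
 have "(\<lambda>n. 1 + real n * (qq n - 1)) \<longlonglongrightarrow> 1 + s" by (intro tendsto_intros nq_tendsto)
 then have "1 + s \<le> LL" by (rule LIMSEQ_le[OF _ EE_Yq_tendsto]) (use lo in blast)
 then show "s \<le> LL - 1" by simp
 have "(\<lambda>n. exp (s * (1 + real (k n) / real n))) \<longlonglongrightarrow> exp (s * (1 + c))" by (intro tendsto_intros k)
 then have "(\<lambda>n. qq n ^ (n + k n)) \<longlonglongrightarrow> exp (s * (1 + c))"
 proof (rule Lim_transform_eventually)
  show "eventually (\<lambda>n. exp (s * (1 + real (k n) / real n)) = qq n ^ (n + k n)) sequentially"
   by (rule eventually_sequentiallyI[of 1]) (simp add: exp_of_nat_mult[symmetric] field_simps)
 qed
 then have "(\<lambda>n. 1 + real n * (qq n - 1) * qq n ^ (n + k n)) \<longlonglongrightarrow> 1 + s * exp (s * (1 + c))" by (intro tendsto_intros nq_tendsto)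
 then have "LL \<le> 1 + s * exp (s * (1 + c))" by (rule LIMSEQ_le[OF EE_Yq_tendsto]) (use hi in blast)
 then show "LL - 1 \<le> s * exp (s * (1 + c))" by simp
qed

section \<open>The limiting density and convergence of the boundary\<close>

locale limit_pair = fgpair f P K M g Q L N c for f P K M g Q L N c + assumes fpos: "pos_mass f = 1"
begin

text \<open>The range of G on the curve starts at -1, as \<open>pos_mass f = 1\<close>, and ends at
  \<open>c * pos_mass g\<close>. If \<open>g\<close> vanishes on a set of positive measure this lies
  below \<open>c\<close>, and the density is 0 beyond it.\<close>

definition rho :: "real => real" where
 "rho t = (if t \<in> {-1..c * pos_mass g} then th (XX t) / pi else 0)"

lemma c'_bounds: "0 \<le> c * pos_mass g" "c * pos_mass g \<le> c" using cpos G.pos_mass_nonneg G.pos_mass_le_1 by (auto simp: mult_left_le)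

lemma rho_range: "0 \<le> rho t" "rho t \<le> 1" using Th_range[of "XX t"] by (auto simp: rho_def)

lemma exponential_limit: assumes k: "(\<lambda>n. real (k n) / real n) \<longlonglongrightarrow> c" and s: "0 < s" and C: "c \<le> C"
 shows "\<exists>l. ((\<lambda>t. s * exp (s * (1 + t)) * rho t) has_integral (l - 1)) {-1..C} \<and>
  (\<lambda>n. EE n (k n) (\<lambda>i. f (real i / real n)) (\<lambda>j. g (real j / real (k n)))
   (\<lambda>lam. (Yq n (exp (s / real n)) lam - l)\<^sup>2)) \<longlonglongrightarrow> 0 \<and>
  s \<le> l - 1 \<and> l - 1 \<le> s * exp (s * (1 + c))" proof -
 interpret S: scaled_pair f P K M g Q L N c k s "1 / (8 * N)" by unfold_locales (use k s G.Mpos in auto)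
 let ?h = "\<lambda>t. th (XX t) * (s * exp (s * (1 + t)))"
 have "(?h has_integral (pi * (S.LL - 1))) {-1..c * pos_mass g}" using integrable_integral[OF S.LL_eq_CI(2)] by (simp add: S.LL_def fpos)
 from has_integral_mult_right[OF this, of "1 / pi"]
 have I: "((\<lambda>t. s * exp (s * (1 + t)) * (th (XX t) / pi)) has_integral (S.LL - 1)) {-1..c * pos_mass g}" by (simp add: mult_ac)
 have sub: "{-1..c * pos_mass g} \<subseteq> {-1..C}" using c'_bounds C by auto
 have "((\<lambda>t. if t \<in> {-1..c * pos_mass g} then s * exp (s * (1 + t)) * (th (XX t) / pi) else 0) has_integral (S.LL - 1)) {-1..C}"
  unfolding has_integral_restrict[OF sub] by (rule I)
 moreover have "(\<lambda>t. if t \<in> {-1..c * pos_mass g} then s * exp (s * (1 + t)) * (th (XX t) / pi) else 0) =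
   (\<lambda>t. s * exp (s * (1 + t)) * rho t)" by (auto simp: rho_def)
 ultimately show ?thesis using S.EE_square_deviation_tendsto S.LL_bounds by (intro exI[of _ S.LL]) simp
qed

text \<open>A concrete admissible sequence of widths, so that properties of \<open>rho\<close> can
  be read off from the moments without a given k.\<close>

lemma floor_tendsto: "(\<lambda>n. real (nat \<lfloor>c * real n\<rfloor>) / real n) \<longlonglongrightarrow> c"
proof (rule tendsto_sandwich[of "\<lambda>n. c - 1 / real n" _ _ "\<lambda>_. c"])
 have r: "real (nat \<lfloor>c * real n\<rfloor>) = of_int \<lfloor>c * real n\<rfloor>" for n using cpos by simp
 show "eventually (\<lambda>n. c - 1 / real n \<le> real (nat \<lfloor>c * real n\<rfloor>) / real n) sequentially"
 proof (rule eventually_sequentiallyI[of 1])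
  fix n :: nat assume "1 \<le> n"
  have "c * real n - 1 \<le> of_int \<lfloor>c * real n\<rfloor>" by linarith
  then have "(c * real n - 1) / real n \<le> of_int \<lfloor>c * real n\<rfloor> / real n" by (rule divide_right_mono) simp
  then show "c - 1 / real n \<le> real (nat \<lfloor>c * real n\<rfloor>) / real n" unfolding r using \<open>1 \<le> n\<close> by (simp add: diff_divide_distrib)
 qed
 show "eventually (\<lambda>n. real (nat \<lfloor>c * real n\<rfloor>) / real n \<le> c) sequentially"
 proof (rule eventually_sequentiallyI[of 1])
  fix n :: nat assume "1 \<le> n"
  have "of_int \<lfloor>c * real n\<rfloor> / real n \<le> c * real n / real n" by (intro divide_right_mono) auto
  then show "real (nat \<lfloor>c * real n\<rfloor>) / real n \<le> c" unfolding r using \<open>1 \<le> n\<close> by simp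
 qed
 have "(\<lambda>n. c - 1 / real n) \<longlonglongrightarrow> c - 0" by (intro tendsto_intros lim_const_over_n)
 then show "(\<lambda>n. c - 1 / real n) \<longlonglongrightarrow> c" by simp
qed simp

text \<open>Integrability is inherited from the exponential moment with s = 1 by multiplying with a
  continuous function.\<close>

lemma rho_integrable: assumes C: "c \<le> C" shows "rho integrable_on {-1..C}" proof -
 obtain l where "((\<lambda>t. 1 * exp (1 * (1 + t)) * rho t) has_integral (l - 1)) {-1..C}"
  using exponential_limit[where k = "\<lambda>n. nat \<lfloor>c * real n\<rfloor>" and s = 1 and C = C] floor_tendsto C by auto
 then have i: "(\<lambda>t. exp (1 + t) * rho t) integrable_on {-1..C}" by (auto simp: integrable_on_def)
 have "(\<lambda>t. exp (- (1 + t)) * (exp (1 + t) * rho t)) integrable_on {-1..C}"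
 proof (rule continuous_times_integrable[OF _ i])
  show "\<bar>exp (1 + t) * rho t\<bar> \<le> exp (1 + C)" if "t \<in> {-1..C}" for t proof -
   have "exp (1 + t) * rho t \<le> exp (1 + C) * 1" using that rho_range[of t] by (intro mult_mono) auto
   then show ?thesis using rho_range[of t] by simp
  qed
 qed (intro continuous_intros)
 moreover have "exp (- (1 + t)) * (exp (1 + t) * rho t) = rho t" for t
  by (simp add: mult.assoc[symmetric] exp_add[symmetric] del: minus_add_distrib)
 ultimately show ?thesis by (simp only:)
qed

text \<open>Only moments with s > 0 are available; the bounds of \<open>LL_bounds\<close> squeeze
  the mass between exp(-s (1 + c)) and exp(s (1 + c)) as s tends to 0.\<close>

lemma integral_rho: "integral {-1..c} rho = 1" proof -
 let ?I = "integral {-1..c} rho"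
 note i = rho_integrable[OF order_refl]
 have b: "?I \<le> exp (s * (1 + c))" "1 \<le> exp (s * (1 + c)) * ?I" if s: "0 < s" for s proof -
  obtain l where l: "((\<lambda>t. s * exp (s * (1 + t)) * rho t) has_integral (l - 1)) {-1..c}"
   "s \<le> l - 1" "l - 1 \<le> s * exp (s * (1 + c))"
   using exponential_limit[where k = "\<lambda>n. nat \<lfloor>c * real n\<rfloor>" and s = s and C = c] floor_tendsto s by auto
  have "s * ?I \<le> l - 1"
  proof (rule has_integral_le[OF has_integral_mult_right[OF integrable_integral[OF i]] l(1)])
   fix t assume "t \<in> {-1..c}"
   then have "1 * rho t \<le> exp (s * (1 + t)) * rho t" using s rho_range(1)[of t] by (intro mult_right_mono) auto
   then show "s * rho t \<le> s * exp (s * (1 + t)) * rho t" using s by (simp add: mult.assoc)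
  qed
  then have "s * ?I \<le> s * exp (s * (1 + c))" using l(3) by linarith
  then show "?I \<le> exp (s * (1 + c))" using s by simp
  have "l - 1 \<le> s * exp (s * (1 + c)) * ?I"
  proof (rule has_integral_le[OF l(1) has_integral_mult_right[OF integrable_integral[OF i]]])
   fix t assume "t \<in> {-1..c}"
   then show "s * exp (s * (1 + t)) * rho t \<le> s * exp (s * (1 + c)) * rho t" using s rho_range(1)[of t] by (intro mult_right_mono) auto
  qed
  then have "s * 1 \<le> s * (exp (s * (1 + c)) * ?I)" using l(2) by (simp add: mult.assoc)
  then show "1 \<le> exp (s * (1 + c)) * ?I" using s by simp
 qed
 have "((\<lambda>s. exp (s * (1 + c))) \<longlongrightarrow> exp (0 * (1 + c))) (at_right 0)" by (intro tendsto_intros)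
 then have lim: "((\<lambda>s. exp (s * (1 + c))) \<longlongrightarrow> 1) (at_right 0)" by simp
 have ev: "eventually (\<lambda>s::real. 0 < s) (at_right 0)" by (rule eventually_at_right_less)
 have "?I \<le> 1" by (rule tendsto_lowerbound[OF lim]) (use ev in \<open>auto elim!: eventually_mono intro: b(1)\<close>)
 moreover have "1 \<le> 1 * ?I"
  by (rule tendsto_lowerbound[OF tendsto_mult_right[OF lim]]) (use ev in \<open>auto elim!: eventually_mono intro: b(2)\<close>)
 ultimately show ?thesis by simp
qed

theorem boundary_tendsto: assumes k: "(\<lambda>n. real (k n) / real n) \<longlonglongrightarrow> c" and e: "0 < e"
  and Om: "\<And>u. u \<in> {-1..c} ==> Om u = 1 + integral {-1..u} (\<lambda>t. 1 - 2 * rho t)" shows "(\<lambda>n. measure (mu f g n (k n))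
      {D \<in> young_diagrams n (k n). (SUP u\<in>{-1..c}. \<bar>rotated_boundary n D u - Om u\<bar>) > e}) \<longlonglongrightarrow> 0" proof -
 \<comment> \<open>k / n may exceed c while tending to it; the larger interval eventually contains
   all particles.\<close>
 define C where "C = c + 1"
 have C: "c \<le> C" "-1 \<le> C" "0 < C" using cpos by (auto simp: C_def)
 \<comment> \<open>Half of e, because the boundary minus the limit shape is -2 times the primitive
   of the density difference.\<close>
 obtain m d where d: "0 < d" and md: "\<And>h u. small_moments C m d h ==> u \<in> {-1..C} ==> \<bar>integral {-1..u} h\<bar> \<le> e / 2"
 proof (rule small_moments_uniform[OF C(2) half_gt_zero[OF e]])
  fix m d assume "0 < d" and "\<And>h u. small_moments C m d h ==> u \<in> {-1..C} ==> \<bar>integral {-1..u} h\<bar> \<le> e / 2"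
  then show ?thesis by (rule that)
 qed
 have "\<forall>s\<in>{1..m}. \<exists>l. ((\<lambda>t. real s * exp (real s * (1 + t)) * rho t) has_integral (l - 1)) {-1..C} \<and>
  (\<lambda>n. EE n (k n) (\<lambda>i. f (real i / real n)) (\<lambda>j. g (real j / real (k n)))
   (\<lambda>lam. (Yq n (exp (real s / real n)) lam - l)\<^sup>2)) \<longlonglongrightarrow> 0"
 proof
  fix i assume "i \<in> {1..m}"
  then have "0 < real i" by simp
  from exponential_limit[OF k this C(1)]
  show "\<exists>l. ((\<lambda>t. real i * exp (real i * (1 + t)) * rho t) has_integral (l - 1)) {-1..C} \<and>
   (\<lambda>n. EE n (k n) (\<lambda>i. f (real i / real n)) (\<lambda>j. g (real j / real (k n)))
    (\<lambda>lam. (Yq n (exp (real i / real n)) lam - l)\<^sup>2)) \<longlonglongrightarrow> 0" by blast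
 qed
 from bchoice[OF this] obtain l where
  l1: "\<And>s. s \<in> {1..m} ==> ((\<lambda>t. real s * exp (real s * (1 + t)) * rho t) has_integral (l s - 1)) {-1..C}" and
  l2: "\<And>s. s \<in> {1..m} ==> (\<lambda>n. EE n (k n) (\<lambda>i. f (real i / real n)) (\<lambda>j. g (real j / real (k n)))
   (\<lambda>lam. (Yq n (exp (real s / real n)) lam - l s)\<^sup>2)) \<longlonglongrightarrow> 0" by blast
 let ?bad = "\<lambda>n. {D \<in> young_diagrams n (k n). (SUP u\<in>{-1..c}. \<bar>rotated_boundary n D u - Om u\<bar>) > e}"
 \<comment> \<open>Chebyshev's inequality at threshold d: if all these are below 1, every moment of
   the density difference is below d / s, hence at most d.\<close>
 let ?F = "\<lambda>n s lam. (1 / d)\<^sup>2 * (Yq n (exp (real s / real n)) lam - l s)\<^sup>2"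
 let ?B = "\<lambda>n. \<Sum>s\<in>{1..m}. EE n (k n) (\<lambda>i. f (real i / real n)) (\<lambda>j. g (real j / real (k n))) (?F n s)"
 have "?B \<longlonglongrightarrow> (\<Sum>s\<in>{1..m}. (1 / d)\<^sup>2 * 0)" unfolding EE_cmult by (intro tendsto_sum tendsto_mult tendsto_const l2)
 then have B0: "?B \<longlonglongrightarrow> 0" by simp
 have "eventually (\<lambda>n. real (k n) / real n < C) sequentially" by (rule order_tendstoD(2)[OF k]) (simp add: C_def)
 moreover have "eventually (\<lambda>n. 0 < n) sequentially" by (rule eventually_gt_at_top)
 ultimately have ev: "eventually (\<lambda>n. measure (mu f g n (k n)) (?bad n) \<le> ?B n) sequentially"
 proof eventually_elim
  case (elim n)
  show ?case
  proof (rule measure_mu_le)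
   show "0 \<le> f s" if "s \<in> {0..1}" for s using F.nonneg[OF that] .
   show "0 \<le> g s" if "s \<in> {0..1}" for s using G.nonneg[OF that] .
   fix lam assume lam: "lam \<in> parts n (k n)" and bad: "dgm n lam \<in> ?bad n"
   show "\<exists>s\<in>{1..m}. 1 \<le> ?F n s lam"
   proof (rule ccontr)
    assume "\<not> (\<exists>s\<in>{1..m}. 1 \<le> ?F n s lam)"
    then have F1: "?F n s lam < 1" if "s \<in> {1..m}" for s using that by force
    have kC: "real (k n) / real n \<le> C" using elim by simp
    define h where "h t = pd n (dgm n lam) t - rho t" for t
    note pdi = pd_integrable[OF elim(2) lam kC]
    have hi: "h integrable_on {-1..C}" unfolding h_def[abs_def] by (intro integrable_diff pdi rho_integrable C)
    have "small_moments C m d h" unfolding small_moments_def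
    proof (intro conjI ballI hi)
     show "\<bar>h t\<bar> \<le> 1" for t using rho_range[of t] by (auto simp: h_def pd_def)
     fix s assume s: "s \<in> {1..m}"
     then have s1: "1 \<le> real s" by simp
     have "((\<lambda>t. real s * exp (real s * (1 + t)) * pd n (dgm n lam) t - real s * exp (real s * (1 + t)) * rho t) has_integral
       ((Yq n (exp (real s / real n)) lam - 1) - (l s - 1))) {-1..C}" by (intro has_integral_diff l1[OF s] pd_exp_moment[OF elim(2) lam kC])
     from has_integral_mult_right[OF this, of "1 / real s"]
     have "((\<lambda>t. exp (real s * (1 + t)) * h t) has_integral (1 / real s * (Yq n (exp (real s / real n)) lam - l s))) {-1..C}"
      using s1 by (simp add: h_def right_diff_distrib)
     then have I: "integral {-1..C} (\<lambda>t. exp (real s * (1 + t)) * h t) = 1 / real s * (Yq n (exp (real s / real n)) lam - l s)"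
      by (rule integral_unique)
     have "(Yq n (exp (real s / real n)) lam - l s)\<^sup>2 < d\<^sup>2" using F1[OF s] d by (simp add: power_divide divide_less_eq)
     then have "\<bar>Yq n (exp (real s / real n)) lam - l s\<bar> < d"
      using power2_less_imp_less[of "\<bar>Yq n (exp (real s / real n)) lam - l s\<bar>" d] d by simp
     moreover have "1 / real s * \<bar>Yq n (exp (real s / real n)) lam - l s\<bar> \<le> 1 * \<bar>Yq n (exp (real s / real n)) lam - l s\<bar>"
      using s1 by (intro mult_right_mono) auto
     ultimately show "\<bar>integral {-1..C} (\<lambda>t. exp (real s * (1 + t)) * h t)\<bar> \<le> d" unfolding I abs_mult by simp
    qed
    note small = md[OF this]
    have "\<bar>rotated_boundary n (dgm n lam) u - Om u\<bar> \<le> e" if u: "u \<in> {-1..c}" for u proof -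
     have sub: "{-1..u} \<subseteq> {-1..C}" using u C by auto
     have ih: "h integrable_on {-1..u}" using hi sub by (rule integrable_on_subinterval)
     have ir: "(\<lambda>t. 1 - 2 * rho t) integrable_on {-1..u}"
      by (intro integrable_diff integrable_const_ivl integrable_on_mult_right integrable_on_subinterval[OF rho_integrable[OF C(1)] sub])
     have "integral {-1..u} (\<lambda>t. 1 - 2 * pd n (dgm n lam) t) = integral {-1..u} (\<lambda>t. (1 - 2 * rho t) - 2 * h t)"
      by (intro integral_cong) (simp add: h_def)
     also have "\<dots> = integral {-1..u} (\<lambda>t. 1 - 2 * rho t) - 2 * integral {-1..u} h"
      using integral_diff[OF ir integrable_on_mult_right[OF ih, of 2]] by simp
     finally have "rotated_boundary n (dgm n lam) u - Om u = - 2 * integral {-1..u} h" unfolding rotated_boundary_eq Om[OF u] by simp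
     then show ?thesis using small[of u] sub u by (auto simp: abs_mult)
    qed
    then have "(SUP u\<in>{-1..c}. \<bar>rotated_boundary n (dgm n lam) u - Om u\<bar>) \<le> e" using cpos by (intro cSUP_least) auto
    then show False using bad by simp
   qed
  qed auto
 qed
 show ?thesis
 proof (rule Lim_null_comparison[OF _ B0])
  show "eventually (\<lambda>n. norm (measure (mu f g n (k n)) (?bad n)) \<le> ?B n) sequentially" using ev by eventually_elim simp
 qed
qed

end

section \<open>Identification of the limit density\<close>

lemma integral_le_AE: fixes F G :: "real => real" assumes "negligible S" "F integrable_on T" "G integrable_on T" "\<And>s. s \<in> T - S ==> F s \<le> G s"
 shows "integral T F \<le> integral T G" proof -
 have "integral T F = integral T (\<lambda>s. if s \<in> S then G s else F s)" by (rule integral_spike[OF assms(1)]) auto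
 also have "\<dots> \<le> integral T G"
 proof (rule integral_le[OF _ assms(3)])
  show "(\<lambda>s. if s \<in> S then G s else F s) integrable_on T" by (rule integrable_spike[OF assms(2,1)]) auto
 qed (use assms(4) in auto)
 finally show ?thesis .
qed

text \<open>At real arguments \<open>G_fun\<close> is an integral of real type while
  \<open>Uf\<close> is complex; these identities pass between the two.\<close>

lemma Re_kernels: fixes a y :: real shows "Re (of_real a * of_real y / (1 - of_real a * of_real y)) = a * y / (1 - a * y)"
  "Re (of_real a / (1 - of_real a * of_real y)\<^sup>2) = a / (1 - a * y)\<^sup>2"
  "Re (- (of_real a / (of_real a + of_real y))) = - (a / (y + a))"
  "Re (of_real a / (1 - of_real a * (- 1 / of_real y))\<^sup>2) = a / (1 - a * (- 1 / y))\<^sup>2" proof -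
 have e: "of_real a * of_real y / (1 - of_real a * of_real y) = complex_of_real (a * y / (1 - a * y))"
  "of_real a / (1 - of_real a * of_real y)\<^sup>2 = complex_of_real (a / (1 - a * y)\<^sup>2)"
  "- (of_real a / (of_real a + of_real y)) = complex_of_real (- (a / (y + a)))"
  "of_real a / (1 - of_real a * (- 1 / of_real y))\<^sup>2 = complex_of_real (a / (1 - a * (- 1 / y))\<^sup>2)" by (simp_all add: add.commute)
 show "Re (of_real a * of_real y / (1 - of_real a * of_real y)) = a * y / (1 - a * y)"
  "Re (of_real a / (1 - of_real a * of_real y)\<^sup>2) = a / (1 - a * y)\<^sup>2"
  "Re (- (of_real a / (of_real a + of_real y))) = - (a / (y + a))"
  "Re (of_real a / (1 - of_real a * (- 1 / of_real y))\<^sup>2) = a / (1 - a * (- 1 / y))\<^sup>2" unfolding e by (rule Re_complex_of_real)+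
qed

section \<open>Real critical points of G and the critical points of the curve\<close>

context fgpair
begin

lemma G_fun_eq:
 "z \<noteq> 0 ==> G_fun f g c z = Uf f z - of_real c * Uf g (- 1 / z)"
 unfolding G_fun_def by (subst G.Uf_neg_inverse) (simp_all add: Uf_def add.commute)

lemma exp_mem_DK: assumes "of_real x \<in> Dm" shows "of_real (exp x) \<in> DK K" "- 1 / of_real (exp x) \<in> DK L"
 using assms neg_exp_eq[of "of_real x"] by (simp_all add: Dm_def exp_of_real)

lemma hF_real_eq: assumes "of_real x \<in> Dm" shows "Re (hh (of_real x)) = G_fun f g c (exp x)" proof -
 have D: "of_real (exp x) \<in> DK K" "- 1 / of_real (exp x) \<in> DK L" using exp_mem_DK[OF assms] by auto
 have z0: "complex_of_real (exp x) \<noteq> 0" by simp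
 have "hh (of_real x) = Uf f (of_real (exp x)) - of_real c * Uf g (- 1 / of_real (exp x))"
  using neg_exp_eq[of "of_real x"] by (simp add: hF_def exp_of_real)
 moreover have "Re (Uf f (of_real (exp x))) = integral {0..1} (\<lambda>s. f s * exp x / (1 - f s * exp x))"
  unfolding Uf_def F.integral_Re_Im(1)[OF F.U_integrable(1)[OF D(1)]] Re_kernels ..
 moreover have "Re (Uf g (- 1 / of_real (exp x))) = integral {0..1} (\<lambda>s. - (g s / (exp x + g s)))"
  unfolding G.Uf_neg_inverse[OF z0] G.integral_Re_Im(1)[OF G.V_integrable[OF D(2) z0]] Re_kernels ..
 ultimately show ?thesis by (simp add: G_fun_def)
qed

lemma hD_real_eq: assumes "of_real x \<in> Dm" shows "(\<lambda>s. f s / (1 - f s * exp x)\<^sup>2) integrable_on {0..1}"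
  "(\<lambda>s. g s / (exp x + g s)\<^sup>2) integrable_on {0..1}"
  "Re (hd' (of_real x)) = exp x * (integral {0..1} (\<lambda>s. f s / (1 - f s * exp x)\<^sup>2)
   - c * integral {0..1} (\<lambda>s. g s / (exp x + g s)\<^sup>2))" proof -
 let ?z = "exp x"
 have D: "of_real ?z \<in> DK K" "- 1 / of_real ?z \<in> DK L" using exp_mem_DK[OF assms] by auto
 have ef: "Re (of_real (f s) / (1 - of_real (f s) * of_real ?z)\<^sup>2) = f s / (1 - f s * ?z)\<^sup>2" for s by (rule Re_kernels)
 have eg: "Re (of_real (g s) / (1 - of_real (g s) * (- 1 / of_real ?z))\<^sup>2) = ?z\<^sup>2 * (g s / (?z + g s)\<^sup>2)" for s proof -
  have e: "1 - g s * (- 1 / ?z) = (?z + g s) / ?z" by (simp add: field_simps)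
  show ?thesis unfolding Re_kernels(4) e by (simp add: power_divide)
 qed
 note If = F.U_integrable(2)[OF D(1)] and Ig = G.U_integrable(2)[OF D(2)]
 have "(\<lambda>s. Re (of_real (f s) / (1 - of_real (f s) * of_real ?z)\<^sup>2)) integrable_on {0..1}"
  using integrable_linear[OF If bounded_linear_Re] by (simp only: o_def)
 then show "(\<lambda>s. f s / (1 - f s * ?z)\<^sup>2) integrable_on {0..1}" unfolding ef .
 have "(\<lambda>s. Re (of_real (g s) / (1 - of_real (g s) * (- 1 / of_real ?z))\<^sup>2)) integrable_on {0..1}"
  using integrable_linear[OF Ig bounded_linear_Re] by (simp only: o_def)
 then have "(\<lambda>s. ?z\<^sup>2 * (g s / (?z + g s)\<^sup>2)) integrable_on {0..1}" unfolding eg .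
 from integrable_on_mult_right[OF this, of "1 / ?z\<^sup>2"]
 show "(\<lambda>s. g s / (?z + g s)\<^sup>2) integrable_on {0..1}" by simp
 have f1: "Re (U1 f (of_real ?z)) = integral {0..1} (\<lambda>s. f s / (1 - f s * ?z)\<^sup>2)" unfolding U1_def F.integral_Re_Im(1)[OF If] ef ..
 have g1: "Re (U1 g (- 1 / of_real ?z)) = ?z\<^sup>2 * integral {0..1} (\<lambda>s. g s / (?z + g s)\<^sup>2)"
  unfolding U1_def G.integral_Re_Im(1)[OF Ig] eg by (rule integral_mult_right)
 have "hd' (of_real x) = of_real ?z * U1 f (of_real ?z) - of_real (c * (1 / ?z)) * U1 g (- 1 / of_real ?z)" proof -
  have "exp (- complex_of_real x) = of_real (1 / ?z)" by (simp add: exp_of_real[symmetric] exp_minus inverse_eq_divide)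
  then show ?thesis using neg_exp_eq[of "of_real x"] by (simp add: hD_def exp_of_real)
 qed
 then have "Re (hd' (of_real x)) = ?z * Re (U1 f (of_real ?z)) - c * (1 / ?z) * Re (U1 g (- 1 / of_real ?z))"
  by (simp only: minus_complex.sel times_complex.sel Re_complex_of_real Im_complex_of_real mult_zero_left diff_zero)
 then show "Re (hd' (of_real x)) = ?z * (integral {0..1} (\<lambda>s. f s / (1 - f s * ?z)\<^sup>2)
   - c * integral {0..1} (\<lambda>s. g s / (?z + g s)\<^sup>2))" unfolding f1 g1 by (simp add: power2_eq_square right_diff_distrib)
qed

text \<open>\<open>is_critical\<close> demands integrability, not that z avoids the poles. For every
  cosine k, \<open>Af f z k\<close> is at most z times the integral of f / (1 - f z)^2; by the
  critical equation this is c z times the integral of g / (z + g)^2, which is at most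
  \<open>c * Af g (1 / z) (- k)\<close>. So \<open>bb\<close> is nonpositive at all heights,
  \<open>th\<close> is 0, and \<open>Th_zero_Dm\<close> gives regularity afterwards.\<close>

lemma critical_pos: assumes z: "0 < z" and crit: "is_critical f g c (Some z)"
 shows "th (ln z) = 0" "ln z \<in> crit" "tc (ln z) = G_fun f g c z" proof -
 let ?x = "ln z"
 have ez: "exp ?x = z" "exp (- ?x) = 1 / z" using z by (auto simp: exp_minus inverse_eq_divide)
 have nf: "negligible {s\<in>{0..1}. 1 - f s * z = 0}" and If: "(\<lambda>s. f s / (1 - f s * z)\<^sup>2) integrable_on {0..1}"
  and Ig: "(\<lambda>s. g s / (z + g s)\<^sup>2) integrable_on {0..1}"
  and eq: "integral {0..1} (\<lambda>s. f s / (1 - f s * z)\<^sup>2) = c * integral {0..1} (\<lambda>s. g s / (z + g s)\<^sup>2)" using crit by auto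
 have b: "bb f g c ?x k \<le> 0" if k: "-1 < k" "k < 1" for k proof -
  have "Af f z k \<le> integral {0..1} (\<lambda>s. z * (f s / (1 - f s * z)\<^sup>2))" unfolding Af_def
  proof (rule integral_le_AE[OF nf])
   show "(\<lambda>s. f s * z / (1 - 2 * (f s * z) * k + (f s * z)\<^sup>2)) integrable_on {0..1}"
    by (rule F.integ_nonneg[OF F.A_continuous]) (use z k in auto)
   show "(\<lambda>s. z * (f s / (1 - f s * z)\<^sup>2)) integrable_on {0..1}" by (intro integrable_on_mult_right If)
   fix s assume s: "s \<in> {0..1} - {s\<in>{0..1}. 1 - f s * z = 0}"
   let ?y = "f s * z"
   have y: "0 \<le> ?y" "?y \<noteq> 1" using s F.nonneg[of s] z by auto
   have "2 * ?y * k \<le> 2 * ?y * 1" using y k by (intro mult_left_mono) auto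
   then have "(1 - ?y)\<^sup>2 \<le> 1 - 2 * ?y * k + ?y\<^sup>2" by (simp add: power2_eq_square algebra_simps)
   then have "?y / (1 - 2 * ?y * k + ?y\<^sup>2) \<le> ?y / (1 - ?y)\<^sup>2" using y by (intro divide_left_mono mult_pos_pos) (auto simp: quadratic_denominator_pos k(2))
   then show "?y / (1 - 2 * ?y * k + ?y\<^sup>2) \<le> z * (f s / (1 - ?y)\<^sup>2)" by (simp add: mult.commute)
  qed
  moreover have "integral {0..1} (\<lambda>s. z * (g s / (z + g s)\<^sup>2)) \<le> Af g (1 / z) (- k)" unfolding Af_def
  proof (rule integral_le)
   show "(\<lambda>s. g s * (1 / z) / (1 - 2 * (g s * (1 / z)) * (- k) + (g s * (1 / z))\<^sup>2)) integrable_on {0..1}"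
    by (rule G.integ_nonneg[OF G.A_continuous]) (use z k in auto)
   show "(\<lambda>s. z * (g s / (z + g s)\<^sup>2)) integrable_on {0..1}" by (intro integrable_on_mult_right Ig)
   fix s :: real assume s: "s \<in> {0..1}"
   let ?y = "g s * (1 / z)"
   have y: "0 \<le> ?y" using G.nonneg[OF s] z by simp
   have "2 * ?y * k \<le> 2 * ?y * 1" using y k by (intro mult_left_mono) auto
   then have "1 - 2 * ?y * (- k) + ?y\<^sup>2 \<le> (1 + ?y)\<^sup>2" by (simp add: power2_eq_square algebra_simps)
   moreover have "0 < 1 - 2 * ?y * (- k) + ?y\<^sup>2" using quadratic_denominator_pos[OF y, of "- k"] k by simp
   ultimately have "?y / (1 + ?y)\<^sup>2 \<le> ?y / (1 - 2 * ?y * (- k) + ?y\<^sup>2)" using y by (intro divide_left_mono mult_pos_pos) auto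
   moreover have "z * (g s / (z + g s)\<^sup>2) = ?y / (1 + ?y)\<^sup>2" proof -
    have "1 + ?y = (z + g s) / z" using z by (simp add: field_simps)
    then show ?thesis using z by (simp add: power_divide power2_eq_square)
   qed
   ultimately show "z * (g s / (z + g s)\<^sup>2) \<le> ?y / (1 - 2 * ?y * (- k) + ?y\<^sup>2)" by (simp only:)
  qed
  then have "c * (z * integral {0..1} (\<lambda>s. g s / (z + g s)\<^sup>2)) \<le> c * Af g (1 / z) (- k)"
   unfolding integral_mult_right by (rule mult_left_mono) (use cpos in simp)
  ultimately show ?thesis unfolding bb_def ez integral_mult_right eq mult.left_commute[of z c] by linarith
 qed
 show T0: "th ?x = 0"
 proof (rule Th_eqI)
  fix t :: real assume t: "0 < t" "t < pi"
  have "0 < sin t" using t by (rule sin_gt_zero)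
  then show "Im (hh (Complex ?x t)) \<le> 0" unfolding polar(1)[OF t] using b[of "cos t"] cos_range[OF t] by (simp add: mult_nonneg_nonpos)
 qed auto
 have zx: "ze ?x = of_real ?x" using T0 by (simp add: zeta_def complex_of_real_def)
 have Dm: "of_real ?x \<in> Dm" by (rule Th_zero_Dm[OF T0])
 have "Re (hd' (of_real ?x)) = 0" unfolding hD_real_eq(3)[OF Dm] ez using eq by simp
 then show "?x \<in> crit" using real_hF(2)[of ?x] by (simp add: crit_def zx complex_eq_iff)
 show "tc ?x = G_fun f g c z" unfolding tt_def zx hF_real_eq[OF Dm] ez ..
qed

lemma critical_pos_converse: assumes T: "th x = 0" and x: "x \<in> crit" shows "is_critical f g c (Some (exp x))" proof -
 have Dm: "of_real x \<in> Dm" by (rule Th_zero_Dm[OF T])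
 have "ze x = of_real x" using T by (simp add: zeta_def complex_of_real_def)
 then have "hd' (of_real x) = 0" using x by (simp add: crit_def)
 then have 0: "integral {0..1} (\<lambda>s. f s / (1 - f s * exp x)\<^sup>2) - c * integral {0..1} (\<lambda>s. g s / (exp x + g s)\<^sup>2) = 0"
  using hD_real_eq(3)[OF Dm] by simp
 have 1: "negligible {s\<in>{0..1}. 1 - f s * exp x = 0}"
 proof (rule negligible_subset[of P])
  show "{s\<in>{0..1}. 1 - f s * exp x = 0} \<subseteq> P"
  proof (intro subsetI, rule ccontr)
   fix s assume s: "s \<in> {s\<in>{0..1}. 1 - f s * exp x = 0}" "s \<notin> P"
   then have "f s \<in> K" using F.fK[of s] by auto
   then have "1 - complex_of_real (f s) * of_real (exp x) \<noteq> 0" using exp_mem_DK(1)[OF Dm] unfolding DK_def by blast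
   moreover have "complex_of_real (f s * exp x) = of_real 1" using s(1) by simp
   ultimately show False by simp
  qed
 qed (use F.finP in auto)
 have "exp x + g s \<noteq> 0" if "s \<in> {0..1}" for s using G.nonneg[OF that] by (simp add: add_pos_nonneg less_imp_neq[symmetric])
 then have "{s\<in>{0..1}. exp x + g s = 0} = {}" by blast
 then have "negligible {s\<in>{0..1}. exp x + g s = 0}" by (simp only: negligible_empty)
 then show ?thesis using 0 1 hD_real_eq(1,2)[OF Dm] by (simp only: is_critical.simps simp_thms)
qed

end

text \<open>Under z -> -1/z both integrals acquire the factor z^2 and change places.\<close>

lemma is_critical_dual: assumes c: "0 < c" and z: "z \<noteq> 0" and crit: "is_critical f g c (Some z)"
 shows "is_critical g f (1 / c) (Some (- 1 / z))" proof -
 have e1: "1 - g s * (- 1 / z) = (z + g s) / z" "- 1 / z + f s = - ((1 - f s * z) / z)" for s using z by (simp_all add: field_simps)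
 have e2: "g s / (1 - g s * (- 1 / z))\<^sup>2 = z\<^sup>2 * (g s / (z + g s)\<^sup>2)"
  "f s / (- 1 / z + f s)\<^sup>2 = z\<^sup>2 * (f s / (1 - f s * z)\<^sup>2)" for s unfolding e1 by (simp_all add: power_divide)
 have e3: "1 - g s * (- 1 / z) = 0 \<longleftrightarrow> z + g s = 0" "- 1 / z + f s = 0 \<longleftrightarrow> 1 - f s * z = 0" for s unfolding e1 using z by simp_all
 have cr: "negligible {s\<in>{0..1}. 1 - f s * z = 0}" "negligible {s\<in>{0..1}. z + g s = 0}"
  "(\<lambda>s. f s / (1 - f s * z)\<^sup>2) integrable_on {0..1}" "(\<lambda>s. g s / (z + g s)\<^sup>2) integrable_on {0..1}"
  "integral {0..1} (\<lambda>s. f s / (1 - f s * z)\<^sup>2) = c * integral {0..1} (\<lambda>s. g s / (z + g s)\<^sup>2)" using crit by auto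
 show ?thesis unfolding is_critical.simps e2 e3 integral_mult_right cr(5)
 proof (intro conjI cr(1,2) integrable_on_mult_right cr(3,4))
  show "z\<^sup>2 * integral {0..1} (\<lambda>s. g s / (z + g s)\<^sup>2) - 1 / c * (z\<^sup>2 * (c * integral {0..1} (\<lambda>s. g s / (z + g s)\<^sup>2))) = 0" using c by simp
 qed
qed

lemma G_fun_dual: fixes z :: real assumes c: "0 < c" and z: "z \<noteq> 0" shows "G_fun g f (1 / c) (- 1 / z) = - (G_fun f g c z) / c" proof -
 have a: "g s * (- 1 / z) / (1 - g s * (- 1 / z)) = - (g s / (z + g s))" for s proof -
  have "1 - g s * (- 1 / z) = (z + g s) / z" using z by (simp add: field_simps)
  then show ?thesis using z by simp
 qed
 have b: "f s / (- 1 / z + f s) = - (f s * z / (1 - f s * z))" for s proof -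
  have "- 1 / z + f s = - ((1 - f s * z) / z)" using z by (simp add: field_simps)
  then show ?thesis using z by simp
 qed
 have e: "- J + 1 / c * - I = - (I + c * J) / c" for I J using c by (simp add: field_simps)
 show ?thesis unfolding G_fun_def of_real_eq_id id_apply a b integral_neg by (rule e)
qed

context fgpair
begin

lemma critical_neg: assumes z: "z < 0" and crit: "is_critical f g c (Some z)"
 shows "th (ln (- z)) = pi" "ln (- z) \<in> crit" "tc (ln (- z)) = G_fun f g c z" proof -
 interpret D: fgpair g Q L N f P K M "1 / c" by (rule fgpair_dual) unfold_locales
 have w: "0 < - 1 / z" "ln (- 1 / z) = - ln (- z)" using z ln_div[of 1 "- z"] by (auto simp: divide_neg_neg)
 have z0: "z \<noteq> 0" using z by simp
 note d = D.critical_pos[OF w(1) is_critical_dual[OF cpos z0 crit], unfolded w(2)]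
 show T: "th (ln (- z)) = pi" using d(1) by (simp add: Th_dual)
 have "hD g f (1 / c) (\<i> * of_real pi - ze (ln (- z))) = 0" using d(2) by (simp add: D.crit_def zeta_dual)
 then show "ln (- z) \<in> crit" using hD_dual[of c g f] cpos by (simp add: crit_def)
 show "tc (ln (- z)) = G_fun f g c z" using d(3) cpos unfolding tt_dual G_fun_dual[OF cpos z0] by simp
qed

lemma critical_neg_converse: assumes T: "th x = pi" and x: "x \<in> crit" shows "is_critical f g c (Some (- exp x))" proof -
 interpret D: fgpair g Q L N f P K M "1 / c" by (rule fgpair_dual) unfold_locales
 have "Th g f (1 / c) (- x) = 0" using T by (simp add: Th_dual)
 moreover have "- x \<in> D.crit" using x hD_dual[of c g f "ze x"] cpos by (simp add: D.crit_def crit_def zeta_dual)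
 ultimately have "is_critical g f (1 / c) (Some (exp (- x)))" by (rule D.critical_pos_converse)
 then have "is_critical f g (1 / (1 / c)) (Some (- 1 / exp (- x)))" by (rule is_critical_dual[rotated 2]) (use cpos in auto)
 then show ?thesis using cpos by (simp add: exp_minus divide_inverse)
qed

end

text \<open>Abstracts the height as a function of t: bands with values strictly between 0 and pi,
  and flat pieces at 0 or pi that are locally constant off the discrete set \<open>E\<close> of
  critical values. So bands can end only at \<open>E\<close> or at an end of the interval. The
  axioms are invariant under t -> -t (\<open>mirror\<close>).\<close>

locale band_curve = fixes A B :: real and tau :: "real => real" and E :: "real set" assumes cont: "\<And>t. A < t ==> t < B ==> isCont tau t"
  and range: "\<And>t. 0 \<le> tau t" "\<And>t. tau t \<le> pi" and locally_constant: "\<And>t. A < t ==> t < B ==> \<not> (0 < tau t \<and> tau t < pi) ==> t \<notin> E ==>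
   eventually (\<lambda>s. tau s = tau t) (nhds t)" and E_flat: "\<And>t. t \<in> E ==> \<not> (0 < tau t \<and> tau t < pi)"
  and E_discrete: "\<And>p q. A < p ==> q < B ==> finite (E \<inter> {p..q})"
begin

abbreviation "TT t \<equiv> 0 < tau t \<and> tau t < pi"

lemma tendsto_nhds: "A < t ==> t < B ==> (tau \<longlongrightarrow> tau t) (nhds t)" using cont[of t] by (simp add: isCont_def tendsto_at_iff_tendsto_nhds)

text \<open>w is the first point after t outside the band. If it were not in \<open>E\<close>, the
  height would be constant near w, although points just before w belong to the band.\<close>

lemma band_right_end: assumes t: "A < t" "t < B" "TT t" shows "\<exists>w. t < w \<and> w \<le> B \<and> (\<forall>u. t \<le> u \<longrightarrow> u < w \<longrightarrow> TT u) \<and> (w = B \<or> w \<in> E \<and> w < B)"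
proof (cases "\<forall>u. t \<le> u \<longrightarrow> u < B \<longrightarrow> TT u")
 case True
 then show ?thesis using t by (intro exI[of _ B]) auto
next
 case False
 define X where "X = {u. t \<le> u \<and> u < B \<and> \<not> TT u}"
 obtain u0 where u0: "u0 \<in> X" using False by (auto simp: X_def)
 have bdd: "bdd_below X" by (rule bdd_belowI[of _ t]) (simp add: X_def)
 define w where "w = Inf X"
 have w: "t \<le> w" "w \<le> u0" "u0 < B" using u0 bdd by (auto simp: w_def X_def intro: cInf_greatest cInf_lower)
 have below: "TT u" if "t \<le> u" "u < w" for u
 proof (rule ccontr)
  assume "\<not> TT u"
  then have "u \<in> X" using that w by (simp add: X_def)
  then have "w \<le> u" unfolding w_def using bdd by (rule cInf_lower)
  then show False using that by simp
 qed
 have wAB: "A < w" "w < B" using w t by auto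
 have near: "\<exists>x\<in>X. x < w + d" if "0 < d" for d using cInf_lessD[of X "w + d"] u0 that by (auto simp: w_def)
 have nTw: "\<not> TT w"
 proof
  assume T: "TT w"
  have "eventually (\<lambda>s. 0 < tau s) (nhds w)" "eventually (\<lambda>s. tau s < pi) (nhds w)" using order_tendstoD[OF tendsto_nhds[OF wAB]] T by auto
  then have "eventually (\<lambda>s. TT s) (nhds w)" by (rule eventually_conj)
  then obtain d where d: "0 < d" "\<And>s. dist s w < d ==> TT s" unfolding eventually_nhds_metric by blast
  obtain x where x: "x \<in> X" "x < w + d" using near[OF d(1)] by blast
  have "w \<le> x" unfolding w_def using x(1) bdd by (rule cInf_lower)
  then have "TT x" using x(2) by (intro d(2)) (simp add: dist_real_def)
  then show False using x(1) by (simp add: X_def)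
 qed
 then have tw: "t < w" using t(3) w(1) by (cases "t = w") auto
 have "w \<in> E"
 proof (rule ccontr)
  assume "w \<notin> E"
  from locally_constant[OF wAB nTw this] obtain d where d: "0 < d" "\<And>s. dist s w < d ==> tau s = tau w"
   unfolding eventually_nhds_metric by blast
  define s where "s = max t (w - d / 2)"
  have s: "t \<le> s" "s < w" "dist s w < d" using tw d(1) by (auto simp: s_def dist_real_def max_def)
  show False using below[OF s(1,2)] d(2)[OF s(3)] nTw by simp
 qed
 then show ?thesis using tw below wAB by (intro exI[of _ w]) auto
qed

lemma mirror: "band_curve (- B) (- A) (\<lambda>t. tau (- t)) (uminus ` E)"
proof
 fix t assume t: "- B < t" "t < - A"
 have "isCont tau (- t)" using cont[of "- t"] t by simp
 then show "isCont (\<lambda>t. tau (- t)) t" by (rule isCont_o2[rotated]) (intro continuous_intros)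
next
 fix t assume t: "- B < t" "t < - A" "\<not> (0 < tau (- t) \<and> tau (- t) < pi)" "t \<notin> uminus ` E"
 have "- t \<notin> E" using t(4) by (metis image_eqI minus_minus)
 then have "eventually (\<lambda>s. tau s = tau (- t)) (nhds (- t))" using t by (intro locally_constant) auto
 then show "eventually (\<lambda>s. tau (- s) = tau (- t)) (nhds t)" by (rule eventually_compose_filterlim) (intro tendsto_minus filterlim_ident)
next
 fix p q assume "- B < p" "q < - A"
 then have "finite (E \<inter> {- q..- p})" by (intro E_discrete) auto
 moreover have "uminus ` E \<inter> {p..q} = uminus ` (E \<inter> {- q..- p})" by (auto simp: image_iff)
 ultimately show "finite (uminus ` E \<inter> {p..q})" by simp
qed (use range E_flat in auto)

lemma band_left_end: assumes t: "A < t" "t < B" "TT t" shows "\<exists>w. w < t \<and> A \<le> w \<and> (\<forall>u. w < u \<longrightarrow> u \<le> t \<longrightarrow> TT u) \<and> (w = A \<or> w \<in> E \<and> A < w)"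
proof -
 interpret R: band_curve "- B" "- A" "\<lambda>t. tau (- t)" "uminus ` E" by (rule mirror)
 obtain w where w: "- t < w" "w \<le> - A" "\<And>u. - t \<le> u ==> u < w ==> TT (- u)" "w = - A \<or> w \<in> uminus ` E \<and> w < - A"
  using R.band_right_end[of "- t"] t by auto
 have "TT u" if "- w < u" "u \<le> t" for u using w(3)[of "- u"] that by simp
 moreover have "- w = A \<or> - w \<in> E \<and> A < - w" using w(4) by auto
 ultimately show ?thesis using w(1,2) by (intro exI[of _ "- w"]) auto
qed

text \<open>v is the last point of the flat piece. Since \<open>E\<close> is locally finite, a
  punctured neighbourhood of v avoids it; the band through a nearby point \<open>u0\<close>
  therefore cannot start inside that neighbourhood and starts at v itself.\<close>

lemma flat_right_end: assumes t: "A < t" "tau t = pi" and t': "t < t'" "t' < B" "tau t' \<noteq> pi"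
 shows "\<exists>v u0. t \<le> v \<and> v < u0 \<and> u0 < B \<and> (\<forall>u. t \<le> u \<longrightarrow> u \<le> v \<longrightarrow> tau u = pi) \<and> v \<in> E \<and>
  (\<forall>u. v < u \<longrightarrow> u \<le> u0 \<longrightarrow> TT u)" proof -
 define X where "X = {u. t \<le> u \<and> u \<le> t' \<and> tau u \<noteq> pi}"
 have X: "t' \<in> X" using t' by (simp add: X_def)
 have bdd: "bdd_below X" by (rule bdd_belowI[of _ t]) (simp add: X_def)
 define v where "v = Inf X"
 have v: "t \<le> v" "v \<le> t'" using X bdd by (auto simp: v_def X_def intro: cInf_greatest cInf_lower)
 have vAB: "A < v" "v < B" using v t t' by auto
 have below: "tau u = pi" if "t \<le> u" "u < v" for u
 proof (rule ccontr)
  assume "tau u \<noteq> pi"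
  then have "u \<in> X" using that v by (simp add: X_def)
  then have "v \<le> u" unfolding v_def using bdd by (rule cInf_lower)
  then show False using that by simp
 qed
 have near: "\<exists>x\<in>X. v \<le> x \<and> x < v + d" if "0 < d" for d using cInf_lessD[of X "v + d"] X that cInf_lower[OF _ bdd] by (auto simp: v_def)
 have tv: "tau v = pi"
 proof (rule ccontr)
  assume ne: "tau v \<noteq> pi"
  then have "tau v < pi" using range(2)[of v] by simp
  then have "eventually (\<lambda>s. tau s < pi) (nhds v)" by (rule order_tendstoD(2)[OF tendsto_nhds[OF vAB]])
  then obtain d where d: "0 < d" "\<And>s. dist s v < d ==> tau s < pi" unfolding eventually_nhds_metric by blast
  have "t < v" using ne t(2) v(1) by (cases "t = v") auto
  define s where "s = max t (v - d / 2)"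
  have s: "t \<le> s" "s < v" "dist s v < d" using \<open>t < v\<close> d(1) by (auto simp: s_def dist_real_def max_def)
  show False using below[OF s(1,2)] d(2)[OF s(3)] by simp
 qed
 have vE: "v \<in> E"
 proof (rule ccontr)
  assume "v \<notin> E"
  with locally_constant[OF vAB] tv obtain d where d: "0 < d" "\<And>s. dist s v < d ==> tau s = pi" unfolding eventually_nhds_metric by auto
  obtain x where x: "x \<in> X" "v \<le> x" "x < v + d" using near[OF d(1)] by blast
  then have "tau x = pi" by (intro d(2)) (simp add: dist_real_def)
  then show False using x(1) by (simp add: X_def)
 qed
 define q where "q = (v + B) / 2"
 have q: "v < q" "q < B" using vAB by (auto simp: q_def)
 have "finite (E \<inter> {v..q} - {v})" using E_discrete[OF vAB(1) q(2)] by simp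
 then have "open (- (E \<inter> {v..q} - {v}))" by (intro open_Compl finite_imp_closed)
 then have "eventually (\<lambda>s. s \<in> - (E \<inter> {v..q} - {v})) (nhds v)" by (rule eventually_nhds_in_open) simp
 moreover have "eventually (\<lambda>s. 0 < tau s) (nhds v)" by (rule order_tendstoD(1)[OF tendsto_nhds[OF vAB]]) (use tv in simp)
 moreover have "eventually (\<lambda>s. s \<in> {..<q}) (nhds v)" by (rule eventually_nhds_in_open) (use q in auto)
 ultimately have "eventually (\<lambda>s. s \<in> - (E \<inter> {v..q} - {v}) \<and> 0 < tau s \<and> s < q) (nhds v)" by eventually_elim auto
 then obtain d where d: "0 < d" "\<And>s. dist s v < d ==> s \<notin> E \<inter> {v..q} - {v} \<and> 0 < tau s \<and> s < q"
  unfolding eventually_nhds_metric by (metis ComplD)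
 obtain u0 where u0: "u0 \<in> X" "v \<le> u0" "u0 < v + d" using near[OF d(1)] by blast
 have "u0 \<noteq> v" using u0(1) tv by (auto simp: X_def)
 then have vu: "v < u0" using u0(2) by simp
 have du: "dist s v < d" if "v \<le> s" "s \<le> u0" for s using that u0(3) by (simp add: dist_real_def)
 have Tu: "TT u0" using d(2)[OF du[of u0]] u0 range(2)[of u0] by (auto simp: X_def order.order_iff_strict)
 have uB: "u0 < B" using d(2)[OF du[of u0]] u0(2) q by auto
 obtain w where w: "w < u0" "A \<le> w" "\<And>u. w < u ==> u \<le> u0 ==> TT u" "w = A \<or> w \<in> E \<and> A < w" using band_left_end[OF _ uB Tu] vAB vu by auto
 have "w \<le> v"
 proof (rule ccontr)
  assume "\<not> w \<le> v"
  then have "v < w" by simp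
  then have "w \<in> E" using w(4) vAB by auto
  moreover have "w < q" using d(2)[OF du[of w]] \<open>v < w\<close> w(1) by auto
  ultimately show False using d(2)[OF du[of w]] \<open>v < w\<close> w(1) by auto
 qed
 moreover have "\<not> w < v"
 proof
  assume "w < v"
  then have "TT v" using w(3)[of v] vu by simp
  then show False using tv by simp
 qed
 ultimately have "w = v" by simp
 then have "\<forall>u. v < u \<longrightarrow> u \<le> u0 \<longrightarrow> TT u" using w(3) by blast
 moreover have "\<forall>u. t \<le> u \<longrightarrow> u \<le> v \<longrightarrow> tau u = pi" using below tv by (auto simp: order.order_iff_strict)
 ultimately show ?thesis using v(1) vu uB vE by blast
qed

lemma flat_left_end: assumes t: "t < B" "tau t = pi" and t': "t' < t" "A < t'" "tau t' \<noteq> pi"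
 shows "\<exists>v u0. v \<le> t \<and> u0 < v \<and> A < u0 \<and> (\<forall>u. v \<le> u \<longrightarrow> u \<le> t \<longrightarrow> tau u = pi) \<and> v \<in> E \<and>
  (\<forall>u. u0 \<le> u \<longrightarrow> u < v \<longrightarrow> TT u)" proof -
 interpret R: band_curve "- B" "- A" "\<lambda>t. tau (- t)" "uminus ` E" by (rule mirror)
 obtain v u0 where v: "- t \<le> v" "v < u0" "u0 < - A" "\<And>u. - t \<le> u ==> u \<le> v ==> tau (- u) = pi" "v \<in> uminus ` E"
  "\<And>u. v < u ==> u \<le> u0 ==> TT (- u)" using R.flat_right_end[of "- t" "- t'"] t t' by auto
 have "tau u = pi" if "- v \<le> u" "u \<le> t" for u using v(4)[of "- u"] that by simp
 moreover have "TT u" if "- u0 \<le> u" "u < - v" for u using v(6)[of "- u"] that by simp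
 moreover have "- v \<in> E" using v(5) by auto
 ultimately show ?thesis using v(1-3) by (intro exI[of _ "- v"] exI[of _ "- u0"]) auto
qed

end

section \<open>Bands, flat pieces and nonreal roots on the curve\<close>

context fgpair
begin

text \<open>At an interior height \<open>bb\<close> vanishes, and \<open>polar\<close> leaves a
  strictly negative real part of the derivative.\<close>

lemma crit_flat: assumes "x \<in> crit" shows "\<not> (0 < th x \<and> th x < pi)"
proof
 assume T: "0 < th x \<and> th x < pi"
 have "Im (hh (ze x)) = 0" by (rule real_on_curve(1))
 then have "sin (th x) * bb f g c x (cos (th x)) = 0" using polar(1)[of "th x" x] T by (simp add: zeta_def)
 moreover have "0 < sin (th x)" using T by (intro sin_gt_zero) auto
 ultimately have "bb f g c x (cos (th x)) = 0" by simp
 moreover obtain p where "0 < p" "Re (hd' (ze x)) = cos (th x) * bb f g c x (cos (th x)) - p"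
  using polar(2)[of "th x" x] T by (auto simp: zeta_def)
 ultimately show False using assms by (simp add: crit_def)
qed

text \<open>Reflection in the horizontal line at height 0 or pi conjugates \<open>hF\<close>. Its
  values on the curve are real, so a curve point and its reflection have the same value; local
  injectivity at a noncritical point makes them equal, which puts the point on the line.\<close>

lemma noncrit_locally_constant: assumes T: "\<not> (0 < th x \<and> th x < pi)" and nc: "x \<notin> crit" shows "eventually (\<lambda>y. th y = th x) (nhds x)"
proof -
 let ?T = "th x"
 have T': "?T = 0 \<or> ?T = pi" using T Th_range[of x] by auto
 obtain gi r where gi: "0 < r" "\<And>w. w \<in> ball (ze x) r ==> gi (hh w) = w" using local_inverse[OF nc] by metis
 have "(ze \<longlongrightarrow> ze x) (nhds x)" using zeta_isCont[of x] by (simp add: isCont_def tendsto_at_iff_tendsto_nhds)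
 then have "eventually (\<lambda>y. ze y \<in> ball (ze x) r) (nhds x)" using gi(1) by (intro topological_tendstoD) auto
 then show ?thesis
 proof eventually_elim
  case (elim y)
  let ?z = "ze y"
  define z' where "z' = Complex y (2 * ?T - th y)"
  have c: "cos (2 * ?T - a) = cos a" "sin (2 * ?T - a) = - sin a" for a using T' by (auto simp: cos_diff sin_diff)
  have e1: "exp z' = cnj (exp ?z)" unfolding z'_def zeta_def exp_Complex by (simp add: complex_eq_iff c)
  have e2: "- exp (- z') = cnj (- exp (- ?z))" proof -
   have "exp (- z') = inverse (cnj (exp ?z))" unfolding exp_minus e1 ..
   then show ?thesis by (simp add: exp_minus)
  qed
  have "hh z' = cnj (hh ?z)" unfolding hF_def e1 e2 by (simp add: F.Uf_cnj G.Uf_cnj del: complex_cnj_minus)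
  then have h: "hh z' = hh ?z" by (simp add: hF_zeta)
  have "ze x - z' = cnj (ze x - ?z)" by (simp add: zeta_def z'_def complex_eq_iff)
  then have "norm (ze x - z') = norm (ze x - ?z)" by (metis complex_mod_cnj)
  then have "z' \<in> ball (ze x) r" using elim by (simp add: dist_norm)
  from gi(2)[OF this] gi(2)[OF elim] have "z' = ?z" unfolding h by simp
  then show ?case by (simp add: z'_def zeta_def)
 qed
qed

lemma tau_XX_tendsto: assumes "- pos_mass f < t" "t < c * pos_mass g" shows "(XX \<longlongrightarrow> XX t) (nhds t)"
 using XX_isCont[of "XX t"] tt_surj[OF assms] by (simp add: isCont_def tendsto_at_iff_tendsto_nhds)

lemma tau_band_curve: "band_curve (- pos_mass f) (c * pos_mass g) (\<lambda>t. th (XX t)) (tc ` crit)"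
proof
 fix t assume t: "- pos_mass f < t" "t < c * pos_mass g"
 have "isCont XX t" using XX_isCont[of "XX t"] tt_surj[OF t] by simp
 then show "isCont (\<lambda>t. th (XX t)) t" by (rule isCont_o2) (rule Th_isCont)
next
 fix t assume t: "- pos_mass f < t" "t < c * pos_mass g" "\<not> (0 < th (XX t) \<and> th (XX t) < pi)" "t \<notin> tc ` crit"
 have "XX t \<notin> crit" using t(4) tt_surj[OF t(1,2)] by (metis image_eqI)
 from noncrit_locally_constant[OF t(3) this]
 show "eventually (\<lambda>s. th (XX s) = th (XX t)) (nhds t)" by (rule eventually_compose_filterlim) (rule tau_XX_tendsto[OF t(1,2)])
next
 fix t assume "t \<in> tc ` crit"
 then obtain x where x: "x \<in> crit" "t = tc x" by blast
 show "\<not> (0 < th (XX t) \<and> th (XX t) < pi)" unfolding x(2) XX_tt by (rule crit_flat[OF x(1)])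
next
 fix p q assume p: "- pos_mass f < p" and q: "q < c * pos_mass g"
 show "finite (tc ` crit \<inter> {p..q})"
 proof (cases "p \<le> q")
  case True
  then have p': "p < c * pos_mass g" and q': "- pos_mass f < q" using p q by auto
  have "tc ` crit \<inter> {p..q} \<subseteq> tc ` (crit \<inter> {XX q..XX p})"
  proof
   fix t assume "t \<in> tc ` crit \<inter> {p..q}"
   then obtain x where x: "x \<in> crit" "t = tc x" "p \<le> tc x" "tc x \<le> q" by auto
   have "x \<le> XX p" "XX q \<le> x" using x(3,4) tt_less_iff[of x "XX p"] tt_less_iff[of "XX q" x] tt_surj[OF p p'] tt_surj[OF q' q]
    by (auto simp: not_less[symmetric])
   then show "t \<in> tc ` (crit \<inter> {XX q..XX p})" using x by auto
  qed
  then show ?thesis using finite_crit finite_subset by blast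
 qed simp
qed (use Th_range in auto)

end

lemma (in pfun) pos_mass_pos: "0 < pos_mass f" proof -
 have c: "continuous_on {0..} (\<lambda>x::real. x / (x + 1))" by (intro continuous_intros) auto
 have "0 < integral {0..1} (\<lambda>s. f s / (f s + 1))" by (rule integral_pos[OF c]) auto
 also have "\<dots> \<le> pos_mass f" unfolding pos_mass_def
  by (intro integral_le pos_mass_integrable integ_nonneg[OF c]) (use nonneg in \<open>auto simp: divide_le_eq_1 add_nonneg_pos\<close>)
 finally show ?thesis .
qed

lemma (in pfun) pos_mass_eq_1: "negligible {s\<in>{0..1}. f s = 0} ==> pos_mass f = 1"
 using integral_spike[of "{s\<in>{0..1}. f s = 0}" "{0..1}" "\<lambda>_. 1" "\<lambda>s. if f s = 0 then 0 else 1 :: real"] by (simp add: pos_mass_def)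

context fgpair
begin

text \<open>In logarithmic coordinates a root in the upper half-plane is an interior zero of the
  imaginary part, and the only one on its vertical segment is at height \<open>th x\<close>.\<close>

lemma upper_root_curve: assumes z: "0 < Im z" and G: "G_fun f g c z = of_real t"
 obtains x where "z = exp (ze x)" "0 < th x" "th x < pi" "tc x = t" proof -
 define x where "x = ln (norm z)"
 have z0: "z \<noteq> 0" using z by auto
 have A: "0 < Arg z" "Arg z < pi" using z Arg_lt_pi[of z] by auto
 have ez: "exp (Complex x (Arg z)) = z" unfolding exp_Complex x_def using z0 rcis_cmod_Arg[of z] by (simp add: rcis_def)
 have h: "hh (Complex x (Arg z)) = of_real t" unfolding hF_def neg_exp_eq ez using G G_fun_eq[OF z0] by simp
 have T: "th x = Arg z"
 proof (rule ccontr)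
  assume "th x \<noteq> Arg z"
  then have "0 < Im (hh (Complex x (Arg z))) \<or> Im (hh (Complex x (Arg z))) < 0"
   using Im_pos_below[of "Arg z" x] Im_neg_above[of x "Arg z"] A by linarith
  then show False unfolding h by simp
 qed
 show ?thesis by (rule that[of x]) (use ez h A in \<open>simp_all add: zeta_def tt_def T\<close>)
qed

lemma curve_is_root: assumes "0 < th x" "th x < pi" shows "0 < Im (exp (ze x))" "G_fun f g c (exp (ze x)) = of_real (tc x)"
  "Arg (exp (ze x)) = th x" proof -
 show "0 < Im (exp (ze x))" using assms sin_gt_zero by (simp add: zeta_def exp_Complex)
 show "G_fun f g c (exp (ze x)) = of_real (tc x)" using G_fun_eq[of "exp (ze x)"] hF_zeta[of x] by (simp add: hF_def neg_exp_eq)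
 show "Arg (exp (ze x)) = th x" by (rule Arg_unique[of "exp x"]) (use assms in \<open>auto simp: zeta_def exp_Complex cis_conv_exp\<close>)
qed

lemma G_fun_cnj: "z \<noteq> 0 ==> G_fun f g c (cnj z) = cnj (G_fun f g c z)" proof -
 assume z: "z \<noteq> 0"
 have "- 1 / cnj z = cnj (- 1 / z)" by simp
 then show ?thesis using z G_fun_eq[of z] G_fun_eq[of "cnj z"] F.Uf_cnj G.Uf_cnj
  by (simp only: complex_cnj_zero_iff complex_cnj_diff complex_cnj_mult complex_cnj_complex_of_real not_False_eq_True)
qed

end

section \<open>Support intervals and the limit density\<close>

context limit_pair
begin

abbreviation "tau t \<equiv> th (XX t)"
abbreviation "cc \<equiv> c * pos_mass g"
abbreviation "CV \<equiv> tc ` crit"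
abbreviation "ld \<equiv> limit_density f g c"

definition bnd :: "real => bool" where
 "bnd t \<longleftrightarrow> -1 < t \<and> t < cc \<and> 0 < tau t \<and> tau t < pi"

sublocale BC: band_curve "-1" cc tau CV using tau_band_curve by (simp only: fpos)

lemma tt_XX: "-1 < t ==> t < cc ==> tc (XX t) = t" using tt_surj[of t] by (simp only: fpos)

lemma tt_range: "-1 < tc x" "tc x < cc" using tt_bounds[of x] by (simp_all only: fpos)

lemma roots_band: assumes "bnd t" shows "nonreal_roots f g c t = {exp (ze (XX t)), cnj (exp (ze (XX t)))}" proof -
 let ?w = "exp (ze (XX t))"
 have t: "-1 < t" "t < cc" "0 < tau t" "tau t < pi" using assms by (auto simp: bnd_def)
 note w = curve_is_root[OF t(3,4)]
 have up: "z = ?w" if z: "0 < Im z" "G_fun f g c z = of_real t" for z by (rule upper_root_curve[OF z]) (metis XX_tt)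
 show ?thesis
 proof (intro equalityI subsetI)
  fix z assume "z \<in> nonreal_roots f g c t"
  then have z: "Im z \<noteq> 0" "G_fun f g c z = of_real t" by (auto simp: nonreal_roots_def)
  then have z0: "z \<noteq> 0" by auto
  show "z \<in> {?w, cnj ?w}"
  proof (cases "0 < Im z")
   case True
   then show ?thesis using up[OF True z(2)] by simp
  next
   case False
   then have "0 < Im (cnj z)" using z(1) by simp
   moreover have "G_fun f g c (cnj z) = of_real t" using G_fun_cnj[OF z0] z(2) by simp
   ultimately have "cnj z = ?w" by (rule up)
   then show ?thesis by (metis complex_cnj_cnj insertI1 insertI2)
  qed
 next
  fix z assume "z \<in> {?w, cnj ?w}"
  then show "z \<in> nonreal_roots f g c t" using w(1,2) G_fun_cnj[of ?w] tt_XX[OF t(1,2)] by (auto simp: nonreal_roots_def)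
 qed
qed

lemma roots_empty: assumes "\<not> bnd t" shows "nonreal_roots f g c t = {}"
proof (rule ccontr)
 assume "nonreal_roots f g c t \<noteq> {}"
 then obtain z where z: "Im z \<noteq> 0" "G_fun f g c z = of_real t" by (auto simp: nonreal_roots_def)
 have z0: "z \<noteq> 0" using z(1) by auto
 obtain w where w: "0 < Im w" "G_fun f g c w = of_real t"
 proof (cases "0 < Im z")
  case True
  then show ?thesis using that z by blast
 next
  case False
  then show ?thesis using that[of "cnj z"] z G_fun_cnj[OF z0] by simp
 qed
 obtain x where "0 < th x" "th x < pi" "tc x = t" by (rule upper_root_curve[OF w])
 then have "bnd t" using tt_range[of x] XX_tt[of x] by (auto simp: bnd_def)
 then show False using assms by simp
qed

lemma upper_root_Arg: assumes "bnd t" shows "Arg (upper_root f g c t) = tau t" proof -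
 have T: "0 < tau t" "tau t < pi" using assms by (auto simp: bnd_def)
 have "upper_root f g c t = exp (ze (XX t))" unfolding upper_root_def roots_band[OF assms]
  by (rule the_equality) (use curve_is_root(1)[OF T] in auto)
 then show ?thesis using curve_is_root(3)[OF T] by simp
qed

lemma neg_critical_value: assumes "z < 0" "is_critical f g c (Some z)"
 shows "critical_value f g c (Some z) \<in> CV" "tau (critical_value f g c (Some z)) = pi"
 using critical_neg[OF assms] by (auto simp flip: critical_neg(3)[OF assms])

lemma neg_critical_value_converse: assumes "v \<in> CV" "tau v = pi"
 obtains z where "z < 0" "is_critical f g c (Some z)" "critical_value f g c (Some z) = v" proof -
 obtain x where x: "x \<in> crit" "v = tc x" using assms(1) by blast
 have "th x = pi" using assms(2) unfolding x(2) XX_tt .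
 from critical_neg_converse[OF this x(1)] have cr: "is_critical f g c (Some (- exp x))" .
 have "- exp x < 0" by simp
 then show ?thesis using that[of "- exp x"] cr critical_neg(3)[OF _ cr] x(2) by simp
qed

text \<open>Nonzero real critical points correspond to critical points of the curve. The point 0 can
  be critical only if \<open>g\<close> is nonzero almost everywhere, and then its value is
  \<open>c\<close>; infinity has the value -1. So both only repeat end points.\<close>

lemma division_points_eq: "division_points f g c = {-1, c} \<union> CV" proof -
 have 1: "critical_value f g c y \<in> {-1, c} \<union> CV" if y: "is_critical f g c y" for y
 proof (cases y)
  case (Some z)
  consider "0 < z" | "z < 0" | "z = 0" by linarith
  then show ?thesis
  proof cases
   case 1
   have "G_fun f g c z \<in> CV"
    unfolding critical_pos(3)[OF 1 y[unfolded Some], symmetric] using critical_pos(2)[OF 1 y[unfolded Some]] by (rule imageI)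
   then show ?thesis by (simp add: Some)
  next
   case 2
   from neg_critical_value(1)[OF 2 y[unfolded Some]] show ?thesis by (simp add: Some)
  next
   case 3
   have "negligible {s\<in>{0..1}. g s = 0}" using y by (simp add: Some 3)
   then have "pos_mass g = 1" by (rule G.pos_mass_eq_1)
   moreover have "integral {0..1} (\<lambda>s. g s / (0 + g s)) = pos_mass g" unfolding pos_mass_def by (intro integral_cong) auto
   ultimately have "G_fun f g c (0::real) = c" by (simp add: G_fun_def)
   then show ?thesis by (simp add: Some 3)
  qed
 qed simp
 have 2: "v \<in> critical_value f g c ` {y. is_critical f g c y}" if v: "v \<in> CV" for v
 proof (cases "tau v = pi")
  case True
  then show ?thesis using neg_critical_value_converse[OF v True] by (metis image_eqI mem_Collect_eq)
 next
  case False
  obtain x where x: "x \<in> crit" "v = tc x" using v by blast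
  have "th x = 0" using False crit_flat[OF x(1)] Th_range[of x] unfolding x(2) XX_tt by auto
  from critical_pos_converse[OF this x(1)] have cr: "is_critical f g c (Some (exp x))" .
  have "critical_value f g c (Some (exp x)) = v" using critical_pos(3)[OF _ cr] x(2) by simp
  then show ?thesis using cr by blast
 qed
 show ?thesis unfolding division_points_def using 1 2 by blast
qed

lemma not_bnd_division: "v \<in> division_points f g c ==> \<not> bnd v" unfolding division_points_eq using BC.E_flat c'_bounds by (auto simp: bnd_def)

lemma support_bnd: assumes S: "support_interval f g c a b" and t: "a < t" "t < b" shows "bnd t"
proof (rule ccontr)
 assume n: "\<not> bnd t"
 have "\<forall>t\<in>{a<..<b}. \<exists>z. Im z > 0 \<and> nonreal_roots f g c t = {z, cnj z}" using S unfolding support_interval_def by (elim conjE)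
 moreover have "t \<in> {a<..<b}" using t by simp
 ultimately obtain z where "nonreal_roots f g c t = {z, cnj z}" by blast
 then show False unfolding roots_empty[OF n] by blast
qed

lemma support_intervalI: assumes "a \<in> division_points f g c" "b \<in> division_points f g c" "a < b" "\<And>u. a < u ==> u < b ==> bnd u"
 shows "support_interval f g c a b" unfolding support_interval_def
proof (intro conjI assms ballI)
 show "{a<..<b} \<inter> division_points f g c = {}"
 proof (rule equals0I)
  fix x assume "x \<in> {a<..<b} \<inter> division_points f g c"
  then have "bnd x" "x \<in> division_points f g c" using assms(4) by auto
  then show False using not_bnd_division by blast
 qed
 fix t assume "t \<in> {a<..<b}"
 then have t: "bnd t" using assms(4) by auto
 then have "0 < tau t" "tau t < pi" by (auto simp: bnd_def)
 then show "\<exists>z. Im z > 0 \<and> nonreal_roots f g c t = {z, cnj z}" using roots_band[OF t] curve_is_root(1) by blast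
qed

text \<open>If \<open>g\<close> vanishes on a set of positive measure then \<open>cc < c\<close>, and a band that ends at \<open>cc\<close> is not
 a support interval, as \<open>cc\<close> need not be a division point. The limit density would then have mass
 less than 1.\<close>

definition bad :: bool where
 "bad \<longleftrightarrow> cc < c \<and> (\<exists>t0. -1 < t0 \<and> t0 < cc \<and> (\<forall>u. t0 < u \<longrightarrow> u < cc \<longrightarrow> bnd u))"

text \<open>A band ends at critical values, at -1 or at \<open>cc\<close>. Outside the bad case a
  band reaching \<open>cc\<close> has \<open>cc = c\<close>, so all these are division
  points.\<close>

lemma in_support: assumes nb: "\<not> bad" and t: "bnd t"
 obtains a b where "support_interval f g c a b" "a < t" "t < b" proof -
 have t': "-1 < t" "t < cc" "0 < tau t \<and> tau t < pi" using t by (auto simp: bnd_def)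
 obtain a where a: "a < t" "-1 \<le> a" "\<And>u. a < u ==> u \<le> t ==> 0 < tau u \<and> tau u < pi" "a = -1 \<or> a \<in> CV \<and> -1 < a"
  using BC.band_left_end[OF t'] by blast
 obtain b where b: "t < b" "b \<le> cc" "\<And>u. t \<le> u ==> u < b ==> 0 < tau u \<and> tau u < pi" "b = cc \<or> b \<in> CV \<and> b < cc"
  using BC.band_right_end[OF t'] by blast
 have ab: "bnd u" if "a < u" "u < b" for u using a(2) a(3)[of u] b(2) b(3)[of u] that by (cases "u \<le> t") (auto simp: bnd_def)
 have bD: "b \<in> division_points f g c"
 proof (cases "b = cc")
  case True
  have "\<not> cc < c"
  proof
   assume "cc < c"
   then have bad using t' ab a(1) True unfolding bad_def by (intro conjI exI[of _ t]) auto
   then show False using nb by simp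
  qed
  then show ?thesis using True c'_bounds by (simp add: division_points_eq)
 next
  case False
  then show ?thesis using b(4) by (simp add: division_points_eq)
 qed
 have aD: "a \<in> division_points f g c" using a(4) by (auto simp: division_points_eq)
 have "a < b" using a(1) b(1) by simp
 from support_intervalI[OF aD bD this ab] show ?thesis by (rule that[OF _ a(1) b(1)])
qed

definition supported :: "real => bool" where
 "supported t \<longleftrightarrow> (\<exists>a b. support_interval f g c a b \<and> a < t \<and> t < b)"

definition adjoins :: "real => bool" where
 "adjoins t \<longleftrightarrow> (\<exists>z a b. z < 0 \<and> is_critical f g c (Some z) \<and> support_interval f g c a b \<and>
   critical_value f g c (Some z) \<in> {a, b} \<inter> frontier (real_interval f g c t))"

lemma ld_eq: "ld t = (if supported t then Arg (upper_root f g c t) / pi else if adjoins t then 1 else 0)"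
 unfolding limit_density_def supported_def adjoins_def ..

lemma supported_bnd: "supported t ==> bnd t" unfolding supported_def using support_bnd by blast

lemma ld_supported: "supported t ==> ld t = rho t" using upper_root_Arg[of t] supported_bnd[of t] by (simp add: ld_eq rho_def bnd_def)

definition SS :: "real set" where "SS = {u\<in>{-1..c}. nonreal_roots f g c u = {}}"

lemma mem_SS: "u \<in> SS \<longleftrightarrow> -1 \<le> u \<and> u \<le> c \<and> \<not> bnd u" using roots_empty[of u] roots_band[of u] by (auto simp: SS_def)

lemma open_bnd: "open {u. bnd u}" proof -
 have "continuous_on {-1<..<cc} tau" using BC.cont by (intro continuous_at_imp_continuous_on) auto
 then have "open ({-1<..<cc} \<inter> tau -` {0<..<pi})" by (rule continuous_open_preimage) auto
 moreover have "{-1<..<cc} \<inter> tau -` {0<..<pi} = {u. bnd u}" by (auto simp: bnd_def)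
 ultimately show ?thesis by simp
qed

lemma closed_SS: "closed SS" proof -
 have "SS = {-1..c} \<inter> - {u. bnd u}" by (auto simp: mem_SS)
 then show ?thesis using open_bnd by auto
qed

text \<open>Components of a closed set are closed. A critical value on the frontier therefore
  belongs to the real interval, so flatness carries over from it to t.\<close>

lemma frontier_sub: "frontier (real_interval f g c t) \<subseteq> real_interval f g c t" unfolding real_interval_def SS_def[symmetric]
 using closed_connected_component[OF closed_SS] by (simp add: frontier_subset_closed)

lemma real_interval_between: assumes "v \<in> real_interval f g c t" "min v t \<le> u" "u \<le> max v t" shows "u \<in> SS" proof -
 let ?C = "connected_component_set SS t"
 have v: "v \<in> ?C" using assms(1) by (simp add: real_interval_def SS_def)
 then have t: "t \<in> ?C" by (metis connected_component_in connected_component_refl mem_Collect_eq)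
 have "connected ?C" by (rule connected_connected_component)
 then have "{v..t} \<subseteq> ?C" "{t..v} \<subseteq> ?C" using v t connected_contains_Icc by blast+
 then have "u \<in> ?C" using assms(2,3) by (cases "v \<le> t") auto
 then show ?thesis using connected_component_subset by blast
qed

lemma real_interval_mem: assumes "\<And>u. min v t \<le> u ==> u \<le> max v t ==> u \<in> SS" shows "v \<in> real_interval f g c t" proof -
 have "connected {min v t..max v t}" "{min v t..max v t} \<subseteq> SS" "t \<in> {min v t..max v t}" "v \<in> {min v t..max v t}" using assms by auto
 then have "connected_component SS t v" unfolding connected_component_def by blast
 then show ?thesis by (simp add: real_interval_def SS_def)
qed

lemma ld_one_imp: assumes "\<not> bnd t" "ld t \<noteq> 0"
 obtains v where "v \<in> CV" "tau v = pi" "v \<in> real_interval f g c t" "ld t = 1" proof -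
 have ns: "\<not> supported t" using assms(1) supported_bnd by blast
 have ad: "adjoins t" using assms(2) ns by (cases "adjoins t") (simp_all add: ld_eq)
 then have 1: "ld t = 1" using ns by (simp add: ld_eq)
 obtain z where z: "z < 0" "is_critical f g c (Some z)"
  "critical_value f g c (Some z) \<in> frontier (real_interval f g c t)" using ad unfolding adjoins_def by blast
 show ?thesis by (rule that[OF neg_critical_value[OF z(1,2)] _ 1]) (rule subsetD[OF frontier_sub z(3)])
qed

lemma ld_one: assumes "\<not> bnd t" "v \<in> CV" "tau v = pi" "v \<in> frontier (real_interval f g c t)"
  "support_interval f g c a b" "v \<in> {a, b}" shows "ld t = 1" proof -
 have ns: "\<not> supported t" using assms(1) supported_bnd by blast
 obtain z where z: "z < 0" "is_critical f g c (Some z)" "critical_value f g c (Some z) = v"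
  by (rule neg_critical_value_converse[OF assms(2,3)])
 have "critical_value f g c (Some z) \<in> {a, b} \<inter> frontier (real_interval f g c t)" unfolding z(3) using assms(4,6) by (rule IntI[rotated])
 then have "adjoins t" unfolding adjoins_def using z(1,2) assms(5) by blast
 then show ?thesis using ns by (simp add: ld_eq)
qed

text \<open>Inside a band the real interval is empty and has empty frontier, so the default value 0
  applies.\<close>

lemma ld_bnd_unsupported: assumes "bnd t" "\<not> supported t" shows "ld t = 0" proof -
 have "t \<notin> SS" using assms(1) by (simp add: mem_SS)
 then have "real_interval f g c t = {}" unfolding real_interval_def SS_def[symmetric] by (rule connected_component_eq_empty[THEN iffD2])
 then have "\<not> adjoins t" unfolding adjoins_def by (simp only: frontier_empty Int_empty_right empty_iff simp_thms ex_simps)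
 then show ?thesis using assms(2) by (simp add: ld_eq)
qed

text \<open>Within a real interval the height takes only the values 0 and pi, and by continuity it
  cannot pass pi/2 to switch.\<close>

lemma flat_eq: assumes u: "-1 < u" "v < cc" "u \<le> v" and S: "\<And>w. u \<le> w ==> w \<le> v ==> w \<in> SS" shows "tau u = pi \<longleftrightarrow> tau v = pi" proof -
 have fl: "tau w = 0 \<or> tau w = pi" if "u \<le> w" "w \<le> v" for w using S[OF that] BC.range[of w] u that by (auto simp: mem_SS bnd_def)
 have c: "continuous_on {u..v} tau" using u BC.cont by (intro continuous_at_imp_continuous_on) auto
 have no: "\<not> (u \<le> w \<and> w \<le> v \<and> tau w = pi / 2)" for w using fl[of w] by auto
 show ?thesis
 proof (rule ccontr)
  assume "\<not> ?thesis"
  then consider "tau u = 0" "tau v = pi" | "tau u = pi" "tau v = 0" using fl[of u] fl[of v] u(3) by auto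
  then show False by cases (use IVT'[of tau u "pi / 2" v] IVT2'[of tau v "pi / 2" u] c u(3) no in auto)
 qed
qed

lemma ld_flat_le: assumes t: "-1 < t" "t < cc" "\<not> bnd t" and l: "ld t \<noteq> 0" shows "ld t = 1" "tau t = pi" proof -
 obtain v where v: "v \<in> CV" "tau v = pi" "v \<in> real_interval f g c t" "ld t = 1" by (rule ld_one_imp[OF t(3) l])
 show "ld t = 1" by (rule v(4))
 have vb: "-1 < v" "v < cc" using v(1) tt_range by auto
 note S = real_interval_between[OF v(3)]
 show "tau t = pi"
 proof (cases "v \<le> t")
  case True
  then show ?thesis using flat_eq[of v t] vb t v(2) S by auto
 next
  case False
  then show ?thesis using flat_eq[of t v] vb t v(2) S by auto
 qed
qed

lemma frontierI: assumes "v \<in> real_interval f g c t" "\<And>d. 0 < d ==> \<exists>u. \<bar>u - v\<bar> < d \<and> bnd u" shows "v \<in> frontier (real_interval f g c t)"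
proof -
 have "v \<notin> interior (real_interval f g c t)"
 proof
  assume "v \<in> interior (real_interval f g c t)"
  then obtain d where d: "0 < d" "ball v d \<subseteq> real_interval f g c t" by (auto simp: mem_interior)
  obtain u where u: "\<bar>u - v\<bar> < d" "bnd u" using assms(2)[OF d(1)] by blast
  then have "u \<in> real_interval f g c t" using d(2) by (auto simp: dist_real_def abs_minus_commute)
  from real_interval_between[OF this, of u] show False using u(2) by (auto simp: mem_SS)
 qed
 then show ?thesis using assms(1) closure_subset by (auto simp: frontier_def)
qed

text \<open>As the height is not pi everywhere, the flat piece ends at some critical value v next to
  a band. The support interval around that band must have v as an end point, because neither can v
  lie inside it nor can it stop within the band; so the rule for z < 0 applies.\<close>

lemma ld_flat_one: assumes nb: "\<not> bad" and t: "-1 < t" "t < cc" "tau t = pi" and t': "-1 < t'" "t' < cc" "tau t' \<noteq> pi" shows "ld t = 1"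
proof -
 have nbt: "\<not> bnd u" if "tau u = pi" for u using that by (simp add: bnd_def)
 consider "t < t'" | "t' < t" using t(3) t'(3) by (cases t t' rule: linorder_cases) auto
 then show ?thesis
 proof cases
  case 1
  from BC.flat_right_end[OF t(1,3) 1 t'(2,3)] obtain v u0 where v: "t \<le> v" "v < u0" "u0 < cc"
   "\<And>u. t \<le> u ==> u \<le> v ==> tau u = pi" "v \<in> CV" "\<And>u. v < u ==> u \<le> u0 ==> 0 < tau u \<and> tau u < pi" by blast
  have b: "bnd u" if "v < u" "u \<le> u0" for u using v(6)[OF that] that v t by (auto simp: bnd_def)
  have tv: "tau v = pi" using v by auto
  obtain a b where ab: "support_interval f g c a b" "a < u0" "u0 < b" by (rule in_support[OF nb b[OF v(2) order_refl]])
  have "\<not> a < v" using support_bnd[OF ab(1), of v] ab v(2) nbt[OF tv] by auto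
  moreover have "a \<in> division_points f g c" using ab(1) unfolding support_interval_def by (elim conjE)
  then have "\<not> v < a" using b[of a] ab(2) not_bnd_division[of a] by linarith
  ultimately have "v \<in> {a, b}" by auto
  moreover have "v \<in> frontier (real_interval f g c t)"
  proof (rule frontierI)
   show "v \<in> real_interval f g c t" by (rule real_interval_mem) (use v t nbt c'_bounds in \<open>auto simp: mem_SS\<close>)
   fix d :: real assume "0 < d"
   then show "\<exists>u. \<bar>u - v\<bar> < d \<and> bnd u" using v(2) by (intro exI[of _ "min u0 (v + d / 2)"]) (auto intro!: b simp: min_def)
  qed
  ultimately show ?thesis using ld_one[OF nbt[OF t(3)] v(5) tv _ ab(1)] by blast
 next
  case 2
  from BC.flat_left_end[OF t(2,3) 2 t'(1,3)] obtain v u0 where v: "v \<le> t" "u0 < v" "-1 < u0"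
   "\<And>u. v \<le> u ==> u \<le> t ==> tau u = pi" "v \<in> CV" "\<And>u. u0 \<le> u ==> u < v ==> 0 < tau u \<and> tau u < pi" by blast
  have b: "bnd u" if "u0 \<le> u" "u < v" for u using v(6)[OF that] that v t by (auto simp: bnd_def)
  have tv: "tau v = pi" using v by auto
  obtain a b where ab: "support_interval f g c a b" "a < u0" "u0 < b" by (rule in_support[OF nb b[OF order_refl v(2)]])
  have "\<not> v < b" using support_bnd[OF ab(1), of v] ab v(2) nbt[OF tv] by auto
  moreover have "b \<in> division_points f g c" using ab(1) unfolding support_interval_def by (elim conjE)
  then have "\<not> b < v" using b[of b] ab(3) not_bnd_division[of b] by linarith
  ultimately have "v \<in> {a, b}" by auto
  moreover have "v \<in> frontier (real_interval f g c t)"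
  proof (rule frontierI)
   show "v \<in> real_interval f g c t" by (rule real_interval_mem) (use v t nbt c'_bounds in \<open>auto simp: mem_SS\<close>)
   fix d :: real assume "0 < d"
   then show "\<exists>u. \<bar>u - v\<bar> < d \<and> bnd u" using v(2) by (intro exI[of _ "max u0 (v - d / 2)"]) (auto intro!: b simp: max_def)
  qed
  ultimately show ?thesis using ld_one[OF nbt[OF t(3)] v(5) tv _ ab(1)] by blast
 qed
qed

lemma ld_interior: assumes nb: "\<not> bad" and t: "-1 < t" "t < cc" and t': "-1 < t'" "t' < cc" "tau t' \<noteq> pi" shows "ld t = rho t"
proof (cases "bnd t")
 case True
 obtain a b where "support_interval f g c a b" "a < t" "t < b" by (rule in_support[OF nb True])
 then have "supported t" unfolding supported_def by blast
 then show ?thesis by (rule ld_supported)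
next
 case False
 then have "tau t = 0 \<or> tau t = pi" using t BC.range[of t] by (auto simp: bnd_def)
 then show ?thesis
 proof
  assume "tau t = 0"
  then have "ld t = 0" using ld_flat_le(2)[OF t False] by force
  then show ?thesis using \<open>tau t = 0\<close> by (simp add: rho_def)
 next
  assume "tau t = pi"
  then have "ld t = 1" using ld_flat_one[OF nb t _ t'] by blast
  then show ?thesis using \<open>tau t = pi\<close> t by (simp add: rho_def)
 qed
qed

lemma ld_le_rho: assumes t: "-1 < t" "t < cc" shows "ld t \<le> rho t"
proof (cases "bnd t")
 case True
 show ?thesis
 proof (cases "supported t")
  case True
  then show ?thesis using ld_supported by simp
 next
  case False
  then show ?thesis using ld_bnd_unsupported[OF \<open>bnd t\<close>] rho_range(1)[of t] by simp
 qed
next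
 case False
 show ?thesis
 proof (cases "ld t = 0")
  case True
  then show ?thesis using rho_range(1)[of t] by simp
 next
  case l: False
  then show ?thesis using ld_flat_le[OF t False l] t by (simp add: rho_def)
 qed
qed

lemma above_cc: "cc < t ==> \<not> bnd t" "cc < t ==> rho t = 0" by (auto simp: bnd_def rho_def)

lemma ld_above_constant: assumes "cc < t" "t \<le> c" "cc < t'" "t' \<le> c" shows "ld t = ld t'" proof -
 have "t' \<in> real_interval f g c t"
  by (rule real_interval_mem) (use assms c'_bounds above_cc(1) in \<open>auto simp: mem_SS min_def max_def split: if_splits\<close>)
 then have "real_interval f g c t = real_interval f g c t'" unfolding real_interval_def by (rule connected_component_eq[symmetric])
 then have "adjoins t = adjoins t'" unfolding adjoins_def by (simp only:)
 moreover have "\<not> supported t" "\<not> supported t'" using supported_bnd above_cc(1) assms by blast+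
 ultimately show ?thesis unfolding ld_eq by (simp only: if_False)
qed

text \<open>Otherwise \<open>rho\<close> would have mass \<open>cc + 1\<close>, more than 1.\<close>

lemma not_all_pi: "\<exists>t'. -1 < t' \<and> t' < cc \<and> tau t' \<noteq> pi"
proof (rule ccontr)
 assume "\<not> ?thesis"
 then have pi: "tau t = pi" if "-1 < t" "t < cc" for t using that by blast
 have cc0: "0 < cc" using cpos G.pos_mass_pos by simp
 have sub: "{-1..cc} \<subseteq> {-1..c}" using c'_bounds by auto
 have "((\<lambda>_. 1 :: real) has_integral (1 * (cc - -1))) {-1..cc}" using has_integral_const_real[of "1::real" "-1" cc] cc0 by simp
 then have "((\<lambda>t. if t \<in> {-1..cc} then 1 else 0 :: real) has_integral (1 * (cc - -1))) {-1..c}" unfolding has_integral_restrict[OF sub] .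
 then have "(rho has_integral (1 * (cc - -1))) {-1..c}"
 proof (rule has_integral_spike_finite[where S = "{-1, cc}", rotated 2])
  fix t assume "t \<in> {-1..c} - {-1, cc}"
  then show "rho t = (if t \<in> {-1..cc} then 1 else 0)" using pi[of t] by (auto simp: rho_def)
 qed simp
 then have "1 = 1 * (cc - -1)" using integral_rho by (metis integral_unique)
 then show False using cc0 by auto
qed

text \<open>For \<open>cc = c\<close> every band is a support interval and the two densities agree.
  Otherwise mass 1 is available: in the bad case the limit density loses the band next to
  \<open>cc\<close> and its mass is too small; in the other case it can differ only by being
  constantly 1 above \<open>cc\<close>, and then its mass is too large.\<close>

theorem limit_density_eq_rho: assumes hyp: "negligible {s\<in>{0..1}. g s = 0} \<or> integral {-1..c} ld = 1" and t: "t \<in> {-1..c} - {-1, cc}"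
 shows "ld t = rho t"
proof (cases "cc = c")
 case True
 then have "\<not> cc < c" by linarith
 then have nb: "\<not> bad" unfolding bad_def by blast
 obtain t' where t': "-1 < t'" "t' < cc" "tau t' \<noteq> pi" using not_all_pi by blast
 have "t \<noteq> -1" "t \<noteq> cc" "-1 \<le> t" "t \<le> c" using t by auto
 then have "-1 < t" "t < cc" using True by linarith+
 then show ?thesis by (rule ld_interior[OF nb _ _ t'])
next
 case False
 then have lt: "cc < c" using c'_bounds(2) by linarith
 have "\<not> negligible {s\<in>{0..1}. g s = 0}" using G.pos_mass_eq_1 lt by auto
 then have I1: "integral {-1..c} ld = 1" using hyp by simp
 then have li: "ld integrable_on {-1..c}" using not_integrable_integral by fastforce
 note ri = rho_integrable[OF order_refl]
 show ?thesis
 proof (cases bad)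
  case True
  then obtain t0 where t0: "-1 < t0" "t0 < cc" "\<And>u. t0 < u ==> u < cc ==> bnd u" by (auto simp: bad_def)
  \<comment> \<open>A value 1 above \<open>cc\<close> would need a real interval containing a
    critical value below \<open>cc\<close>, and this interval would have to cross the last
    band.\<close>
  have ab0: "ld u = 0" if u: "cc < u" "u \<le> c" for u
  proof (rule ccontr)
   assume l: "ld u \<noteq> 0"
   obtain v where v: "v \<in> CV" "v \<in> real_interval f g c u" by (rule ld_one_imp[OF above_cc(1)[OF u(1)] l])
   have vc: "v < cc" using v(1) tt_range by auto
   define w where "w = (max v t0 + cc) / 2"
   have w: "v \<le> w" "t0 < w" "w < cc" using vc t0(2) by (auto simp: w_def max_def)
   have "w \<in> SS" by (rule real_interval_between[OF v(2)]) (use w u in auto)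
   then show False using t0(3)[OF w(2,3)] by (simp add: mem_SS)
  qed
  \<comment> \<open>A support interval meeting the last band would end at \<open>cc\<close>, which
    is not a division point, or inside the band, where there are none.\<close>
  have in0: "ld u = 0" if u: "t0 < u" "u < cc" for u
  proof (rule ld_bnd_unsupported[OF t0(3)[OF u]], rule notI, unfold supported_def, elim exE conjE)
   fix a b assume ab: "support_interval f g c a b" "a < u" "u < b"
   have bD: "b \<in> division_points f g c" using ab(1) unfolding support_interval_def by (elim conjE)
   have "b \<le> cc"
   proof (rule ccontr)
    assume "\<not> b \<le> cc"
    then have "bnd cc" using ab u by (intro support_bnd[OF ab(1)]) auto
    then show False by (simp add: bnd_def)
   qed
   moreover have "b \<noteq> cc"
   proof
    assume "b = cc"
    then consider "cc = -1" | "cc = c" | x where "cc = tc x" using bD unfolding division_points_eq by blast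
    then show False
    proof cases
     case 1
     then show False using t0(1,2) by linarith
    next
     case 2
     then show False using lt by linarith
    next
     case 3
     then show False using tt_range(2)[of x] by linarith
    qed
   qed
   ultimately have "bnd b" using u ab by (intro t0(3)) auto
   then show False using not_bnd_division[OF bD] by simp
  qed
  \<comment> \<open>The middle third of the last band stays away from its ends, so the continuous
    height has a positive minimum there and the missing mass is positive.\<close>
  define p where "p = (2 * t0 + cc) / 3"
  define q where "q = (t0 + 2 * cc) / 3"
  have pq: "t0 < p" "p < q" "q < cc" using t0(2) by (auto simp: p_def q_def)
  have "continuous_on {p..q} tau" by (intro continuous_at_imp_continuous_on ballI BC.cont) (use pq t0 in auto)
  then obtain x where x: "x \<in> {p..q}" "\<And>y. y \<in> {p..q} ==> tau x \<le> tau y" using continuous_attains_inf[OF compact_Icc, of p q tau] pq by auto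
  define m where "m = tau x / pi"
  have m0: "0 < m" using t0(3)[of x] x(1) pq by (auto simp: m_def bnd_def)
  have sub: "{p..q} \<subseteq> {-1..c}" using pq t0 lt by auto
  have "((\<lambda>t. m) has_integral (m * (q - p))) {p..q}" using has_integral_const_real[of m p q] pq by (simp add: mult.commute)
  then have mi: "((\<lambda>t. if t \<in> {p..q} then m else 0) has_integral (m * (q - p))) {-1..c}" unfolding has_integral_restrict[OF sub] .
  have "integral {-1..c} (\<lambda>t. if t \<in> {p..q} then m else 0) \<le> integral {-1..c} (\<lambda>t. rho t - ld t)"
  proof (rule integral_le_AE)
   show "negligible {-1, cc}" by simp
   show "(\<lambda>t. if t \<in> {p..q} then m else 0) integrable_on {-1..c}" using mi by blast
   show "(\<lambda>t. rho t - ld t) integrable_on {-1..c}" by (intro integrable_diff ri li)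
   fix u assume u: "u \<in> {-1..c} - {-1, cc}"
   show "(if u \<in> {p..q} then m else 0) \<le> rho u - ld u"
   proof (cases "u \<in> {p..q}")
    case True
    then have "ld u = 0" using pq by (intro in0) auto
    moreover have "m \<le> rho u" unfolding m_def rho_def using x(2)[OF True] True pq t0 by (auto intro!: divide_right_mono)
    ultimately show ?thesis using True by simp
   next
    case False
    have "ld u \<le> rho u" using ld_le_rho[of u] ab0[of u] rho_range(1)[of u] u by (cases "u < cc") auto
    then show ?thesis unfolding if_not_P[OF False] by linarith
   qed
  qed
  also have "integral {-1..c} (\<lambda>t. rho t - ld t) = 0" using integral_diff[OF ri li] integral_rho I1 by simp
  finally have "m * (q - p) \<le> 0" using integral_unique[OF mi] by simp
  then show ?thesis using m0 pq by (simp add: mult_le_0_iff)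
 next
  case nb: False
  have int: "ld u = rho u" if "-1 < u" "u < cc" for u using ld_interior[OF nb that] not_all_pi by blast
  have ab0: "ld u = 0" if u: "cc < u" "u \<le> c" for u
  proof (rule ccontr)
   assume "ld u \<noteq> 0"
   then have "ld u = 1" using ld_one_imp[OF above_cc(1)[OF u(1)]] by metis
   then have one: "ld w = 1" if "cc < w" "w \<le> c" for w using ld_above_constant[OF that u] by simp
   have sub: "{cc..c} \<subseteq> {-1..c}" using c'_bounds by auto
   have "((\<lambda>_. 1 :: real) has_integral (1 * (c - cc))) {cc..c}" using has_integral_const_real[of "1::real" cc c] lt by simp
   then have "((\<lambda>t. if t \<in> {cc..c} then 1 else 0 :: real) has_integral (1 * (c - cc))) {-1..c}" unfolding has_integral_restrict[OF sub] .
   from has_integral_add[OF integrable_integral[OF ri] this]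
   have "((\<lambda>t. rho t + (if t \<in> {cc..c} then 1 else 0)) has_integral (1 + (c - cc))) {-1..c}" by (simp add: integral_rho)
   then have "(ld has_integral (1 + (c - cc))) {-1..c}"
   proof (rule has_integral_spike_finite[where S = "{-1, cc}", rotated 2])
    fix w assume w: "w \<in> {-1..c} - {-1, cc}"
    show "ld w = rho w + (if w \<in> {cc..c} then 1 else 0)" using int[of w] one[of w] above_cc(2)[of w] w by (cases "w < cc") auto
   qed simp
   then have "integral {-1..c} ld = 1 + (c - cc)" by (rule integral_unique)
   then have "(1::real) = 1 + (c - cc)" using I1 by (rule trans[OF sym, rotated])
   then show False using lt by linarith
  qed
  show ?thesis using int[of t] ab0[of t] above_cc(2)[of t] t by (cases "t < cc") auto
 qed
qed

lemma limit_shape_eq: assumes "negligible {s\<in>{0..1}. g s = 0} \<or> integral {-1..c} ld = 1" and u: "u \<in> {-1..c}"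
 shows "limit_shape f g c u = 1 + integral {-1..u} (\<lambda>t. 1 - 2 * rho t)" proof -
 have "integral {-1..u} (\<lambda>t. 1 - 2 * ld t) = integral {-1..u} (\<lambda>t. 1 - 2 * rho t)"
  by (rule integral_spike[of "{-1, cc}"]) (use limit_density_eq_rho[OF assms(1)] u in auto)
 then show ?thesis by (simp add: limit_shape_def)
qed

end

text \<open>The last hypothesis makes the prescribed limit density a probability density. If
  \<open>g\<close> is nonzero almost everywhere this is automatic; otherwise the curve stops before
  \<open>c\<close>, the prescription near that point may miss or add mass, and mass 1 is required
  explicitly.\<close>

theorem corollary1p4:
  fixes c :: real and f g :: "real \<Rightarrow> real" and k :: "nat \<Rightarrow> nat"
  assumes "c > 0"
    and "piecewise_C1 f" and "piecewise_C1 g"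
    and "\<forall>s\<in>{0..1}. f s > 0" and "\<forall>s\<in>{0..1}. g s \<ge> 0"
    and "(\<lambda>n. real (k n) / real n) \<longlonglongrightarrow> c"
    and "negligible {s\<in>{0..1}. g s = 0} \<or> integral {-1..c} (limit_density f g c) = 1"
  shows "\<forall>\<epsilon>>0. (\<lambda>n. measure (mu f g n (k n))
           {D \<in> young_diagrams n (k n).
              (SUP u\<in>{-1..c}. \<bar>rotated_boundary n D u - limit_shape f g c u\<bar>) > \<epsilon>})
         \<longlonglongrightarrow> 0"
proof -
 have f0: "{s\<in>{0..1}. f s = 0} = {}" "{s\<in>{0..1}. f s \<noteq> 0} = {0..1}" using assms(4) by force+
 have nonneg: "0 \<le> f s" if "s \<in> {0..1}" for s using assms(4) that by (simp add: less_imp_le)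
 have I01: "\<not> negligible {0..1::real}" using negligible_interval(1)[of 0 "1::real"] by simp
 have ntf: "\<not> negligible {s\<in>{0..1}. f s \<noteq> 0}" unfolding f0 by (rule I01)
 obtain P K M where F: "pfun f P K M" using pfun_of_piecewise_C1[OF assms(2) nonneg ntf] by blast
 \<comment> \<open>If \<open>g\<close> were 0 almost everywhere, G would reduce to
   \<open>Uf f\<close>, whose imaginary part is nonzero off the real line. There would be no support
   interval, the limit density would vanish, and both alternatives of the last hypothesis would
   fail.\<close>
 have ntg: "\<not> negligible {s\<in>{0..1}. g s \<noteq> 0}"
 proof
  assume n: "negligible {s\<in>{0..1}. g s \<noteq> 0}"
  have ng: "\<not> negligible {s\<in>{0..1}. g s = 0}"
  proof
   assume "negligible {s\<in>{0..1}. g s = 0}"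
   then have u: "negligible ({s\<in>{0..1}. g s \<noteq> 0} \<union> {s\<in>{0..1}. g s = 0})" using n by (rule negligible_Un[rotated])
   have "{s\<in>{0..1}. g s \<noteq> 0} \<union> {s\<in>{0..1}. g s = 0} = {0..1}" by blast
   from u[unfolded this] show False using I01 by contradiction
  qed
  have "nonreal_roots f g c t = {}" for t
  proof (rule ccontr)
   assume "nonreal_roots f g c t \<noteq> {}"
   then obtain z where z: "Im z \<noteq> 0" "G_fun f g c z = of_real t" by (auto simp: nonreal_roots_def)
   have "integral {0..1} (\<lambda>s. of_real (g s) / (z + of_real (g s))) = integral {0..1} (\<lambda>s::real. 0 :: complex)"
    by (rule integral_spike[OF n]) auto
   then have U: "Uf f z = of_real t" using z(2) by (simp add: G_fun_def Uf_def)
   define r where "r = norm z"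
   define a where "a = Arg z"
   have z0: "z \<noteq> 0" using z(1) by auto
   have r: "0 < r" using z0 by (simp add: r_def)
   have zp: "z = of_real r * cis a" using rcis_cmod_Arg[of z] by (simp add: rcis_def r_def a_def)
   have sa: "sin a \<noteq> 0" using z(1) unfolding zp by simp
   have ca: "-1 \<le> cos a" "cos a < 1" using cos_less_one[OF sa] by auto
   have "Im (Uf f z) = sin a * Af f r (cos a)" unfolding zp by (rule pfun.Uf_polar(1)[OF F r sa])
   moreover have "0 < Af f r (cos a)" unfolding Af_def
   proof (rule pfun.integral_pos[OF F pfun.A_continuous[OF F r ca(2)]])
    show "0 \<le> x * r / (1 - 2 * (x * r) * cos a + (x * r)\<^sup>2)" if "0 \<le> x" for x
     using that r quadratic_denominator_pos[of "x * r" "cos a"] ca(2) by simp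
    show "0 < x * r / (1 - 2 * (x * r) * cos a + (x * r)\<^sup>2)" if "0 < x" for x
     using that r quadratic_denominator_pos[of "x * r" "cos a"] ca(2) by simp
   qed
   ultimately show False using U sa by simp
  qed
  then have "\<not> support_interval f g c a b" for a b proof -
   assume e: "\<And>t. nonreal_roots f g c t = {}"
   show ?thesis
   proof
    assume S: "support_interval f g c a b"
    then have ab: "a < b" unfolding support_interval_def by (elim conjE)
    from S have roots: "\<forall>t\<in>{a<..<b}. \<exists>z. Im z > 0 \<and> nonreal_roots f g c t = {z, cnj z}" unfolding support_interval_def by (elim conjE)
    from ab have "(a + b) / 2 \<in> {a<..<b}" by simp
    with roots show False using e by blast
   qed
  qed
  then have "limit_density f g c t = 0" for t unfolding limit_density_def by simp
  then have "limit_density f g c = (\<lambda>_. 0)" by (rule ext)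
  then have "integral {-1..c} (limit_density f g c) = 0" by simp
  then show False using assms(7) ng by simp
 qed
 have nonneg_g: "0 \<le> g s" if "s \<in> {0..1}" for s using assms(5) that by simp
 obtain Q L N where G: "pfun g Q L N" using pfun_of_piecewise_C1[OF assms(3) nonneg_g ntg] by blast
 interpret limit_pair f P K M g Q L N c
 proof (intro limit_pair.intro fgpair.intro F G fgpair_axioms.intro limit_pair_axioms.intro assms(1))
  show "pos_mass f = 1" by (rule pfun.pos_mass_eq_1[OF F]) (simp only: f0 negligible_empty)
 qed
 show ?thesis
 proof (intro allI impI)
  fix e :: real assume "0 < e"
  then show "(\<lambda>n. measure (mu f g n (k n))
      {D \<in> young_diagrams n (k n).
       (SUP u\<in>{-1..c}. \<bar>rotated_boundary n D u - limit_shape f g c u\<bar>) > e})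
     \<longlonglongrightarrow> 0" by (rule boundary_tendsto[OF assms(6)]) (rule limit_shape_eq[OF assms(7)])
 qed
qed

end
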